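(* Let $G$ be a real reductive group and let $\rho\colon SL(2,\mathbb{R})\to G$ be a Lie group homomorphism. Then there exists an integer $g_0\ge 2$ such that for every $g\ge g_0$ and every discrete subgroup $\Gamma_g$ of $SL(2,\mathbb{R})$ isomorphic to the fundamental group $\pi_1(\Sigma_g)$ of a closed oriented surface $\Sigma_g$ of genus $g$, the following holds: every neighborhood of $\rho|_{\Gamma_g}$ in $\mathrm{Hom}(\Gamma_g,G)$ contains a representation $\rho'$ such that the Zariski closure of $\rho'(\Gamma_g)$ in $G$ coincides with $G^{\rho}_{\mathrm{even}}$.
   Context: A real reductive group is a (Euclidean) open subgroup $G$ of $\mathbf{G}(\mathbb{R})$, where $\mathbf{G}$ is a connected reductive linear algebraic group defined over $\mathbb{R}$. The Zariski topology on $G$ is the one induced from the Zariski topology of $\mathbf{G}(\mathbb{C})$. $\mathrm{Hom}(\Gamma_g,G)$ carries the topology of pointwise convergence. For a Lie group homomorphism $\rho\colon SL(2,\mathbb{R})\to G$ put $A_0=\begin{pmatrix}1&0\\0&-1\end{pmatrix}$ and $\sigma:=\exp(\pi\sqrt{-1}\,d\rho(A_0))\in\mathbf{G}(\mathbb{C})$. Let $\mathbf{G}^{\rho}_{\mathrm{even}}$ be the Zariski identity component of the centralizer $\{x\in\mathbf{G}\mid \sigma x=x\sigma\}$; it is defined over $\mathbb{R}$. Put $G^{\rho}_{\mathrm{even}}:=G\cap\mathbf{G}^{\rho}_{\mathrm{even}}(\mathbb{R})$. *)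

theory Defs
  imports "HOL-Analysis.Analysis" "HOL-Algebra.Coset"
begin

section \<open>Matrix groups\<close>

definition matrix_group :: "('a::semiring_1^'n^'n) set \<Rightarrow> ('a^'n^'n) monoid" where
  "matrix_group S = \<lparr>carrier = S, mult = (**), one = mat 1\<rparr>"

abbreviation GL_set :: "('a::semiring_1^'n^'n) set" where
  "GL_set \<equiv> {X. invertible X}"

definition SL2R :: "(real^2^2) set" where
  "SL2R = {X. det X = 1}"

primrec matrix_pow :: "'a::semiring_1^'n^'n \<Rightarrow> nat \<Rightarrow> 'a^'n^'n" where
  "matrix_pow X 0 = mat 1"
| "matrix_pow X (Suc k) = X ** matrix_pow X k"

text \<open>The type of square matrices is not an instance of the class required by the library's
  exponential, whence the explicit series.\<close>

definition matrix_exp :: "'a::real_normed_algebra_1^'n^'n \<Rightarrow> 'a^'n^'n" where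
  "matrix_exp X = (\<Sum>k. (1 / fact k) *\<^sub>R matrix_pow X k)"

lemma group_GL: "group (matrix_group (GL_set :: ('a::field^'n^'n) set))"
proof (rule groupI)
  show "\<one>\<^bsub>matrix_group GL_set\<^esub> \<in> carrier (matrix_group (GL_set :: ('a^'n^'n) set))"
    unfolding matrix_group_def invertible_def by (auto intro: exI[of _ "mat 1"])
  fix X :: "'a^'n^'n"
  assume "X \<in> carrier (matrix_group GL_set)"
  then obtain Y where "X ** Y = mat 1" "Y ** X = mat 1"
    unfolding matrix_group_def invertible_def by auto
  then show "\<exists>Y\<in>carrier (matrix_group GL_set).
      Y \<otimes>\<^bsub>matrix_group GL_set\<^esub> X = \<one>\<^bsub>matrix_group GL_set\<^esub>"
    unfolding matrix_group_def invertible_def by (intro bexI[of _ Y]) auto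
qed (simp_all add: matrix_group_def invertible_mult matrix_mul_assoc)

lemma subgroup_SL2R: "subgroup SL2R (matrix_group GL_set)"
proof (rule group.subgroupI[OF group_GL])
  show "SL2R \<subseteq> carrier (matrix_group GL_set)"
    by (auto simp: SL2R_def matrix_group_def invertible_det_nz)
  show "SL2R \<noteq> {}"
    unfolding SL2R_def using det_I[where 'a=real and 'n=2] by blast
  fix X :: "real^2^2"
  assume X: "X \<in> SL2R"
  then have Xc: "X \<in> carrier (matrix_group GL_set)"
    by (auto simp: SL2R_def matrix_group_def invertible_det_nz)
  have "inv\<^bsub>matrix_group GL_set\<^esub> X ** X = mat 1"
    using group.l_inv[OF group_GL Xc] by (simp add: matrix_group_def)
  then have "det (inv\<^bsub>matrix_group GL_set\<^esub> X) * det X = 1"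
    by (metis det_I det_mul)
  then show "inv\<^bsub>matrix_group GL_set\<^esub> X \<in> SL2R"
    using X by (simp add: SL2R_def)
next
  fix X Y :: "real^2^2"
  assume "X \<in> SL2R" "Y \<in> SL2R"
  then show "X \<otimes>\<^bsub>matrix_group GL_set\<^esub> Y \<in> SL2R"
    by (simp add: SL2R_def matrix_group_def det_mul)
qed


section \<open>The Zariski topology on the general linear group\<close>

text \<open>Polynomial functions in the matrix entries with coefficients in \<open>K\<close>.\<close>

inductive_set poly_fun :: "complex set \<Rightarrow> (complex^'n^'n \<Rightarrow> complex) set"
  for K :: "complex set" where
  const: "c \<in> K \<Longrightarrow> (\<lambda>X. c) \<in> poly_fun K"
| entry: "(\<lambda>X. X $ i $ j) \<in> poly_fun K"
| add: "p \<in> poly_fun K \<Longrightarrow> q \<in> poly_fun K \<Longrightarrow> (\<lambda>X. p X + q X) \<in> poly_fun K"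
| mult: "p \<in> poly_fun K \<Longrightarrow> q \<in> poly_fun K \<Longrightarrow> (\<lambda>X. p X * q X) \<in> poly_fun K"

text \<open>Regular functions on the general linear group are quotients of polynomial functions by
  powers of the determinant, so polynomials suffice to cut out all Zariski closed subsets.\<close>

definition zero_locus :: "(complex^'n^'n \<Rightarrow> complex) set \<Rightarrow> (complex^'n^'n) set" where
  "zero_locus P = {X \<in> GL_set. \<forall>p\<in>P. p X = 0}"

definition zariski :: "(complex^'n^'n) topology" where
  "zariski = topology (\<lambda>U. \<exists>P\<subseteq>poly_fun UNIV. U = GL_set - zero_locus P)"

lemma istopology_zariski:
  "istopology (\<lambda>U :: (complex^'n^'n) set. \<exists>P\<subseteq>poly_fun UNIV. U = GL_set - zero_locus P)"
  (is "istopology ?open")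
  unfolding istopology_def
proof (intro conjI allI impI)
  fix S T :: "(complex^'n^'n) set"
  assume "?open S" "?open T"
  then obtain P Q where PQ: "P \<subseteq> poly_fun UNIV" "Q \<subseteq> poly_fun UNIV"
    "S = GL_set - zero_locus P" "T = GL_set - zero_locus Q" by blast
  let ?R = "{\<lambda>X. p X * q X |p q. p \<in> P \<and> q \<in> Q}"
  have "?R \<subseteq> poly_fun UNIV"
    using PQ(1,2) by (auto intro!: poly_fun.mult)
  moreover have "S \<inter> T = GL_set - zero_locus ?R"
  proof (intro Set.set_eqI iffI)
    fix X assume "X \<in> S \<inter> T"
    then obtain p q where "X \<in> GL_set" "p \<in> P" "q \<in> Q" "p X \<noteq> 0" "q X \<noteq> 0"
      unfolding PQ(3,4) zero_locus_def by blast
    then have "(\<lambda>X. p X * q X) \<in> ?R" "p X * q X \<noteq> 0" by auto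
    then show "X \<in> GL_set - zero_locus ?R"
      using \<open>X \<in> GL_set\<close> unfolding zero_locus_def by fast
  next
    fix X assume "X \<in> GL_set - zero_locus ?R"
    then obtain p q where "X \<in> GL_set" "p \<in> P" "q \<in> Q" "p X * q X \<noteq> 0"
      unfolding zero_locus_def by blast
    then show "X \<in> S \<inter> T"
      unfolding PQ(3,4) zero_locus_def by auto
  qed
  ultimately show "?open (S \<inter> T)" by blast
next
  fix K :: "(complex^'n^'n) set set"
  assume "\<forall>S\<in>K. ?open S"
  then obtain P where P: "\<And>S. S \<in> K \<Longrightarrow> P S \<subseteq> poly_fun UNIV"
    "\<And>S. S \<in> K \<Longrightarrow> S = GL_set - zero_locus (P S)" by metis
  have "(\<Union>S\<in>K. P S) \<subseteq> poly_fun UNIV"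
    using P(1) by blast
  moreover have "\<Union>K = (\<Union>S\<in>K. GL_set - zero_locus (P S))"
    using P(2) by auto
  then have "\<Union>K = GL_set - zero_locus (\<Union>S\<in>K. P S)"
    by (auto simp: zero_locus_def)
  ultimately show "?open (\<Union>K)" by blast
qed

lemma openin_zariski:
  "openin zariski U \<longleftrightarrow> (\<exists>P\<subseteq>poly_fun UNIV. U = GL_set - zero_locus P)"
  unfolding zariski_def topology_inverse'[OF istopology_zariski] by (rule refl)

lemma topspace_zariski [simp]: "topspace zariski = GL_set"
proof -
  have "GL_set = GL_set - zero_locus {\<lambda>X. 1}"
    by (auto simp: zero_locus_def)
  then have "openin zariski (GL_set :: (complex^'n^'n) set)"
    unfolding openin_zariski by (metis UNIV_I empty_subsetI insert_subset poly_fun.const)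
  then have "GL_set \<subseteq> topspace (zariski :: (complex^'n^'n) topology)"
    by (rule openin_subset)
  moreover have "topspace (zariski :: (complex^'n^'n) topology) \<subseteq> GL_set"
    using openin_topspace[of "zariski :: (complex^'n^'n) topology"]
    unfolding openin_zariski by blast
  ultimately show ?thesis by blast
qed

lemma closedin_zariski:
  "closedin zariski S \<longleftrightarrow> (\<exists>P\<subseteq>poly_fun UNIV. S = zero_locus P)"
proof -
  have "S \<subseteq> GL_set \<and> GL_set - S = GL_set - zero_locus P \<longleftrightarrow> S = zero_locus P" for P
    unfolding zero_locus_def by blast
  then show ?thesis
    unfolding closedin_def topspace_zariski openin_zariski by blast
qed


section \<open>Linear algebraic groups and real reductive groups\<close>

text \<open>A linear algebraic group is identified with its group of complex points, a Zariski
  closed subgroup of a general linear group.\<close>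

definition linear_algebraic_group :: "(complex^'n^'n) set \<Rightarrow> bool" where
  "linear_algebraic_group H \<longleftrightarrow> closedin zariski H \<and> subgroup H (matrix_group GL_set)"

definition defined_over_R :: "(complex^'n^'n) set \<Rightarrow> bool" where
  "defined_over_R H \<longleftrightarrow> (\<exists>P\<subseteq>poly_fun \<real>. H = zero_locus P)"

definition real_points :: "(complex^'n^'n) set \<Rightarrow> (complex^'n^'n) set" where
  "real_points H = {X \<in> H. \<forall>i j. X $ i $ j \<in> \<real>}"

definition unipotent :: "complex^'n^'n \<Rightarrow> bool" where
  "unipotent X \<longleftrightarrow> (\<exists>k. matrix_pow (X - mat 1) k = 0)"

text \<open>Reductive: the unipotent radical, i.e. the largest Zariski connected closed normal
  unipotent subgroup, is trivial.\<close>

definition reductive :: "(complex^'n^'n) set \<Rightarrow> bool" where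
  "reductive H \<longleftrightarrow> linear_algebraic_group H \<and>
     (\<forall>U. closedin zariski U \<and> connectedin zariski U \<and> normal U (matrix_group H) \<and>
          (\<forall>X\<in>U. unipotent X) \<longrightarrow> U = {mat 1})"

definition real_reductive_group :: "(complex^'n^'n) set \<Rightarrow> (complex^'n^'n) set \<Rightarrow> bool" where
  "real_reductive_group GG G \<longleftrightarrow>
     reductive GG \<and> connectedin zariski GG \<and> defined_over_R GG \<and>
     subgroup G (matrix_group (real_points GG)) \<and> openin (top_of_set (real_points GG)) G"

definition identity_component :: "(complex^'n^'n) set \<Rightarrow> (complex^'n^'n) set" where
  "identity_component H = connected_component_of_set (subtopology zariski H) (mat 1)"


section \<open>Lie group homomorphisms\<close>

primrec Ck_on :: "nat \<Rightarrow> 'a::euclidean_space set \<Rightarrow> ('a \<Rightarrow> 'b::euclidean_space) \<Rightarrow> bool" where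
  "Ck_on 0 S f \<longleftrightarrow> continuous_on S f"
| "Ck_on (Suc k) S f \<longleftrightarrow> (\<forall>x\<in>S. f differentiable (at x)) \<and>
     (\<forall>v. Ck_on k S (\<lambda>x. frechet_derivative f (at x) v))"

text \<open>Smoothness of a map on an embedded submanifold \<open>S\<close> of a Euclidean space.\<close>

definition smooth_map_on :: "'a::euclidean_space set \<Rightarrow> ('a \<Rightarrow> 'b::euclidean_space) \<Rightarrow> bool" where
  "smooth_map_on S f \<longleftrightarrow> (\<forall>x\<in>S. \<exists>U F. open U \<and> x \<in> U \<and> (\<forall>k. Ck_on k U F) \<and>
     (\<forall>y\<in>U \<inter> S. F y = f y))"

definition lie_group_hom ::
  "(real^'m^'m) set \<Rightarrow> (complex^'n^'n) set \<Rightarrow> (real^'m^'m \<Rightarrow> complex^'n^'n) \<Rightarrow> bool" where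
  "lie_group_hom S G \<rho> \<longleftrightarrow> \<rho> \<in> hom (matrix_group S) (matrix_group G) \<and> smooth_map_on S \<rho>"

definition lie_differential :: "(real^'m^'m \<Rightarrow> complex^'n^'n) \<Rightarrow> real^'m^'m \<Rightarrow> complex^'n^'n" where
  "lie_differential \<rho> A = vector_derivative (\<lambda>t. \<rho> (matrix_exp (t *\<^sub>R A))) (at 0)"

definition A0 :: "real^2^2" where
  "A0 = vector [vector [1, 0], vector [0, -1]]"

definition sigma :: "(real^2^2 \<Rightarrow> complex^'n^'n) \<Rightarrow> complex^'n^'n" where
  "sigma \<rho> = matrix_exp (\<chi> i j. of_real pi * \<i> * lie_differential \<rho> A0 $ i $ j)"

definition GG_even :: "(complex^'n^'n) set \<Rightarrow> (real^2^2 \<Rightarrow> complex^'n^'n) \<Rightarrow> (complex^'n^'n) set" where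
  "GG_even GG \<rho> = identity_component {X \<in> GG. sigma \<rho> ** X = X ** sigma \<rho>}"

definition G_even ::
  "(complex^'n^'n) set \<Rightarrow> (complex^'n^'n) set \<Rightarrow> (real^2^2 \<Rightarrow> complex^'n^'n) \<Rightarrow> (complex^'n^'n) set" where
  "G_even GG G \<rho> = G \<inter> real_points (GG_even GG \<rho>)"


section \<open>Representation spaces\<close>

text \<open>Homomorphisms are made extensional, so that functions agreeing on \<open>\<Gamma>\<close> are identified; the
  product topology is the topology of pointwise convergence.\<close>

definition Hom_topology ::
  "(real^'m^'m) set \<Rightarrow> (complex^'n^'n) set \<Rightarrow> (real^'m^'m \<Rightarrow> complex^'n^'n) topology" where
  "Hom_topology \<Gamma> G = subtopology (product_topology (\<lambda>_. top_of_set G) \<Gamma>)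
     (hom (matrix_group \<Gamma>) (matrix_group G))"

lemma topspace_Hom_topology:
  "topspace (Hom_topology \<Gamma> G) = hom (matrix_group \<Gamma>) (matrix_group G) \<inter> extensional \<Gamma>"
  by (auto simp: Hom_topology_def PiE_def hom_def matrix_group_def)


section \<open>Fundamental groups\<close>

definition loops :: "'a topology \<Rightarrow> 'a \<Rightarrow> (real \<Rightarrow> 'a) set" where
  "loops X x = {p. pathin X p \<and> p 0 = x \<and> p 1 = x}"

definition loop_homotopy :: "'a topology \<Rightarrow> 'a \<Rightarrow> ((real \<Rightarrow> 'a) \<times> (real \<Rightarrow> 'a)) set" where
  "loop_homotopy X x = {(p, q). p \<in> loops X x \<and> q \<in> loops X x \<and>
     homotopic_with (\<lambda>r. r 0 = x \<and> r 1 = x) (top_of_set {0..1}) X p q}"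

definition loop_concat :: "(real \<Rightarrow> 'a) \<Rightarrow> (real \<Rightarrow> 'a) \<Rightarrow> real \<Rightarrow> 'a" where
  "loop_concat p q = (\<lambda>t. if t \<le> 1/2 then p (2 * t) else q (2 * t - 1))"

definition fundamental_group :: "'a topology \<Rightarrow> 'a \<Rightarrow> (real \<Rightarrow> 'a) set monoid" where
  "fundamental_group X x =
     \<lparr>carrier = loops X x // loop_homotopy X x,
      mult = (\<lambda>P Q. \<Union>p\<in>P. \<Union>q\<in>Q. loop_homotopy X x `` {loop_concat p q}),
      one = loop_homotopy X x `` {\<lambda>_. x}\<rparr>"


section \<open>The closed oriented surface of genus g\<close>

definition quotient_topology :: "'a topology \<Rightarrow> ('a \<times> 'a) set \<Rightarrow> 'a set topology" where
  "quotient_topology X R = topology (\<lambda>U. U \<subseteq> topspace X // R \<and>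
     openin X {x \<in> topspace X. R `` {x} \<in> U})"

lemma istopology_quotient:
  "istopology (\<lambda>U. U \<subseteq> topspace X // R \<and> openin X {x \<in> topspace X. R `` {x} \<in> U})"
  unfolding istopology_def
proof (intro conjI allI impI; (elim conjE)?)
  fix S T
  assume "openin X {x \<in> topspace X. R `` {x} \<in> S}" "openin X {x \<in> topspace X. R `` {x} \<in> T}"
  then have "openin X ({x \<in> topspace X. R `` {x} \<in> S} \<inter> {x \<in> topspace X. R `` {x} \<in> T})"
    by blast
  then show "openin X {x \<in> topspace X. R `` {x} \<in> S \<inter> T}"
    by (rule back_subst[of "openin X"]) auto
next
  fix K
  assume "\<forall>S\<in>K. S \<subseteq> topspace X // R \<and> openin X {x \<in> topspace X. R `` {x} \<in> S}"
  then have "openin X (\<Union>S\<in>K. {x \<in> topspace X. R `` {x} \<in> S})"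
    by blast
  then show "openin X {x \<in> topspace X. R `` {x} \<in> \<Union>K}"
    by (rule back_subst[of "openin X"]) auto
qed auto

lemma openin_quotient_topology:
  "openin (quotient_topology X R) U \<longleftrightarrow>
     U \<subseteq> topspace X // R \<and> openin X {x \<in> topspace X. R `` {x} \<in> U}"
  unfolding quotient_topology_def topology_inverse'[OF istopology_quotient] by (rule refl)

lemma topspace_quotient_topology: "topspace (quotient_topology X R) = topspace X // R"
proof -
  have "{x \<in> topspace X. R `` {x} \<in> topspace X // R} = topspace X"
    by (auto simp: quotient_def)
  then have "openin (quotient_topology X R) (topspace X // R)"
    by (simp add: openin_quotient_topology)
  then show ?thesis
    by (meson openin_quotient_topology openin_subset openin_topspace subset_antisym)
qed

lemma quotient_map_quotient_topology:
  "quotient_map X (quotient_topology X R) (\<lambda>x. R `` {x})"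
proof -
  have "(\<lambda>x. R `` {x}) ` topspace X = topspace X // R"
    by (auto simp: quotient_def)
  then show ?thesis
    unfolding quotient_map_def topspace_quotient_topology openin_quotient_topology by blast
qed

text \<open>The closed unit disc is regarded as a polygon with \<open>4 g\<close> sides, the \<open>k\<close>-th side being the
  boundary arc \<open>polygon_bd g ` {k..k+1}\<close>.  The sides are glued according to the boundary word
  \<open>a\<^sub>1 b\<^sub>1 a\<^sub>1\<^sup>-\<^sup>1 b\<^sub>1\<^sup>-\<^sup>1 \<dots> a\<^sub>g b\<^sub>g a\<^sub>g\<^sup>-\<^sup>1 b\<^sub>g\<^sup>-\<^sup>1\<close>: for \<open>j < g\<close> and \<open>k \<in> {0, 1}\<close>, side \<open>4 j + k\<close> is glued to
  side \<open>4 j + k + 2\<close> with reversed direction.  This is meaningful for \<open>g \<ge> 1\<close>.\<close>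

definition polygon_bd :: "nat \<Rightarrow> real \<Rightarrow> complex" where
  "polygon_bd g s = cis (2 * pi * s / (4 * real g))"

definition side_gluing :: "nat \<Rightarrow> (complex \<times> complex) set" where
  "side_gluing g =
     {(polygon_bd g (real (4 * j + k) + t), polygon_bd g (real (4 * j + k + 3) - t)) | j k t.
        j < g \<and> k < 2 \<and> 0 \<le> t \<and> t \<le> 1}"

definition genus_surface :: "nat \<Rightarrow> complex set topology" where
  "genus_surface g = quotient_topology (top_of_set (cball 0 1))
     ((side_gluing g \<union> (side_gluing g)\<inverse>)\<^sup>*)"

lemma genus_surface_gluing_class:
  assumes "z \<in> cball 0 1"
  shows "((side_gluing g \<union> (side_gluing g)\<inverse>)\<^sup>*) `` {z} \<subseteq> cball 0 1"
proof -
  have "w \<in> cball 0 1" if "(z, w) \<in> (side_gluing g \<union> (side_gluing g)\<inverse>)\<^sup>*" for w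
    using that assms
    by (induction rule: rtrancl_induct) (auto simp: side_gluing_def polygon_bd_def)
  then show ?thesis by blast
qed

end

theory Submission
  imports Defs "HOL-Computational_Algebra.Fundamental_Theorem_Algebra" "HOL-Library.Function_Algebras"
begin

text \<open>Let \<open>a\<^sub>i, b\<^sub>i\<close> be the standard generators of the surface group.  A homomorphism \<open>r\<close> into any group can
  be twisted along the curves \<open>a\<^sub>i\<close>: if \<open>z\<^sub>i\<close> commutes with \<open>r(a\<^sub>i)\<close>, then \<open>b\<^sub>i\<close> may be sent to \<open>z\<^sub>i r(b\<^sub>i)\<close>
  (van Kampen for path functors on the polygon with glued sides).  Discreteness makes every \<open>a\<^sub>i\<close> equal to
  \<open>\<plusminus>exp X\<^sub>i\<close> with \<open>X\<^sub>i\<close> conjugate to a multiple of the diagonal or the strictly upper triangular generator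
  of \<open>sl\<^sub>2\<close>.  Twisting by \<open>exp(t v\<^sub>i)\<close>, where the \<open>v\<^sub>i\<close> are conjugates of vectors spanning the centralizer of
  that generator in the Lie algebra of \<open>Z = {X \<in> GG. \<sigma> X = X \<sigma>}\<close>, deforms \<open>\<rho>\<close>.  For generic \<open>t\<close> the
  Zariski closure of the image contains \<open>\<rho>(SL\<^sub>2)\<close>, because \<open>a\<^sub>0, a\<^sub>1\<close> share no eigenvector, and all \<open>exp(s v\<^sub>i)\<close>.
  As \<open>\<sigma> = \<rho>(-1)\<close>, the \<open>sl\<^sub>2\<close>-module \<open>Lie Z\<close> has only even weights and is generated by such a centralizer,
  so the closure is a closed subgroup of \<open>Z\<close> with the same Lie algebra and contains the identity component.\<close>

section \<open>Paths up to homotopy\<close>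

notation loop_concat (infixr "\<cdot>" 75)

abbreviation unit_square :: "(real \<times> real) set" where "unit_square \<equiv> {0..1} \<times> {0..1}"

lemma continuous_on_pieces:
 fixes f h :: "real => 'a::topological_space"
 assumes "continuous_on {a..b} f" "continuous_on {b..c} h" "f b = h b" "a <= b" "b <= c"
 shows "continuous_on {a..c} (%t. if t <= b then f t else h t)"
proof -
 have "continuous_on ({a..b} \<union> {b..c}) (%t. if t <= b then f t else h t)"
  using assms by (intro continuous_on_If) (auto dest: antisym)
 moreover have "{a..b} \<union> {b..c} = {a..c}" using assms by auto
 ultimately show ?thesis by simp
qed

lemma pathin_topspace: "pathin X p ==> t \<in> {0..1} ==> p t \<in> topspace X"
 by (auto simp: pathin_def continuous_map_def Pi_iff)

lemma pathin_compose:
 assumes "continuous_map (top_of_set S) X f" "continuous_on {0..1} a" "a ` {0..1} \<subseteq> S"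
 shows "pathin X (%t. f (a t))"
proof -
 have "continuous_map (top_of_set {0..1}) (top_of_set S) a"
  using assms(2,3) by (auto simp: continuous_map_in_subtopology)
 from continuous_map_compose[OF this assms(1)] show ?thesis by (simp add: pathin_def o_def)
qed

definition path_homotopic :: "'a topology => (real => 'a) => (real => 'a) => bool" where
 "path_homotopic X p q \<longleftrightarrow> p 0 = q 0 & p 1 = q 1 &
   homotopic_with (%r. r 0 = p 0 & r 1 = p 1) (top_of_set {0..1}) X p q"

lemma path_homotopicE:
 assumes "path_homotopic X p q"
 obtains h :: "real \<times> real => 'a" where "continuous_map (top_of_set unit_square) X h"
  "\<forall>t. h (0, t) = p t" "\<forall>t. h (1, t) = q t" "\<forall>s\<in>{0..1}. h (s, 0) = p 0 & h (s, 1) = p 1"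
 using assms unfolding path_homotopic_def homotopic_with_def prod_topology_subtopology_eu by blast

text \<open>The straight-line homotopy in \<open>K\<close>, extended by \<open>p\<close> and \<open>q\<close> to parameters outside the unit
 interval, where \<^const>\<open>homotopic_with\<close> still compares the two maps.\<close>

lemma path_homotopic_convex:
 fixes K :: "'b::real_normed_vector set"
 assumes H: "continuous_map (top_of_set K) X H" and K: "convex K"
  and a: "continuous_on {0..1} a" "a ` {0..1} \<subseteq> K"
  and b: "continuous_on {0..1} b" "b ` {0..1} \<subseteq> K"
  and ends: "a 0 = b 0" "a 1 = b 1"
  and p: "!!t. t \<in> {0..1} ==> p t = H (a t)" and q: "!!t. t \<in> {0..1} ==> q t = H (b t)"
 shows "path_homotopic X p q"
proof -
 let ?line = "%(s::real, t). (1 - s) *\<^sub>R a t + s *\<^sub>R b t"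
 define h where "h = (%(s, t). if t \<in> {0..1::real} then H (?line (s, t)) else if s = 0 then p t else q t)"
 have "continuous_on ({0..1} \<times> {0..1}) ?line"
  unfolding split_beta
  by (intro continuous_intros continuous_on_compose2[OF a(1)] continuous_on_compose2[OF b(1)]) auto
 moreover have "?line (s, t) \<in> K" if "s \<in> {0..1}" "t \<in> {0..1}" for s t
  using that a(2) b(2) by (auto intro!: convexD[OF K])
 ultimately have "continuous_map (top_of_set unit_square) (top_of_set K) ?line"
  by (auto simp: continuous_map_in_subtopology image_subset_iff)
 from continuous_map_compose[OF this H]
 have "continuous_map (prod_topology (top_of_set {0..1}) (top_of_set {0..1})) X h"
  unfolding prod_topology_subtopology_eu by (rule continuous_map_eq) (auto simp: h_def)
 moreover have "h (0, t) = p t" "h (1, t) = q t" for t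
  by (auto simp: h_def p q)
 moreover have "h (s, 0) = p 0 & h (s, 1) = p 1" for s
  by (auto simp: h_def p q ends simp flip: scaleR_add_left)
 ultimately show ?thesis
  unfolding path_homotopic_def homotopic_with_def using p q ends by (auto intro!: exI[of _ h])
qed

lemma path_homotopic_pathin: "path_homotopic X p q ==> pathin X p & pathin X q"
 unfolding path_homotopic_def pathin_def using homotopic_with_imp_continuous_maps by blast

lemma path_homotopic_ends: "path_homotopic X p q ==> p 0 = q 0 & p 1 = q 1"
 by (simp add: path_homotopic_def)

lemma path_homotopic_refl: "pathin X p ==> path_homotopic X p p"
 by (simp add: path_homotopic_def pathin_def)

lemma path_homotopic_sym: "path_homotopic X p q ==> path_homotopic X q p"
 unfolding path_homotopic_def
 by (elim conjE, drule homotopic_with_symD) simp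

lemma path_homotopic_trans [trans]:
 "path_homotopic X p q ==> path_homotopic X q r ==> path_homotopic X p r"
 unfolding path_homotopic_def by (auto intro: homotopic_with_trans)

lemma path_homotopic_subtopology:
 "path_homotopic (subtopology X U) p q ==> path_homotopic X p q"
 unfolding path_homotopic_def homotopic_with_def by (auto simp: continuous_map_in_subtopology)

lemma path_homotopic_reparam:
 assumes "pathin X p" "continuous_on {0..1} a" "a ` {0..1} \<subseteq> {0..1}" "continuous_on {0..1} b" "b ` {0..1} \<subseteq> {0..1}"
  "a 0 = b 0" "a 1 = b 1" "!!t. t \<in> {0..1} ==> q t = p (a t)" "!!t. t \<in> {0..1} ==> r t = p (b t)"
 shows "path_homotopic X q r"
 by (rule path_homotopic_convex[OF assms(1)[unfolded pathin_def] _ assms(2-9)]) auto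

lemma path_homotopic_eqI:
 "pathin X p ==> (!!t. t \<in> {0..1} ==> p t = q t) ==> path_homotopic X p q"
 by (rule path_homotopic_reparam[of X p "%t. t" "%t. t"]) auto

lemma loop_concat_ends [simp]: "(p \<cdot> q) 0 = p 0" "(p \<cdot> q) 1 = q 1"
 by (auto simp: loop_concat_def)

lemma loop_concat_const [simp]: "(%_. x) \<cdot> (%_. x) = (%_. x)"
 by (simp add: loop_concat_def)

lemma continuous_map_concat:
 fixes f h :: "'b::topological_space \<times> real => 'a"
 assumes f: "continuous_map (top_of_set (S \<times> {0..1})) X f" and h: "continuous_map (top_of_set (S \<times> {0..1})) X h"
  and join: "!!s. s \<in> S ==> f (s, 1) = h (s, 0)"
 shows "continuous_map (top_of_set (S \<times> {0..1})) X
   (%z. if snd z <= 1/2 then f (fst z, 2 * snd z) else h (fst z, 2 * snd z - 1))"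
proof (rule continuous_map_cases_le)
 let ?Y = "top_of_set (S \<times> {0..1::real})"
 let ?A = "{z \<in> topspace ?Y. snd z <= 1/2}" and ?B = "{z \<in> topspace ?Y. 1/2 <= snd z}"
 have "continuous_map (subtopology ?Y ?A) ?Y (%z. (fst z, 2 * snd z))"
  unfolding subtopology_subtopology continuous_map_in_subtopology by (auto intro!: continuous_intros)
 from continuous_map_compose[OF this f]
 show "continuous_map (subtopology ?Y ?A) X (%z. f (fst z, 2 * snd z))" by (simp add: o_def)
 have "continuous_map (subtopology ?Y ?B) ?Y (%z. (fst z, 2 * snd z - 1))"
  unfolding subtopology_subtopology continuous_map_in_subtopology by (auto intro!: continuous_intros)
 from continuous_map_compose[OF this h]
 show "continuous_map (subtopology ?Y ?B) X (%z. h (fst z, 2 * snd z - 1))" by (simp add: o_def)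
 show "f (fst z, 2 * snd z) = h (fst z, 2 * snd z - 1)" if "z \<in> topspace ?Y" "snd z = 1/2" for z
  using join[of "fst z"] that by (simp add: mem_Times_iff) (simp add: that)
qed (auto intro!: continuous_intros)

lemma path_homotopic_cong:
 assumes "path_homotopic X p p'" "path_homotopic X q q'" "p 1 = q 0"
 shows "path_homotopic X (p \<cdot> q) (p' \<cdot> q')"
proof -
 obtain h where h: "continuous_map (top_of_set unit_square) X h"
  "\<forall>t. h (0, t) = p t" "\<forall>t. h (1, t) = p' t" "\<forall>s\<in>{0..1}. h (s, 0) = p 0 & h (s, 1) = p 1"
  using path_homotopicE[OF assms(1)] .
 obtain k where k: "continuous_map (top_of_set unit_square) X k"
  "\<forall>t. k (0, t) = q t" "\<forall>t. k (1, t) = q' t" "\<forall>s\<in>{0..1}. k (s, 0) = q 0 & k (s, 1) = q 1"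
  using path_homotopicE[OF assms(2)] .
 let ?f = "%z. if snd z <= 1/2 then h (fst z, 2 * snd z) else k (fst z, 2 * snd z - 1)"
 have "continuous_map (top_of_set unit_square) X ?f"
  using h k assms(3) by (intro continuous_map_concat) auto
 then have "continuous_map (prod_topology (top_of_set {0..1}) (top_of_set {0..1})) X ?f"
  by (simp add: prod_topology_subtopology_eu)
 moreover have "?f (0, t) = (p \<cdot> q) t" "?f (1, t) = (p' \<cdot> q') t" for t
  using h k by (auto simp: loop_concat_def)
 moreover have "?f (s, 0) = p 0 & ?f (s, 1) = q 1" if "s \<in> {0..1}" for s
  using h(4) k(4) that by simp
 ultimately show ?thesis using assms(1,2)
  unfolding path_homotopic_def homotopic_with_def by (auto intro!: exI[of _ ?f])
qed

lemma pathin_loop_concat: "pathin X p ==> pathin X q ==> p 1 = q 0 ==> pathin X (p \<cdot> q)"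
 using path_homotopic_cong[OF path_homotopic_refl path_homotopic_refl] path_homotopic_pathin by metis

lemmas path_homotopic_congL = path_homotopic_cong[OF _ path_homotopic_refl]
lemmas path_homotopic_congR = path_homotopic_cong[OF path_homotopic_refl]

definition path_rev :: "(real => 'a) => real => 'a" where
 "path_rev p = (%t. p (1 - t))"

lemma path_rev_simps [simp]:
 "path_rev p 0 = p 1" "path_rev p 1 = p 0" "path_rev (path_rev p) = p" "path_rev (%_. x) = (%_. x)"
 by (auto simp: path_rev_def)

lemma pathin_path_rev: "pathin X p ==> pathin X (path_rev p)"
 unfolding path_rev_def by (rule pathin_compose[of "{0..1}"]) (auto simp: pathin_def intro!: continuous_intros)

lemma path_homotopic_assoc:
 assumes "pathin X p" "pathin X q" "pathin X r" "p 1 = q 0" "q 1 = r 0"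
 shows "path_homotopic X ((p \<cdot> q) \<cdot> r) (p \<cdot> q \<cdot> r)"
proof -
 let ?b = "%t::real. if t <= 1/2 then t / 2 else if t <= 3/4 then t - 1/4 else 2 * t - 1"
 have "continuous_on {0..1} ?b"
  by (intro continuous_on_pieces continuous_intros) auto
 moreover have "pathin X ((p \<cdot> q) \<cdot> r)"
  using assms by (intro pathin_loop_concat) auto
 ultimately show ?thesis
  by (intro path_homotopic_reparam[where a="%t. t" and b="?b"])
    (auto intro!: continuous_intros simp: loop_concat_def algebra_simps)
qed

lemma path_homotopic_lunit:
 assumes "pathin X p" "!!t. t \<in> {0..1} ==> c t = p 0"
 shows "path_homotopic X (c \<cdot> p) p"
proof -
 have "continuous_on {0..1} (%t::real. if t <= 1/2 then 0 else 2 * t - 1)"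
  by (intro continuous_on_pieces continuous_intros) auto
 with assms show ?thesis
  by (intro path_homotopic_reparam[OF assms(1), where a="%t. if t <= 1/2 then 0 else 2 * t - 1" and b="%t. t"])
    (auto intro!: continuous_intros simp: loop_concat_def)
qed

lemma path_homotopic_runit:
 assumes "pathin X p" "!!t. t \<in> {0..1} ==> c t = p 1"
 shows "path_homotopic X (p \<cdot> c) p"
proof -
 have "continuous_on {0..1} (%t::real. if t <= 1/2 then 2 * t else 1)"
  by (intro continuous_on_pieces continuous_intros) auto
 with assms show ?thesis
  by (intro path_homotopic_reparam[OF assms(1), where a="%t. if t <= 1/2 then 2 * t else 1" and b="%t. t"])
    (auto intro!: continuous_intros simp: loop_concat_def)
qed

lemma path_homotopic_rinv:
 assumes "pathin X p" shows "path_homotopic X (p \<cdot> path_rev p) (%_. p 0)"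
proof -
 have "continuous_on {0..1} (%t::real. if t <= 1/2 then 2 * t else 2 - 2 * t)"
  by (intro continuous_on_pieces continuous_intros) auto
 with assms show ?thesis
  by (intro path_homotopic_reparam[OF assms(1), where a="%t. if t <= 1/2 then 2 * t else 2 - 2 * t" and b="%t. 0"])
    (auto intro!: continuous_intros simp: loop_concat_def path_rev_def)
qed

lemma path_homotopic_linv: "pathin X p ==> path_homotopic X (path_rev p \<cdot> p) (%_. p 1)"
 using path_homotopic_rinv[OF pathin_path_rev, of X p] by simp

abbreviation loop_class :: "'a topology => 'a => (real => 'a) => (real => 'a) set" where
 "loop_class X x p \<equiv> loop_homotopy X x `` {p}"

lemma loop_homotopy_iff:
 "(p, q) \<in> loop_homotopy X x \<longleftrightarrow> p 0 = x & p 1 = x & path_homotopic X p q"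
 unfolding loop_homotopy_def loops_def
 using path_homotopic_pathin[of X p q] by (auto simp: path_homotopic_def)

lemma loop_class_eqI:
 assumes "p 0 = x" "p 1 = x" "path_homotopic X p q"
 shows "loop_class X x p = loop_class X x q"
proof (rule Set.set_eqI)
 fix r
 have "q 0 = x" "q 1 = x" using assms by (auto simp: path_homotopic_def)
 then show "r \<in> loop_class X x p \<longleftrightarrow> r \<in> loop_class X x q"
  using assms path_homotopic_trans[OF assms(3), of r]
   path_homotopic_trans[OF path_homotopic_sym[OF assms(3)], of r]
  by (auto simp: loop_homotopy_iff)
qed

lemma loop_class_self: "p \<in> loops X x ==> p \<in> loop_class X x p"
 using path_homotopic_refl[of X p] by (auto simp: loop_homotopy_iff loops_def)

lemma loop_class_carrier: "p \<in> loops X x ==> loop_class X x p \<in> carrier (fundamental_group X x)"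
 by (auto simp: fundamental_group_def quotient_def)

lemma fundamental_group_carrierE:
 assumes "P \<in> carrier (fundamental_group X x)"
 obtains p where "p \<in> loops X x" "P = loop_class X x p"
 using assms by (auto simp: fundamental_group_def quotient_def)

lemma loop_concat_loops: "p \<in> loops X x ==> q \<in> loops X x ==> p \<cdot> q \<in> loops X x"
 by (auto simp: loops_def intro: pathin_loop_concat)

lemma loop_class_mult:
 assumes "p \<in> loops X x" "q \<in> loops X x"
 shows "loop_class X x p \<otimes>\<^bsub>fundamental_group X x\<^esub> loop_class X x q = loop_class X x (p \<cdot> q)"
proof -
 have "loop_class X x (p' \<cdot> q') = loop_class X x (p \<cdot> q)"
  if "p' \<in> loop_class X x p" "q' \<in> loop_class X x q" for p' q'
  using that assms
  by (intro loop_class_eqI[symmetric]) (auto simp: loop_homotopy_iff loops_def intro: path_homotopic_cong)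
 then have "(\<Union>p'\<in>loop_class X x p. \<Union>q'\<in>loop_class X x q. loop_class X x (p' \<cdot> q')) =
   (\<Union>p'\<in>loop_class X x p. \<Union>q'\<in>loop_class X x q. loop_class X x (p \<cdot> q))"
  by (intro SUP_cong refl)
 also have "... = loop_class X x (p \<cdot> q)" using assms loop_class_self by fastforce
 finally show ?thesis by (simp add: fundamental_group_def)
qed

section \<open>Path functors\<close>

locale path_functor = Q: group Q
 for Q :: "('q, 'b) monoid_scheme" (structure) +
 fixes X :: "'a topology" and E :: "(real => 'a) => 'q"
 assumes E_closed: "pathin X p ==> E p \<in> carrier Q"
  and E_concat: "pathin X p ==> pathin X q ==> p 1 = q 0 ==> E (p \<cdot> q) = E p \<otimes> E q"
  and E_homotopic: "path_homotopic X p q ==> E p = E q"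

lemma path_functor_subtopology:
 assumes "path_functor Q X E" and "!!p. pathin (subtopology X U) p ==> F p = E p"
 shows "path_functor Q (subtopology X U) F"
proof -
 interpret path_functor Q X E by fact
 show ?thesis
 proof
  fix p q assume "path_homotopic (subtopology X U) p q"
  then show "F p = F q"
   using assms(2) path_homotopic_pathin E_homotopic path_homotopic_subtopology by metis
 next
  fix p q assume "pathin (subtopology X U) p" "pathin (subtopology X U) q" "p 1 = q 0"
  then show "F (p \<cdot> q) = F p \<otimes>\<^bsub>Q\<^esub> F q"
   by (metis assms(2) E_concat pathin_loop_concat pathin_subtopology)
 qed (simp add: assms(2) E_closed pathin_subtopology)
qed

context path_functor
begin

lemma E_eq: "pathin X p ==> (!!t. t \<in> {0..1} ==> p t = q t) ==> E p = E q"
 using E_homotopic path_homotopic_eqI by metis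

lemma E_const:
 assumes "x \<in> topspace X" "!!t. t \<in> {0..1} ==> c t = x" shows "E c = \<one>"
proof -
 have path: "pathin X (%_. x)" using assms(1) by (simp add: pathin_const)
 then have "E (%_. x) \<otimes> E (%_. x) = E (%_. x)" using E_concat[OF path path] by simp
 then have "E (%_. x) = \<one>" using E_closed[OF path] by (simp add: Q.l_cancel_one)
 then show ?thesis using E_eq[OF path] assms(2) by metis
qed

lemma E_rev:
 assumes "pathin X p" shows "E (path_rev p) = inv E p"
proof -
 have "E p \<otimes> E (path_rev p) = \<one>"
  using E_homotopic[OF path_homotopic_rinv[OF assms]] E_concat[OF assms pathin_path_rev[OF assms]]
   E_const[OF pathin_topspace[OF assms, of 0]] by simp
 then show ?thesis
  using assms E_closed pathin_path_rev by (metis Q.inv_equality Q.inv_inv)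
qed

lemma E_square:
 assumes h: "continuous_map (top_of_set unit_square) X h"
 shows "E (%t. h (0, t)) \<otimes> E (%s. h (s, 1)) = E (%s. h (s, 0)) \<otimes> E (%t. h (1, t))"
proof -
 let ?a = "%t::real. if t <= 1/2 then (0, 2 * t) else (2 * t - 1, 1)"
 let ?b = "%t::real. if t <= 1/2 then (2 * t, 0) else (1, 2 * t - 1)"
 have cont: "continuous_on {0..1} ?a" "continuous_on {0..1} ?b"
  by (intro continuous_on_pieces continuous_intros; simp)+
 have edge: "pathin X (%t. h (0, t))" "pathin X (%s. h (s, 1))" "pathin X (%s. h (s, 0))" "pathin X (%t. h (1, t))"
  by (rule pathin_compose[OF h]; auto intro!: continuous_intros)+
 have "path_homotopic X ((%t. h (0, t)) \<cdot> (%s. h (s, 1))) ((%s. h (s, 0)) \<cdot> (%t. h (1, t)))"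
  by (rule path_homotopic_convex[OF h _ cont(1) _ cont(2)]) (auto intro!: convex_Times simp: loop_concat_def)
 then show ?thesis using E_homotopic E_concat edge by metis
qed

lemma gauge_transform:
 assumes c: "!!x. x \<in> topspace X ==> c x \<in> carrier Q"
 shows "path_functor Q X (%p. inv c (p 0) \<otimes> E p \<otimes> c (p 1))"
proof
 have end_closed: "c (p 0) \<in> carrier Q" "c (p 1) \<in> carrier Q" if "pathin X p" for p
  using c pathin_topspace[OF that] by auto
 show "inv c (p 0) \<otimes> E p \<otimes> c (p 1) \<in> carrier Q" if "pathin X p" for p
  using end_closed[OF that] E_closed[OF that] by simp
 show "inv c ((p \<cdot> q) 0) \<otimes> E (p \<cdot> q) \<otimes> c ((p \<cdot> q) 1) =
   inv c (p 0) \<otimes> E p \<otimes> c (p 1) \<otimes> (inv c (q 0) \<otimes> E q \<otimes> c (q 1))"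
  if "pathin X p" "pathin X q" "p 1 = q 0" for p q
 proof -
  have "c (q 0) \<otimes> (inv c (q 0) \<otimes> (E q \<otimes> c (q 1))) = E q \<otimes> c (q 1)"
   using end_closed[OF that(2)] E_closed[OF that(2)] by (simp add: Q.m_assoc[symmetric])
  then show ?thesis using that end_closed E_closed by (simp add: E_concat Q.m_assoc)
 qed
 show "inv c (p 0) \<otimes> E p \<otimes> c (p 1) = inv c (q 0) \<otimes> E q \<otimes> c (q 1)" if "path_homotopic X p q" for p q
  using E_homotopic[OF that] path_homotopic_ends[OF that] by simp
qed

lemma induced_hom:
 obtains r where "r \<in> hom (fundamental_group X x) Q" "!!p. p \<in> loops X x ==> r (loop_class X x p) = E p"
proof
 let ?r = "%P. E (SOME p. p \<in> P)"
 show r: "?r (loop_class X x p) = E p" if "p \<in> loops X x" for p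
 proof -
  have "(SOME q. q \<in> loop_class X x p) \<in> loop_class X x p" using someI[of "%q. q \<in> loop_class X x p", OF loop_class_self[OF that]] .
  then show ?thesis using E_homotopic by (auto simp: loop_homotopy_iff)
 qed
 show "?r \<in> hom (fundamental_group X x) Q"
 proof (rule homI)
  fix P assume "P \<in> carrier (fundamental_group X x)"
  then show "?r P \<in> carrier Q" using r E_closed by (elim fundamental_group_carrierE) (simp add: loops_def)
 next
  fix P P' assume "P \<in> carrier (fundamental_group X x)" "P' \<in> carrier (fundamental_group X x)"
  then obtain p p' where "p \<in> loops X x" "P = loop_class X x p" "p' \<in> loops X x" "P' = loop_class X x p'"
   by (elim fundamental_group_carrierE)
  then show "?r (P \<otimes>\<^bsub>fundamental_group X x\<^esub> P') = ?r P \<otimes> ?r P'"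
   using r loop_concat_loops[of p X x p'] by (simp add: loop_class_mult E_concat loops_def)
 qed
qed

end

locale base_paths =
 fixes X :: "'a topology" and x and B :: "'a => real => 'a"
 assumes B: "y \<in> topspace X ==> pathin X (B y) & B y 0 = x & B y 1 = y" and B_base: "B x = (%_. x)"
  and x: "x \<in> topspace X"
begin

definition based_loop :: "(real => 'a) => real => 'a" where
 "based_loop p = (B (p 0) \<cdot> p) \<cdot> path_rev (B (p 1))"

lemma based_loop_loops: "pathin X p ==> based_loop p \<in> loops X x"
 using B pathin_topspace[of X p] by (auto simp: based_loop_def loops_def intro!: pathin_loop_concat pathin_path_rev)

lemma based_loop_ends: "pathin X p ==> based_loop p 0 = x" "pathin X p ==> based_loop p 1 = x"
 using based_loop_loops by (auto simp: loops_def)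

lemma based_loop_cong: "path_homotopic X p q ==> path_homotopic X (based_loop p) (based_loop q)"
 using B path_homotopic_pathin[of X p q] path_homotopic_ends[of X p q] pathin_topspace[of X q 0] pathin_topspace[of X q 1]
 unfolding based_loop_def by (auto intro!: path_homotopic_congL path_homotopic_congR pathin_path_rev)

lemma based_loop_concat:
 assumes p: "pathin X p" and q: "pathin X q" and e: "p 1 = q 0"
 shows "path_homotopic X (based_loop p \<cdot> based_loop q) (based_loop (p \<cdot> q))"
proof -
 let ?A = "B (p 0)" and ?B = "B (q 0)" and ?C = "path_rev (B (q 1))"
 note paths = pathin_loop_concat pathin_path_rev p q e B pathin_topspace
 have "path_homotopic X (((?A \<cdot> p) \<cdot> path_rev (B (p 1))) \<cdot> ((?B \<cdot> q) \<cdot> ?C))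
   ((?A \<cdot> p) \<cdot> path_rev ?B \<cdot> (?B \<cdot> q) \<cdot> ?C)"
  unfolding e by (rule path_homotopic_assoc) (simp_all add: paths)
 also have "path_homotopic X ... ((?A \<cdot> p) \<cdot> (path_rev ?B \<cdot> ?B \<cdot> q) \<cdot> ?C)"
  by (rule path_homotopic_congR[OF _ path_homotopic_sym[OF path_homotopic_assoc]]) (simp_all add: paths)
 also have "path_homotopic X ... ((?A \<cdot> p) \<cdot> ((path_rev ?B \<cdot> ?B) \<cdot> q) \<cdot> ?C)"
  by (rule path_homotopic_congR[OF _ path_homotopic_congL[OF path_homotopic_sym[OF path_homotopic_assoc]]])
    (simp_all add: paths)
 also have "path_homotopic X ... ((?A \<cdot> p) \<cdot> ((%_. ?B 1) \<cdot> q) \<cdot> ?C)"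
  by (rule path_homotopic_congR[OF _ path_homotopic_congL[OF path_homotopic_congL[OF path_homotopic_linv]]])
    (simp_all add: paths)
 also have "path_homotopic X ... ((?A \<cdot> p) \<cdot> q \<cdot> ?C)"
  by (rule path_homotopic_congR[OF _ path_homotopic_congL[OF path_homotopic_lunit]]) (simp_all add: paths)
 also have "path_homotopic X ... (((?A \<cdot> p) \<cdot> q) \<cdot> ?C)"
  by (rule path_homotopic_sym[OF path_homotopic_assoc]) (simp_all add: paths)
 also have "path_homotopic X ... ((?A \<cdot> p \<cdot> q) \<cdot> ?C)"
  by (rule path_homotopic_congL[OF path_homotopic_assoc]) (simp_all add: paths)
 finally show ?thesis by (simp add: based_loop_def)
qed

lemma based_loop_of_loop: assumes "p \<in> loops X x" shows "path_homotopic X (based_loop p) p"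
proof -
 have p: "pathin X p" "p 0 = x" "p 1 = x" using assms by (auto simp: loops_def)
 have path: "pathin X ((%_. x) \<cdot> p)" using p x by (intro pathin_loop_concat) (auto simp: pathin_const)
 have "path_homotopic X (based_loop p) ((%_. x) \<cdot> p)"
  unfolding based_loop_def p B_base path_rev_simps using p path by (intro path_homotopic_runit) auto
 also have "path_homotopic X ... p" using p by (intro path_homotopic_lunit) auto
 finally show ?thesis .
qed

end

lemma (in group) path_functor_of_hom:
 assumes r: "r \<in> hom (fundamental_group X x) G" and x: "x \<in> topspace X"
  and connected: "!!y. y \<in> topspace X ==> \<exists>p. pathin X p & p 0 = x & p 1 = y"
 shows "\<exists>E. path_functor G X E & (\<forall>p\<in>loops X x. E p = r (loop_class X x p))"
proof -
 let ?B = "%y. if y = x then (%_. x) else SOME p. pathin X p & p 0 = x & p 1 = y"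
 interpret base_paths X x ?B
 proof
  show "pathin X (?B y) & ?B y 0 = x & ?B y 1 = y" if "y \<in> topspace X" for y
   using x someI_ex[OF connected[OF that]] by (auto simp: pathin_const)
 qed (simp_all add: x)
 let ?E = "%p. r (loop_class X x (based_loop p))"
 have "path_functor G X ?E"
 proof
  show "?E p \<in> carrier G" if "pathin X p" for p
   using hom_in_carrier[OF r loop_class_carrier[OF based_loop_loops[OF that]]] .
  show "?E (p \<cdot> q) = ?E p \<otimes> ?E q" if pq: "pathin X p" "pathin X q" "p 1 = q 0" for p q
  proof -
   have "loop_class X x (based_loop (p \<cdot> q)) = loop_class X x (based_loop p \<cdot> based_loop q)"
    using based_loop_ends pq based_loop_concat[OF pq] by (intro loop_class_eqI[symmetric]) auto
   then show ?thesis
    using hom_mult[OF r loop_class_carrier loop_class_carrier, OF based_loop_loops based_loop_loops, OF pq(1,2)]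
    by (simp add: loop_class_mult[OF based_loop_loops based_loop_loops, OF pq(1,2)])
  qed
  show "?E p = ?E q" if "path_homotopic X p q" for p q
   by (simp add: loop_class_eqI[OF based_loop_ends[OF conjunct1[OF path_homotopic_pathin[OF that]]] based_loop_cong[OF that]])
 qed
 moreover have "loop_class X x (based_loop p) = loop_class X x p" if p: "p \<in> loops X x" for p
  by (rule loop_class_eqI[OF _ _ based_loop_of_loop[OF p]]) (use based_loop_ends p in \<open>auto simp: loops_def\<close>)
 ultimately show ?thesis by (intro exI[of _ ?E]) simp
qed

text \<open>A gauge transformation makes the functor trivial along prescribed paths \<open>\<nu> y\<close> from a base point.\<close>

lemma (in group) path_functor_exists:
 assumes r: "r \<in> hom (fundamental_group X x) G" and x: "x \<in> topspace X"
  and \<nu>: "!!y. y \<in> topspace X ==> pathin X (\<nu> y) & \<nu> y 0 = o' & \<nu> y 1 = y"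
  and \<nu>o: "!!t. \<nu> o' t = o'"
 shows "\<exists>E. path_functor G X E & (\<forall>p\<in>loops X x. E p = r (loop_class X x p)) &
   (\<forall>y\<in>topspace X. E (\<nu> y) = \<one>)"
proof -
 have o': "o' \<in> topspace X" using \<nu>[OF x] pathin_topspace[of X "\<nu> x" 0] by simp
 have "pathin X (path_rev (\<nu> x) \<cdot> \<nu> y)" if "y \<in> topspace X" for y
  using \<nu>[OF x] \<nu>[OF that] by (auto intro!: pathin_loop_concat pathin_path_rev)
 then have "\<exists>p. pathin X p & p 0 = x & p 1 = y" if "y \<in> topspace X" for y
  using \<nu>[OF x] \<nu>[OF that] that by (intro exI[of _ "path_rev (\<nu> x) \<cdot> \<nu> y"]) simp
 then obtain E where E: "path_functor G X E" "!!p. p \<in> loops X x ==> E p = r (loop_class X x p)"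
  using path_functor_of_hom[OF r x] by blast
 interpret path_functor G X E by fact
 have E\<nu>: "E (\<nu> y) \<in> carrier G" if "y \<in> topspace X" for y using \<nu>[OF that] E_closed by simp
 define c where "c y = inv E (\<nu> y) \<otimes> E (\<nu> x)" for y
 have c: "c y \<in> carrier G" if "y \<in> topspace X" for y using E\<nu> that x by (simp add: c_def)
 have cx: "c x = \<one>" using E\<nu>[OF x] by (simp add: c_def)
 have "E (\<nu> o') = \<one>" using E_const[OF o'] \<nu>o by metis
 then have co: "c o' = E (\<nu> x)" using E\<nu>[OF x] by (simp add: c_def)
 have "inv c o' \<otimes> E (\<nu> y) \<otimes> c y = \<one>" if y: "y \<in> topspace X" for y
 proof -
  have "E (\<nu> y) \<otimes> (inv E (\<nu> y) \<otimes> E (\<nu> x)) = E (\<nu> x)" using E\<nu>[OF y] E\<nu>[OF x] by (simp add: m_assoc[symmetric])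
  then show ?thesis using E\<nu>[OF y] E\<nu>[OF x] by (simp add: c_def[of y] co m_assoc)
 qed
 moreover have "inv c x \<otimes> E p \<otimes> c x = r (loop_class X x p)" if "p \<in> loops X x" for p
  using that E_closed by (simp add: E(2)[symmetric] cx loops_def)
 ultimately show ?thesis
  using gauge_transform[of c, OF c] \<nu> by (intro exI[of _ "%p. inv c (p 0) \<otimes> E p \<otimes> c (p 1)"]) (auto simp: loops_def)
qed

subsection \<open>Subdivision of paths\<close>

primrec rprod :: "('q, 'b) monoid_scheme => (nat => 'q) => nat => 'q" where
 "rprod Q f 0 = \<one>\<^bsub>Q\<^esub>"
| "rprod Q f (Suc n) = rprod Q f n \<otimes>\<^bsub>Q\<^esub> f n"

context monoid begin

lemma rprod_closed: "(!!i. i < n ==> f i \<in> carrier G) ==> rprod G f n \<in> carrier G"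
 by (induction n) auto

lemma rprod_cong: "(!!i. i < n ==> f i = h i) ==> rprod G f n = rprod G h n"
 by (induction n) auto

lemma rprod_add:
 "(!!i. i < m + n ==> f i \<in> carrier G) ==>
   rprod G f (m + n) = rprod G f m \<otimes> rprod G (%i. f (m + i)) n"
 by (induction n) (auto simp: m_assoc rprod_closed)

lemma rprod_mult:
 "(!!i. i < n * k ==> f i \<in> carrier G) ==>
   rprod G f (n * k) = rprod G (%i. rprod G (%j. f (i * k + j)) k) n"
proof (induction n)
 case (Suc n)
 have "rprod G f (n * k + k) = rprod G f (n * k) \<otimes> rprod G (%i. f (n * k + i)) k"
  using Suc.prems by (intro rprod_add) (simp add: add.commute)
 moreover have "rprod G f (n * k) = rprod G (%i. rprod G (%j. f (i * k + j)) k) n"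
  using Suc by simp
 ultimately show ?case by (simp add: add.commute)
qed auto

lemma rprod_telescope:
 assumes "!!i. i < n ==> f i \<in> carrier G & h i \<in> carrier G" "!!i. i <= n ==> c i \<in> carrier G"
  and "!!i. i < n ==> f i \<otimes> c (Suc i) = c i \<otimes> h i"
 shows "rprod G f n \<otimes> c n = c 0 \<otimes> rprod G h n"
 using assms
proof (induction n)
 case (Suc n)
 have [simp]: "rprod G f n \<in> carrier G" "rprod G h n \<in> carrier G" "f n \<in> carrier G" "h n \<in> carrier G"
   "c n \<in> carrier G" "c (Suc n) \<in> carrier G" "c 0 \<in> carrier G"
  using Suc.prems(1,2) by (auto intro!: rprod_closed)
 have "rprod G f (Suc n) \<otimes> c (Suc n) = rprod G f n \<otimes> (c n \<otimes> h n)"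
  using Suc.prems(3)[of n] by (simp add: m_assoc)
 also have "... = (rprod G f n \<otimes> c n) \<otimes> h n" by (simp add: m_assoc)
 also have "rprod G f n \<otimes> c n = c 0 \<otimes> rprod G h n"
  using Suc by simp
 finally show ?case by (simp add: m_assoc)
qed auto

end

lemma (in group_hom) hom_rprod:
 "(!!i. i < n ==> f i \<in> carrier G) ==> h (rprod G f n) = rprod H (%i. h (f i)) n"
 by (induction n) (auto simp: G.rprod_closed)

definition piece :: "(real => 'a) => nat => nat => real => 'a" where
 "piece p n j = (%t. p ((real j + t) / real n))"

lemma piece_unit: "j < n ==> t \<in> {0..1} ==> (real j + t) / real n \<in> {0..1}"
 by (auto simp: field_simps)

lemma pathin_piece:
 assumes "pathin X p" "j < n" shows "pathin X (piece p n j)"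
 unfolding piece_def using piece_unit[OF assms(2)] assms(2)
 by (intro pathin_compose[OF assms(1)[unfolded pathin_def]]) (auto intro!: continuous_intros simp del: atLeastAtMost_iff)

lemma piece_piece: "k > 0 ==> piece p (n * k) (j * k + i) = piece (piece p n j) k i"
 by (cases "n = 0") (auto simp: piece_def field_simps intro!: arg_cong[where f=p])

lemma piece_loop_concat:
 assumes "j < n" "t \<in> {0..1}"
 shows "piece (p \<cdot> q) (n + n) j t = piece p n j t"
  and "p 1 = q 0 ==> piece (p \<cdot> q) (n + n) (n + j) t = piece q n j t"
proof -
 have "2 * ((real j + t) / real (n + n)) = (real j + t) / real n" using assms(1) by (simp add: divide_simps)
 moreover have "(real j + t) / real (n + n) <= 1/2" using assms by (auto simp: field_simps)
 ultimately show "piece (p \<cdot> q) (n + n) j t = piece p n j t"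
  by (simp only: piece_def loop_concat_def if_True)
 assume e: "p 1 = q 0"
 have half: "(real (n + j) + t) / real (n + n) = 1/2 + (real j + t) / real n / 2"
  using assms(1) by (simp add: field_simps)
 have second_half: "(p \<cdot> q) (1/2 + s / 2) = q s" if "0 <= s" for s
  using e that by (cases "s = 0") (simp_all add: loop_concat_def)
 then show "piece (p \<cdot> q) (n + n) (n + j) t = piece q n j t"
  unfolding piece_def half using assms(2) by (intro second_half) simp
qed

definition initial :: "(real => 'a) => nat => nat => real => 'a" where
 "initial p n i = (%t. p (real i * t / real n))"

lemma pathin_initial: assumes p: "pathin X p" and i: "i <= n" "n > 0" shows "pathin X (initial p n i)"
proof -
 have "real i * t <= n" if "t <= 1" "0 <= t" for t using mult_mono[of "real i" n t 1] that i(1) by simp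
 then show ?thesis unfolding initial_def using i(2)
  by (intro pathin_compose[OF p[unfolded pathin_def]]) (auto intro!: continuous_intros)
qed

lemma path_homotopic_initial_piece:
 assumes p: "pathin X p" and i: "i < n"
 shows "path_homotopic X (initial p n i \<cdot> piece p n i) (initial p n (Suc i))"
proof -
 let ?a = "%t. if t <= 1/2 then real i * (2 * t) / n else (real i + (2 * t - 1)) / n"
 let ?b = "%t. real (Suc i) * t / n"
 have "?a t \<in> {0..1}" if t: "t \<in> {0..1}" for t
 proof (cases "t <= 1/2")
  case True
  then have "real i * (2 * t) <= real n * 1" using t i by (intro mult_mono) auto
  then show ?thesis using True t i by simp
 next
  case False
  then show ?thesis using t i piece_unit[of i n "2 * t - 1"] by simp
 qed
 then have "?a ` {0..1} \<subseteq> {0..1}" by blast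
 moreover have "?b t \<in> {0..1}" if "t \<in> {0..1}" for t
  using that mult_mono[of "real (Suc i)" n t 1] i by auto
 then have "?b ` {0..1} \<subseteq> {0..1}" by blast
 moreover have "continuous_on {0..1} ?a" by (intro continuous_on_pieces continuous_intros) (use i in auto)
 moreover have "continuous_on {0..1} ?b" using i by (intro continuous_intros) auto
 ultimately show ?thesis
  by (intro path_homotopic_reparam[OF p, of ?a ?b]) (simp_all add: loop_concat_def initial_def piece_def)
qed

lemma (in path_functor) E_pieces:
 assumes p: "pathin X p" and n: "n > 0" shows "E p = rprod Q (%j. E (piece p n j)) n"
proof -
 have "E (initial p n i) = rprod Q (%j. E (piece p n j)) i" if "i <= n" for i
  using that
 proof (induction i)
  case 0
  then show ?case using pathin_topspace[OF p, of 0] by (auto intro!: E_const simp: initial_def)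
 next
  case (Suc i)
  have "E (initial p n (Suc i)) = E (initial p n i \<cdot> piece p n i)"
   using path_homotopic_initial_piece[OF p] Suc.prems by (intro E_homotopic[symmetric]) simp
  also have "... = E (initial p n i) \<otimes>\<^bsub>Q\<^esub> E (piece p n i)"
   using Suc.prems n by (intro E_concat pathin_initial pathin_piece p) (simp_all add: initial_def piece_def)
  finally show ?case using Suc by simp
 qed
 moreover have "initial p n n = p" using n by (simp add: initial_def)
 ultimately show ?thesis by (metis order_refl)
qed

lemma cover_Lebesgue:
 fixes S :: "'b::euclidean_space set"
 assumes S: "compact S" "S ~= {}" and f: "continuous_map (top_of_set S) X f"
  and C: "!!U. U \<in> C ==> openin X U" "topspace X \<subseteq> \<Union>C"
 obtains \<delta> where "\<delta> > 0" "\<forall>T\<subseteq>S. diameter T < \<delta> --> (\<exists>U\<in>C. f ` T \<subseteq> U)"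
proof -
 define D where "D = {W. open W & (\<exists>U\<in>C. f ` (S \<inter> W) \<subseteq> U)}"
 have "\<exists>W\<in>D. x \<in> W" if "x \<in> S" for x
 proof -
  have "f x \<in> topspace X" using f that by (auto simp: continuous_map_def)
  then obtain U where U: "U \<in> C" "f x \<in> U" using C by blast
  then have "openin (top_of_set S) {y \<in> topspace (top_of_set S). f y \<in> U}"
   using f C(1) openin_continuous_map_preimage by blast
  then obtain W where "open W" "{y \<in> S. f y \<in> U} = S \<inter> W"
   by (auto simp: openin_open)
  then show ?thesis using U that unfolding D_def by blast
 qed
 then have D: "S \<subseteq> \<Union>D" "D ~= {}" using S(2) by blast+
 have "open B" if "B \<in> D" for B using that by (simp add: D_def)
 then obtain \<delta> where d: "\<delta> > 0" "!!T. T \<subseteq> S ==> diameter T < \<delta> ==> \<exists>B\<in>D. T \<subseteq> B"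
  using Lebesgue_number_lemma[OF S(1) D(2,1)] by blast
 have "\<exists>U\<in>C. f ` T \<subseteq> U" if T: "T \<subseteq> S" "diameter T < \<delta>" for T
 proof -
  obtain B where B: "B \<in> D" "T \<subseteq> B" using d(2)[OF T] by blast
  then obtain U where "U \<in> C" "f ` (S \<inter> B) \<subseteq> U" by (auto simp: D_def)
  then show ?thesis using B(2) T(1) by blast
 qed
 with d(1) show ?thesis using that by blast
qed

lemma cover_grid:
 fixes h :: "real \<times> real => 'a"
 assumes h: "continuous_map (top_of_set unit_square) X h"
  and C: "!!U. U \<in> C ==> openin X U" "topspace X \<subseteq> \<Union>C"
 obtains n where "n > 0" "\<forall>i<n. \<forall>j<n. \<exists>U\<in>C.
   continuous_map (top_of_set unit_square) (subtopology X U)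
     (%z. h ((real i + fst z) / n, (real j + snd z) / n))"
proof -
 have "unit_square ~= {}" by simp
 then obtain \<delta> where \<delta>: "\<delta> > 0" "\<forall>T\<subseteq>unit_square. diameter T < \<delta> --> (\<exists>U\<in>C. h ` T \<subseteq> U)"
  using cover_Lebesgue[OF compact_Times[OF compact_Icc compact_Icc] _ h C] by metis
 obtain m where "inverse (real (Suc m)) < \<delta> / 4" using reals_Archimedean[of "\<delta> / 4"] \<delta>(1) by auto
 then have n: "2 / real (Suc m) < \<delta>" using \<delta>(1) by (simp add: field_simps)
 have "\<exists>U\<in>C. continuous_map (top_of_set unit_square) (subtopology X U)
   (%z. h ((real i + fst z) / Suc m, (real j + snd z) / Suc m))" if ij: "i < Suc m" "j < Suc m" for i j
 proof -
  let ?a = "%z. ((real i + fst z) / Suc m, (real j + snd z) / Suc m)"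
  have a: "?a ` unit_square \<subseteq> unit_square" using piece_unit[OF ij(1)] piece_unit[OF ij(2)] by auto
  have "dist (?a y) (?a z) <= 2 / Suc m" if "y \<in> unit_square" "z \<in> unit_square" for y z
  proof -
   have "dist (?a y) (?a z) <= \<bar>(fst y - fst z) / Suc m\<bar> + \<bar>(snd y - snd z) / Suc m\<bar>"
    using norm_triangle_ineq[of "((fst y - fst z) / Suc m, 0)" "(0::real, (snd y - snd z) / Suc m)"]
    by (simp add: dist_norm norm_Pair diff_divide_distrib add_divide_distrib)
   also have "\<bar>c / Suc m\<bar> <= 1 / Suc m" if "\<bar>c\<bar> <= 1" for c :: real
    using divide_right_mono[OF that, of "Suc m"] by (simp add: abs_divide)
   then have "\<bar>(fst y - fst z) / Suc m\<bar> + \<bar>(snd y - snd z) / Suc m\<bar> <= 1 / Suc m + 1 / Suc m"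
    using that by (intro add_mono) (auto simp: abs_le_iff)
   finally show ?thesis by simp
  qed
  then have "diameter (?a ` unit_square) <= 2 / Suc m" by (intro diameter_le) (auto simp: dist_norm)
  then obtain U where U: "U \<in> C" "h ` ?a ` unit_square \<subseteq> U" using \<delta>(2) a n by (meson le_less_trans)
  have "continuous_map (top_of_set unit_square) (top_of_set unit_square) ?a"
   using a by (auto simp: continuous_map_in_subtopology intro!: continuous_intros)
  then have "continuous_map (top_of_set unit_square) X (h \<circ> ?a)" using h by (rule continuous_map_compose)
  then show ?thesis using U by (intro bexI[of _ U]) (auto simp: continuous_map_in_subtopology o_def)
 qed
 then show ?thesis by (intro that[of "Suc m"]) auto
qed

subsection \<open>Gluing local path functors\<close>

locale local_transport = Q: group Q
 for Q :: "('q, 'b) monoid_scheme" (structure) +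
 fixes X :: "'a topology" and C :: "'a set set" and \<tau> :: "(real => 'a) => 'q"
 assumes C_open: "U \<in> C ==> openin X U"
  and C_cover: "topspace X \<subseteq> \<Union>C"
  and \<tau>_functor: "U \<in> C ==> path_functor Q (subtopology X U) \<tau>"
begin

lemmas \<tau>_closed = path_functor.E_closed[OF \<tau>_functor]
lemmas \<tau>_eq = path_functor.E_eq[OF \<tau>_functor]
lemmas \<tau>_pieces = path_functor.E_pieces[OF \<tau>_functor]
lemmas \<tau>_square = path_functor.E_square[OF \<tau>_functor]

definition subord :: "(real => 'a) => nat => bool" where
 "subord p n \<longleftrightarrow> n > 0 & (\<forall>j<n. \<exists>U\<in>C. pathin (subtopology X U) (piece p n j))"

definition subdivide :: "(real => 'a) => nat => 'q" where
 "subdivide p n = rprod Q (%j. \<tau> (piece p n j)) n"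

definition transport :: "(real => 'a) => 'q" where
 "transport p = subdivide p (SOME n. subord p n)"

lemma subordE:
 assumes "subord p n" "j < n" obtains U where "U \<in> C" "pathin (subtopology X U) (piece p n j)"
 using assms unfolding subord_def by blast

lemma \<tau>_const:
 assumes "x \<in> topspace X" "!!t. t \<in> {0..1} ==> p t = x" shows "\<tau> p = \<one>"
proof -
 obtain U where "U \<in> C" "x \<in> U" using C_cover assms(1) by blast
 then show ?thesis using path_functor.E_const[OF \<tau>_functor, of U x p] assms by simp
qed

lemma subord_exists:
 assumes p: "pathin X p" obtains n where "subord p n"
proof -
 have "continuous_map (top_of_set unit_square) (top_of_set {0..1}) (snd :: real \<times> real => real)"
  by (auto simp: continuous_map_in_subtopology intro!: continuous_intros)
 from cover_grid[OF continuous_map_compose[OF this p[unfolded pathin_def]] C_open C_cover, unfolded o_def snd_conv]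
 obtain n where n: "n > 0" "\<forall>i<n. \<forall>j<n. \<exists>U\<in>C. continuous_map (top_of_set unit_square)
   (subtopology X U) (%z. p ((real j + snd z) / n))" .
 have "\<exists>U\<in>C. pathin (subtopology X U) (piece p n j)" if j: "j < n" for j
 proof -
  obtain U where U: "U \<in> C" "continuous_map (top_of_set unit_square) (subtopology X U) (%z. p ((real j + snd z) / n))"
   using n(2)[rule_format, OF n(1) j] by blast
  have "pathin (subtopology X U) (%t. p ((real j + snd (0::real, t)) / n))"
   by (rule pathin_compose[OF U(2), of "%t. (0, t)"]) (auto intro!: continuous_intros)
  then show ?thesis using U(1) by (auto simp: piece_def)
 qed
 then show ?thesis using n(1) by (intro that) (auto simp: subord_def)
qed

lemma subord_\<tau>_closed: "subord p n ==> j < n ==> \<tau> (piece p n j) \<in> carrier Q"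
 using subordE \<tau>_closed by metis

lemma subord_mult:
 assumes "subord p n" "k > 0" shows "subord p (n * k)"
 unfolding subord_def
proof (intro conjI allI impI)
 fix l assume "l < n * k"
 then have l: "l div k < n" "l mod k < k" using assms(2) by (auto simp: less_mult_imp_div_less)
 obtain U where "U \<in> C" "pathin (subtopology X U) (piece p n (l div k))" using subordE[OF assms(1) l(1)] .
 then show "\<exists>U\<in>C. pathin (subtopology X U) (piece p (n * k) l)"
  using piece_piece[OF assms(2), of p n "l div k" "l mod k"] pathin_piece[OF _ l(2)] by auto
qed (use assms in \<open>auto simp: subord_def\<close>)

lemma subdivide_mult:
 assumes n: "subord p n" and k: "k > 0" shows "subdivide p (n * k) = subdivide p n"
proof -
 have "subdivide p (n * k) = rprod Q (%j. rprod Q (%i. \<tau> (piece p (n * k) (j * k + i))) k) n"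
  unfolding subdivide_def using subord_\<tau>_closed[OF subord_mult[OF n k]] by (rule Q.rprod_mult)
 also have "... = subdivide p n"
  unfolding subdivide_def piece_piece[OF k]
 proof (rule Q.rprod_cong)
  fix j assume "j < n"
  then obtain U where "U \<in> C" "pathin (subtopology X U) (piece p n j)" using subordE[OF n] by blast
  then show "rprod Q (%i. \<tau> (piece (piece p n j) k i)) k = \<tau> (piece p n j)" using \<tau>_pieces k by metis
 qed
 finally show ?thesis .
qed

lemma transport_eq:
 assumes "subord p n" shows "transport p = subdivide p n"
proof -
 define m where "m = (SOME n. subord p n)"
 have "subord p m" unfolding m_def using assms by (rule someI)
 then have "subdivide p (m * n) = subdivide p m" "subdivide p (n * m) = subdivide p n"
  using assms subdivide_mult by (auto simp: subord_def)
 then show ?thesis by (simp add: transport_def m_def mult.commute)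
qed

lemma transport_closed:
 assumes "pathin X p" shows "transport p \<in> carrier Q"
proof -
 obtain n where n: "subord p n" using subord_exists[OF assms] .
 show ?thesis
  unfolding transport_eq[OF n] subdivide_def using subord_\<tau>_closed[OF n] by (rule Q.rprod_closed)
qed

lemma transport_local:
 assumes "U \<in> C" "pathin (subtopology X U) p" shows "transport p = \<tau> p"
proof -
 have "subord p 1" using assms by (auto simp: subord_def piece_def)
 then show ?thesis using transport_eq \<tau>_closed[OF assms] by (simp add: subdivide_def piece_def)
qed

lemma transport_concat:
 assumes p: "pathin X p" and q: "pathin X q" and e: "p 1 = q 0"
 shows "transport (p \<cdot> q) = transport p \<otimes> transport q"
proof -
 obtain m k where "subord p m" "subord q k" using subord_exists p q by metis
 then have "subord p (m * k)" "subord q (m * k)"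
  using subord_mult[of p m k] subord_mult[of q k m] by (auto simp: subord_def mult.commute)
 then obtain n where n: "subord p n" "subord q n" by blast
 have path: "pathin (subtopology X U) (piece (p \<cdot> q) (n + n) l)" and \<tau>: "\<tau> (piece (p \<cdot> q) (n + n) l) = \<tau> (piece r n j)"
  if "U \<in> C" "pathin (subtopology X U) (piece r n j)"
   "!!t. t \<in> {0..1} ==> piece r n j t = piece (p \<cdot> q) (n + n) l t" for U r j l
  using path_homotopic_pathin[OF path_homotopic_eqI[OF that(2,3)]] \<tau>_eq[OF that] by auto
 have "\<exists>U\<in>C. pathin (subtopology X U) (piece (p \<cdot> q) (n + n) l)" if "l < n + n" for l
 proof (cases "l < n")
  case True
  then obtain U where "U \<in> C" "pathin (subtopology X U) (piece p n l)" using subordE[OF n(1)] by blast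
  then show ?thesis using path piece_loop_concat(1)[OF True] by (metis (full_types))
 next
  case False
  define j where "j = l - n"
  have j: "l = n + j" "j < n" using False that by (auto simp: j_def)
  then obtain U where "U \<in> C" "pathin (subtopology X U) (piece q n j)" using subordE[OF n(2)] by blast
  then show ?thesis using path piece_loop_concat(2)[OF j(2)] e unfolding j(1) by (metis (full_types))
 qed
 then have subord: "subord (p \<cdot> q) (n + n)" using n(1) by (auto simp: subord_def)
 have "\<tau> (piece (p \<cdot> q) (n + n) j) = \<tau> (piece p n j)" "\<tau> (piece (p \<cdot> q) (n + n) (n + j)) = \<tau> (piece q n j)"
  if j: "j < n" for j
 proof -
  show "\<tau> (piece (p \<cdot> q) (n + n) j) = \<tau> (piece p n j)"
   using subordE[OF n(1) j] \<tau> piece_loop_concat(1)[OF j] by (metis (full_types))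
  show "\<tau> (piece (p \<cdot> q) (n + n) (n + j)) = \<tau> (piece q n j)"
   using subordE[OF n(2) j] \<tau> piece_loop_concat(2)[OF j] e by (metis (full_types))
 qed
 then have "subdivide (p \<cdot> q) (n + n) = subdivide p n \<otimes> subdivide q n"
  unfolding subdivide_def using subord_\<tau>_closed[OF subord]
  by (subst Q.rprod_add) (auto intro!: arg_cong2[where f="mult Q"] Q.rprod_cong)
 then show ?thesis using transport_eq[OF n(1)] transport_eq[OF n(2)] transport_eq[OF subord] by simp
qed

lemma transport_grid_row:
 fixes h :: "real \<times> real => 'a"
 assumes "n > 0" and i: "i < n"
  and grid: "!!j. j < n ==> \<exists>U\<in>C. continuous_map (top_of_set unit_square) (subtopology X U)
     (%z. h ((real i + fst z) / n, (real j + snd z) / n))"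
  and ends: "!!s. s \<in> {0..1} ==> h (s, 0) = x & h (s, 1) = y" "x \<in> topspace X" "y \<in> topspace X"
 shows "transport (%t. h (real i / n, t)) = transport (%t. h (real (Suc i) / n, t))"
proof -
 define row where "row i = (%t. h (real i / n, t))" for i
 define col where "col j = (%s. h ((real i + s) / n, real j / n))" for j
 have cell: "\<exists>U\<in>C. pathin (subtopology X U) (piece (row i) n j) & pathin (subtopology X U) (piece (row (Suc i)) n j) &
    pathin (subtopology X U) (col j)" (is ?paths)
  and square: "\<tau> (piece (row i) n j) \<otimes> \<tau> (col (Suc j)) = \<tau> (col j) \<otimes> \<tau> (piece (row (Suc i)) n j)" (is ?square)
  if j: "j < n" for j
 proof -
  let ?h = "%z. h ((real i + fst z) / n, (real j + snd z) / n)"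
  obtain U where U: "U \<in> C" "continuous_map (top_of_set unit_square) (subtopology X U) ?h"
   using grid[OF j] by blast
  have edges: "piece (row i) n j = (%t. ?h (0, t))" "piece (row (Suc i)) n j = (%t. ?h (1, t))"
   "col j = (%s. ?h (s, 0))" "col (Suc j) = (%s. ?h (s, 1))"
   by (auto simp: row_def piece_def col_def add.commute)
  have "pathin (subtopology X U) (%t. ?h (0, t))" "pathin (subtopology X U) (%t. ?h (1, t))"
   "pathin (subtopology X U) (%s. ?h (s, 0))"
   by (rule pathin_compose[OF U(2)]; auto intro!: continuous_intros)+
  then show ?paths unfolding edges using U(1) by blast
  show ?square unfolding edges using \<tau>_square[OF U] .
 qed
 have subord: "subord (row i) n" "subord (row (Suc i)) n" using cell assms(1) unfolding subord_def by blast+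
 have "col 0 s = x & col n s = y" if "s \<in> {0..1}" for s
  using ends(1) piece_unit[OF i that] assms(1) by (simp add: col_def)
 then have trivial: "\<tau> (col 0) = \<one>" "\<tau> (col n) = \<one>" using \<tau>_const ends(2,3) by blast+
 have "\<tau> (col j) \<in> carrier Q" if "j <= n" for j
  using cell[of j] \<tau>_closed trivial(2) that by (cases "j = n") fastforce+
 then have "rprod Q (%j. \<tau> (piece (row i) n j)) n \<otimes> \<tau> (col n) = \<tau> (col 0) \<otimes> rprod Q (%j. \<tau> (piece (row (Suc i)) n j)) n"
  using square subord_\<tau>_closed[OF subord(1)] subord_\<tau>_closed[OF subord(2)] by (intro Q.rprod_telescope) auto
 then have "subdivide (row i) n = subdivide (row (Suc i)) n"
  using trivial subord_\<tau>_closed[OF subord(1)] subord_\<tau>_closed[OF subord(2)] by (simp add: subdivide_def Q.rprod_closed)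
 then show ?thesis using transport_eq[OF subord(1)] transport_eq[OF subord(2)] by (simp add: row_def)
qed

lemma transport_homotopic:
 assumes "path_homotopic X p q" shows "transport p = transport q"
proof -
 obtain h where h: "continuous_map (top_of_set unit_square) X h"
  "\<forall>t. h (0, t) = p t" "\<forall>t. h (1, t) = q t" "\<forall>s\<in>{0..1}. h (s, 0) = p 0 & h (s, 1) = p 1"
  using path_homotopicE[OF assms] .
 obtain n where n: "n > 0" "\<forall>i<n. \<forall>j<n. \<exists>U\<in>C.
   continuous_map (top_of_set unit_square) (subtopology X U)
     (%z. h ((real i + fst z) / n, (real j + snd z) / n))"
  using cover_grid[OF h(1) C_open C_cover] .
 have ends: "p 0 \<in> topspace X" "p 1 \<in> topspace X" using path_homotopic_pathin[OF assms] pathin_topspace[of X p] by auto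
 have "transport (%t. h (real i / n, t)) = transport (%t. h (0, t))" if "i <= n" for i
  using that
 proof (induction i)
  case (Suc i)
  then show ?case using transport_grid_row[OF n(1), of i h "p 0" "p 1"] n(2) h(4) ends by simp
 qed simp
 from this[of n] show ?thesis using n(1) h(2,3) by simp
qed

lemma transport_unique:
 assumes T: "path_functor Q' X T" and f: "f \<in> hom Q Q'"
  and T_local: "!!U p. U \<in> C ==> pathin (subtopology X U) p ==> T p = f (\<tau> p)"
  and p: "pathin X p"
 shows "T p = f (transport p)"
proof -
 interpret T: path_functor Q' X T by fact
 interpret f: group_hom Q Q' f using f by unfold_locales
 obtain n where n: "subord p n" using subord_exists[OF p] .
 have "T p = rprod Q' (%j. T (piece p n j)) n" using n p by (intro T.E_pieces) (auto simp: subord_def)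
 also have "... = rprod Q' (%j. f (\<tau> (piece p n j))) n"
  using subordE[OF n] T_local by (intro T.Q.rprod_cong) metis
 also have "... = f (transport p)"
  using subord_\<tau>_closed[OF n] by (simp add: transport_eq[OF n] subdivide_def f.hom_rprod)
 finally show ?thesis .
qed

end

section \<open>The polygon model of a surface\<close>

locale surface =
 fixes g :: nat
 assumes g: "g >= 1"
begin

abbreviation "bd \<equiv> polygon_bd g"
abbreviation "D \<equiv> cball (0::complex) 1"
abbreviation "X \<equiv> genus_surface g"

definition glue :: "(complex \<times> complex) set" where "glue = (side_gluing g \<union> (side_gluing g)\<inverse>)\<^sup>*"
definition proj :: "complex => complex set" where "proj z = glue `` {z}"
definition rep_pt :: "complex set => complex" where "rep_pt y = (SOME z. z \<in> y)"

lemma norm_bd [simp]: "cmod (bd s) = 1" by (simp add: polygon_bd_def)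

lemma bd_D [simp]: "bd s \<in> D" "r *\<^sub>R bd s \<in> D \<longleftrightarrow> \<bar>r\<bar> <= 1" by auto

lemma bd_add: "bd (s + t) = bd s * bd t"
 by (simp add: polygon_bd_def cis_mult distrib_left add_divide_distrib)

lemma cnj_bd: "cnj (bd s) = bd (- s)" by (simp add: polygon_bd_def cis_cnj)

lemma bd_mult_cnj: "bd s * cnj (bd t) = bd (s - t)"
 unfolding cnj_bd by (simp flip: bd_add)

lemma bd_eq: "bd s = cis (pi * s / (2 * real g))"
 by (simp add: polygon_bd_def field_simps)

lemma continuous_on_bd [continuous_intros]: "continuous_on S f ==> continuous_on S (%t. bd (f t))"
 unfolding polygon_bd_def using g by (intro continuous_intros) auto

lemma equiv_glue: "equiv UNIV glue"
proof -
 have "sym ((side_gluing g \<union> (side_gluing g)\<inverse>)\<^sup>*)" by (intro sym_rtrancl sym_Un_converse)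
 then show ?thesis unfolding glue_def equiv_def by (auto simp: refl_rtrancl trans_rtrancl)
qed

lemma proj_eq_iff: "proj z = proj w \<longleftrightarrow> (z, w) \<in> glue"
 unfolding proj_def using eq_equiv_class_iff[OF equiv_glue] by auto

lemma side_gluing_norm: "(z, w) \<in> side_gluing g ==> cmod z = 1 & cmod w = 1"
 by (auto simp: side_gluing_def)

lemma proj_glue: "(z, w) \<in> side_gluing g ==> proj z = proj w"
 by (auto simp: proj_eq_iff glue_def)

lemma topspace_X: "topspace X = proj ` D"
 unfolding genus_surface_def topspace_quotient_topology by (auto simp: quotient_def proj_def glue_def)

lemma openin_X: "openin X U \<longleftrightarrow> U \<subseteq> topspace X & openin (top_of_set D) {z \<in> D. proj z \<in> U}"
 unfolding genus_surface_def openin_quotient_topology topspace_quotient_topology proj_def glue_def by simp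

lemma continuous_map_proj: "continuous_map (top_of_set D) X proj"
 using quotient_imp_continuous_map[OF quotient_map_quotient_topology[of "top_of_set D" "(side_gluing g \<union> (side_gluing g)\<inverse>)\<^sup>*"]]
 by (simp add: genus_surface_def proj_def[abs_def] glue_def)

lemma rep_pt: assumes "y \<in> topspace X" shows "rep_pt y \<in> D" "proj (rep_pt y) = y"
proof -
 obtain z where z: "z \<in> D" "y = proj z" using assms topspace_X by auto
 have "z \<in> y" using z(2) by (simp add: proj_def glue_def)
 then have r: "rep_pt y \<in> y" unfolding rep_pt_def by (rule someI)
 then show "proj (rep_pt y) = y"
  unfolding z(2) proj_eq_iff[symmetric] using proj_eq_iff[of z "rep_pt (proj z)"] by (simp add: proj_def)
 show "rep_pt y \<in> D" using r genus_surface_gluing_class[OF z(1), of g] z(2) by (auto simp: proj_def glue_def)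
qed

subsection \<open>Saturated sets\<close>

definition saturated :: "complex set => bool" where
 "saturated S \<longleftrightarrow> S \<subseteq> D & (\<forall>z w. (z, w) \<in> side_gluing g --> (z \<in> S \<longleftrightarrow> w \<in> S))"

lemma saturated_glue:
 assumes S: "saturated S" and f: "!!z w. (z, w) \<in> side_gluing g ==> z \<in> S ==> f z = f w"
  and z: "z \<in> S" "(z, w) \<in> glue"
 shows "w \<in> S & f w = f z"
 using z(2) unfolding glue_def
proof (induction rule: rtrancl_induct)
 case (step y w)
 then show ?case using S f[of y w] f[of w y] by (auto simp: saturated_def)
qed (use z in auto)

lemma saturated_mem_iff: assumes "saturated S" shows "proj z \<in> proj ` S \<longleftrightarrow> z \<in> S"
proof
 assume "proj z \<in> proj ` S"
 then obtain x where "x \<in> S" "proj x = proj z" by (metis imageE)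
 then show "z \<in> S" using saturated_glue[OF assms, of "%_. ()" x z] by (simp add: proj_eq_iff)
qed simp

lemma saturated_topspace: "saturated S ==> proj ` S \<subseteq> topspace X"
 by (auto simp: topspace_X saturated_def)

lemma openin_proj_image:
 assumes "saturated S" "openin (top_of_set D) S" shows "openin X (proj ` S)"
proof -
 have "{z \<in> D. proj z \<in> proj ` S} = S"
  using saturated_mem_iff[OF assms(1)] assms(1) by (auto simp: saturated_def)
 then show ?thesis using assms saturated_topspace by (simp add: openin_X)
qed

lemma rep_pt_saturated:
 assumes "saturated S" "y \<in> proj ` S" shows "rep_pt y \<in> S"
 using saturated_mem_iff[OF assms(1)] assms rep_pt(2) saturated_topspace by (metis subsetD)

lemma rep_pt_fun:
 assumes S: "saturated S" and f: "!!z w. (z, w) \<in> side_gluing g ==> z \<in> S ==> f z = f w" and z: "z \<in> S"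
 shows "f (rep_pt (proj z)) = f z"
proof -
 have "proj z \<in> topspace X" using saturated_topspace[OF S] z by blast
 then have "(z, rep_pt (proj z)) \<in> glue" using rep_pt(2) proj_eq_iff by metis
 then show ?thesis using saturated_glue[OF S f z, of "%x. x"] saturated_glue[OF S f z] by blast
qed

lemma continuous_map_descend:
 fixes f :: "complex => 'b::topological_space"
 assumes S: "saturated S" "openin (top_of_set D) S" and f: "!!z w. (z, w) \<in> side_gluing g ==> z \<in> S ==> f z = f w"
  and c: "continuous_on S f"
 shows "continuous_map (subtopology X (proj ` S)) euclidean (%y. f (rep_pt y))"
 unfolding continuous_map_def
proof (intro conjI allI impI)
 fix V :: "'b set" assume V: "openin euclidean V"
 define T where "T = {z \<in> S. f z \<in> V}"
 have "openin (top_of_set S) T"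
  using continuous_openin_preimage_gen[OF c, of V] V unfolding T_def by (simp add: vimage_def Int_def)
 then have "openin (top_of_set D) T" using S(2) openin_trans by blast
 moreover have "saturated T"
  using S(1) f unfolding saturated_def T_def by (metis (mono_tags, lifting) mem_Collect_eq subset_iff)
 ultimately have "openin X (proj ` T)" by (intro openin_proj_image)
 moreover have "f (rep_pt (proj z)) = f z" if "z \<in> S" for z
  by (rule rep_pt_fun[OF S(1) _ that]) (rule f)
 then have "{y \<in> topspace (subtopology X (proj ` S)). f (rep_pt y) \<in> V} = proj ` T"
  using S(1) by (auto simp: T_def topspace_X saturated_def)
 moreover have "proj ` T \<subseteq> proj ` S" by (auto simp: T_def)
 ultimately show "openin (subtopology X (proj ` S)) {y \<in> topspace (subtopology X (proj ` S)). f (rep_pt y) \<in> V}"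
  by (metis inf.absorb1 openin_subtopology_Int)
qed auto

lemma saturated_ball: "S \<subseteq> ball 0 1 ==> saturated S"
 using side_gluing_norm by (fastforce simp: saturated_def subset_iff)

lemma rep_pt_ball: "z \<in> ball 0 1 ==> rep_pt (proj z) = z"
 using rep_pt_fun[OF saturated_ball[of "ball 0 1"], of "%z. z" z] side_gluing_norm by fastforce

lemma pathin_proj:
 assumes "continuous_on {0..1} \<sigma>" "\<sigma> ` {0..1} \<subseteq> D" shows "pathin X (%t. proj (\<sigma> t))"
 by (rule pathin_compose[OF continuous_map_proj assms])

lemma pathin_proj_subtopology:
 assumes "continuous_on {0..1} \<sigma>" "\<sigma> ` {0..1} \<subseteq> S" "S \<subseteq> D"
 shows "pathin (subtopology X (proj ` S)) (%t. proj (\<sigma> t))"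
 using pathin_proj[of \<sigma>] assms by (auto simp: pathin_subtopology)

definition ray :: "complex => real => complex set" where "ray z = (%t. proj (t *\<^sub>R z))"

lemma scale_D: "z \<in> D ==> 0 <= t ==> t <= 1 ==> t *\<^sub>R z \<in> D"
 by (auto simp: mult_le_one)

lemma pathin_ray: "z \<in> D ==> pathin X (ray z)"
 unfolding ray_def using scale_D by (intro pathin_proj) (auto intro!: continuous_intros)

lemma ray_ends [simp]: "ray z 0 = proj 0" "ray z 1 = proj z" by (auto simp: ray_def)

subsection \<open>Sectors and collars\<close>

text \<open>The side \<open>m\<close> is glued to the side \<open>m + 2\<close> if \<open>m mod 4 < 2\<close>, by a reflection in the direction
 \<open>bd (m + 3/2)\<close>.  The curve joining their midpoints, at angular distance 1 from this direction and at radius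
 \<open>1/2\<close> in between, is closed on the surface; its collar is cut by it into an inner and an outer part.\<close>

definition first_side :: "nat => bool" where "first_side m \<longleftrightarrow> m < 4 * g & m mod 4 < 2"
definition side_cos :: "real => real" where "side_cos a = cos (a * pi / (2 * real g))"
definition along :: "nat => complex => real" where "along m z = Re (z * cnj (bd (real m + 3/2)))"

definition open_sector :: "nat => real => real => complex set" where
 "open_sector m a r = {z \<in> D. r < cmod z & side_cos a * cmod z < along m z}"
definition closed_sector :: "nat => real => real => complex set" where
 "closed_sector m a r = {z \<in> D. r <= cmod z & side_cos a * cmod z <= along m z}"
definition collar :: "nat => complex set" where
 "collar m = open_sector m (9/8) (3/8) - closed_sector m (7/8) (5/8)"
definition inner_collar :: "nat => complex set" where "inner_collar m = collar m \<inter> open_sector m 1 (1/2)"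
definition outer_collar :: "nat => complex set" where "outer_collar m = collar m - closed_sector m 1 (1/2)"
definition side_collar :: "nat => complex set" where "side_collar m = collar m \<inter> {z. 5/8 < cmod z}"
definition cut_curve :: "nat => complex set" where "cut_curve m = closed_sector m 1 (1/2) - open_sector m 1 (1/2)"

lemma first_side_bound: "first_side m ==> m + 3 <= 4 * g"
 unfolding first_side_def by presburger

lemma side_gluing_iff:
 "(z, w) \<in> side_gluing g \<longleftrightarrow>
   (\<exists>m t. first_side m & 0 <= t & t <= 1 & z = bd (real m + t) & w = bd (real m + 3 - t))"
proof
 assume "(z, w) \<in> side_gluing g"
 then obtain j k t where "z = bd (real (4 * j + k) + t)" "w = bd (real (4 * j + k + 3) - t)"
  "j < g" "k < 2" "0 <= t" "t <= 1" unfolding side_gluing_def by blast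
 then show "\<exists>m t. first_side m & 0 <= t & t <= 1 & z = bd (real m + t) & w = bd (real m + 3 - t)"
  by (intro exI[of _ "4 * j + k"] exI[of _ t]) (auto simp: first_side_def)
next
 assume "\<exists>m t. first_side m & 0 <= t & t <= 1 & z = bd (real m + t) & w = bd (real m + 3 - t)"
 then obtain m t where m: "first_side m" and t: "0 <= t" "t <= 1" "z = bd (real m + t)" "w = bd (real m + 3 - t)" by blast
 have "m div 4 < g" "m mod 4 < 2" "4 * (m div 4) + m mod 4 = m"
  using m unfolding first_side_def by (auto simp: less_mult_imp_div_less)
 then show "(z, w) \<in> side_gluing g"
  unfolding side_gluing_def using t by (intro CollectI exI[of _ "m div 4"] exI[of _ "m mod 4"] exI[of _ t]) simp
qed

lemma proj_side:
 assumes "first_side m" "0 <= t" "t <= 1" shows "proj (bd (real m + t)) = proj (bd (real m + 3 - t))"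
 by (rule proj_glue) (use assms in \<open>auto simp: side_gluing_iff\<close>)

lemma continuous_on_along [continuous_intros]: "continuous_on S f ==> continuous_on S (%z. along m (f z))"
 unfolding along_def by (intro continuous_intros)

lemma openin_open_sector: "openin (top_of_set D) (open_sector m a r)"
proof -
 have "open {z. r < cmod z & side_cos a * cmod z < along m z}"
  by (intro open_Collect_conj open_Collect_less continuous_intros)
 moreover have "open_sector m a r = D \<inter> {z. r < cmod z & side_cos a * cmod z < along m z}"
  by (auto simp: open_sector_def)
 ultimately show ?thesis by (auto simp: openin_open)
qed

lemma closedin_closed_sector: "closedin (top_of_set D) (closed_sector m a r)"
proof -
 have "closed {z. r <= cmod z & side_cos a * cmod z <= along m z}"
  by (intro closed_Collect_conj closed_Collect_le continuous_intros)
 moreover have "closed_sector m a r = D \<inter> {z. r <= cmod z & side_cos a * cmod z <= along m z}"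
  by (auto simp: closed_sector_def)
 ultimately show ?thesis by (auto simp: closedin_closed)
qed

lemma openin_collar: "openin (top_of_set D) (collar m)"
 unfolding collar_def by (intro openin_diff openin_open_sector closedin_closed_sector)
lemma openin_inner_collar: "openin (top_of_set D) (inner_collar m)"
 unfolding inner_collar_def by (intro openin_Int openin_open_sector openin_collar)
lemma openin_outer_collar: "openin (top_of_set D) (outer_collar m)"
 unfolding outer_collar_def by (intro openin_diff openin_collar closedin_closed_sector)
lemma openin_side_collar: "openin (top_of_set D) (side_collar m)"
 unfolding side_collar_def by (intro openin_Int_open openin_collar open_Collect_less continuous_intros)
lemma closedin_cut_curve: "closedin (top_of_set D) (cut_curve m)"
 unfolding cut_curve_def by (intro closedin_diff openin_open_sector closedin_closed_sector)

lemma side_cos_less_iff: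
 assumes d: "\<bar>d\<bar> <= 4 * real g - 3/2" and a: "0 <= a" "a < 3/2"
 shows "side_cos a < side_cos d \<longleftrightarrow> \<bar>d\<bar> < a" and "side_cos a <= side_cos d \<longleftrightarrow> \<bar>d\<bar> <= a"
proof -
 define h where "h = pi / (2 * real g)"
 have h: "h > 0" "2 * real g * h = pi" using g by (auto simp: h_def)
 have abs: "side_cos x = cos (\<bar>x\<bar> * h)" for x
  using cos_abs_real[of "x * h"] h(1) by (simp add: side_cos_def h_def abs_mult)
 have ah: "a * h < 3/2 * h" using a h by simp
 also have "... <= 2 * real g * h" using h g by (intro mult_right_mono) auto
 finally have ah_pi: "0 <= a * h" "a * h < pi" using a h by (auto simp: h(2))
 have "(cos (a * h) < cos (\<bar>d\<bar> * h) \<longleftrightarrow> \<bar>d\<bar> < a) & (cos (a * h) <= cos (\<bar>d\<bar> * h) \<longleftrightarrow> \<bar>d\<bar> <= a)"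
 proof (cases "\<bar>d\<bar> <= 2 * real g")
  case True
  then have "\<bar>d\<bar> * h <= 2 * real g * h" using h by (intro mult_right_mono) auto
  then have "\<bar>d\<bar> * h <= pi" using h by simp
  then have "(cos (a * h) < cos (\<bar>d\<bar> * h) \<longleftrightarrow> \<bar>d\<bar> * h < a * h) & (cos (a * h) <= cos (\<bar>d\<bar> * h) \<longleftrightarrow> \<bar>d\<bar> * h <= a * h)"
   using ah_pi h by (auto simp: cos_mono_less_eq cos_mono_le_eq)
  then show ?thesis using h by simp
 next
  case False
  have "\<bar>d\<bar> * h <= (4 * real g - 3/2) * h" using d h by (intro mult_right_mono) auto
  then have reflected: "3/2 * h <= 2 * pi - \<bar>d\<bar> * h" using h(2) by (simp add: algebra_simps)
  have "2 * real g * h < \<bar>d\<bar> * h" using False h(1) by (intro mult_strict_right_mono) auto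
  then have "2 * pi - \<bar>d\<bar> * h < pi" using h(2) by simp
  then have "cos (2 * pi - \<bar>d\<bar> * h) < cos (a * h)" using ah_pi reflected ah by (intro cos_monotone_0_pi) auto
  then have "cos (\<bar>d\<bar> * h) < cos (a * h)" by (simp add: cos_diff)
  then show ?thesis using False a g by auto
 qed
 then show "side_cos a < side_cos d \<longleftrightarrow> \<bar>d\<bar> < a" "side_cos a <= side_cos d \<longleftrightarrow> \<bar>d\<bar> <= a"
  using a(1) by (auto simp: abs)
qed

lemma along_polar: "along m (r *\<^sub>R bd s) = r * side_cos (s - (real m + 3/2))"
 unfolding along_def using bd_mult_cnj[of s "real m + 3/2"]
 by (simp add: side_cos_def bd_eq mult.commute)

lemma sector_polar:
 assumes "0 <= s" "s <= 4 * real g" "m + 3 <= 4 * g" "0 <= a" "a < 3/2" "0 < \<rho>" "\<rho> <= 1"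
 shows "\<rho> *\<^sub>R bd s \<in> open_sector m a r \<longleftrightarrow> r < \<rho> & \<bar>s - (real m + 3/2)\<bar> < a"
  and "\<rho> *\<^sub>R bd s \<in> closed_sector m a r \<longleftrightarrow> r <= \<rho> & \<bar>s - (real m + 3/2)\<bar> <= a"
proof -
 have "\<bar>s - (real m + 3/2)\<bar> <= 4 * real g - 3/2" using assms(1-3) by linarith
 from side_cos_less_iff[OF this assms(4,5)] assms(6,7)
 show "\<rho> *\<^sub>R bd s \<in> open_sector m a r \<longleftrightarrow> r < \<rho> & \<bar>s - (real m + 3/2)\<bar> < a"
  "\<rho> *\<^sub>R bd s \<in> closed_sector m a r \<longleftrightarrow> r <= \<rho> & \<bar>s - (real m + 3/2)\<bar> <= a"
  by (auto simp: open_sector_def closed_sector_def along_polar mult.commute[of _ \<rho>])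
qed

lemma polar_coordinates:
 assumes "z \<in> D" "z ~= 0"
 obtains \<rho> s where "0 < \<rho>" "\<rho> <= 1" "0 <= s" "s <= 4 * real g" "z = \<rho> *\<^sub>R bd s" "cmod z = \<rho>"
proof -
 define s where "s = Arg2pi z * (2 * real g) / pi"
 have "bd s = cis (Arg2pi z)" unfolding bd_eq s_def using g by simp
 then have "z = cmod z *\<^sub>R bd s" using Arg2pi_eq[of z] by (simp add: cis_conv_exp scaleR_conv_of_real is_Arg_def)
 moreover have "0 <= s" using Arg2pi_ge_0[of z] by (simp add: s_def)
 moreover have "s <= 2 * pi * (2 * real g) / pi"
  unfolding s_def using Arg2pi_lt_2pi[of z] by (intro divide_right_mono mult_right_mono) auto
 ultimately show ?thesis using that[of "cmod z" s] assms by simp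
qed

lemma cut_curve_nonzero: "z \<in> cut_curve m ==> z ~= 0" by (auto simp: cut_curve_def closed_sector_def)

lemma collar_nonzero: "z \<in> collar m ==> z ~= 0 & z \<in> D" unfolding collar_def by (auto simp: open_sector_def)

lemma cut_curve_subset_collar: assumes "m + 3 <= 4 * g" shows "cut_curve m \<subseteq> collar m"
proof
 fix z assume z: "z \<in> cut_curve m"
 then have "z ~= 0" "z \<in> D" using cut_curve_nonzero by (auto simp: cut_curve_def closed_sector_def)
 then obtain \<rho> s where p: "0 < \<rho>" "\<rho> <= 1" "0 <= s" "s <= 4 * real g" "z = \<rho> *\<^sub>R bd s" using polar_coordinates by metis
 show "z \<in> collar m"
  using z unfolding cut_curve_def collar_def p(5) by (auto simp: sector_polar[OF p(3,4) assms _ _ p(1,2)])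
qed

lemma collar_polar:
 assumes "z \<in> collar m" "m + 3 <= 4 * g"
 obtains s where "0 <= s" "s <= 4 * real g" "z = cmod z *\<^sub>R bd s" "\<bar>s - (real m + 3/2)\<bar> < 9/8"
  "5/8 <= cmod z ==> 7/8 < \<bar>s - (real m + 3/2)\<bar>"
proof -
 obtain \<rho> s where p: "0 < \<rho>" "\<rho> <= 1" "0 <= s" "s <= 4 * real g" "z = \<rho> *\<^sub>R bd s" "cmod z = \<rho>"
  using polar_coordinates collar_nonzero[OF assms(1)] by metis
 have "\<bar>s - (real m + 3/2)\<bar> < 9/8" "5/8 <= \<rho> ==> 7/8 < \<bar>s - (real m + 3/2)\<bar>"
  using assms(1) unfolding collar_def p(5) by (auto simp: sector_polar[OF p(3,4) assms(2) _ _ p(1,2)])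
 then show ?thesis using that p by simp
qed

lemma side_gluing_collar:
 assumes zw: "(z, w) \<in> side_gluing g" and m: "first_side m"
 shows "z \<notin> collar m & w \<notin> collar m \<or>
   (\<exists>t. 0 <= t & t <= 1 & z = bd (real m + t) & w = bd (real m + 3 - t) &
    (\<forall>a r. 0 <= a --> a < 3/2 -->
      (z \<in> open_sector m a r \<longleftrightarrow> w \<in> open_sector m a r) & (z \<in> closed_sector m a r \<longleftrightarrow> w \<in> closed_sector m a r)))"
proof -
 obtain n t where n: "first_side n" and t: "0 <= t" "t <= 1" and "z = bd (real n + t)" "w = bd (real n + 3 - t)"
  using zw side_gluing_iff by blast
 then have z: "z = 1 *\<^sub>R bd (real n + t)" and w: "w = 1 *\<^sub>R bd (real n + 3 - t)" by simp_all
 have n3: "real n + 3 <= 4 * real g" using first_side_bound[OF n] by linarith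
 note sector = sector_polar[of "real n + t", OF _ _ first_side_bound[OF m], of _ 1]
  sector_polar[of "real n + 3 - t", OF _ _ first_side_bound[OF m], of _ 1]
 show ?thesis
 proof (cases "n = m")
  case True
  have "\<bar>real n + t - (real m + 3/2)\<bar> = \<bar>real n + 3 - t - (real m + 3/2)\<bar>" using True by (simp add: abs_if)
  then have "\<forall>a r. 0 <= a --> a < 3/2 -->
    (z \<in> open_sector m a r \<longleftrightarrow> w \<in> open_sector m a r) & (z \<in> closed_sector m a r \<longleftrightarrow> w \<in> closed_sector m a r)"
   unfolding z w using t n3 by (simp add: sector del: scaleR_one)
  then show ?thesis using t True by (intro disjI2 exI[of _ t]) (auto simp: z w)
 next
  case False
  have "m mod 4 < 2" "n mod 4 < 2" using m n by (auto simp: first_side_def)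
  then have "n ~= m + 2" "m ~= n + 2" by presburger+
  then have "n + 3 <= m \<or> n + 1 = m \<or> n = m + 1 \<or> n >= m + 3" using False by linarith
  then have "real n + 3 <= real m \<or> real n + 1 = real m \<or> real n = real m + 1 \<or> real n >= real m + 3" by linarith
  then have "\<not> (\<bar>real n + t - (real m + 3/2)\<bar> < 9/8 & \<not> \<bar>real n + t - (real m + 3/2)\<bar> <= 7/8)"
   "\<not> (\<bar>real n + 3 - t - (real m + 3/2)\<bar> < 9/8 & \<not> \<bar>real n + 3 - t - (real m + 3/2)\<bar> <= 7/8)"
   using t by (auto simp: abs_if)
  then have "z \<notin> collar m & w \<notin> collar m" unfolding z w collar_def using t n3 by (simp add: sector del: scaleR_one)
  then show ?thesis by blast
 qed
qed

lemma saturated_sector: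
 assumes m: "first_side m" and S: "S \<subseteq> collar m"
  and "!!z w. (!!a r. 0 <= a ==> a < 3/2 ==>
      (z \<in> open_sector m a r \<longleftrightarrow> w \<in> open_sector m a r) & (z \<in> closed_sector m a r \<longleftrightarrow> w \<in> closed_sector m a r)) ==>
   cmod z = 1 ==> cmod w = 1 ==> z \<in> S \<longleftrightarrow> w \<in> S"
 shows "saturated S"
 unfolding saturated_def
proof (intro conjI allI impI)
 show "S \<subseteq> D" using S collar_nonzero by blast
 fix z w assume zw: "(z, w) \<in> side_gluing g"
 show "z \<in> S \<longleftrightarrow> w \<in> S"
  using side_gluing_collar[OF zw m] S assms(3)[of z w] side_gluing_norm[OF zw] by blast
qed

lemma saturated_collars:
 assumes m: "first_side m"
 shows "saturated (collar m)" "saturated (inner_collar m)" "saturated (outer_collar m)" "saturated (cut_curve m)"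
  "saturated (side_collar m)"
 using cut_curve_subset_collar[OF first_side_bound[OF m]]
 by (auto intro!: saturated_sector[OF m]
   simp: collar_def inner_collar_def outer_collar_def cut_curve_def side_collar_def)

lemma collars_disjoint:
 assumes "m + 3 <= 4 * g" "n + 3 <= 4 * g" "m + 3 <= n" shows "collar m \<inter> collar n = {}"
proof (rule ccontr)
 assume "\<not> ?thesis"
 then obtain z where z: "z \<in> collar m" "z \<in> collar n" by blast
 obtain s where s: "0 <= s" "s <= 4 * real g" "z = cmod z *\<^sub>R bd s" "\<bar>s - (real m + 3/2)\<bar> < 9/8"
  using collar_polar[OF z(1) assms(1)] by metis
 have "z \<in> open_sector n (9/8) (3/8)" using z(2) by (simp add: collar_def)
 then have "\<bar>s - (real n + 3/2)\<bar> < 9/8"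
  using sector_polar(1)[OF s(1,2) assms(2), of "9/8" "cmod z"] collar_nonzero[OF z(1)] s(3) by simp
 then show False using s(4) assms(3) by linarith
qed

subsection \<open>A chart around a glued side\<close>

text \<open>A side point is described by the sine \<open>x\<close> of its angle to the midpoint of the side; the chart
 \<open>chart m\<close> unfolds a neighbourhood of the side \<open>m\<close> and of its partner \<open>m + 2\<close>.\<close>

definition right_arc :: "real => complex" where "right_arc x = Complex (sqrt (1 - x\<^sup>2)) x"
definition side_sin :: "real => real" where "side_sin t = sin (pi * t / (2 * real g))"

definition chart :: "nat => real \<times> real => complex set" where
 "chart m p = (if snd p <= 0 then proj ((1 + snd p) *\<^sub>R (bd (real m + 1/2) * right_arc (fst p)))
  else proj ((1 - snd p) *\<^sub>R (bd (real m + 5/2) * cnj (right_arc (fst p)))))"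

definition chart_dom :: "(real \<times> real) set" where
 "chart_dom = {p. \<bar>fst p\<bar> <= side_sin (1/2) & \<bar>snd p\<bar> <= 1}"

definition side_coord :: "nat => complex => real \<times> real" where
 "side_coord m z = (if Im (z * cnj (bd (real m + 3/2))) < 0
  then (Im (z * cnj (bd (real m + 1/2))) / cmod z, cmod z - 1)
  else (- Im (z * cnj (bd (real m + 5/2))) / cmod z, 1 - cmod z))"

lemma side_sin_minus [simp]: "side_sin (- t) = - side_sin t"
 by (simp add: side_sin_def)

lemma Im_mult_cnj_bd: "Im (r *\<^sub>R bd s * cnj (bd t)) = r * side_sin (s - t)"
 using bd_mult_cnj[of s t] by (simp add: bd_eq side_sin_def)

lemma side_sin_pos: assumes "0 < t" "t <= 3/2" shows "0 < side_sin t"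
 unfolding side_sin_def
proof (rule sin_gt_zero)
 have "pi * t / (2 * real g) <= pi * (3/2) / 2" using assms g by (intro frac_le mult_left_mono) auto
 also have "... < pi" by simp
 finally show "pi * t / (2 * real g) < pi" .
qed (use assms g in auto)

lemma side_angle: assumes "\<bar>t\<bar> <= 1/2" shows "\<bar>pi * t / (2 * real g)\<bar> <= pi / (4 * real g)" "pi / (4 * real g) <= pi / 2"
proof -
 have "\<bar>pi * t / (2 * real g)\<bar> = pi * \<bar>t\<bar> / (2 * real g)" by (simp add: abs_mult)
 also have "... <= pi * (1/2) / (2 * real g)" using assms by (intro divide_right_mono mult_left_mono) auto
 finally show "\<bar>pi * t / (2 * real g)\<bar> <= pi / (4 * real g)" by simp
 show "pi / (4 * real g) <= pi / 2" using g by (intro divide_left_mono) auto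
qed

lemma abs_side_sin_le: assumes "\<bar>t\<bar> <= 1/2" shows "\<bar>side_sin t\<bar> <= side_sin (1/2)"
proof -
 have "\<bar>sin y\<bar> <= sin q" if "\<bar>y\<bar> <= q" "q <= pi / 2" for y q :: real
 proof -
  have "sin y <= sin q" "sin (- q) <= sin y" using that by (intro sin_monotone_2pi_le; auto)+
  then show ?thesis by auto
 qed
 from this[OF side_angle[OF assms]] show ?thesis by (simp add: side_sin_def)
qed

lemma side_sin_half: "0 <= side_sin (1/2)" "side_sin (1/2) <= 1"
 using side_sin_pos[of "1/2"] by (auto simp: side_sin_def)

lemma side_sin_surj:
 assumes "\<bar>x\<bar> <= side_sin (1/2)" obtains t where "\<bar>t\<bar> <= 1/2" "side_sin t = x"
proof -
 define t where "t = arcsin x * (2 * real g) / pi"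
 have x: "- 1 <= x" "x <= 1" using assms side_sin_half by auto
 have "arcsin (side_sin (1/2)) = pi / (4 * real g)"
  unfolding side_sin_def using side_angle(2)[of "1/2"] by (subst arcsin_sin) (auto intro: order_trans[of _ 0])
 moreover have "arcsin x <= arcsin (side_sin (1/2))" "arcsin (- side_sin (1/2)) <= arcsin x"
  using assms side_sin_half x by (intro arcsin_le_arcsin; auto)+
 moreover have "arcsin (- side_sin (1/2)) = - arcsin (side_sin (1/2))" using side_sin_half by (simp add: arcsin_minus)
 ultimately have "\<bar>arcsin x\<bar> <= pi / (4 * real g)" by auto
 then have "\<bar>t\<bar> <= 1/2" using g by (simp add: t_def abs_mult field_simps)
 moreover have "side_sin t = x" using g x by (simp add: side_sin_def t_def)
 ultimately show ?thesis by (rule that)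
qed

lemma bd_right_arc: assumes "\<bar>t\<bar> <= 1/2" shows "bd t = right_arc (side_sin t)"
proof -
 have "\<bar>pi * t / (2 * real g)\<bar> <= pi / 2" using side_angle[OF assms] by (rule order_trans)
 then have "0 <= cos (pi * t / (2 * real g))" by (intro cos_ge_zero) linarith+
 moreover have "1 - (sin y)\<^sup>2 = (cos y)\<^sup>2" for y :: real by (simp add: cos_squared_eq)
 ultimately show ?thesis by (simp add: bd_eq side_sin_def right_arc_def complex_eq_iff)
qed

lemma norm_right_arc: "\<bar>x\<bar> <= 1 ==> cmod (right_arc x) = 1"
 by (simp add: right_arc_def cmod_def abs_square_le_1)

lemma continuous_on_right_arc [continuous_intros]: "continuous_on S f ==> continuous_on S (%p. right_arc (f p))"
 unfolding right_arc_def by (intro continuous_intros)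

lemma chart_glue:
 assumes m: "first_side m" and x: "\<bar>x\<bar> <= side_sin (1/2)"
 shows "proj (bd (real m + 1/2) * right_arc x) = proj (bd (real m + 5/2) * cnj (right_arc x))"
proof -
 obtain t where t: "\<bar>t\<bar> <= 1/2" "side_sin t = x" using side_sin_surj[OF x] .
 have "proj (bd (real m + (1/2 + t))) = proj (bd (real m + 3 - (1/2 + t)))" by (rule proj_side[OF m]) (use t in auto)
 also have "real m + 3 - (1/2 + t) = real m + 5/2 - t" by simp
 finally have "proj (bd (real m + (1/2 + t))) = proj (bd (real m + 5/2 - t))" .
 moreover have "bd (real m + (1/2 + t)) = bd (real m + 1/2) * right_arc x"
  using bd_right_arc[OF t(1)] t(2) bd_add[of "real m + 1/2" t] by (simp add: add.assoc)
 moreover have "bd (real m + 5/2 - t) = bd (real m + 5/2) * cnj (right_arc x)"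
  using bd_right_arc[OF t(1)] t(2) bd_mult_cnj[of "real m + 5/2" t] by simp
 ultimately show ?thesis by simp
qed

lemma chart_pos:
 assumes m: "first_side m" and "\<bar>fst p\<bar> <= side_sin (1/2)" "0 <= snd p"
 shows "chart m p = proj ((1 - snd p) *\<^sub>R (bd (real m + 5/2) * cnj (right_arc (fst p))))"
 using assms(3) chart_glue[OF m assms(2)] by (auto simp: chart_def)

lemma convex_chart_dom: "convex chart_dom"
proof -
 have "chart_dom = {- side_sin (1/2)..side_sin (1/2)} \<times> {- 1..1}" by (auto simp: chart_dom_def abs_le_iff)
 then show ?thesis by (simp add: convex_Times)
qed

lemma scale_chart_dom: "p \<in> chart_dom ==> 0 <= t ==> t <= 1 ==> t *\<^sub>R p \<in> chart_dom"
 using convexD[OF convex_chart_dom, of 0 p "1 - t" t] side_sin_half by (auto simp: chart_dom_def)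

lemma right_arc_D:
 assumes "\<bar>x\<bar> <= side_sin (1/2)" "0 <= r" "r <= 1"
 shows "r *\<^sub>R (bd s * right_arc x) \<in> D" "r *\<^sub>R (bd s * cnj (right_arc x)) \<in> D"
 using norm_right_arc[of x] side_sin_half assms by (auto simp: norm_mult)

lemma continuous_chart:
 assumes m: "first_side m" shows "continuous_map (top_of_set chart_dom) X (chart m)"
proof -
 let ?l = "%p. (1 + snd p) *\<^sub>R (bd (real m + 1/2) * right_arc (fst p))"
 let ?r = "%p. (1 - snd p) *\<^sub>R (bd (real m + 5/2) * cnj (right_arc (fst p)))"
 have "continuous_map (top_of_set chart_dom) X (%p. if snd p <= 0 then proj (?l p) else proj (?r p))"
 proof (rule continuous_map_cases_le)
  have "continuous_map (subtopology (top_of_set chart_dom) {p \<in> topspace (top_of_set chart_dom). snd p <= 0}) (top_of_set D) ?l"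
   unfolding subtopology_subtopology continuous_map_in_subtopology
   using right_arc_D by (auto intro!: continuous_intros simp: chart_dom_def simp del: mem_cball)
  from continuous_map_compose[OF this continuous_map_proj]
  show "continuous_map (subtopology (top_of_set chart_dom) {p \<in> topspace (top_of_set chart_dom). snd p <= 0}) X (%p. proj (?l p))"
   by (simp add: o_def)
  have "continuous_map (subtopology (top_of_set chart_dom) {p \<in> topspace (top_of_set chart_dom). 0 <= snd p}) (top_of_set D) ?r"
   unfolding subtopology_subtopology continuous_map_in_subtopology
   using right_arc_D by (auto intro!: continuous_intros simp: chart_dom_def simp del: mem_cball)
  from continuous_map_compose[OF this continuous_map_proj]
  show "continuous_map (subtopology (top_of_set chart_dom) {p \<in> topspace (top_of_set chart_dom). 0 <= snd p}) X (%p. proj (?r p))"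
   by (simp add: o_def)
  show "proj (?l p) = proj (?r p)" if "p \<in> topspace (top_of_set chart_dom)" "snd p = 0" for p
   using chart_glue[OF m, of "fst p"] that by (auto simp: chart_dom_def)
 qed (auto intro!: continuous_intros)
 then show ?thesis by (simp add: chart_def[abs_def])
qed

lemma side_collar_cases:
 assumes m: "first_side m" and z: "z \<in> side_collar m"
 obtains
  (first) x where "\<bar>x\<bar> <= side_sin (1/2)" "z = cmod z *\<^sub>R (bd (real m + 1/2) * right_arc x)"
    "side_coord m z = (x, cmod z - 1)" "Im (z * cnj (bd (real m + 3/2))) < 0"
 | (second) x where "\<bar>x\<bar> <= side_sin (1/2)" "z = cmod z *\<^sub>R (bd (real m + 5/2) * cnj (right_arc x))"
    "side_coord m z = (x, 1 - cmod z)" "Im (z * cnj (bd (real m + 3/2))) > 0"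
proof -
 obtain s where "z = cmod z *\<^sub>R bd s" and s: "\<bar>s - (real m + 3/2)\<bar> < 9/8" "7/8 < \<bar>s - (real m + 3/2)\<bar>"
  using collar_polar[OF _ first_side_bound[OF m], of z] z unfolding side_collar_def by (metis IntE mem_Collect_eq less_imp_le)
 then obtain \<rho> where \<rho>: "z = \<rho> *\<^sub>R bd s" "cmod z = \<rho>" "0 < \<rho>"
  using z by (intro that[of "cmod z"]) (auto simp: side_collar_def)
 have Im: "Im (z * cnj (bd t)) = \<rho> * side_sin (s - t)" for t unfolding \<rho>(1) by (rule Im_mult_cnj_bd)
 show ?thesis
 proof (cases "s < real m + 3/2")
  case True
  define t where "t = s - (real m + 1/2)"
  have t: "\<bar>t\<bar> <= 1/2" using s True by (auto simp: t_def abs_if split: if_splits)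
  have "bd s = bd (real m + 1/2) * right_arc (side_sin t)"
   using bd_right_arc[OF t] bd_add[of "real m + 1/2" t] by (simp add: t_def)
  moreover have "side_sin (s - (real m + 3/2)) < 0"
   using side_sin_pos[of "real m + 3/2 - s"] side_sin_minus[of "real m + 3/2 - s"] True s(1) by simp
  then have "Im (z * cnj (bd (real m + 3/2))) < 0" unfolding Im using \<rho> by (simp add: mult_less_0_iff)
  moreover from this have "side_coord m z = (side_sin t, \<rho> - 1)"
   unfolding side_coord_def Im[of "real m + 1/2"] using \<rho> by (simp add: t_def)
  ultimately show ?thesis using first[of "side_sin t"] abs_side_sin_le[OF t] \<rho> by simp
 next
  case False
  define t where "t = real m + 5/2 - s"
  have t: "\<bar>t\<bar> <= 1/2" using s False by (auto simp: t_def abs_if split: if_splits)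
  have "bd s = bd (real m + 5/2) * cnj (right_arc (side_sin t))"
   using bd_right_arc[OF t] bd_mult_cnj[of "real m + 5/2" t] by (simp add: t_def)
  moreover have "Im (z * cnj (bd (real m + 3/2))) > 0"
   unfolding Im using \<rho> side_sin_pos[of "s - (real m + 3/2)"] False s by simp
  moreover from this have "side_coord m z = (side_sin t, 1 - \<rho>)"
   unfolding side_coord_def Im[of "real m + 5/2"] using \<rho> side_sin_minus[of "s - (real m + 5/2)"] by (simp add: t_def)
  ultimately show ?thesis using second[of "side_sin t"] abs_side_sin_le[OF t] \<rho> by simp
 qed
qed

lemma side_coord_chart:
 assumes m: "first_side m" and z: "z \<in> side_collar m"
 shows "side_coord m z \<in> chart_dom" "chart m (side_coord m z) = proj z"
proof -
 have c: "cmod z <= 1" "5/8 < cmod z" using z collar_nonzero[of z m] by (auto simp: side_collar_def)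
 show "side_coord m z \<in> chart_dom" using side_collar_cases[OF m z] c by cases (auto simp: chart_dom_def)
 show "chart m (side_coord m z) = proj z"
 proof (rule side_collar_cases[OF m z])
  fix x assume "z = cmod z *\<^sub>R (bd (real m + 1/2) * right_arc x)" "side_coord m z = (x, cmod z - 1)"
  then show ?thesis using c by (simp add: chart_def)
 next
  fix x assume "\<bar>x\<bar> <= side_sin (1/2)" "z = cmod z *\<^sub>R (bd (real m + 5/2) * cnj (right_arc x))"
   "side_coord m z = (x, 1 - cmod z)"
  then show ?thesis using c chart_pos[OF m, of "side_coord m z"] by simp
 qed
qed

lemma side_coord_glue:
 assumes m: "first_side m" and z: "z \<in> side_collar m" and zw: "(z, w) \<in> side_gluing g"
 shows "side_coord m z = side_coord m w"
proof -
 obtain t where t: "0 <= t" "t <= 1" and zw_eq: "z = 1 *\<^sub>R bd (real m + t)" "w = 1 *\<^sub>R bd (real m + 3 - t)"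
  using side_gluing_collar[OF zw m] z by (auto simp: side_collar_def)
 have "Im (z * cnj (bd (real m + 3/2))) = - side_sin (3/2 - t)" "Im (w * cnj (bd (real m + 3/2))) = side_sin (3/2 - t)"
  "Im (w * cnj (bd (real m + 5/2))) = - Im (z * cnj (bd (real m + 1/2)))"
  unfolding zw_eq Im_mult_cnj_bd using side_sin_minus[of "3/2 - t"] side_sin_minus[of "t - 1/2"]
  by (simp_all add: algebra_simps)
 then show ?thesis using side_sin_pos[of "3/2 - t"] t zw_eq by (simp add: side_coord_def)
qed

lemma continuous_side_coord:
 assumes m: "first_side m" shows "continuous_on (side_collar m) (side_coord m)"
proof -
 let ?A = "side_collar m \<inter> {z. Im (z * cnj (bd (real m + 3/2))) < 0}"
 let ?B = "side_collar m \<inter> {z. 0 < Im (z * cnj (bd (real m + 3/2)))}"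
 have nonzero: "z ~= 0" if "z \<in> side_collar m" for z using that by (auto simp: side_collar_def)
 have S: "side_collar m = ?A \<union> ?B" using side_collar_cases[OF m] by auto
 have "continuous_on (?A \<union> ?B) (side_coord m)"
 proof (rule continuous_on_Un_local_open)
  show "openin (top_of_set (?A \<union> ?B)) ?A" "openin (top_of_set (?A \<union> ?B)) ?B"
   unfolding S[symmetric] by (intro openin_Int_open openin_subtopology_self open_Collect_less continuous_intros)+
  show "continuous_on ?A (side_coord m)"
  proof (rule continuous_on_eq)
   show "continuous_on ?A (%z. (Im (z * cnj (bd (real m + 1/2))) / cmod z, cmod z - 1))"
    using nonzero by (intro continuous_intros) auto
  qed (auto simp: side_coord_def)
  show "continuous_on ?B (side_coord m)"
  proof (rule continuous_on_eq)
   show "continuous_on ?B (%z. (- Im (z * cnj (bd (real m + 5/2))) / cmod z, 1 - cmod z))"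
    using nonzero by (intro continuous_intros) auto
  qed (auto simp: side_coord_def)
 qed
 then show ?thesis using S by simp
qed

definition chart_ray :: "nat => real \<times> real => real => complex set" where
 "chart_ray m p = (%t. chart m (t *\<^sub>R p))"

lemma pathin_chart_ray: "first_side m ==> p \<in> chart_dom ==> pathin X (chart_ray m p)"
 unfolding chart_ray_def
 by (intro pathin_compose[OF continuous_chart] image_subsetI continuous_intros scale_chart_dom) auto

lemma chart_path_homotopic:
 assumes m: "first_side m" and \<sigma>: "continuous_on {0..1} \<sigma>" "\<sigma> ` {0..1} \<subseteq> chart_dom"
  and q: "!!t. t \<in> {0..1} ==> q t = chart m (\<sigma> t)"
 shows "path_homotopic X (path_rev (chart_ray m (\<sigma> 0)) \<cdot> chart_ray m (\<sigma> 1)) q"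
proof -
 let ?a = "%t. if t <= 1/2 then (1 - 2 * t) *\<^sub>R \<sigma> 0 else (2 * t - 1) *\<^sub>R \<sigma> 1"
 have ends: "\<sigma> 0 \<in> chart_dom" "\<sigma> 1 \<in> chart_dom" using \<sigma>(2) by auto
 have "continuous_on {0..1} ?a" by (intro continuous_on_pieces continuous_intros) auto
 moreover have "?a t \<in> chart_dom" if "t \<in> {0..1}" for t using that scale_chart_dom ends by auto
 then have "?a ` {0..1} \<subseteq> chart_dom" by blast
 ultimately show ?thesis
  using \<sigma> q by (intro path_homotopic_convex[OF continuous_chart[OF m] convex_chart_dom, of ?a \<sigma>])
   (auto simp: loop_concat_def path_rev_def chart_ray_def)
qed

subsection \<open>Loops dual to the sides\<close>

definition dual_loop :: "nat => real => complex set" where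
 "dual_loop m = ray (bd (real m + 1/4)) \<cdot> path_rev (ray (bd (real m + 11/4)))"

lemma proj_dual_loop: "first_side m ==> proj (bd (real m + 11/4)) = proj (bd (real m + 1/4))"
 using proj_side[of m "1/4"] by (simp add: add.commute)

lemma dual_loop:
 assumes "first_side m" shows "pathin X (dual_loop m)" "dual_loop m 0 = proj 0" "dual_loop m 1 = proj 0"
 using proj_dual_loop[OF assms] by (simp_all add: dual_loop_def pathin_loop_concat pathin_path_rev pathin_ray)

end

section \<open>Twisting representations of surface groups\<close>

lemma (in surface) functor_disc:
 fixes Q (structure)
 assumes T: "path_functor Q X T" and \<sigma>: "continuous_on {0..1} \<sigma>" "\<sigma> ` {0..1} \<subseteq> D"
 shows "T (ray (\<sigma> 0)) \<otimes> T (%t. proj (\<sigma> t)) = T (ray (\<sigma> 1))"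
proof -
 interpret T: path_functor Q X T by fact
 have D: "\<sigma> 0 \<in> D" "\<sigma> 1 \<in> D" using \<sigma>(2) unfolding image_subset_iff by (auto simp del: mem_cball)
 let ?a = "%t. if t <= 1/2 then (2 * t) *\<^sub>R \<sigma> 0 else \<sigma> (2 * t - 1)"
 have "continuous_on {0..1} ?a"
  by (intro continuous_on_pieces continuous_intros continuous_on_compose2[OF \<sigma>(1)]) auto
 moreover have "?a t \<in> D" if "t \<in> {0..1}" for t
  using that scale_D[OF D(1), of "2 * t"] subsetD[OF \<sigma>(2) imageI[of "2 * t - 1"]] by (auto simp del: mem_cball)
 then have "?a ` {0..1} \<subseteq> D" by blast
 moreover have "(%t. t *\<^sub>R \<sigma> 1) ` {0..1} \<subseteq> D" using scale_D[OF D(2)] by auto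
 ultimately have "path_homotopic X (ray (\<sigma> 0) \<cdot> (%t. proj (\<sigma> t))) (ray (\<sigma> 1))"
  by (intro path_homotopic_convex[OF continuous_map_proj convex_cball, of ?a "%t. t *\<^sub>R \<sigma> 1"])
    (auto intro!: continuous_intros simp: loop_concat_def ray_def)
 then show ?thesis
  using T.E_homotopic T.E_concat[OF pathin_ray[OF D(1)] pathin_proj[OF \<sigma>]] by simp
qed

lemma (in surface) functor_dual_loop:
 fixes Q (structure)
 assumes T: "path_functor Q X T" and m: "first_side m"
 shows "T (dual_loop m) = T (ray (bd (real m + 1/4))) \<otimes> inv T (ray (bd (real m + 11/4)))"
proof -
 interpret T: path_functor Q X T by fact
 show ?thesis
  unfolding dual_loop_def using proj_dual_loop[OF m]
  by (subst T.E_concat) (simp_all add: T.E_rev pathin_ray pathin_path_rev)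
qed

subsection \<open>Functors trivial along the chosen rays\<close>

locale surface_functor = surface g + path_functor Q "genus_surface g" E
 for g :: nat and Q :: "('q, 'b) monoid_scheme" (structure) and E +
 assumes E_rep_pt: "!!y. y \<in> topspace (genus_surface g) ==> E (ray (rep_pt y)) = \<one>"
begin

abbreviation "e z \<equiv> E (ray z)"

lemma e_closed [simp]: "z \<in> D ==> e z \<in> carrier Q" using E_closed pathin_ray by simp

lemma e_ball: "z \<in> ball 0 1 ==> e z = \<one>"
 using E_rep_pt[of "proj z"] rep_pt_ball[of z] by (auto simp: topspace_X)

lemma E_disc:
 assumes "continuous_on {0..1} \<sigma>" "\<sigma> ` {0..1} \<subseteq> D"
 shows "E (%t. proj (\<sigma> t)) = inv e (\<sigma> 0) \<otimes> e (\<sigma> 1)"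
proof -
 have "e (\<sigma> 0) \<in> carrier Q" by (intro e_closed subsetD[OF assms(2)]) simp
 moreover have "E (%t. proj (\<sigma> t)) \<in> carrier Q" by (intro E_closed pathin_proj assms)
 moreover have "e (\<sigma> 0) \<otimes> E (%t. proj (\<sigma> t)) = e (\<sigma> 1)" by (rule functor_disc[OF path_functor_axioms assms])
 ultimately show ?thesis by (metis Q.inv_closed Q.l_inv Q.l_one Q.m_assoc)
qed

lemma E_interior:
 assumes "pathin (subtopology X (proj ` S)) q" "S \<subseteq> ball 0 1"
 shows "E q = \<one>"
proof -
 have "pathin X q" "\<forall>t\<in>{0..1}. q t \<in> proj ` S" using assms by (simp_all add: pathin_subtopology)
 then have q: "pathin X q" "!!t. t \<in> {0..1} ==> q t \<in> proj ` ball 0 1"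
  using image_mono[OF assms(2), of proj] by blast+
 have "continuous_map (subtopology X (proj ` ball 0 1)) euclidean rep_pt"
  by (rule continuous_map_descend[where f="%z. z"])
    (use side_gluing_norm in \<open>fastforce simp: saturated_ball openin_open intro: exI[of _ "ball 0 1"]\<close>)+
 moreover have "continuous_map (top_of_set {0..1}) (subtopology X (proj ` ball 0 1)) q"
  using q by (auto simp: pathin_def continuous_map_in_subtopology)
 ultimately have "continuous_map (top_of_set {0..1}) euclidean (rep_pt \<circ> q)" using continuous_map_compose by blast
 then have c: "continuous_on {0..1} (%t. rep_pt (q t))" by (simp add: o_def)
 have b: "rep_pt (q t) \<in> ball 0 1" "proj (rep_pt (q t)) = q t" if "t \<in> {0..1}" for t
  using q(2)[OF that] rep_pt_ball by auto
 then have D: "(%t. rep_pt (q t)) ` {0..1} \<subseteq> D"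
  by (force simp del: mem_ball mem_cball dest: subsetD[OF ball_subset_cball])
 have "E q = E (%t. proj (rep_pt (q t)))" by (rule E_eq[OF q(1)]) (simp add: b)
 also have "... = inv e (rep_pt (q 0)) \<otimes> e (rep_pt (q 1))" using E_disc[OF c D] .
 also have "... = \<one>" using b[of 0] b[of 1] by (simp add: e_ball)
 finally show ?thesis .
qed

lemma E_dual_loop:
 assumes m: "first_side m"
 shows "E (dual_loop m) = e (bd (real m + 1/2)) \<otimes> inv e (bd (real m + 5/2))"
proof -
 have "proj (bd (real m + (1/4 + t / 4))) = proj (bd (real m + 3 - (1/4 + t / 4)))" if "t \<in> {0..1}" for t
  by (rule proj_side[OF m]) (use that in auto)
 then have "E (%t. proj (bd (real m + (1/4 + t / 4)))) = E (%t. proj (bd (real m + 3 - (1/4 + t / 4))))"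
  by (intro E_eq pathin_proj) (auto intro!: continuous_intros)
 moreover have "E (%t. proj (bd (real m + (1/4 + t / 4)))) = inv e (bd (real m + 1/4)) \<otimes> e (bd (real m + 1/2))"
  by (subst E_disc) (auto intro!: continuous_intros)
 moreover have "E (%t. proj (bd (real m + 3 - (1/4 + t / 4)))) = inv e (bd (real m + 11/4)) \<otimes> e (bd (real m + 5/2))"
  by (subst E_disc) (auto intro!: continuous_intros simp: algebra_simps)
 ultimately have along_sides: "inv e (bd (real m + 1/4)) \<otimes> e (bd (real m + 1/2)) = inv e (bd (real m + 11/4)) \<otimes> e (bd (real m + 5/2))"
  by simp
 have "a \<otimes> inv b = c \<otimes> inv d"
  if "a \<in> carrier Q" "b \<in> carrier Q" "c \<in> carrier Q" "d \<in> carrier Q" "inv a \<otimes> c = inv b \<otimes> d" for a b c d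
 proof -
  have "c = a \<otimes> (inv b \<otimes> d)" using that(1-4) by (simp add: that(5)[symmetric] Q.m_assoc[symmetric])
  then show ?thesis using that(1-4) by (simp add: Q.m_assoc)
 qed
 then show ?thesis unfolding functor_dual_loop[OF path_functor_axioms m] using along_sides by simp
qed

lemma E_chart_ray:
 assumes m: "first_side m" and w: "w \<in> side_collar m" "e w = \<one>"
 shows "E (chart_ray m (side_coord m w)) = inv e (bd (real m + 1/2)) \<or>
   E (chart_ray m (side_coord m w)) = inv e (bd (real m + 5/2))"
proof (rule side_collar_cases[OF m w(1)])
 have w1: "cmod w <= 1" using w(1) collar_nonzero[of w m] by (auto simp: side_collar_def)
 have E_ray: "E (chart_ray m (side_coord m w)) = inv e c"
  if "continuous_on {0..1} S" and S: "!!u. u \<in> {0..1} ==> S u \<in> D & chart_ray m (side_coord m w) u = proj (S u)" "S 0 = c" "S 1 = w" for S c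
 proof -
  have "E (chart_ray m (side_coord m w)) = E (%u. proj (S u))"
   using S(1) pathin_chart_ray[OF m side_coord_chart(1)[OF m w(1)]] by (intro E_eq) auto
  also have "... = inv e (S 0) \<otimes> e (S 1)" using S(1) by (intro E_disc that(1)) blast
  finally show ?thesis using w(2) S(1)[of 0] by (simp add: S(2,3) del: mem_cball)
 qed
 have scaled: "u * (1 - cmod w) <= 1" "0 <= u * (1 - cmod w)" "\<bar>x\<bar> <= side_sin (1/2) ==> \<bar>u * x\<bar> <= side_sin (1/2)"
  if "u \<in> {0..1}" for u x
  using that w1 mult_left_le_one_le[of "\<bar>x\<bar>" u] by (auto simp: abs_mult intro!: mult_le_one)
 show ?thesis if x: "\<bar>x\<bar> <= side_sin (1/2)" "w = cmod w *\<^sub>R (bd (real m + 1/2) * right_arc x)"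
   "side_coord m w = (x, cmod w - 1)" for x
 proof (rule disjI1, rule E_ray)
  let ?S = "%u. (1 - u * (1 - cmod w)) *\<^sub>R (bd (real m + 1/2) * right_arc (u * x))"
  show "?S u \<in> D & chart_ray m (side_coord m w) u = proj (?S u)" if u: "u \<in> {0..1}" for u
  proof -
   have "1 + u * (cmod w - 1) = 1 - u * (1 - cmod w)" by (simp add: algebra_simps)
   moreover from this have "u * (cmod w - 1) <= 0" using scaled(2)[OF u] by linarith
   ultimately show ?thesis using scaled[OF u] x by (intro conjI right_arc_D) (auto simp: chart_ray_def chart_def)
  qed
 qed (use x(2) in \<open>auto simp: right_arc_def complex_eq_iff intro!: continuous_intros\<close>)
 show ?thesis if x: "\<bar>x\<bar> <= side_sin (1/2)" "w = cmod w *\<^sub>R (bd (real m + 5/2) * cnj (right_arc x))"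
   "side_coord m w = (x, 1 - cmod w)" for x
 proof (rule disjI2, rule E_ray)
  let ?S = "%u. (1 - u * (1 - cmod w)) *\<^sub>R (bd (real m + 5/2) * cnj (right_arc (u * x)))"
  show "?S u \<in> D & chart_ray m (side_coord m w) u = proj (?S u)" if u: "u \<in> {0..1}" for u
   using scaled[OF u] x chart_pos[OF m, of "u *\<^sub>R side_coord m w"] by (intro conjI right_arc_D) (auto simp: chart_ray_def)
 qed (use x(2) in \<open>auto simp: right_arc_def complex_eq_iff intro!: continuous_intros\<close>)
qed

lemma E_side_collar:
 assumes m: "first_side m" and q: "pathin (subtopology X (proj ` side_collar m)) q"
 shows "E q = \<one> \<or> E q = E (dual_loop m) \<or> E q = inv E (dual_loop m)"
proof -
 have sat: "saturated (side_collar m)" by (rule saturated_collars[OF m])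
 have q': "pathin X q" "!!t. t \<in> {0..1} ==> q t \<in> proj ` side_collar m" using q by (auto simp: pathin_subtopology)
 define \<sigma> where "\<sigma> t = side_coord m (rep_pt (q t))" for t
 have "continuous_map (subtopology X (proj ` side_collar m)) euclidean (%y. side_coord m (rep_pt y))"
  using side_coord_glue[OF m] by (intro continuous_map_descend[OF sat openin_side_collar _ continuous_side_coord[OF m]])
 from continuous_map_compose[OF q[unfolded pathin_def] this]
 have c: "continuous_on {0..1} \<sigma>" by (simp add: \<sigma>_def[abs_def] o_def)
 have r: "rep_pt (q t) \<in> side_collar m" "proj (rep_pt (q t)) = q t" if "t \<in> {0..1}" for t
  using rep_pt_saturated[OF sat q'(2)[OF that]] rep_pt(2) pathin_topspace[OF q'(1) that] by auto
 have \<sigma>: "\<sigma> t \<in> chart_dom" "q t = chart m (\<sigma> t)" if "t \<in> {0..1}" for t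
  using side_coord_chart[OF m r(1)[OF that]] r(2)[OF that] by (auto simp: \<sigma>_def)
 then have rays: "pathin X (chart_ray m (\<sigma> 0))" "pathin X (chart_ray m (\<sigma> 1))" using pathin_chart_ray[OF m] by auto
 have "\<sigma> ` {0..1} \<subseteq> chart_dom" using \<sigma>(1) by blast
 then have "E (path_rev (chart_ray m (\<sigma> 0)) \<cdot> chart_ray m (\<sigma> 1)) = E q"
  using \<sigma>(2) by (intro E_homotopic chart_path_homotopic[OF m c])
 moreover have "chart_ray m (\<sigma> 0) 0 = chart_ray m (\<sigma> 1) 0" by (simp add: chart_ray_def)
 ultimately have "E q = inv E (chart_ray m (\<sigma> 0)) \<otimes> E (chart_ray m (\<sigma> 1))"
  using rays E_concat[of "path_rev (chart_ray m (\<sigma> 0))" "chart_ray m (\<sigma> 1)"] by (simp add: E_rev pathin_path_rev)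
 moreover have "E (chart_ray m (\<sigma> t)) = inv e (bd (real m + 1/2)) \<or> E (chart_ray m (\<sigma> t)) = inv e (bd (real m + 5/2))"
  if "t \<in> {0..1}" for t
  using E_chart_ray[OF m r(1)[OF that] E_rep_pt[OF pathin_topspace[OF q'(1) that]]] by (simp add: \<sigma>_def)
 from this[of 0] this[of 1] have "E (chart_ray m (\<sigma> 0)) \<in> {inv e (bd (real m + 1/2)), inv e (bd (real m + 5/2))}"
  "E (chart_ray m (\<sigma> 1)) \<in> {inv e (bd (real m + 1/2)), inv e (bd (real m + 5/2))}" by auto
 ultimately show ?thesis by (auto simp: E_dual_loop[OF m] Q.inv_mult_group)
qed

end

subsection \<open>Cutting along curves and regluing\<close>

locale surface_twist = surface_functor g Q E
 for g :: nat and Q :: "('q, 'b) monoid_scheme" (structure) and E +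
 fixes k :: nat and z :: "nat => 'q"
 assumes k: "k < 2" and z_closed: "i < g ==> z i \<in> carrier Q"
  and z_commute: "i < g ==> z i \<otimes> E (dual_loop (4 * i + k)) = E (dual_loop (4 * i + k)) \<otimes> z i"
begin

definition side :: "nat => nat" where "side i = 4 * i + k"
definition uncut :: "complex set" where "uncut = D - (\<Union>i<g. cut_curve (side i))"
definition jump :: "nat => complex set => 'q" where
 "jump i y = (if y \<in> proj ` inner_collar (side i) then z i else \<one>)"
definition collar_index :: "complex set => nat" where
 "collar_index y = (THE i. i < g & y \<in> proj ` collar (side i))"
definition regauged :: "nat => (real => complex set) => 'q" where
 "regauged i q = inv jump i (q 0) \<otimes> E q \<otimes> jump i (q 1)"
definition \<tau> :: "(real => complex set) => 'q" where
 "\<tau> q = (if q ` {0..1} \<subseteq> proj ` uncut then E q else regauged (collar_index (q 0)) q)"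
definition strips :: "nat => complex set set" where
 "strips i = {collar (side i) \<inter> ball 0 1, side_collar (side i)}"
definition cover :: "complex set set set" where
 "cover = insert (proj ` uncut) (\<Union>i<g. (`) proj ` strips i)"

lemma first_side_side: "i < g ==> first_side (side i)" using k by (simp add: side_def first_side_def)

lemma side_bound: "i < g ==> side i + 3 <= 4 * g" using first_side_bound[OF first_side_side] .

lemma jump_closed [simp]: "i < g ==> jump i y \<in> carrier Q" by (simp add: jump_def z_closed)

lemma saturated_uncut: "saturated uncut"
 unfolding saturated_def
proof (intro conjI allI impI)
 fix a b assume ab: "(a, b) \<in> side_gluing g"
 have "a \<in> D" "b \<in> D" using side_gluing_norm[OF ab] by auto
 moreover have "a \<in> cut_curve (side i) \<longleftrightarrow> b \<in> cut_curve (side i)" if "i < g" for i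
  using saturated_collars(4)[OF first_side_side[OF that]] ab by (simp add: saturated_def)
 ultimately show "a \<in> uncut \<longleftrightarrow> b \<in> uncut" by (auto simp: uncut_def)
qed (auto simp: uncut_def)

lemma openin_uncut: "openin (top_of_set D) uncut"
 unfolding uncut_def by (intro openin_diff closedin_Union) (auto simp: closedin_cut_curve)

lemma strips:
 assumes "i < g" "S \<in> strips i" shows "saturated S" "openin (top_of_set D) S" "S \<subseteq> collar (side i)"
 using assms saturated_collars(5)[OF first_side_side] openin_side_collar saturated_ball[of "collar (side i) \<inter> ball 0 1"]
 by (auto simp: strips_def side_collar_def intro: openin_Int_open openin_collar)

lemma collar_index: assumes "i < g" "y \<in> proj ` collar (side i)" shows "collar_index y = i"
 unfolding collar_index_def
proof (rule the_equality)
 fix j assume j: "j < g & y \<in> proj ` collar (side j)"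
 then have "rep_pt y \<in> collar (side j) \<inter> collar (side i)"
  using rep_pt_saturated saturated_collars(1) first_side_side assms by blast
 then show "j = i"
  using collars_disjoint[OF side_bound[of i] side_bound[of j]] collars_disjoint[OF side_bound[of j] side_bound[of i]] j assms(1)
  by (cases i j rule: linorder_cases) (auto simp: side_def)
qed (use assms in auto)

lemma collar_uncut_cases:
 assumes i: "i < g" and q: "pathin X q" "q ` {0..1} \<subseteq> proj ` collar (side i)" "q ` {0..1} \<subseteq> proj ` uncut"
 shows "q ` {0..1} \<subseteq> proj ` inner_collar (side i) \<or> q ` {0..1} \<inter> proj ` inner_collar (side i) = {}"
proof -
 note sat = saturated_collars[OF first_side_side[OF i]]
 have "y \<in> proj ` inner_collar (side i) \<union> proj ` outer_collar (side i)" if y: "y \<in> q ` {0..1}" for y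
 proof -
  have "y \<in> proj ` collar (side i)" "y \<in> proj ` uncut" using q(2,3) y by (simp_all only: subsetD)
  then have "rep_pt y \<in> collar (side i)" "rep_pt y \<in> uncut"
   using rep_pt_saturated sat(1) saturated_uncut by simp_all
  then have "rep_pt y \<in> inner_collar (side i) \<union> outer_collar (side i)"
   using i by (auto simp: uncut_def inner_collar_def outer_collar_def cut_curve_def)
  moreover have "y \<in> topspace X" using y pathin_topspace[OF q(1)] by auto
  ultimately show ?thesis using rep_pt(2) by (metis UnE UnI1 UnI2 imageI)
 qed
 then have covered: "q ` {0..1} \<subseteq> proj ` inner_collar (side i) \<union> proj ` outer_collar (side i)" by blast
 have "proj ` inner_collar (side i) \<inter> proj ` outer_collar (side i) = {}"
 proof (rule ccontr)
  assume "\<not> ?thesis"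
  then obtain y where "y \<in> proj ` inner_collar (side i)" "y \<in> proj ` outer_collar (side i)" by blast
  then have "rep_pt y \<in> inner_collar (side i)" "rep_pt y \<in> outer_collar (side i)" using rep_pt_saturated sat by blast+
  then show False by (auto simp: inner_collar_def outer_collar_def open_sector_def closed_sector_def)
 qed
 moreover have "connectedin X (q ` {0..1})" using q(1) by (rule connectedin_path_image)
 moreover have "openin X (proj ` inner_collar (side i))" "openin X (proj ` outer_collar (side i))"
  using openin_proj_image sat openin_inner_collar openin_outer_collar by auto
 ultimately have "proj ` inner_collar (side i) \<inter> q ` {0..1} = {} \<or> proj ` outer_collar (side i) \<inter> q ` {0..1} = {}"
  using covered connectedinD[of X "q ` {0..1}" "proj ` inner_collar (side i)" "proj ` outer_collar (side i)"] by blast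
 moreover have "I \<subseteq> A \<or> I \<inter> A = {}" if "I \<subseteq> A \<union> B" "A \<inter> I = {} \<or> B \<inter> I = {}" for I A B :: "complex set set"
  using that by blast
 ultimately show ?thesis using covered by metis
qed

lemma z_commute_strip:
 assumes i: "i < g" "S \<in> strips i" and q: "pathin (subtopology X (proj ` S)) q"
 shows "z i \<otimes> E q = E q \<otimes> z i"
proof (cases "S = side_collar (side i)")
 case True
 let ?d = "E (dual_loop (side i))"
 have d: "?d \<in> carrier Q" using E_closed dual_loop(1)[OF first_side_side[OF i(1)]] .
 have comm: "z i \<otimes> ?d = ?d \<otimes> z i" using z_commute[OF i(1)] by (simp add: side_def)
 have "z i \<otimes> inv ?d = inv ?d \<otimes> (?d \<otimes> z i) \<otimes> inv ?d" using z_closed[OF i(1)] d by (simp add: Q.m_assoc[symmetric])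
 also have "... = inv ?d \<otimes> z i" unfolding comm[symmetric] using z_closed[OF i(1)] d by (simp add: Q.m_assoc)
 finally show ?thesis
  using E_side_collar[OF first_side_side[OF i(1)] q[unfolded True]] comm z_closed[OF i(1)] by auto
next
 case False
 then have "E q = \<one>" using E_interior[OF q] i(2) by (auto simp: strips_def)
 then show ?thesis using z_closed[OF i(1)] by simp
qed

lemma \<tau>_strip:
 assumes i: "i < g" "S \<in> strips i" and q: "pathin (subtopology X (proj ` S)) q"
 shows "\<tau> q = regauged i q"
proof -
 have "pathin X q" "q ` {0..1} \<subseteq> proj ` S" using q by (auto simp: pathin_subtopology)
 then have path: "pathin X q" "q ` {0..1} \<subseteq> proj ` collar (side i)"
  using subset_trans[OF _ image_mono[OF strips(3)[OF i]]] by simp_all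
 then have ends: "q 0 \<in> q ` {0..1}" "q 1 \<in> q ` {0..1}" "E q \<in> carrier Q" using E_closed by auto
 show ?thesis
 proof (cases "q ` {0..1} \<subseteq> proj ` uncut")
  case False
  then show ?thesis using collar_index[OF i(1) subsetD[OF path(2) ends(1)]] by (simp add: \<tau>_def)
 next
  case True
  from collar_uncut_cases[OF i(1) path True]
  have "(jump i (q 0) = z i & jump i (q 1) = z i) \<or> (jump i (q 0) = \<one> & jump i (q 1) = \<one>)"
   using ends(1,2) unfolding jump_def by (auto simp del: image_eqI)
  moreover have "inv z i \<otimes> E q \<otimes> z i = E q"
   using z_commute_strip[OF i q] z_closed[OF i(1)] ends(3) by (metis Q.inv_closed Q.inv_solve_left Q.m_assoc Q.m_closed)
  ultimately have "regauged i q = E q" using ends(3) by (auto simp: regauged_def)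
  then show ?thesis using True by (simp add: \<tau>_def)
 qed
qed

lemma \<tau>_uncut: "pathin (subtopology X (proj ` uncut)) q ==> \<tau> q = E q"
 by (auto simp: \<tau>_def pathin_subtopology)

lemma cover_cases:
 assumes "U \<in> cover" obtains (uncut) "U = proj ` uncut" | (strip) i S where "i < g" "S \<in> strips i" "U = proj ` S"
 using assms by (auto simp: cover_def)

lemma cover_covers: "topspace X \<subseteq> \<Union>cover"
proof
 fix y assume "y \<in> topspace X"
 then have r: "rep_pt y \<in> D" "proj (rep_pt y) = y" using rep_pt by auto
 show "y \<in> \<Union>cover"
 proof (cases "rep_pt y \<in> uncut")
  case True
  then show ?thesis using r(2) unfolding cover_def by (metis UnionI imageI insertI1)
 next
  case False
  then obtain i where i: "i < g" "rep_pt y \<in> cut_curve (side i)" using r(1) by (auto simp: uncut_def)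
  then have "rep_pt y \<in> collar (side i)" using cut_curve_subset_collar[OF side_bound] by blast
  then have "\<exists>S\<in>strips i. rep_pt y \<in> S"
   using r(1) by (cases "cmod (rep_pt y) < 1") (auto simp: strips_def side_collar_def)
  then obtain S where "S \<in> strips i" "rep_pt y \<in> S" by blast
  then have "y \<in> proj ` S" "proj ` S \<in> cover" using r(2) i(1) by (auto simp: cover_def)
  then show ?thesis by blast
 qed
qed

sublocale tr: local_transport Q X cover \<tau>
proof (intro local_transport.intro local_transport_axioms.intro Q.group_axioms)
 show "openin X U" if "U \<in> cover" for U
  using that by (cases rule: cover_cases) (auto intro: openin_proj_image saturated_uncut openin_uncut strips)
 show "path_functor Q (subtopology X U) \<tau>" if "U \<in> cover" for U
  using that
 proof (cases rule: cover_cases)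
  case uncut
  then show ?thesis using path_functor_subtopology[OF path_functor_axioms \<tau>_uncut] by simp
 next
  case (strip i S)
  then show ?thesis
   using path_functor_subtopology[OF gauge_transform[of "jump i"], of "proj ` S" \<tau>] \<tau>_strip by (simp add: regauged_def)
 qed
qed (rule cover_covers)

abbreviation "T \<equiv> tr.transport"

sublocale T: path_functor Q X T
 by unfold_locales (auto intro: tr.transport_closed tr.transport_concat tr.transport_homotopic)

lemma T_uncut: "pathin (subtopology X (proj ` uncut)) q ==> T q = E q"
 using tr.transport_local[of "proj ` uncut"] \<tau>_uncut by (simp add: cover_def)

lemma polar_uncut:
 assumes "0 <= s" "s <= 4 * real g" "0 <= \<rho>" "\<rho> <= 1"
  and off: "!!i. i < g ==> 1 < \<bar>s - (real (side i) + 3/2)\<bar> \<or> \<rho> < 1/2 \<or> \<bar>s - (real (side i) + 3/2)\<bar> < 1 & 1/2 < \<rho>"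
 shows "\<rho> *\<^sub>R bd s \<in> uncut"
proof -
 have "\<rho> *\<^sub>R bd s \<notin> cut_curve (side i)" if i: "i < g" for i
 proof (cases "\<rho> = 0")
  case True
  then show ?thesis using cut_curve_nonzero by auto
 next
  case False
  then have "0 < \<rho>" using assms by simp
  from sector_polar[OF assms(1,2) side_bound[OF i] _ _ this assms(4), of 1 "1/2"]
  show ?thesis using off[OF i] by (auto simp: cut_curve_def)
 qed
 then show ?thesis using assms(3,4) by (auto simp: uncut_def)
qed

definition radial :: "real => real => real => real => complex" where
 "radial s a b = (%t. (a + (b - a) * t) *\<^sub>R bd s)"

lemma radial_ends [simp]: "radial s a b 0 = a *\<^sub>R bd s" "radial s a b 1 = b *\<^sub>R bd s"
 by (auto simp: radial_def)

lemma continuous_radial: "continuous_on {0..1} (radial s a b)"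
 unfolding radial_def by (intro continuous_intros)

lemma radial_range:
 assumes "a <= b" shows "radial s a b ` {0..1} \<subseteq> (%\<rho>. \<rho> *\<^sub>R bd s) ` {a..b}"
proof -
 have "a + (b - a) * t \<in> {a..b}" if "t \<in> {0..1}" for t using that assms mult_left_le[of t "b - a"] by auto
 then show ?thesis by (auto simp: radial_def)
qed

lemma radial_D:
 assumes "0 <= a" "a <= b" "b <= 1" shows "radial s a b ` {0..1} \<subseteq> D"
 by (rule subset_trans[OF radial_range[OF assms(2)]]) (use assms in auto)

lemma T_radial_uncut:
 assumes "0 <= s" "s <= 4 * real g" "0 <= a" "a <= b" "b <= 1"
  and "!!i \<rho>. i < g ==> \<rho> \<in> {a..b} ==>
    1 < \<bar>s - (real (side i) + 3/2)\<bar> \<or> \<rho> < 1/2 \<or> \<bar>s - (real (side i) + 3/2)\<bar> < 1 & 1/2 < \<rho>"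
 shows "T (%t. proj (radial s a b t)) = inv e (a *\<^sub>R bd s) \<otimes> e (b *\<^sub>R bd s)"
proof -
 have "\<rho> *\<^sub>R bd s \<in> uncut" if "\<rho> \<in> {a..b}" for \<rho> using that assms by (intro polar_uncut) auto
 then have "radial s a b ` {0..1} \<subseteq> uncut" by (intro subset_trans[OF radial_range[OF assms(4)]] image_subsetI)
 then have "T (%t. proj (radial s a b t)) = E (%t. proj (radial s a b t))"
  by (intro T_uncut pathin_proj_subtopology continuous_radial) (auto simp: uncut_def)
 then show ?thesis using E_disc[OF continuous_radial radial_D] assms by simp
qed

lemma T_ray_uncut:
 assumes "0 <= s" "s <= 4 * real g" "0 <= b" "b <= 1"
  and "!!i. i < g ==> 1 < \<bar>s - (real (side i) + 3/2)\<bar> \<or> b < 1/2"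
 shows "T (ray (b *\<^sub>R bd s)) = e (b *\<^sub>R bd s)"
proof -
 have "ray (b *\<^sub>R bd s) = (%t. proj (radial s 0 b t))" by (simp add: ray_def radial_def mult.commute)
 moreover have "T (%t. proj (radial s 0 b t)) = inv e (0 *\<^sub>R bd s) \<otimes> e (b *\<^sub>R bd s)"
  by (rule T_radial_uncut[OF assms(1,2)]) (use assms(3-5) in fastforce)+
 ultimately show ?thesis using e_ball[of 0] e_closed[of "b *\<^sub>R bd s"] assms(3,4) by simp
qed

lemma T_radial_crossing:
 assumes s: "0 <= s" "s <= 4 * real g" and j: "j < g" "\<bar>s - (real (side j) + 3/2)\<bar> < 7/8"
 shows "T (%t. proj (radial s (7/16) (9/16) t)) = z j"
proof -
 let ?S = "collar (side j) \<inter> ball 0 1" and ?q = "%t. proj (radial s (7/16) (9/16) t)"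
 note sector = sector_polar[OF s side_bound[OF j(1)]]
 have S: "\<rho> *\<^sub>R bd s \<in> ?S" if "\<rho> \<in> {7/16..9/16}" for \<rho>
  using that j(2) sector[of "9/8" \<rho>] sector[of "7/8" \<rho>] by (auto simp: collar_def)
 then have "radial s (7/16) (9/16) ` {0..1} \<subseteq> ?S" using radial_range[of "7/16" "9/16" s] by auto
 then have path: "pathin (subtopology X (proj ` ?S)) ?q"
  using collar_nonzero by (intro pathin_proj_subtopology continuous_radial) blast+
 have strip: "?S \<in> strips j" by (simp add: strips_def)
 have "T ?q = regauged j ?q"
  using tr.transport_local[OF _ path] \<tau>_strip[OF j(1) strip path] strip j(1) by (auto simp: cover_def)
 moreover have "E ?q = \<one>" using E_interior[OF path] by simp
 moreover have "(7/16) *\<^sub>R bd s \<notin> inner_collar (side j)" by (auto simp: inner_collar_def open_sector_def)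
 then have "jump j (?q 0) = \<one>"
  using saturated_mem_iff[OF saturated_collars(2)[OF first_side_side[OF j(1)]]] by (simp add: jump_def)
 moreover have "(9/16) *\<^sub>R bd s \<in> inner_collar (side j)"
  using S[of "9/16"] j(2) sector[of 1 "9/16"] by (auto simp: inner_collar_def)
 then have "jump j (?q 1) = z j" by (simp add: jump_def)
 ultimately show ?thesis using z_closed[OF j(1)] by (simp add: regauged_def)
qed

lemma T_ray_cross:
 assumes s: "0 <= s" "s <= 4 * real g" and j: "j < g" "\<bar>s - (real (side j) + 3/2)\<bar> < 7/8"
  and out: "!!i. i < g ==> i ~= j ==> 1 < \<bar>s - (real (side i) + 3/2)\<bar>"
 shows "T (ray (bd s)) = z j \<otimes> e (bd s)"
proof -
 note step = functor_disc[OF T.path_functor_axioms continuous_radial radial_D, simplified]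
 have "T (ray ((7/16) *\<^sub>R bd s)) = \<one>" using T_ray_uncut[OF s, of "7/16"] e_ball[of "(7/16) *\<^sub>R bd s"] by simp
 then have "T (ray ((9/16) *\<^sub>R bd s)) = z j"
  using step[of "7/16" "9/16" s] T_radial_crossing[OF s j] z_closed[OF j(1)] by simp
 moreover have "1 < \<bar>s - (real (side i) + 3/2)\<bar> \<or> \<rho> < 1/2 \<or> \<bar>s - (real (side i) + 3/2)\<bar> < 1 & 1/2 < \<rho>"
  if "i < g" "\<rho> \<in> {9/16..1}" for i and \<rho> :: real using out[OF that(1)] j(2) that(2) by (cases "i = j") auto
 then have "T (%t. proj (radial s (9/16) 1 t)) = e (bd s)"
  using T_radial_uncut[OF s, of "9/16" 1] e_ball[of "(9/16) *\<^sub>R bd s"] by simp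
 ultimately show ?thesis using step[of "9/16" 1 s] by simp
qed

lemma T_dual_loop_twist: assumes i: "i < g"
 shows "k = 0 ==> T (dual_loop (4 * i)) = E (dual_loop (4 * i))"
  "k = 0 ==> T (dual_loop (4 * i + 1)) = z i \<otimes> E (dual_loop (4 * i + 1))"
  "k = 1 ==> T (dual_loop (4 * i)) = E (dual_loop (4 * i)) \<otimes> inv z i"
proof -
 have side: "real (side j) = 4 * real j + real k" "real k <= 1" for j using k by (simp_all add: side_def)
 have ig: "real i + 1 <= real g" and sep: "j ~= i ==> real i + 1 <= real j \<or> real j + 1 <= real i" for j using i by linarith+
 have far: "1 < \<bar>4 * real i + c - (real (side j) + 3/2)\<bar>" if "0 <= c" "c <= 15/4" "j ~= i" for c j
  using sep[OF that(3)] that(1,2) side(1)[of j] side(2) of_nat_0_le_iff[of k, where 'a=real] by (elim disjE; linarith)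
 have out: "T (ray (bd (4 * real i + c))) = e (bd (4 * real i + c))" if c: "0 <= c" "c <= 15/4" "1 < \<bar>c - (real k + 3/2)\<bar>" for c
 proof -
  have "1 < \<bar>4 * real i + c - (real (side j) + 3/2)\<bar>" for j
   using far[OF c(1,2)] c(3) by (cases "j = i") (simp_all add: side(1))
  then show ?thesis using T_ray_uncut[of "4 * real i + c" 1] c ig by simp
 qed
 have cross: "T (ray (bd (4 * real i + c))) = z i \<otimes> e (bd (4 * real i + c))" if c: "0 <= c" "c <= 15/4" "\<bar>c - (real k + 3/2)\<bar> < 7/8" for c
  by (rule T_ray_cross[OF _ _ i _ far[OF c(1,2)]]) (use c ig side(1)[of i] in linarith)+
 have first: "first_side (4 * i)" "first_side (4 * i + 1)" using i unfolding first_side_def by presburger+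
 have b: "real (4 * i) + c = 4 * real i + c" "real (4 * i + 1) + 1/4 = 4 * real i + 5/4" "real (4 * i + 1) + 11/4 = 4 * real i + 15/4" for c by simp_all
 note loops = functor_dual_loop[OF T.path_functor_axioms first(1), unfolded b] functor_dual_loop[OF path_functor_axioms first(1), unfolded b]
  functor_dual_loop[OF T.path_functor_axioms first(2), unfolded b] functor_dual_loop[OF path_functor_axioms first(2), unfolded b]
 show "T (dual_loop (4 * i)) = E (dual_loop (4 * i))" if "k = 0" using loops(1,2) out[of "1/4"] out[of "11/4"] that by simp
 show "T (dual_loop (4 * i + 1)) = z i \<otimes> E (dual_loop (4 * i + 1))" if "k = 0"
  using loops(3,4) cross[of "5/4"] out[of "15/4"] that i z_closed by (simp add: Q.m_assoc)
 show "T (dual_loop (4 * i)) = E (dual_loop (4 * i)) \<otimes> inv z i" if "k = 1"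
  using loops(1,2) out[of "1/4"] cross[of "11/4"] that i z_closed by (simp add: Q.m_assoc Q.inv_mult_group)
qed

lemma hom_T:
 assumes Q': "group Q'" and f: "f \<in> hom Q Q'" "!!i. i < g ==> f (z i) = \<one>\<^bsub>Q'\<^esub>" and p: "pathin X p"
 shows "f (T p) = f (E p)"
proof -
 interpret Q': group Q' by (rule Q')
 interpret f: group_hom Q Q' f using f(1) by unfold_locales
 have "path_functor Q' X (%p. f (E p))" by unfold_locales (auto simp: E_concat E_closed dest: E_homotopic)
 then show ?thesis
 proof (rule tr.transport_unique[OF _ f(1) _ p, symmetric])
  show "f (E p) = f (\<tau> p)" if "U \<in> cover" "pathin (subtopology X U) p" for U p
   using that(1)
  proof (cases rule: cover_cases)
   case uncut
   then show ?thesis using that \<tau>_uncut by simp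
  next
   case (strip i S)
   have "E p \<in> carrier Q" using that by (intro E_closed) (simp add: pathin_subtopology)
   moreover have "f (jump i y) = \<one>\<^bsub>Q'\<^esub>" for y using f(2)[OF strip(1)] by (simp add: jump_def)
   ultimately show ?thesis using \<tau>_strip[OF strip(1,2)] that strip by (simp add: regauged_def f.hom_inv)
  qed
 qed
qed

lemma hom_conj_T:
 assumes Q': "group Q'" and f: "f \<in> hom Q Q'" "!!i. i < g ==> f (z i) = \<one>\<^bsub>Q'\<^esub>"
  and p: "pathin X p" and \<nu>: "pathin X \<nu>" "E \<nu> = \<one>"
 shows "f (T \<nu> \<otimes> T p \<otimes> inv T \<nu>) = f (E p)"
proof -
 interpret Q': group Q' by (rule Q')
 interpret f: group_hom Q Q' f using f(1) by unfold_locales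
 have "f (T \<nu>) = \<one>\<^bsub>Q'\<^esub>" using hom_T[OF Q' f \<nu>(1)] \<nu>(2) by simp
 moreover have "f (T p) \<in> carrier Q'" using f.hom_closed T.E_closed[OF p] .
 ultimately show ?thesis using T.E_closed[OF p] T.E_closed[OF \<nu>(1)] hom_T[OF Q' f p] by (simp add: f.hom_inv)
qed

end

subsection \<open>The standard loops\<close>

definition surface_loop :: "nat => complex set => nat => (real => complex set) set" where
 "surface_loop g x m = loop_class (genus_surface g) x
   ((path_rev (surface.ray g (surface.rep_pt x)) \<cdot> surface.dual_loop g m) \<cdot> surface.ray g (surface.rep_pt x))"

context surface
begin

lemma ray_rep_pt:
 assumes "y \<in> topspace X"
 shows "pathin X (ray (rep_pt y))" "ray (rep_pt y) 0 = proj 0" "ray (rep_pt y) 1 = y"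
 using rep_pt[OF assms] pathin_ray by simp_all

lemma surface_loop_loops:
 assumes "x \<in> topspace X" "first_side m"
 shows "(path_rev (ray (rep_pt x)) \<cdot> dual_loop m) \<cdot> ray (rep_pt x) \<in> loops X x"
 using ray_rep_pt[OF assms(1)] dual_loop[OF assms(2)] by (simp add: loops_def pathin_loop_concat pathin_path_rev)

lemma surface_loop_carrier:
 assumes "x \<in> topspace X" "first_side m" shows "surface_loop g x m \<in> carrier (fundamental_group X x)"
 unfolding surface_loop_def by (rule loop_class_carrier[OF surface_loop_loops[OF assms]])

lemma functor_surface_loop:
 fixes Q (structure)
 assumes F: "path_functor Q X F" and x: "x \<in> topspace X" and m: "first_side m"
 shows "F ((path_rev (ray (rep_pt x)) \<cdot> dual_loop m) \<cdot> ray (rep_pt x)) =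
   inv F (ray (rep_pt x)) \<otimes> F (dual_loop m) \<otimes> F (ray (rep_pt x))"
proof -
 interpret F: path_functor Q X F by fact
 show ?thesis
  using ray_rep_pt[OF x] dual_loop[OF m] by (simp add: F.E_concat F.E_rev pathin_loop_concat pathin_path_rev)
qed

lemma functor_hom:
 fixes Q (structure)
 assumes F: "path_functor Q X F" and x: "x \<in> topspace X"
 obtains r where "r \<in> hom (fundamental_group X x) Q"
  "\<forall>p\<in>loops X x. r (loop_class X x p) = F (ray (rep_pt x)) \<otimes> F p \<otimes> inv F (ray (rep_pt x))"
  "\<forall>m. first_side m --> r (surface_loop g x m) = F (dual_loop m)"
proof -
 interpret F: path_functor Q X F by fact
 let ?c = "F (ray (rep_pt x))"
 have c: "?c \<in> carrier Q" using ray_rep_pt(1)[OF x] by (rule F.E_closed)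
 interpret conj: path_functor Q X "%p. inv (inv ?c) \<otimes> F p \<otimes> inv ?c" by (rule F.gauge_transform) (simp add: c)
 obtain r where r: "r \<in> hom (fundamental_group X x) Q"
  "!!p. p \<in> loops X x ==> r (loop_class X x p) = inv (inv ?c) \<otimes> F p \<otimes> inv ?c" using conj.induced_hom by blast
 have "r (surface_loop g x m) = F (dual_loop m)" if m: "first_side m" for m
 proof -
  have d: "F (dual_loop m) \<in> carrier Q" using dual_loop(1)[OF m] by (rule F.E_closed)
  have "r (surface_loop g x m) = ?c \<otimes> (inv ?c \<otimes> F (dual_loop m) \<otimes> ?c) \<otimes> inv ?c"
   unfolding surface_loop_def using r(2)[OF surface_loop_loops[OF x m]] c by (simp add: functor_surface_loop[OF F x m])
  also have "... = (?c \<otimes> inv ?c) \<otimes> F (dual_loop m) \<otimes> (?c \<otimes> inv ?c)"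
   using c d by (simp only: F.Q.m_assoc F.Q.m_closed F.Q.inv_closed)
  also have "... = F (dual_loop m)" using c d by simp
  finally show ?thesis .
 qed
 then show ?thesis using that r c by simp
qed

end

theorem surface_twist:
 fixes r :: "(real => complex set) set => 'q" and f :: "'q => 'p" and Q' :: "('p, 'c) monoid_scheme" and Q (structure)
 assumes g: "g >= 1" and x: "x \<in> topspace (genus_surface g)" and Q: "group Q"
  and r: "r \<in> hom (fundamental_group (genus_surface g) x) Q" and k: "k < 2"
  and z: "!!i. i < g ==> z i \<in> carrier Q"
  and zr: "!!i. i < g ==> z i \<otimes> r (surface_loop g x (4 * i + k)) = r (surface_loop g x (4 * i + k)) \<otimes> z i"
  and Q': "group Q'" and f: "f \<in> hom Q Q'" "!!i. i < g ==> f (z i) = \<one>\<^bsub>Q'\<^esub>"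
 shows "\<exists>r'\<in>hom (fundamental_group (genus_surface g) x) Q.
   (\<forall>i<g. (k = 0 --> r' (surface_loop g x (4 * i)) = r (surface_loop g x (4 * i)) &
        r' (surface_loop g x (4 * i + 1)) = z i \<otimes> r (surface_loop g x (4 * i + 1))) &
      (k = 1 --> r' (surface_loop g x (4 * i)) = r (surface_loop g x (4 * i)) \<otimes> inv z i)) &
   (\<forall>\<gamma>\<in>carrier (fundamental_group (genus_surface g) x). f (r' \<gamma>) = f (r \<gamma>))"
proof -
 interpret S: surface g by unfold_locales (rule g)
 interpret Q: group Q by (rule Q)
 let ?X = "genus_surface g" and ?\<nu> = "%y. S.ray (S.rep_pt y)"
 have "?\<nu> (S.proj 0) t = S.proj 0" for t using S.rep_pt_ball[of 0] by (simp add: S.ray_def)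
 moreover have "pathin ?X (?\<nu> y) & ?\<nu> y 0 = S.proj 0 & ?\<nu> y 1 = y" if "y \<in> topspace ?X" for y
  using S.ray_rep_pt[OF that] by simp
 ultimately obtain E where E: "path_functor Q ?X E" "\<forall>p\<in>loops ?X x. E p = r (loop_class ?X x p)"
  "\<forall>y\<in>topspace ?X. E (?\<nu> y) = \<one>"
  using Q.path_functor_exists[OF r x, of ?\<nu> "S.proj 0"] by metis
 interpret E: path_functor Q ?X E by (rule E(1))
 have rE: "r (surface_loop g x m) = E (S.dual_loop m)" if m: "S.first_side m" for m
  unfolding surface_loop_def using E(2,3) S.surface_loop_loops[OF x m] S.functor_surface_loop[OF E(1) x m] x
   E.E_closed[OF S.dual_loop(1)[OF m]] by simp
 have first: "S.first_side (4 * i + k')" if "i < g" "k' < 2" for i k' using that by (simp add: S.first_side_def)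
 interpret W: surface_twist g Q E k z
 proof unfold_locales
  show "z i \<otimes> E (S.dual_loop (4 * i + k)) = E (S.dual_loop (4 * i + k)) \<otimes> z i" if "i < g" for i
   using zr[OF that] rE[OF first[OF that k]] by simp
 qed (use k z E(3) in auto)
 obtain r' where r': "r' \<in> hom (fundamental_group ?X x) Q"
  "\<forall>p\<in>loops ?X x. r' (loop_class ?X x p) = W.T (?\<nu> x) \<otimes> W.T p \<otimes> inv W.T (?\<nu> x)"
  "\<forall>m. S.first_side m --> r' (surface_loop g x m) = W.T (S.dual_loop m)"
  using S.functor_hom[OF W.T.path_functor_axioms x] .
 have "f (r' \<gamma>) = f (r \<gamma>)" if \<gamma>: "\<gamma> \<in> carrier (fundamental_group ?X x)" for \<gamma>
 proof -
  obtain p where p: "p \<in> loops ?X x" "\<gamma> = loop_class ?X x p" using fundamental_group_carrierE[OF \<gamma>] .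
  then have "pathin ?X p" by (simp add: loops_def)
  from W.hom_conj_T[OF Q' f this S.ray_rep_pt(1)[OF x]] show ?thesis using r'(2) E(2,3) p x by simp
 qed
 moreover have "(k = 0 --> r' (surface_loop g x (4 * i)) = r (surface_loop g x (4 * i)) &
        r' (surface_loop g x (4 * i + 1)) = z i \<otimes> r (surface_loop g x (4 * i + 1))) &
      (k = 1 --> r' (surface_loop g x (4 * i)) = r (surface_loop g x (4 * i)) \<otimes> inv z i)" if i: "i < g" for i
  using r'(3) first[OF i, of 0] first[OF i, of 1] rE[of "4 * i"] rE[of "4 * i + 1"] W.T_dual_loop_twist[OF i] by simp
 ultimately show ?thesis using r'(1) by blast
qed

section \<open>Two by two matrices\<close>

definition mat2 :: "real => real => real => real => real^2^2" where
 "mat2 a b c d = vector [vector [a, b], vector [c, d]]"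

lemma mat2_nth [simp]: "mat2 a b c d $ 1 $ 1 = a" "mat2 a b c d $ 1 $ 2 = b" "mat2 a b c d $ 2 $ 1 = c" "mat2 a b c d $ 2 $ 2 = d"
 by (simp_all add: mat2_def)

lemma mat2_collapse: "mat2 (X $ 1 $ 1) (X $ 1 $ 2) (X $ 2 $ 1) (X $ 2 $ 2) = X"
 by (simp add: vec_eq_iff forall_2)

lemma mat2_cases: obtains a b c d where "X = mat2 a b c d" using mat2_collapse by metis

lemma mat2_eq_iff [simp]: "mat2 a b c d = mat2 a' b' c' d' \<longleftrightarrow> a = a' & b = b' & c = c' & d = d'"
 by (auto simp: vec_eq_iff forall_2)

lemma mat2_simps:
 "mat2 a b c d ** mat2 a' b' c' d' = mat2 (a * a' + b * c') (a * b' + b * d') (c * a' + d * c') (c * b' + d * d')"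
 "mat2 a b c d + mat2 a' b' c' d' = mat2 (a + a') (b + b') (c + c') (d + d')"
 "mat2 a b c d - mat2 a' b' c' d' = mat2 (a - a') (b - b') (c - c') (d - d')"
 "x *\<^sub>R mat2 a b c d = mat2 (x * a) (x * b) (x * c) (x * d)"
 "- mat2 a b c d = mat2 (- a) (- b) (- c) (- d)"
 by (simp_all add: vec_eq_iff forall_2 matrix_matrix_mult_def sum_2)

lemma mat2_one: "mat 1 = mat2 1 0 0 1" by (simp add: vec_eq_iff forall_2 mat_def)

lemma mat2_SL2R [simp]: "mat2 a b c d \<in> SL2R \<longleftrightarrow> a * d - b * c = 1"
 by (simp add: SL2R_def det_2)

definition adj2 :: "real^2^2 => real^2^2" where
 "adj2 X = mat2 (X $ 2 $ 2) (- X $ 1 $ 2) (- X $ 2 $ 1) (X $ 1 $ 1)"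

lemma adj2_mat2 [simp]: "adj2 (mat2 a b c d) = mat2 d (- b) (- c) a" by (simp add: adj2_def)

lemma SL2R_mult: "k \<in> SL2R ==> l \<in> SL2R ==> k ** l \<in> SL2R" by (simp add: SL2R_def det_mul)
lemma SL2R_one: "mat 1 \<in> SL2R" by (simp add: SL2R_def)

lemma adj2_SL2R:
 assumes "k \<in> SL2R" shows "adj2 k \<in> SL2R" "k ** adj2 k = mat 1" "adj2 k ** k = mat 1" "adj2 (adj2 k) = k"
proof -
 obtain a b c d where k: "k = mat2 a b c d" by (rule mat2_cases)
 have "a * d - b * c = 1" using assms by (simp add: k)
 then show "adj2 k \<in> SL2R" "k ** adj2 k = mat 1" "adj2 k ** k = mat 1" "adj2 (adj2 k) = k"
  unfolding k mat2_one by (simp_all add: mat2_simps algebra_simps)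
qed

lemma has_vector_derivative_mat2:
 assumes "(a has_vector_derivative a') F" "(b has_vector_derivative b') F" "(c has_vector_derivative c') F" "(d has_vector_derivative d') F"
 shows "((%t. mat2 (a t) (b t) (c t) (d t)) has_vector_derivative mat2 a' b' c' d') F"
proof -
 have e: "mat2 a b c d = a *\<^sub>R mat2 1 0 0 0 + b *\<^sub>R mat2 0 1 0 0 + c *\<^sub>R mat2 0 0 1 0 + d *\<^sub>R mat2 0 0 0 1" for a b c d
  by (simp add: mat2_simps)
 show ?thesis
  unfolding e[of "a _"] e[of a'] using assms
  by (intro has_vector_derivative_add bounded_linear.has_vector_derivative[OF bounded_linear_scaleR_left])
qed

lemma linear_sandwich2: "linear (%Y. (k :: real^2^2) ** Y ** (l :: real^2^2))"
proof (rule linearI)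
 fix x y :: "real^2^2" and r :: real
 obtain a b c d where k: "k = mat2 a b c d" by (rule mat2_cases)
 obtain a' b' c' d' where l: "l = mat2 a' b' c' d'" by (rule mat2_cases)
 obtain p q u v where x: "x = mat2 p q u v" by (rule mat2_cases)
 obtain p' q' u' v' where y: "y = mat2 p' q' u' v'" by (rule mat2_cases)
 show "k ** (x + y) ** l = k ** x ** l + k ** y ** l" "k ** (r *\<^sub>R x) ** l = r *\<^sub>R (k ** x ** l)"
  unfolding k l x y by (simp_all add: mat2_simps algebra_simps)
qed

abbreviation sl :: "real => real => real => real^2^2" where "sl p q r \<equiv> mat2 p q r (- p)"
abbreviation "upper t \<equiv> mat2 1 t 0 1"
abbreviation "lower t \<equiv> mat2 1 0 t 1"
abbreviation "diag t \<equiv> mat2 (exp t) 0 0 (exp (- t))"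
abbreviation "rot t \<equiv> mat2 (cos t) (sin t) (- sin t) (cos t)"

definition one_param :: "(real => real^2^2) => real^2^2 => bool" where
 "one_param c X \<longleftrightarrow> (\<forall>t. c t \<in> SL2R) & c 0 = mat 1 & (\<forall>s t. c (s + t) = c s ** c t) & (c has_vector_derivative X) (at 0)"

lemma has_vector_derivative_real: "(f has_real_derivative f') (at x) ==> (f has_vector_derivative f') (at x)"
 by (simp add: has_real_derivative_iff_has_vector_derivative)

lemma one_param_upper: "one_param (%t. upper t) (sl 0 1 0)"
 unfolding one_param_def
 by (auto simp: mat2_one mat2_simps intro!: has_vector_derivative_mat2 has_vector_derivative_real derivative_eq_intros)
lemma one_param_lower: "one_param (%t. lower t) (sl 0 0 1)"
 unfolding one_param_def
 by (auto simp: mat2_one mat2_simps intro!: has_vector_derivative_mat2 has_vector_derivative_real derivative_eq_intros)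
lemma one_param_diag: "one_param (%t. diag t) (sl 1 0 0)"
 unfolding one_param_def
 by (auto simp: mat2_one mat2_simps exp_add exp_diff exp_minus field_simps intro!: has_vector_derivative_mat2 has_vector_derivative_real derivative_eq_intros)
lemma one_param_rot: "one_param (%t. rot t) (sl 0 1 (- 1))"
 unfolding one_param_def
 by (auto simp: mat2_one mat2_simps cos_add sin_add power2_eq_square[symmetric] intro!: has_vector_derivative_mat2 has_vector_derivative_real derivative_eq_intros)

lemma matrix_exp_A0: "matrix_exp (t *\<^sub>R A0) = diag t"
proof -
 have A: "t *\<^sub>R A0 = mat2 t 0 0 (- t)" unfolding A0_def mat2_def[symmetric] by (simp add: mat2_simps)
 have p: "matrix_pow (mat2 t 0 0 (- t)) k = mat2 (t ^ k) 0 0 ((- t) ^ k)" for k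
  by (induction k) (auto simp: mat2_one mat2_simps)
 have "(%k. (t ^ k /\<^sub>R fact k) *\<^sub>R mat2 1 0 0 0 + ((- t) ^ k /\<^sub>R fact k) *\<^sub>R mat2 0 0 0 1)
   sums (exp t *\<^sub>R mat2 1 0 0 0 + exp (- t) *\<^sub>R mat2 0 0 0 1)"
  by (intro sums_add bounded_linear.sums[OF bounded_linear_scaleR_left] exp_converges)
 then have "(%k. (1 / fact k) *\<^sub>R matrix_pow (t *\<^sub>R A0) k) sums diag t"
  unfolding A p by (simp add: mat2_simps field_simps)
 then show ?thesis unfolding matrix_exp_def by (rule sums_unique[symmetric])
qed

lemma SL2R_generated:
 assumes "k \<in> SL2R" shows "\<exists>x y z w. k = upper x ** lower y ** upper z ** lower w"
proof -
 obtain a b c d where k: "k = mat2 a b c d" by (rule mat2_cases)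
 have det: "a * d - b * c = 1" using assms by (simp add: k)
 show ?thesis
 proof (cases "c = 0")
  case False
  have "k = upper ((a - 1) / c) ** lower c ** upper ((d - 1) / c) ** lower 0"
   unfolding k using False det by (simp add: mat2_simps field_simps)
  then show ?thesis by blast
 next
  case True
  have ad: "a * d = 1" using det True by simp
  then have d: "d ~= 0" by auto
  have "k = upper ((a + b - 1) / d) ** lower d ** upper ((d - 1) / d) ** lower (- 1)"
   unfolding k using True d ad by (simp add: mat2_simps field_simps)
  then show ?thesis by blast
 qed
qed

lemma matrix_mult_adj2:
 "X ** adj2 Y = mat2 (X$1$1 * Y$2$2 - X$1$2 * Y$2$1) (X$1$2 * Y$1$1 - X$1$1 * Y$1$2)
   (X$2$1 * Y$2$2 - X$2$2 * Y$2$1) (X$2$2 * Y$1$1 - X$2$1 * Y$1$2)"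
 by (simp add: vec_eq_iff forall_2 matrix_matrix_mult_def sum_2 adj2_def)

lemma tendsto_mat2:
 assumes "(a \<longlongrightarrow> a') F" "(b \<longlongrightarrow> b') F" "(c \<longlongrightarrow> c') F" "(d \<longlongrightarrow> d') F"
 shows "((%t. mat2 (a t) (b t) (c t) (d t)) \<longlongrightarrow> mat2 a' b' c' d') F"
proof -
 have e: "mat2 a b c d = a *\<^sub>R mat2 1 0 0 0 + b *\<^sub>R mat2 0 1 0 0 + c *\<^sub>R mat2 0 0 1 0 + d *\<^sub>R mat2 0 0 0 1" for a b c d
  by (simp add: mat2_simps)
 show ?thesis unfolding e[of "a _"] e[of a'] by (intro tendsto_intros assms)
qed

lemma tendsto_mult_adj2:
 fixes X Y :: "nat => real^2^2"
 assumes "X \<longlonglongrightarrow> L" "Y \<longlonglongrightarrow> M" shows "(%n. X n ** adj2 (Y n)) \<longlonglongrightarrow> L ** adj2 M"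
 unfolding matrix_mult_adj2 by (intro tendsto_mat2 tendsto_intros tendsto_vec_nth assms)

lemma elliptic_power:
 assumes a: "a \<in> SL2R" "a $ 1 $ 1 + a $ 2 $ 2 = 2 * cos \<theta>" "sin \<theta> ~= 0"
 shows "matrix_pow a (Suc n) = (sin (real (Suc n) * \<theta>) / sin \<theta>) *\<^sub>R a - (sin (real n * \<theta>) / sin \<theta>) *\<^sub>R mat 1"
proof (induction n)
 case 0 then show ?case using a by simp
next
 case (Suc n)
 obtain p q r w where k: "a = mat2 p q r w" by (rule mat2_cases)
 have det: "p * w - q * r = 1" and tr: "w = 2 * cos \<theta> - p" using a by (simp_all add: k)
 have sq: "a ** (u *\<^sub>R a - v *\<^sub>R mat 1) = (2 * cos \<theta> * u - v) *\<^sub>R a - u *\<^sub>R mat 1" for u v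
 proof -
  have "u * (p * p + q * r) = u * (2 * cos \<theta> * p - 1)" "u * (r * q + w * w) = u * (2 * cos \<theta> * w - 1)"
   using det unfolding tr by (simp_all add: algebra_simps)
  then show ?thesis unfolding k mat2_one mat2_simps mat2_eq_iff tr by (auto simp: algebra_simps)
 qed
 have "sin (real (Suc (Suc n)) * \<theta>) = 2 * cos \<theta> * sin (real (Suc n) * \<theta>) - sin (real n * \<theta>)"
 proof -
  have "sin (real (Suc n) * \<theta> + \<theta>) + sin (real (Suc n) * \<theta> - \<theta>) = 2 * cos \<theta> * sin (real (Suc n) * \<theta>)"
   unfolding sin_add sin_diff by simp
  then show ?thesis by (simp add: algebra_simps)
 qed
 then have "2 * cos \<theta> * (sin (real (Suc n) * \<theta>) / sin \<theta>) - sin (real n * \<theta>) / sin \<theta> = sin (real (Suc (Suc n)) * \<theta>) / sin \<theta>"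
  by (simp add: diff_divide_distrib)
 moreover have "matrix_pow a (Suc (Suc n)) = a ** matrix_pow a (Suc n)" by simp
 ultimately show ?case unfolding Suc.IH sq by simp
qed

lemma elliptic_powers_bounded:
 assumes a: "a \<in> SL2R" "\<bar>a $ 1 $ 1 + a $ 2 $ 2\<bar> < 2"
 shows "bounded (range (%m. matrix_pow a (Suc m)))"
proof -
 define \<theta> where "\<theta> = arccos ((a $ 1 $ 1 + a $ 2 $ 2) / 2)"
 have cos: "cos \<theta> = (a $ 1 $ 1 + a $ 2 $ 2) / 2" unfolding \<theta>_def by (rule cos_arccos_abs) (use a in simp)
 then have "(cos \<theta>)\<^sup>2 < 1" using a(2) by (simp add: abs_square_less_1)
 then have sin: "sin \<theta> ~= 0" using sin_cos_squared_add[of \<theta>] by (metis add_0 less_irrefl zero_power2)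
 have bound: "\<bar>sin t / sin \<theta>\<bar> <= 1 / \<bar>sin \<theta>\<bar>" for t by (simp add: abs_divide divide_right_mono)
 have "norm (matrix_pow a (Suc m)) <= (1 / \<bar>sin \<theta>\<bar>) * norm a + (1 / \<bar>sin \<theta>\<bar>) * norm (mat 1 :: real^2^2)" for m
 proof -
  have "matrix_pow a (Suc m) = (sin (real (Suc m) * \<theta>) / sin \<theta>) *\<^sub>R a - (sin (real m * \<theta>) / sin \<theta>) *\<^sub>R mat 1"
   by (rule elliptic_power[OF a(1) _ sin]) (simp add: cos)
  then have "norm (matrix_pow a (Suc m)) <=
    norm ((sin (real (Suc m) * \<theta>) / sin \<theta>) *\<^sub>R a) + norm ((sin (real m * \<theta>) / sin \<theta>) *\<^sub>R (mat 1 :: real^2^2))"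
   using norm_triangle_ineq4 by metis
  also have "... <= (1 / \<bar>sin \<theta>\<bar>) * norm a + (1 / \<bar>sin \<theta>\<bar>) * norm (mat 1 :: real^2^2)"
   unfolding norm_scaleR by (intro add_mono mult_right_mono bound norm_ge_zero)
  finally show ?thesis .
 qed
 then show ?thesis by (auto intro!: boundedI)
qed

text \<open>The normal forms of hyperbolic (\<open>T\<close>) and parabolic (\<open>\<not> T\<close>) one-parameter groups.\<close>

definition std_curve :: "bool => real => real^2^2" where "std_curve T c = (if T then diag c else upper c)"
definition std_gen :: "bool => real^2^2" where "std_gen T = (if T then sl 1 0 0 else sl 0 1 0)"

lemma std_curve_SL2R: "std_curve T c \<in> SL2R" by (simp add: std_curve_def exp_minus)

lemma std_curve_span: "\<exists>\<alpha> \<beta>. std_curve T c = \<alpha> *\<^sub>R mat 1 + \<beta> *\<^sub>R std_gen T"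
proof (cases T)
 case True
 then have "std_curve T c = ((exp c + exp (- c)) / 2) *\<^sub>R mat 1 + ((exp c - exp (- c)) / 2) *\<^sub>R std_gen T"
  by (simp add: std_curve_def std_gen_def mat2_one mat2_simps field_simps)
 then show ?thesis by blast
next
 case False
 then have "std_curve T c = 1 *\<^sub>R mat 1 + c *\<^sub>R std_gen T" by (simp add: std_curve_def std_gen_def mat2_one mat2_simps)
 then show ?thesis by blast
qed

lemma adj2_mult: "adj2 (X ** Y) = adj2 Y ** adj2 X"
proof -
 obtain a b c d where k: "X = mat2 a b c d" by (rule mat2_cases)
 obtain a' b' c' d' where l: "Y = mat2 a' b' c' d'" by (rule mat2_cases)
 show ?thesis unfolding k l by (simp add: mat2_simps algebra_simps)
qed

lemma upper_triangular_conj: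
 assumes lm: "l > 0" "l * m = 1" and "l ~= 1 \<or> b ~= 0"
 shows "\<exists>c k T. c ~= 0 & k \<in> SL2R & mat2 l b 0 m = k ** std_curve T c ** adj2 k"
proof (cases "l = 1")
 case True
 then show ?thesis
  using assms by (intro exI[of _ b] exI[of _ "mat 1"] exI[of _ False]) (simp add: std_curve_def SL2R_one mat2_one mat2_simps)
next
 case False
 define u where "u = b / (m - l)"
 have m: "m = 1 / l" using lm by (simp add: field_simps)
 have "m ~= l" using False lm by (auto simp: square_eq_1_iff)
 then have "b = u * (m - l)" by (simp add: u_def)
 then have "mat2 l b 0 m = upper u ** std_curve True (ln l) ** adj2 (upper u)"
  using lm(1) by (simp add: std_curve_def mat2_simps exp_minus m inverse_eq_divide algebra_simps)
 then show ?thesis using False lm(1) by (intro exI[of _ "ln l"] exI[of _ "upper u"] exI[of _ True]) simp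
qed

lemma trace_ge_2_triangular:
 assumes det: "p * w - q * r = 1" and tr: "p + w >= 2"
 shows "\<exists>k l m b. k \<in> SL2R & l > 0 & l * m = 1 & mat2 p q r w = k ** mat2 l b 0 m ** adj2 k"
proof (cases "r = 0")
 case True
 have "p > 0" using det tr True mult_nonpos_nonneg[of p w] by (cases "p > 0") auto
 then show ?thesis using True det
  by (intro exI[of _ "mat2 1 0 0 1"] exI[of _ p] exI[of _ w] exI[of _ q]) (simp add: mat2_simps)
next
 case False
 define S l m where "S = sqrt ((p + w)\<^sup>2 - 4)" and "l = (p + w + S) / 2" and "m = p + w - l"
 have "(p + w)\<^sup>2 >= 4" using power_mono[of 2 "p + w" 2] tr by simp
 then have S: "S * S = (p + w)\<^sup>2 - 4" "S >= 0" by (simp_all add: S_def)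
 have lm: "l * m = 1" using S(1) by (simp add: l_def m_def power2_eq_square field_simps)
 have p: "p = l + m - w" by (simp add: m_def)
 have "q * r = (l - w) * (w - m)" using det lm unfolding p by (simp add: algebra_simps)
 then have q: "q = (l - w) * (w - m) / r" using False by (simp add: field_simps)
 let ?k = "mat2 (l - w) (- 1 / r) r 0"
 have "mat2 p q r w = ?k ** mat2 l (- 1 / r) 0 m ** adj2 ?k"
  unfolding adj2_mat2 mat2_simps mat2_eq_iff q p using False lm by (simp add: field_simps)
 moreover have "?k \<in> SL2R" "l > 0" using False tr S(2) by (simp_all add: l_def)
 ultimately show ?thesis using lm by blast
qed

definition normal_form :: "bool => real^2^2 => real^2^2 => bool" where
 "normal_form T k a \<longleftrightarrow> k \<in> SL2R & (\<exists>s c. (s = 1 \<or> s = - 1) & c ~= 0 & a = s *\<^sub>R (k ** std_curve T c ** adj2 k))"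

lemma normal_form_SL2R: assumes "normal_form T k a" shows "k \<in> SL2R" "a \<in> SL2R"
proof -
 obtain s c where k: "k \<in> SL2R" "s = 1 \<or> s = - 1" "a = s *\<^sub>R (k ** std_curve T c ** adj2 k)"
  using assms unfolding normal_form_def by blast
 have "k ** std_curve T c ** adj2 k \<in> SL2R" by (intro SL2R_mult adj2_SL2R k(1) std_curve_SL2R)
 then show "k \<in> SL2R" "a \<in> SL2R" using k by (auto simp: SL2R_def det_2)
qed

lemma trace_ge_2_normal_form:
 assumes a: "a \<in> SL2R" "\<bar>a $ 1 $ 1 + a $ 2 $ 2\<bar> >= 2" "a ** a ~= mat 1"
 shows "\<exists>T k. normal_form T k a"
proof -
 obtain p q r w where k: "a = mat2 p q r w" by (rule mat2_cases)
 define s :: real where "s = (if p + w >= 0 then 1 else - 1)"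
 have s: "s = 1 \<or> s = - 1" "s * p + s * w >= 2" using a(2) by (auto simp: s_def k)
 have "s * p * (s * w) - s * q * (s * r) = 1" using a(1) s(1) by (auto simp: k)
 then obtain k l m b where tri: "k \<in> SL2R" "l > 0" "l * m = 1" "mat2 (s * p) (s * q) (s * r) (s * w) = k ** mat2 l b 0 m ** adj2 k"
  using trace_ge_2_triangular[OF _ s(2)] by blast
 have a_eq: "a = s *\<^sub>R (k ** mat2 l b 0 m ** adj2 k)"
  using s(1) unfolding tri(4)[symmetric] by (auto simp: \<open>a = mat2 p q r w\<close> mat2_simps)
 have "l ~= 1 \<or> b ~= 0"
 proof (rule ccontr)
  assume "\<not> ?thesis"
  then have "a = s *\<^sub>R mat 1" using tri a_eq by (simp add: mat2_one[symmetric] adj2_SL2R)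
  then show False using a(3) s(1) by (auto simp: mat2_one mat2_simps)
 qed
 then obtain c u T where u: "c ~= 0" "u \<in> SL2R" "mat2 l b 0 m = u ** std_curve T c ** adj2 u"
  using upper_triangular_conj[OF tri(2,3)] by blast
 then have "a = s *\<^sub>R ((k ** u) ** std_curve T c ** adj2 (k ** u))" by (simp add: a_eq adj2_mult matrix_mul_assoc)
 then show ?thesis using s(1) u(1) SL2R_mult[OF tri(1) u(2)] unfolding normal_form_def by blast
qed

lemma adj2_adj2: "adj2 (adj2 X) = X" using mat2_collapse[of X] by (simp add: adj2_def)

definition words_commute :: "real^2^2 => real^2^2 => bool" where
 "words_commute a b \<longleftrightarrow> (a ** b ** adj2 a ** adj2 b) ** (adj2 a ** b ** a ** adj2 b) = (adj2 a ** b ** a ** adj2 b) ** (a ** b ** adj2 a ** adj2 b)"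

lemma words_commute_conj:
 assumes k: "k \<in> SL2R" and w: "words_commute a b"
 shows "words_commute (k ** a ** adj2 k) (k ** b ** adj2 k)"
proof -
 let ?c = "%x. k ** x ** adj2 k"
 have conj_mult: "?c x ** ?c y = ?c (x ** y)" for x y
 proof -
  have "?c x ** ?c y = k ** x ** (adj2 k ** k) ** y ** adj2 k" by (simp add: matrix_mul_assoc)
  then show ?thesis by (simp add: adj2_SL2R[OF k] matrix_mul_assoc)
 qed
 have conj_adj2: "adj2 (?c x) = ?c (adj2 x)" for x by (simp add: adj2_mult adj2_adj2 matrix_mul_assoc)
 show ?thesis using w unfolding words_commute_def conj_adj2 conj_mult by simp
qed

lemma words_commute_upper:
 assumes "a * d = 1" "a' * d' = 1" shows "words_commute (mat2 a b 0 d) (mat2 a' b' 0 d')"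
proof -
 have "\<exists>x. mat2 a b 0 d ** mat2 a' b' 0 d' ** adj2 (mat2 a b 0 d) ** adj2 (mat2 a' b' 0 d') = upper x"
  if "a * d = 1" "a' * d' = 1" for a b d a' b' d' :: real
 proof -
  have nonzero: "a ~= 0" "a' ~= 0" using that by auto
  then have d: "d = 1 / a" "d' = 1 / a'" using that by (simp_all add: nonzero_eq_divide_eq mult.commute)
  show ?thesis unfolding adj2_mat2 mat2_simps
  proof (rule exI, rule iffD2[OF mat2_eq_iff], intro conjI)
   show "((a * a' + b * 0) * d + (a * b' + b * d') * - 0) * d' + ((a * a' + b * 0) * - b + (a * b' + b * d') * a) * - 0 = 1"
    unfolding d using nonzero by simp
  qed (unfold d, rule refl, use nonzero in simp_all)
 qed
 note commutator = this
 obtain x y where "mat2 a b 0 d ** mat2 a' b' 0 d' ** adj2 (mat2 a b 0 d) ** adj2 (mat2 a' b' 0 d') = upper x"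
  "adj2 (mat2 a b 0 d) ** mat2 a' b' 0 d' ** mat2 a b 0 d ** adj2 (mat2 a' b' 0 d') = upper y"
  using commutator[OF assms, of b b'] commutator[of d a a' d' "- b" b'] assms by (auto simp: mult.commute)
 then show ?thesis unfolding words_commute_def by (simp add: mat2_simps)
qed

lemma words_commute_lower:
 assumes "a * d = 1" "a' * d' = 1" shows "words_commute (mat2 a 0 b d) (mat2 a' 0 b' d')"
proof -
 let ?J = "mat2 0 1 (- 1) 0"
 have "words_commute (?J ** mat2 d (- b) 0 a ** adj2 ?J) (?J ** mat2 d' (- b') 0 a' ** adj2 ?J)"
  by (rule words_commute_conj[OF _ words_commute_upper]) (use assms in \<open>simp_all add: mult.commute\<close>)
 then show ?thesis by (simp add: mat2_simps)
qed

lemma scaleR_sandwich: "k ** (t *\<^sub>R y) ** l = t *\<^sub>R (k ** y ** l)" for k y l :: "real^2^2"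
 using linear_scale[OF linear_sandwich2] .

lemma sl_conj: "\<exists>p q r. k ** std_gen T ** adj2 k = sl p q r"
proof -
 obtain a b c d where "k = mat2 a b c d" by (rule mat2_cases)
 then show ?thesis unfolding std_gen_def by (simp add: mat2_simps algebra_simps)
qed

lemma not_words_commute_entries:
 assumes noncomm: "\<not> words_commute (s0 *\<^sub>R std_curve T0 c0) b1" and s0: "s0 = 1 \<or> s0 = - 1"
  and b1: "b1 \<in> SL2R" "b1 = mat2 a (\<beta> * q) (\<beta> * r) d"
 shows "r ~= 0 & (T0 --> q ~= 0)"
proof (intro conjI impI notI)
 assume r: "r = 0"
 have "words_commute (s0 *\<^sub>R std_curve T0 c0) b1"
  using s0 b1(1) unfolding b1(2) r mult_zero_right std_curve_def by (auto simp: mat2_simps exp_minus intro!: words_commute_upper)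
 with noncomm show False by simp
next
 assume T0 and q: "q = 0"
 then have "words_commute (s0 *\<^sub>R std_curve T0 c0) b1"
  using s0 b1(1) unfolding b1(2) q mult_zero_right std_curve_def by (auto simp: mat2_simps exp_minus intro!: words_commute_lower)
 with noncomm show False by simp
qed

lemma generation_criterion:
 assumes "normal_form T0 k0 a0" "normal_form T1 k1 a1" and noncomm: "\<not> words_commute a0 a1"
 shows "\<exists>p q r. (adj2 k0 ** k1) ** std_gen T1 ** adj2 (adj2 k0 ** k1) = sl p q r & r ~= 0 & (T0 --> q ~= 0)"
proof -
 obtain s0 c0 s1 c1 where a0: "a0 = s0 *\<^sub>R (k0 ** std_curve T0 c0 ** adj2 k0)" "s0 = 1 \<or> s0 = - 1" "k0 \<in> SL2R"
  and a1: "a1 = s1 *\<^sub>R (k1 ** std_curve T1 c1 ** adj2 k1)" "s1 = 1 \<or> s1 = - 1" "k1 \<in> SL2R"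
  using assms(1,2) unfolding normal_form_def by blast
 let ?M = "adj2 k0 ** k1"
 have M: "?M \<in> SL2R" by (intro SL2R_mult adj2_SL2R a0 a1)
 obtain p q r where X: "?M ** std_gen T1 ** adj2 ?M = sl p q r" using sl_conj by blast
 obtain \<alpha> \<beta> where span: "std_curve T1 c1 = \<alpha> *\<^sub>R mat 1 + \<beta> *\<^sub>R std_gen T1" using std_curve_span by blast
 have lin: "?M ** std_curve T1 c1 ** adj2 ?M = \<alpha> *\<^sub>R mat 1 + \<beta> *\<^sub>R sl p q r"
  unfolding span linear_add[OF linear_sandwich2] scaleR_sandwich X by (simp add: adj2_SL2R[OF M])
 define b1 where "b1 = s1 *\<^sub>R (?M ** std_curve T1 c1 ** adj2 ?M)"
 have b1: "b1 = mat2 (s1 * (\<alpha> + \<beta> * p)) (s1 * \<beta> * q) (s1 * \<beta> * r) (s1 * (\<alpha> - \<beta> * p))"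
  unfolding b1_def lin mat2_one by (simp add: mat2_simps algebra_simps)
 have "?M ** std_curve T1 c1 ** adj2 ?M \<in> SL2R" by (intro SL2R_mult adj2_SL2R M std_curve_SL2R)
 then have b1_SL: "b1 \<in> SL2R" using a1(2) unfolding b1_def SL2R_def by (auto simp: det_2)
 have "k0 ** (?M ** std_curve T1 c1 ** adj2 ?M) ** adj2 k0 = (k0 ** adj2 k0) ** k1 ** std_curve T1 c1 ** adj2 k1 ** (k0 ** adj2 k0)"
  by (simp add: adj2_mult adj2_adj2 matrix_mul_assoc)
 then have "a1 = k0 ** b1 ** adj2 k0" unfolding a1(1) b1_def scaleR_sandwich by (simp add: adj2_SL2R[OF a0(3)])
 moreover have "a0 = k0 ** (s0 *\<^sub>R std_curve T0 c0) ** adj2 k0" unfolding a0(1) scaleR_sandwich ..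
 ultimately have "\<not> words_commute (s0 *\<^sub>R std_curve T0 c0) b1" using noncomm words_commute_conj[OF a0(3)] by blast
 then show ?thesis using not_words_commute_entries[OF _ a0(2) b1_SL b1] X by blast
qed

lemma group_SL2R: "group (matrix_group SL2R)"
 using group.subgroup_imp_group[OF group_GL subgroup_SL2R] by (simp add: matrix_group_def)

locale SL2R_subgroup =
 fixes \<Gamma> :: "(real^2^2) set"
 assumes sub: "subgroup \<Gamma> (matrix_group SL2R)"
begin

lemma group_\<Gamma>: "group (matrix_group \<Gamma>)"
 using group.subgroup_imp_group[OF group_SL2R sub] by (simp add: matrix_group_def)

lemma \<Gamma>_SL: "\<Gamma> \<subseteq> SL2R" using subgroup.subset[OF sub] by (simp add: matrix_group_def)
lemma \<Gamma>_mult: "a \<in> \<Gamma> ==> b \<in> \<Gamma> ==> a ** b \<in> \<Gamma>" using subgroup.m_closed[OF sub] by (simp add: matrix_group_def)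
lemma \<Gamma>_one: "mat 1 \<in> \<Gamma>" using subgroup.one_closed[OF sub] by (simp add: matrix_group_def)

lemma \<Gamma>_adj2: assumes "a \<in> \<Gamma>" shows "adj2 a \<in> \<Gamma>"
proof -
 have a: "a \<in> SL2R" using assms \<Gamma>_SL by blast
 have "inv\<^bsub>matrix_group SL2R\<^esub> a = adj2 a"
  by (rule group.inv_equality[OF group_SL2R]) (simp_all add: matrix_group_def adj2_SL2R a)
 then show ?thesis using subgroup.m_inv_closed[OF sub assms] by simp
qed

lemma \<Gamma>_pow: "a \<in> \<Gamma> ==> matrix_pow a n \<in> \<Gamma>" by (induction n) (auto simp: \<Gamma>_one \<Gamma>_mult)

lemma \<Gamma>_hom:
 assumes "\<psi> \<in> hom (matrix_group \<Gamma>) (matrix_group SL2R)"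
 shows "a \<in> \<Gamma> ==> \<psi> a \<in> SL2R" "a \<in> \<Gamma> ==> b \<in> \<Gamma> ==> \<psi> (a ** b) = \<psi> a ** \<psi> b" "\<psi> (mat 1) = mat 1"
  "a \<in> \<Gamma> ==> \<psi> (adj2 a) = adj2 (\<psi> a)"
proof -
 show c: "\<psi> a \<in> SL2R" if "a \<in> \<Gamma>" for a using assms that by (auto simp: hom_def matrix_group_def)
 show m: "\<psi> (a ** b) = \<psi> a ** \<psi> b" if "a \<in> \<Gamma>" "b \<in> \<Gamma>" for a b using assms that by (auto simp: hom_def matrix_group_def)
 show o: "\<psi> (mat 1) = mat 1"
  using group_hom.hom_one[of "matrix_group \<Gamma>" "matrix_group SL2R" \<psi>] assms group_\<Gamma> group_SL2R
  by (simp add: group_hom_def group_hom_axioms_def matrix_group_def)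
 show "\<psi> (adj2 a) = adj2 (\<psi> a)" if a: "a \<in> \<Gamma>"
 proof -
  have aS: "a \<in> SL2R" using a \<Gamma>_SL by blast
  have "\<psi> a ** \<psi> (adj2 a) = mat 1" using m[OF a \<Gamma>_adj2[OF a]] adj2_SL2R(2)[OF aS] o by simp
  then have "adj2 (\<psi> a) ** (\<psi> a ** \<psi> (adj2 a)) = adj2 (\<psi> a)" by simp
  then show ?thesis by (simp add: matrix_mul_assoc adj2_SL2R[OF c[OF a]])
 qed
qed

lemma discrete_bounded_powers:
 assumes disc: "discrete \<Gamma>" and a: "a \<in> \<Gamma>" and bd: "bounded (range (%m. matrix_pow a (Suc m)))"
 shows "\<exists>p q. p ~= q & matrix_pow a p = matrix_pow a q"
proof -
 obtain L r where r: "strict_mono r" "((%m. matrix_pow a (Suc m)) \<circ> r) \<longlonglongrightarrow> L"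
  using bounded_imp_convergent_subsequence[OF bd] by blast
 define X where "X m = matrix_pow a (Suc (r m))" for m
 have XL: "X \<longlonglongrightarrow> L" using r(2) by (simp add: X_def[abs_def] o_def)
 have X: "X m \<in> \<Gamma>" "X m \<in> SL2R" for m using \<Gamma>_pow[OF a, of "Suc (r m)"] \<Gamma>_SL by (auto simp only: X_def)
 have "(%m. X m ** adj2 (X m)) \<longlonglongrightarrow> L ** adj2 L" by (rule tendsto_mult_adj2[OF XL XL])
 then have "L ** adj2 L = mat 1" unfolding adj2_SL2R(2)[OF X(2)] using LIMSEQ_unique tendsto_const by blast
 then have lim: "(%m. X (Suc m) ** adj2 (X m)) \<longlonglongrightarrow> mat 1"
  using tendsto_mult_adj2[OF LIMSEQ_Suc[OF XL] XL] by simp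
 obtain U where U: "open U" "U \<inter> \<Gamma> = {mat 1}" using disc \<Gamma>_one unfolding discrete_def isolated_in_def by blast
 then have "mat 1 \<in> U" by blast
 from topological_tendstoD[OF lim U(1) this] obtain m where "X (Suc m) ** adj2 (X m) \<in> U"
  by (auto simp: eventually_sequentially)
 then have "X (Suc m) ** adj2 (X m) = mat 1" using U(2) \<Gamma>_mult[OF X(1) \<Gamma>_adj2[OF X(1)]] by blast
 then have "X (Suc m) ** adj2 (X m) ** X m = X m" by simp
 then have "X (Suc m) = X m" by (simp add: matrix_mul_assoc[symmetric] adj2_SL2R[OF X(2)])
 moreover have "Suc (r (Suc m)) ~= Suc (r m)" using strict_mono_less[OF r(1), of m "Suc m"] by simp
 ultimately show ?thesis unfolding X_def by blast
qed

end

locale surface_group = SL2R_subgroup \<Gamma> for \<Gamma> +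
 fixes g :: nat and x :: "complex set" and \<phi> :: "real^2^2 => (real => complex set) set"
 assumes g1: "g >= 1" and x: "x \<in> topspace (genus_surface g)"
  and iso: "\<phi> \<in> iso (matrix_group \<Gamma>) (fundamental_group (genus_surface g) x)"
begin

definition gen_a :: "nat => real^2^2" where "gen_a i = inv_into \<Gamma> \<phi> (surface_loop g x (4 * i))"
definition gen_b :: "nat => real^2^2" where "gen_b i = inv_into \<Gamma> \<phi> (surface_loop g x (4 * i + 1))"

lemma \<phi>_image: "\<phi> ` \<Gamma> = carrier (fundamental_group (genus_surface g) x)"
 using iso by (auto simp: iso_def bij_betw_def matrix_group_def)

lemma gen_a: assumes "i < g" shows "gen_a i \<in> \<Gamma>" "\<phi> (gen_a i) = surface_loop g x (4 * i)"
 and gen_b: "gen_b i \<in> \<Gamma>" "\<phi> (gen_b i) = surface_loop g x (4 * i + 1)"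
proof -
 have "surface_loop g x (4 * i) \<in> \<phi> ` \<Gamma>" "surface_loop g x (4 * i + 1) \<in> \<phi> ` \<Gamma>"
  unfolding \<phi>_image using assms
  by (auto intro!: surface.surface_loop_carrier[OF surface.intro[OF g1] x] simp: surface.first_side_def[OF surface.intro[OF g1]])
 then show "gen_a i \<in> \<Gamma>" "\<phi> (gen_a i) = surface_loop g x (4 * i)" "gen_b i \<in> \<Gamma>" "\<phi> (gen_b i) = surface_loop g x (4 * i + 1)"
  unfolding gen_a_def gen_b_def by (simp_all only: inv_into_into f_inv_into_f)
qed

lemma inv_\<phi>_hom: "inv_into \<Gamma> \<phi> \<in> hom (fundamental_group (genus_surface g) x) (matrix_group \<Gamma>)"
 using group.iso_set_sym[OF group_\<Gamma> iso] by (simp add: iso_def matrix_group_def)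

lemma \<phi>_hom: "\<phi> \<in> hom (matrix_group \<Gamma>) (fundamental_group (genus_surface g) x)"
 using iso by (simp add: iso_def)

lemma surface_hom_twist:
 fixes r :: "real^2^2 => 'q" and f :: "'q => 'p" and Q' :: "('p, 'c) monoid_scheme" and Q (structure)
 assumes Q: "group Q" and r: "r \<in> hom (matrix_group \<Gamma>) Q" and z: "!!i. i < g ==> z i \<in> carrier Q"
  and zr: "!!i. i < g ==> z i \<otimes> r (gen_a i) = r (gen_a i) \<otimes> z i"
  and Q': "group Q'" and f: "f \<in> hom Q Q'" "!!i. i < g ==> f (z i) = \<one>\<^bsub>Q'\<^esub>"
 shows "\<exists>r'\<in>hom (matrix_group \<Gamma>) Q. (\<forall>i<g. r' (gen_a i) = r (gen_a i) & r' (gen_b i) = z i \<otimes> r (gen_b i)) &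
   (\<forall>\<gamma>\<in>\<Gamma>. f (r' \<gamma>) = f (r \<gamma>))"
proof -
 let ?P = "fundamental_group (genus_surface g) x"
 let ?r = "r \<circ> inv_into \<Gamma> \<phi>"
 have r': "?r \<in> hom ?P Q" by (rule hom_compose[OF inv_\<phi>_hom r])
 have commute: "z i \<otimes> ?r (surface_loop g x (4 * i + 0)) = ?r (surface_loop g x (4 * i + 0)) \<otimes> z i" if "i < g" for i
  using zr[OF that] by (simp add: gen_a_def)
 have "(0::nat) < 2" by simp
 note twist = surface_twist[OF g1 x Q r' this z commute Q' f]
 obtain r' where r': "r' \<in> hom ?P Q" "\<forall>i<g. r' (surface_loop g x (4 * i)) = ?r (surface_loop g x (4 * i)) &
        r' (surface_loop g x (4 * i + 1)) = z i \<otimes> ?r (surface_loop g x (4 * i + 1))"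
   "\<forall>\<gamma>\<in>carrier ?P. f (r' \<gamma>) = f (?r \<gamma>)" using twist by auto
 show ?thesis
 proof (intro bexI[of _ "r' \<circ> \<phi>"] conjI allI impI ballI)
  show "r' \<circ> \<phi> \<in> hom (matrix_group \<Gamma>) Q" by (rule hom_compose[OF \<phi>_hom r'(1)])
  fix i assume i: "i < g"
  show "(r' \<circ> \<phi>) (gen_a i) = r (gen_a i)" "(r' \<circ> \<phi>) (gen_b i) = z i \<otimes> r (gen_b i)"
   using r'(2) i gen_a[OF i] gen_b[OF i] by (simp_all add: gen_a_def gen_b_def)
 next
  fix \<gamma> assume "\<gamma> \<in> \<Gamma>"
  then have "\<phi> \<gamma> \<in> carrier ?P" "inv_into \<Gamma> \<phi> (\<phi> \<gamma>) = \<gamma>"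
   using \<phi>_image iso by (auto simp: iso_def bij_betw_def matrix_group_def)
  then show "f ((r' \<circ> \<phi>) \<gamma>) = f (r \<gamma>)" using r'(3) by simp
 qed
qed

lemma surface_hom_assign:
 fixes Q :: "'q monoid" (structure)
 assumes Q: "group Q" and q: "!!i. i < g ==> q i \<in> carrier Q"
 shows "\<exists>r'\<in>hom (matrix_group \<Gamma>) Q. \<forall>i<g. r' (gen_a i) = q i"
proof -
 interpret Q: group Q by (rule Q)
 let ?P = "fundamental_group (genus_surface g) x"
 have trivial: "(%_. \<one>) \<in> hom ?P Q" "(%_. \<one>) \<in> hom Q Q" by (auto simp: hom_def)
 have q': "inv (q i) \<in> carrier Q" if "i < g" for i using q[OF that] by simp
 have commute: "inv (q i) \<otimes> \<one> = \<one> \<otimes> inv (q i)" if "i < g" for i using q[OF that] by simp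
 have "(1::nat) < 2" by simp
 note twist = surface_twist[OF g1 x Q trivial(1) this, of "%i. inv (q i)" Q "%_. \<one>", OF q' commute Q trivial(2) refl]
 obtain r' where r': "r' \<in> hom ?P Q" "\<forall>i<g. r' (surface_loop g x (4 * i)) = \<one> \<otimes> inv (inv (q i))" using twist by auto
 show ?thesis
 proof (intro bexI[of _ "r' \<circ> \<phi>"] allI impI)
  show "r' \<circ> \<phi> \<in> hom (matrix_group \<Gamma>) Q" by (rule hom_compose[OF \<phi>_hom r'(1)])
  fix i assume i: "i < g"
  show "(r' \<circ> \<phi>) (gen_a i) = q i" using r'(2) i gen_a(2)[OF i] q[OF i] by simp
 qed
qed

lemma gen_a_infinite_order:
 assumes i: "i < g" and e: "matrix_pow (gen_a i) p = matrix_pow (gen_a i) q" shows "p = q"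
proof -
 have c: "upper 1 \<in> carrier (matrix_group SL2R)" by (simp add: matrix_group_def)
 obtain \<psi> where \<psi>: "\<psi> \<in> hom (matrix_group \<Gamma>) (matrix_group SL2R)" "\<forall>i<g. \<psi> (gen_a i) = upper 1"
  using surface_hom_assign[OF group_SL2R, of "%_. upper 1", OF c] by (elim bexE)
 note h = \<Gamma>_hom[OF \<psi>(1)]
 have "\<psi> (matrix_pow (gen_a i) n) = upper (real n)" for n
 proof (induction n)
  case 0 show ?case using h(3) by (simp add: mat2_one)
 next
  case (Suc n)
  then show ?case using h(2)[OF gen_a(1)[OF i] \<Gamma>_pow[OF gen_a(1)[OF i]]] \<psi>(2) i by (simp add: mat2_simps)
 qed
 then have "upper (real p) = upper (real q)" by (metis e)
 then show ?thesis by simp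
qed

lemma not_words_commute: assumes "g >= 2" shows "\<not> words_commute (gen_a 0) (gen_a 1)"
proof
 assume w: "words_commute (gen_a 0) (gen_a 1)"
 let ?q = "%i::nat. if i = 0 then upper 1 else lower 1"
 have c: "?q i \<in> carrier (matrix_group SL2R)" for i by (simp add: matrix_group_def)
 obtain \<psi> where \<psi>: "\<psi> \<in> hom (matrix_group \<Gamma>) (matrix_group SL2R)" "\<forall>i<g. \<psi> (gen_a i) = ?q i"
  using surface_hom_assign[OF group_SL2R, of ?q, OF c] by (elim bexE)
 note h = \<Gamma>_hom[OF \<psi>(1)]
 have G: "gen_a 0 \<in> \<Gamma>" "gen_a 1 \<in> \<Gamma>" "\<psi> (gen_a 0) = upper 1" "\<psi> (gen_a 1) = lower 1" using gen_a(1) \<psi>(2) assms by auto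
 have "words_commute (\<psi> (gen_a 0)) (\<psi> (gen_a 1))"
  using arg_cong[OF w[unfolded words_commute_def], of \<psi>] unfolding words_commute_def
  by (simp only: h(2) h(4) G(1,2) \<Gamma>_mult \<Gamma>_adj2)
 then show False unfolding G words_commute_def by (simp add: mat2_simps)
qed

lemma gen_a_normal_form: assumes disc: "discrete \<Gamma>" and i: "i < g" shows "\<exists>T k. normal_form T k (gen_a i)"
proof (rule trace_ge_2_normal_form)
 show SL: "gen_a i \<in> SL2R" using gen_a(1)[OF i] \<Gamma>_SL by blast
 show "gen_a i ** gen_a i ~= mat 1" using gen_a_infinite_order[OF i, of 2 0] by (auto simp: numeral_2_eq_2)
 show "\<bar>gen_a i $ 1 $ 1 + gen_a i $ 2 $ 2\<bar> >= 2"
 proof (rule ccontr)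
  assume "\<not> ?thesis"
  then have "bounded (range (%m. matrix_pow (gen_a i) (Suc m)))" by (intro elliptic_powers_bounded[OF SL]) simp
  then show False using discrete_bounded_powers[OF disc gen_a(1)[OF i]] gen_a_infinite_order[OF i] by blast
 qed
qed

end

section \<open>Complex matrices as a normed algebra\<close>

typedef 'n cmat = "UNIV :: (complex^'n::finite^'n) set" morphisms rep Cm ..

setup_lifting type_definition_cmat

lemma rep_Cm [simp]: "rep (Cm A) = A" by (simp add: Cm_inverse)
lemma Cm_rep [simp]: "Cm (rep A) = A" by (simp add: rep_inverse)
lemma cmat_eqI: "rep A = rep B ==> A = B" by (simp add: rep_inject)

lemma matrix_add_rdistrib: "((A :: complex^'n::finite^'m) + B) ** C = A ** C + B ** C"
 by (simp add: matrix_matrix_mult_def vec_eq_iff sum.distrib distrib_right)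

instantiation cmat :: (finite) ring_1
begin
lift_definition zero_cmat :: "'a cmat" is 0 .
lift_definition one_cmat :: "'a cmat" is "mat 1" .
lift_definition plus_cmat :: "'a cmat => 'a cmat => 'a cmat" is "(+)" .
lift_definition minus_cmat :: "'a cmat => 'a cmat => 'a cmat" is "(-)" .
lift_definition uminus_cmat :: "'a cmat => 'a cmat" is "uminus" .
lift_definition times_cmat :: "'a cmat => 'a cmat => 'a cmat" is "(**)" .
instance
proof
 have "(mat 1 :: complex^'a^'a) ~= 0"
  by (auto simp: vec_eq_iff mat_def)
 then show "(0 :: 'a cmat) ~= 1" by transfer metis
qed (transfer; simp add: algebra_simps matrix_mul_assoc matrix_add_ldistrib matrix_add_rdistrib)+
end

instantiation cmat :: (finite) real_algebra_1
begin
lift_definition scaleR_cmat :: "real => 'a cmat => 'a cmat" is "scaleR" .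
instance
proof
 fix A B :: "'a cmat" and a b :: real
 show "a *\<^sub>R (A + B) = a *\<^sub>R A + a *\<^sub>R B" "(a + b) *\<^sub>R A = a *\<^sub>R A + b *\<^sub>R A"
  "a *\<^sub>R b *\<^sub>R A = (a * b) *\<^sub>R A" "1 *\<^sub>R A = A"
  by (transfer; simp add: algebra_simps)+
 show "a *\<^sub>R A * B = a *\<^sub>R (A * B)" "A * a *\<^sub>R B = a *\<^sub>R (A * B)"
  by (transfer; simp add: vec_eq_iff matrix_matrix_mult_def scaleR_sum_right)+
qed
end

instantiation cmat :: (finite) real_normed_algebra_1
begin
definition norm_cmat :: "'a cmat => real" where "norm_cmat A = onorm (%x. rep A *v x)"
definition dist_cmat :: "'a cmat => 'a cmat => real" where "dist_cmat A B = norm (A - B)"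
definition sgn_cmat :: "'a cmat => 'a cmat" where "sgn_cmat A = A /\<^sub>R norm A"
definition uniformity_cmat :: "('a cmat \<times> 'a cmat) filter" where
 "uniformity_cmat = (INF e\<in>{0<..}. principal {(x, y). dist x y < e})"
definition open_cmat :: "'a cmat set => bool" where
 "open_cmat U = (\<forall>x\<in>U. eventually (%(x', y). x' = x --> y \<in> U) uniformity)"
instance
proof
 fix A B :: "'a cmat" and a b :: real
 have bl: "bounded_linear (%x. rep A *v x)" for A :: "'a cmat" by (rule matrix_vector_mul_bounded_linear)
 show "dist A B = norm (A - B)" by (rule dist_cmat_def)
 show "sgn A = A /\<^sub>R norm A" by (rule sgn_cmat_def)
 show "uniformity = (INF e\<in>{0<..}. principal {(x :: 'a cmat, y). dist x y < e})" by (rule uniformity_cmat_def)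
 show "open U = (\<forall>x\<in>U. eventually (%(x', y). x' = x --> y \<in> U) uniformity)" for U :: "'a cmat set"
  by (rule open_cmat_def)
 have "(\<forall>x. rep A *v x = 0) \<longleftrightarrow> rep A = 0"
  by (metis matrix_vector_mul_lid matrix_vector_mult_0 matrix_eq)
 then show "norm A = 0 \<longleftrightarrow> A = 0"
  unfolding norm_cmat_def onorm_eq_0[OF bl] by (transfer; simp)
 have "(%x. rep (A + B) *v x) = (%x. rep A *v x + rep B *v x)"
  by transfer (auto simp: matrix_vector_mult_add_rdistrib)
 then show "norm (A + B) <= norm A + norm B"
  unfolding norm_cmat_def using onorm_triangle[OF bl bl] by simp
 have "(%x. rep (a *\<^sub>R A) *v x) = (%x. a *\<^sub>R (rep A *v x))"
  by transfer (auto simp: vec_eq_iff matrix_vector_mult_def scaleR_sum_right)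
 then show "norm (a *\<^sub>R A) = \<bar>a\<bar> * norm A"
  unfolding norm_cmat_def using onorm_scaleR[OF bl] by simp
 have "(%x. rep (A * B) *v x) = (%x. rep A *v x) \<circ> (%x. rep B *v x)"
  by transfer (auto simp: matrix_vector_mul_assoc)
 then show "norm (A * B) <= norm A * norm B"
  unfolding norm_cmat_def using onorm_compose[OF bl bl] by simp
 have "(%x. rep (1 :: 'a cmat) *v x) = (%x. x)"
  by transfer (auto simp: matrix_vector_mul_lid)
 then show "norm (1 :: 'a cmat) = 1"
  unfolding norm_cmat_def using onorm_id by simp
qed
end

abbreviation entry :: "'n::finite cmat => 'n => 'n => complex" where "entry A i j \<equiv> rep A $ i $ j"

lemma rep_simps [simp]:
 "rep 0 = 0" "rep 1 = mat 1" "rep (A + B) = rep A + rep B" "rep (A - B) = rep A - rep B"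
 "rep (- A) = - rep A" "rep (A * B) = rep A ** rep B" "rep (r *\<^sub>R A) = r *\<^sub>R rep A"
 by (transfer; simp)+

lemma rep_sum [simp]: "rep (sum f S) = (\<Sum>x\<in>S. rep (f x))"
 by (induction S rule: infinite_finite_induct) auto

lemma cmat_entryI: "(!!i j. entry A i j = entry B i j) ==> A = B"
 by (rule cmat_eqI) (simp add: vec_eq_iff)

lemma norm_axis: "norm (axis j (c::complex) :: complex^'n) = cmod c"
 by (simp add: norm_vec_def L2_set_def axis_def if_distrib[of norm] if_distrib[of "%x. x\<^sup>2"] cong: if_cong)

lemma entry_le_norm: "cmod (entry A i j) <= norm A"
proof -
 have "entry A i j = (rep A *v axis j 1) $ i"
  by (simp add: matrix_vector_mult_def axis_def if_distrib cong: if_cong)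
 also have "cmod ... <= norm (rep A *v axis j 1)" by (rule Finite_Cartesian_Product.norm_nth_le)
 also have "... <= norm A * norm (axis j (1::complex))"
  unfolding norm_cmat_def by (rule onorm[OF matrix_vector_mul_bounded_linear])
 also have "norm (axis j (1::complex)) = 1" by (simp add: norm_axis)
 finally show ?thesis by simp
qed

lemma bounded_linear_Cm: "bounded_linear (Cm :: (complex^'n^'n) => 'n cmat)"
proof -
 have "linear (Cm :: (complex^'n^'n) => 'n cmat)" by (rule linearI; rule cmat_eqI; simp)
 then show ?thesis by (simp add: linear_conv_bounded_linear)
qed

lemma norm_vec_le_sum: "norm (x :: 'a::real_normed_vector^'n) <= (\<Sum>i\<in>UNIV. norm (x $ i))"
 unfolding norm_vec_def by (rule L2_set_le_sum) auto

lemma bounded_linear_rep: "bounded_linear (rep :: 'n::finite cmat => complex^'n^'n)"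
proof
 show "\<exists>K. \<forall>x :: 'n cmat. norm (rep x) <= norm x * K"
 proof (intro exI allI)
  fix x :: "'n cmat"
  have "norm (rep x) <= (\<Sum>i\<in>UNIV. norm (rep x $ i))" by (rule norm_vec_le_sum)
  also have "... <= (\<Sum>i\<in>(UNIV::'n set). \<Sum>j\<in>(UNIV::'n set). norm (entry x i j))"
   by (intro sum_mono norm_vec_le_sum)
  also have "... <= (\<Sum>i\<in>(UNIV::'n set). \<Sum>j\<in>(UNIV::'n set). norm x)" by (intro sum_mono entry_le_norm)
  finally show "norm (rep x) <= norm x * (real CARD('n) * real CARD('n))" by (simp add: algebra_simps)
 qed
qed auto

lemmas tendsto_rep [tendsto_intros] = bounded_linear.tendsto[OF bounded_linear_rep]
lemmas tendsto_Cm [tendsto_intros] = bounded_linear.tendsto[OF bounded_linear_Cm]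
lemmas continuous_on_rep [continuous_intros] = bounded_linear.continuous_on[OF bounded_linear_rep]
lemmas continuous_on_Cm [continuous_intros] = bounded_linear.continuous_on[OF bounded_linear_Cm]

instance cmat :: (finite) banach
proof
 fix X :: "nat => 'a cmat" assume "Cauchy X"
 then have "Cauchy (%n. rep (X n))" by (rule bounded_linear.Cauchy[OF bounded_linear_rep])
 then have "convergent (%n. rep (X n))" by (simp add: Cauchy_convergent_iff)
 then obtain L where "(%n. rep (X n)) \<longlonglongrightarrow> L" by (auto simp: convergent_def)
 then have "(%n. Cm (rep (X n))) \<longlonglongrightarrow> Cm L" by (rule tendsto_Cm)
 then show "convergent X" by (auto simp: convergent_def)
qed

lemma rep_power: "rep (A ^ k) = matrix_pow (rep A) k"
 by (induction k) auto

lemma matrix_exp_eq: "matrix_exp A = rep (exp (Cm A))"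
proof -
 have "(%k. Cm A ^ k /\<^sub>R fact k) sums exp (Cm A)" by (rule exp_converges)
 then have "(%k. rep (Cm A ^ k /\<^sub>R fact k)) sums rep (exp (Cm A))"
  by (rule bounded_linear.sums[OF bounded_linear_rep])
 then have "(%k. (1 / fact k) *\<^sub>R matrix_pow A k) sums rep (exp (Cm A))"
  by (simp add: rep_power divide_inverse)
 then show ?thesis unfolding matrix_exp_def by (rule sums_unique[symmetric])
qed

definition smat :: "complex => 'n::finite cmat" where "smat c = Cm (mat c)"

lemma rep_smat [simp]: "rep (smat c) = mat c" by (simp add: smat_def)

lemma entry_smat_mult [simp]: "entry (smat c * A) i j = c * entry A i j"
 by (simp add: matrix_matrix_mult_def mat_def if_distrib[of "%x. x * _"] cong: if_cong)

lemma smat_central: "A * smat c = smat c * A"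
 by (rule cmat_entryI) (simp only: entry_smat_mult, simp add: matrix_matrix_mult_def mat_def if_distrib cong: if_cong)

lemma smat_left_commute: "A * (smat c * B) = smat c * (A * B)"
 by (metis mult.assoc smat_central)

lemma smat_simps:
 "smat 0 = 0" "smat 1 = 1" "smat (c + d) = smat c + smat d" "smat (c - d) = smat c - smat d"
 "smat (- c) = - smat c"
 by (rule cmat_entryI; simp add: mat_def)+

lemma smat_mult: "smat (c * d) = smat c * smat d"
 by (rule cmat_entryI) (simp only: entry_smat_mult, simp add: mat_def)

lemma smat_mult_eq_0_iff [simp]: "smat c * A = 0 \<longleftrightarrow> c = 0 \<or> A = (0 :: 'n::finite cmat)"
proof -
 have "A = smat (1 / c) * (smat c * A)" if "c ~= 0"
  using that by (simp add: mult.assoc[symmetric] smat_mult[symmetric] smat_simps)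
 then show ?thesis by (metis mult_zero_left mult_zero_right smat_simps(1))
qed

lemma smat_of_real: "smat (of_real r) * A = r *\<^sub>R A"
 by (rule cmat_entryI) (simp only: entry_smat_mult, simp add: scaleR_conv_of_real[where 'a=complex])

lemma smat_power: "smat (c ^ k) = smat c ^ k"
 by (induction k) (auto simp: smat_simps smat_mult)

lemma norm_smat: "norm (smat c :: 'n::finite cmat) = cmod c"
proof -
 have "norm ((mat c :: complex^'n^'n) *v x) = cmod c * norm x" for x
 proof -
  have "(mat c :: complex^'n^'n) *v x = (\<chi> i. c * x $ i)"
   by (simp add: vec_eq_iff matrix_vector_mult_def mat_def if_distrib[of "%x. x * _"] cong: if_cong)
  then show ?thesis
   by (simp add: norm_vec_def norm_mult L2_set_right_distrib)
 qed
 then have "onorm (%x. (mat c :: complex^'n^'n) *v x) = cmod c"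
  using onorm[OF matrix_vector_mul_bounded_linear, of "mat c :: complex^'n^'n" "axis undefined 1"]
  by (intro antisym onorm_bound) (auto simp: norm_axis)
 then show ?thesis by (simp add: norm_cmat_def)
qed

lemma bounded_linear_smat: "bounded_linear (smat :: complex => 'n::finite cmat)"
proof
 show "smat (r *\<^sub>R c) = r *\<^sub>R smat c" for r c
  by (simp add: scaleR_conv_of_real smat_mult smat_of_real)
qed (auto simp: smat_simps norm_smat intro!: exI[of _ 1])

lemmas continuous_on_smat [continuous_intros] = bounded_linear.continuous_on[OF bounded_linear_smat]

lemma smat_scaleR: "smat (r *\<^sub>R c) = r *\<^sub>R smat c"
 using bounded_linear_smat by (metis linear_simps(5))

lemma exp_smat: "exp (smat c) = smat (exp c)"
proof -
 have "(%k. c ^ k /\<^sub>R fact k) sums exp c" by (rule exp_converges)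
 then have "(%k. smat (c ^ k /\<^sub>R fact k)) sums smat (exp c)"
  by (rule bounded_linear.sums[OF bounded_linear_smat])
 then have "(%k. smat c ^ k /\<^sub>R fact k) sums smat (exp c)"
  by (simp add: smat_scaleR smat_power)
 then show ?thesis using exp_converges sums_unique2 by blast
qed

lemma exp_add_smat: "exp (smat c + A) = smat (exp c) * exp A"
 by (subst exp_add_commuting) (auto simp: smat_central exp_smat)

lemma exp_smat_add: "exp (smat (s + t) * A) = exp (smat s * A) * exp (smat t * A)"
proof -
 have "(smat s * A) * (smat t * A) = (smat t * A) * (smat s * A)"
  by (metis (no_types, opaque_lifting) mult.assoc smat_central)
 from exp_add_commuting[OF this] show ?thesis by (simp add: smat_simps distrib_right)
qed

lemma norm_exp_remainder:
 fixes x :: "'a::{real_normed_algebra_1, banach}"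
 assumes "norm x <= 1" shows "norm (exp x - 1 - x) <= (norm x)\<^sup>2"
proof -
 have s: "summable (%n. norm x ^ (n + 2) /\<^sub>R fact (n + 2))"
  by (rule summable_ignore_initial_segment) (rule summable_exp_generic)
 have "exp x - 1 - x = (\<Sum>n. inverse (fact (n + 2)) *\<^sub>R x ^ (n + 2))"
  by (subst exp_first_two_terms) simp
 also have "norm ... <= (\<Sum>n. norm x ^ (n + 2) /\<^sub>R fact (n + 2))"
  by (rule norm_suminf_le[OF _ s]) (simp del: power_Suc add_2_eq_Suc' add: norm_power_ineq mult_left_mono)
 also have "... = exp (norm x) - 1 - norm x"
  using exp_first_two_terms[of "norm x"] by simp
 also have "... <= (norm x)\<^sup>2" using exp_bound[of "norm x"] assms by simp
 finally show ?thesis .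
qed

lemma exp_power: "exp (A :: 'n::finite cmat) ^ k = exp (of_nat k * A)"
proof (induction k)
 case (Suc k)
 have "exp A * exp (of_nat k * A) = exp (A + of_nat k * A)"
  by (rule exp_add_commuting[symmetric]) (metis mult.assoc mult_of_nat_commute)
 then show ?case using Suc by (simp add: distrib_right)
qed simp

lemma of_nat_smat: "(of_nat k :: 'n::finite cmat) = smat (of_nat k)"
 by (induction k) (auto simp: smat_simps)

lemma exp_inverse_cmat: "exp A * exp (- A) = 1" "exp (- A) * exp A = (1 :: 'n::finite cmat)"
 by (rule exp_minus_inverse, metis exp_minus_inverse minus_minus)

lemma has_derivative_exp_0: "((exp :: 'a => 'a::{real_normed_algebra_1, banach}) has_derivative (%h. h)) (at 0)"
 unfolding has_derivative_at
proof (rule conjI[OF bounded_linear_ident Lim_null_comparison])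
 have "\<forall>\<^sub>F h in at (0 :: 'a). norm h < 1" by (rule order_tendstoD(2)[of norm 0]) (auto intro!: tendsto_eq_intros)
 then show "\<forall>\<^sub>F h in at (0 :: 'a). norm (norm (exp (0 + h) - exp 0 - h) / norm h) <= norm h"
 proof (rule eventually_mono)
  fix h :: 'a assume "norm h < 1"
  then have "norm (exp h - 1 - h) <= norm h * norm h" using norm_exp_remainder[of h] by (simp add: power2_eq_square)
  then show "norm (norm (exp (0 + h) - exp 0 - h) / norm h) <= norm h" by (cases "h = 0") (simp_all add: divide_le_eq)
 qed
qed (auto intro!: tendsto_eq_intros)

lemma has_field_derivative_exp_entry:
 "((%s. entry (A * exp (smat s * v) * B) i j) has_field_derivative entry (A * exp (smat s * v) * v * B) i j) (at s)"
proof -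
 let ?G = "%s. exp (smat s * v)" and ?L = "%y. entry (A * exp (smat s * v) * y * B) i j"
 have "bounded_linear (%h. smat h * v)"
  using bounded_linear_compose[OF bounded_linear_mult_left bounded_linear_smat] .
 then have inner: "((%h. smat h * v) has_derivative (%h. smat h * v)) (at 0)" by (rule bounded_linear_imp_has_derivative)
 have "(?G has_derivative (%h. smat h * v)) (at 0)"
  using has_derivative_compose[OF inner, of exp "%h. h"] has_derivative_exp_0 by (simp add: smat_simps)
 moreover have "bounded_linear ?L"
  by (intro bounded_linear_compose[OF bounded_linear_vec_nth] bounded_linear_compose[OF bounded_linear_rep]
    bounded_linear_compose[OF bounded_linear_mult_left] bounded_linear_mult_right)
 ultimately have "((%h. ?L (?G h)) has_derivative (%h. ?L (smat h * v))) (at 0)" using bounded_linear.has_derivative by blast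
 moreover have "?L (?G h) = entry (A * ?G (h + s) * B) i j" for h by (simp only: add.commute[of h s] exp_smat_add mult.assoc)
 moreover have "?L (smat h * v) = entry (A * ?G s * v * B) i j * h" for h
 proof -
  have "A * ?G s * (smat h * v) * B = smat h * (A * ?G s * v * B)" by (simp add: mult.assoc smat_left_commute)
  then show ?thesis by (simp only: entry_smat_mult mult.commute)
 qed
 ultimately have "((%h. entry (A * ?G (h + s) * B) i j) has_field_derivative entry (A * ?G s * v * B) i j) (at 0)"
  unfolding has_field_derivative_def by simp
 then show ?thesis using DERIV_shift[of "%s. entry (A * ?G s * B) i j" _ 0 s] by simp
qed

subsection \<open>Exponential polynomials\<close>

inductive_set exp_poly :: "complex set => (complex => complex) set" for \<Lambda> where
 zero: "(%_. 0) \<in> exp_poly \<Lambda>"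
| add_term: "f \<in> exp_poly \<Lambda> ==> \<mu> \<in> \<Lambda> ==> (%s. f s + poly p s * exp (\<mu> * s)) \<in> exp_poly \<Lambda>"

lemma exp_poly_term: "\<mu> \<in> \<Lambda> ==> (%s. poly p s * exp (\<mu> * s)) \<in> exp_poly \<Lambda>"
 using exp_poly.add_term[OF exp_poly.zero, of \<mu> \<Lambda> p] by simp

lemma exp_poly_const: "0 \<in> \<Lambda> ==> (%_. c) \<in> exp_poly \<Lambda>"
 using exp_poly_term[of 0 \<Lambda> "[:c:]"] by simp

lemma exp_poly_add: "f \<in> exp_poly \<Lambda> ==> h \<in> exp_poly \<Lambda> ==> (%s. f s + h s) \<in> exp_poly \<Lambda>"
proof (induction rule: exp_poly.induct)
 case (add_term f \<mu> p)
 from exp_poly.add_term[OF add_term.IH[OF add_term.prems] add_term.hyps(2), of p]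
 show ?case by (simp add: algebra_simps)
qed simp

lemma exp_poly_mult_term:
 assumes "f \<in> exp_poly \<Lambda>" "!!\<mu>. \<mu> \<in> \<Lambda> ==> \<mu> + \<nu> \<in> \<Lambda>'"
 shows "(%s. f s * (poly q s * exp (\<nu> * s))) \<in> exp_poly \<Lambda>'"
 using assms(1)
proof (induction rule: exp_poly.induct)
 case (add_term f \<mu> p)
 from exp_poly.add_term[OF add_term.IH assms(2)[OF add_term.hyps(2)], of "p * q"]
 show ?case by (simp add: algebra_simps exp_add)
qed (use exp_poly.zero in simp)

lemma exp_poly_mult:
 assumes "f \<in> exp_poly \<Lambda>" "h \<in> exp_poly \<Lambda>'" "!!\<mu> \<nu>. \<mu> \<in> \<Lambda> ==> \<nu> \<in> \<Lambda>' ==> \<mu> + \<nu> \<in> \<Lambda>''"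
 shows "(%s. f s * h s) \<in> exp_poly \<Lambda>''"
 using assms(2)
proof (induction rule: exp_poly.induct)
 case (add_term h \<mu> p)
 from exp_poly_add[OF add_term.IH exp_poly_mult_term[OF assms(1), of \<mu> \<Lambda>'' p]] assms(3) add_term.hyps
 show ?case by (simp add: algebra_simps)
qed (use exp_poly.zero in simp)

lemma exp_poly_mono: assumes "f \<in> exp_poly \<Lambda>" "\<Lambda> \<subseteq> \<Lambda>'" shows "f \<in> exp_poly \<Lambda>'"
 using exp_poly_mult_term[OF assms(1), of 0 \<Lambda>' 1] assms(2) by auto

lemma exp_poly_normal_form:
 assumes "f \<in> exp_poly \<Lambda>"
 shows "\<exists>M P. finite M & M \<subseteq> \<Lambda> & (\<forall>s. f s = (\<Sum>\<mu>\<in>M. poly (P \<mu>) s * exp (\<mu> * s)))"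
 using assms
proof (induction rule: exp_poly.induct)
 case zero
 then show ?case by (intro exI[of _ "{}"]) auto
next
 case (add_term f \<mu> p)
 then obtain M P where M: "finite M" "M \<subseteq> \<Lambda>" "!!s. f s = (\<Sum>\<mu>\<in>M. poly (P \<mu>) s * exp (\<mu> * s))" by blast
 define P' where "P' \<nu> = (if \<nu> \<in> M then P \<nu> else 0) + (if \<nu> = \<mu> then p else 0)" for \<nu>
 have "(\<Sum>\<nu>\<in>insert \<mu> M. poly (P' \<nu>) s * exp (\<nu> * s)) =
   (\<Sum>\<nu>\<in>insert \<mu> M. (if \<nu> \<in> M then poly (P \<nu>) s * exp (\<nu> * s) else 0)) +
   (\<Sum>\<nu>\<in>insert \<mu> M. (if \<nu> = \<mu> then poly p s * exp (\<nu> * s) else 0))" for s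
  unfolding sum.distrib[symmetric] by (rule sum.cong) (auto simp: P'_def algebra_simps)
 moreover have "(\<Sum>\<nu>\<in>insert \<mu> M. (if \<nu> \<in> M then poly (P \<nu>) s * exp (\<nu> * s) else 0)) = f s" for s
  unfolding M(3) using M(1) by (intro sum.mono_neutral_cong_right) auto
 moreover have "(\<Sum>\<nu>\<in>insert \<mu> M. (if \<nu> = \<mu> then poly p s * exp (\<nu> * s) else 0)) = poly p s * exp (\<mu> * s)" for s
  using M(1) by simp
 ultimately show ?case using M add_term.hyps(2)
  by (intro exI[of _ "insert \<mu> M"] exI[of _ P']) auto
qed

lemma lead_coeff_shift: "coeff (pcompose p [:1, 1:]) (degree p) = lead_coeff (p :: complex poly)"
 using lead_coeff_comp[of "[:1, 1:]" p] by (simp add: degree_pcompose)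

lemma shift_combination_nonzero:
 fixes p :: "complex poly" assumes "y ~= z" "smult y (pcompose p [:1, 1:]) - smult z p = 0" shows "p = 0"
proof -
 have "coeff (smult y (pcompose p [:1, 1:]) - smult z p) (degree p) = (y - z) * lead_coeff p"
  by (simp add: lead_coeff_shift algebra_simps)
 then show ?thesis using assms by simp
qed

lemma degree_shift_combination: "degree (smult y (pcompose p [:1, 1:]) - smult z p) <= degree (p :: complex poly)"
 by (rule degree_diff_le) (auto intro: order_trans[OF degree_smult_le] simp: degree_pcompose)

lemma psize_shift_combination: "psize (smult y (pcompose p [:1, 1:]) - smult z p) <= psize (p :: complex poly)"
 using degree_shift_combination[of y p z] by (auto simp: psize_def)

lemma psize_shift_difference:
 fixes p :: "complex poly" assumes "p ~= 0" shows "psize (smult y (pcompose p [:1, 1:]) - smult y p) < psize p"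
proof (rule ccontr)
 let ?q = "smult y (pcompose p [:1, 1:]) - smult y p"
 assume "\<not> ?thesis"
 then have "?q ~= 0" "degree ?q = degree p"
  using degree_shift_combination[of y p y] assms by (auto simp: psize_def split: if_splits)
 moreover have "coeff ?q (degree p) = 0" by (simp add: lead_coeff_shift)
 ultimately show False by (metis leading_coeff_0_iff)
qed

text \<open>The operator that shifts \<open>k\<close> and subtracts \<open>x \<nu>\<close> times the sum lowers the degree of the \<open>\<nu>\<close>-th polynomial.\<close>

lemma poly_power_sum_zero:
 fixes x :: "'i => complex"
 assumes M: "finite M" "inj_on x M" "!!\<mu>. \<mu> \<in> M ==> x \<mu> ~= 0"
  and "!!k::nat. (\<Sum>\<mu>\<in>M. poly (Q \<mu>) (of_nat k) * x \<mu> ^ k) = 0"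
 shows "\<forall>\<mu>\<in>M. Q \<mu> = 0"
 using assms(4)
proof (induction "\<Sum>\<mu>\<in>M. psize (Q \<mu>)" arbitrary: Q rule: less_induct)
 case less
 show ?case
 proof (rule ccontr)
  assume "\<not> ?thesis"
  then obtain \<nu> where \<nu>: "\<nu> \<in> M" "Q \<nu> ~= 0" by blast
  define R where "R \<mu> = smult (x \<mu>) (pcompose (Q \<mu>) [:1, 1:]) - smult (x \<nu>) (Q \<mu>)" for \<mu>
  have "poly (R \<mu>) (of_nat k) * x \<mu> ^ k =
    poly (Q \<mu>) (of_nat (Suc k)) * x \<mu> ^ Suc k - x \<nu> * (poly (Q \<mu>) (of_nat k) * x \<mu> ^ k)" for \<mu> k
   by (simp add: R_def poly_pcompose algebra_simps)
  then have "(\<Sum>\<mu>\<in>M. poly (R \<mu>) (of_nat k) * x \<mu> ^ k) = (\<Sum>\<mu>\<in>M. poly (Q \<mu>) (of_nat (Suc k)) * x \<mu> ^ Suc k) -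
    x \<nu> * (\<Sum>\<mu>\<in>M. poly (Q \<mu>) (of_nat k) * x \<mu> ^ k)" for k
   by (simp only: sum_subtractf sum_distrib_left)
  then have "(\<Sum>\<mu>\<in>M. poly (R \<mu>) (of_nat k) * x \<mu> ^ k) = 0" for k by (simp only: less.prems) simp
  moreover have "(\<Sum>\<mu>\<in>M. psize (R \<mu>)) < (\<Sum>\<mu>\<in>M. psize (Q \<mu>))"
   using \<nu> M(1) psize_shift_combination psize_shift_difference by (intro sum_strict_mono_ex1 bexI[of _ \<nu>]) (auto simp: R_def)
  ultimately have "R \<mu> = 0" if "\<mu> \<in> M" for \<mu> using less.hyps that by blast
  then have other: "Q \<mu> = 0" if "\<mu> \<in> M - {\<nu>}" for \<mu>
   using that \<nu>(1) inj_onD[OF M(2), of \<mu> \<nu>] shift_combination_nonzero[of "x \<mu>" "x \<nu>"] unfolding R_def by blast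
  have "poly (Q \<nu>) (of_nat k) = 0" for k :: nat
   using less.prems[of k] M(3)[OF \<nu>(1)] sum.remove[OF M(1) \<nu>(1), of "%\<mu>. poly (Q \<mu>) (of_nat k) * x \<mu> ^ k"] other by simp
  then have "range (of_nat :: nat => complex) \<subseteq> {z. poly (Q \<nu>) z = 0}" by auto
  then show False
   using poly_roots_finite[OF \<nu>(2)] infinite_super range_inj_infinite[OF inj_of_nat] by blast
 qed
qed

lemma exp_poly_zero:
 assumes f: "f \<in> exp_poly \<Lambda>" and inj: "inj_on (%\<mu>. exp (\<mu> * t)) \<Lambda>" and t: "t ~= 0"
  and z: "!!k::nat. f (of_nat k * t) = 0"
 shows "f s = 0"
proof -
 obtain M P where M: "finite M" "M \<subseteq> \<Lambda>" "!!s. f s = (\<Sum>\<mu>\<in>M. poly (P \<mu>) s * exp (\<mu> * s))"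
  using exp_poly_normal_form[OF f] by blast
 define Q where "Q \<mu> = pcompose (P \<mu>) [:0, t:]" for \<mu>
 have "(\<Sum>\<mu>\<in>M. poly (Q \<mu>) (of_nat k) * exp (\<mu> * t) ^ k) = 0" for k :: nat
  using z[of k] unfolding M(3) by (simp add: Q_def poly_pcompose exp_of_nat_mult[symmetric] mult_ac)
 from poly_power_sum_zero[OF M(1) inj_on_subset[OF inj M(2)] _ this]
 have Q: "\<forall>\<mu>\<in>M. Q \<mu> = 0" by simp
 have "poly (P \<mu>) s = 0" if "\<mu> \<in> M" for \<mu>
 proof -
  have "poly (Q \<mu>) (s / t) = 0" using Q that by simp
  then show ?thesis using t by (simp add: Q_def poly_pcompose)
 qed
 then show ?thesis unfolding M(3) by simp
qed

lemma poly_antideriv: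
 fixes p :: "complex poly" shows "\<exists>R. pderiv R + smult \<mu> R = p"
proof (cases "\<mu> = 0")
 case True
 have "pderiv (\<Sum>i\<le>degree p. monom (coeff p i / of_nat (Suc i)) (Suc i)) = (\<Sum>i\<le>degree p. monom (coeff p i) i)"
  by (simp add: higher_pderiv_sum[of 1, simplified] pderiv_monom del: of_nat_Suc)
 then show ?thesis using True poly_as_sum_of_monoms[of p] by auto
next
 case False
 show ?thesis
 proof (induction "degree p" arbitrary: p rule: less_induct)
  case less
  define R where "R = smult (1 / \<mu>) p"
  show ?case
  proof (cases "degree p = 0")
   case True
   then have "pderiv R = 0" by (simp add: R_def pderiv_smult pderiv_eq_0_iff)
   then show ?thesis using False by (intro exI[of _ R]) (simp add: R_def)
  next
   case dp: False
   have "degree (- pderiv R) < degree p" using dp by (simp add: R_def pderiv_smult degree_pderiv False)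
   from less[OF this] obtain S where "pderiv S + smult \<mu> S = - pderiv R" by blast
   then have "pderiv (R + S) + smult \<mu> (R + S) = smult \<mu> R" by (simp add: pderiv_add smult_add_right algebra_simps)
   then show ?thesis using False by (intro exI[of _ "R + S"]) (simp add: R_def)
  qed
 qed
qed

lemma exp_poly_antideriv:
 assumes "f \<in> exp_poly \<Lambda>"
 shows "\<exists>F\<in>exp_poly \<Lambda>. \<forall>s. (F has_field_derivative f s) (at s)"
 using assms
proof (induction rule: exp_poly.induct)
 case zero
 show ?case by (rule bexI[OF _ exp_poly.zero]) auto
next
 case (add_term f \<mu> p)
 then obtain F where F: "F \<in> exp_poly \<Lambda>" "!!s. (F has_field_derivative f s) (at s)" by blast
 obtain R where R: "pderiv R + smult \<mu> R = p" using poly_antideriv by blast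
 have "((%s. F s + poly R s * exp (\<mu> * s)) has_field_derivative f s + poly p s * exp (\<mu> * s)) (at s)" for s
  unfolding R[symmetric] by (auto intro!: derivative_eq_intros F(2) poly_DERIV simp: algebra_simps)
 then show ?case using exp_poly.add_term[OF F(1) add_term.hyps(2)] by blast
qed

section \<open>Exponentials of matrices\<close>

definition poly_cmat :: "complex poly => 'n::finite cmat => 'n cmat" where
 "poly_cmat p v = fold_coeffs (%a B. smat a + v * B) p 0"

lemma poly_cmat_0 [simp]: "poly_cmat 0 v = 0" by (simp add: poly_cmat_def)

lemma poly_cmat_pCons [simp]: "poly_cmat (pCons a p) v = smat a + v * poly_cmat p v"
 by (cases "p = 0 & a = 0") (auto simp: poly_cmat_def smat_simps)

lemma poly_cmat_add: "poly_cmat (p + q) v = poly_cmat p v + poly_cmat q v"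
 by (induction p q rule: poly_induct2) (auto simp: smat_simps algebra_simps)

lemma poly_cmat_smult: "poly_cmat (smult c p) v = smat c * poly_cmat p v"
 by (induction p) (auto simp: smat_mult algebra_simps smat_left_commute intro: smat_central)

lemma poly_cmat_linear_factor: "poly_cmat ([:- l, 1:] * q) v = (v - smat l) * poly_cmat q v"
proof -
 have e: "[:- l, 1:] * q = smult (- l) q + pCons 0 q" by (simp only: mult_pCons_left) simp
 show ?thesis unfolding e poly_cmat_add poly_cmat_smult by (simp add: smat_simps left_diff_distrib)
qed

lemma poly_cmat_monom: "poly_cmat (monom c i) v = smat c * v ^ i"
 by (induction i) (auto simp: monom_Suc smat_simps monom_0 smat_left_commute power_commutes)

lemma poly_cmat_sum: "poly_cmat (sum f S) v = (\<Sum>i\<in>S. poly_cmat (f i) v)"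
 by (induction S rule: infinite_finite_induct) (auto simp: poly_cmat_add)

lemma annihilating_poly: "\<exists>p\<noteq>0. poly_cmat p (v :: 'n::finite cmat) = 0"
proof -
 define N where "N = DIM(complex^'n^'n)"
 define S where "S = (%i. rep (v ^ i)) ` {..N}"
 show ?thesis
 proof (cases "inj_on (%i. rep (v ^ i)) {..N}")
  case False
  then obtain i j where ij: "i ~= j" "v ^ i = v ^ j" by (auto simp: inj_on_def rep_inject)
  define p where "p = monom (1::complex) i + monom (-1) j"
  have "coeff p i = 1" using ij by (simp add: p_def)
  then have "p ~= 0" by auto
  moreover have "poly_cmat p v = 0" using ij by (simp add: p_def poly_cmat_add poly_cmat_monom smat_simps)
  ultimately show ?thesis by blast
 next
  case True
  then have "card S = Suc N" by (simp add: S_def card_image)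
  then have "dependent S" using dependent_biggerset[of S] by (simp add: S_def N_def)
  then obtain u w where u: "w \<in> S" "u w ~= 0" "(\<Sum>w\<in>S. u w *\<^sub>R w) = 0"
   using dependent_finite[of S] by (auto simp: S_def)
  define p where "p = (\<Sum>i\<le>N. monom (complex_of_real (u (rep (v ^ i)))) i)"
  obtain j where j: "j <= N" "w = rep (v ^ j)" using u(1) by (auto simp: S_def)
  have "coeff p j = complex_of_real (u (rep (v ^ j)))"
   unfolding p_def coeff_sum using j(1) by simp
  then have "p ~= 0" using u(2) j by auto
  moreover have "(\<Sum>i\<le>N. u (rep (v ^ i)) *\<^sub>R rep (v ^ i)) = 0"
   using u(3) True unfolding S_def by (simp add: sum.reindex)
  then have "rep (\<Sum>i\<le>N. u (rep (v ^ i)) *\<^sub>R v ^ i) = rep 0" by simp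
  then have "(\<Sum>i\<le>N. u (rep (v ^ i)) *\<^sub>R v ^ i) = 0" by (rule cmat_eqI)
  then have "poly_cmat p v = 0" by (simp add: p_def poly_cmat_sum poly_cmat_monom smat_of_real)
  ultimately show ?thesis by blast
 qed
qed

definition eigenvalue :: "'n::finite cmat => complex => bool" where
 "eigenvalue v l \<longleftrightarrow> (\<exists>u\<noteq>0. v * u = smat l * u)"

lemma eigenvalueI: "v * u = smat l * u ==> u ~= 0 ==> eigenvalue v l"
 unfolding eigenvalue_def by blast

abbreviation factors :: "'n::finite cmat => complex list => 'n cmat" where
 "factors v ls \<equiv> foldr (%l A. (v - smat l) * A) ls 1"

lemma poly_cmat_factors: "p ~= 0 ==> \<exists>c ls. c ~= 0 & poly_cmat p v = smat c * factors v ls"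
proof (induction "degree p" arbitrary: p)
 case 0
 then obtain c where "p = [:c:]" by (metis degree_eq_zeroE)
 then show ?case using 0 by (intro exI[of _ c] exI[of _ "[]"]) auto
next
 case (Suc n)
 then have "\<not> constant (poly p)" by (simp add: constant_degree)
 then obtain l where "poly p l = 0" using fundamental_theorem_of_algebra by blast
 then obtain q where q: "p = [:- l, 1:] * q" by (auto simp: poly_eq_0_iff_dvd)
 have "q ~= 0" using Suc q by auto
 moreover have "degree q = n" using Suc(2) \<open>q ~= 0\<close> unfolding q by (subst (asm) degree_mult_eq) auto
 ultimately obtain c ls where "c ~= 0" "poly_cmat q v = smat c * factors v ls" using Suc(1) by blast
 then show ?case unfolding q poly_cmat_linear_factor
  by (intro exI[of _ c] exI[of _ "l # ls"]) (simp add: smat_left_commute)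
qed

lemma linear_commute: "(v - smat a) * (v - smat l) = (v - smat l) * (v - smat a)"
 by (simp add: algebra_simps smat_central[of v] smat_central[of "smat a" l])

lemma factors_commute: "factors v ls * (v - smat l) = (v - smat l) * factors v ls"
proof (induction ls)
 case (Cons a ls)
 have "factors v (a # ls) * (v - smat l) = (v - smat a) * (factors v ls * (v - smat l))" by (simp add: mult.assoc)
 also have "... = ((v - smat a) * (v - smat l)) * factors v ls" unfolding Cons by (simp only: mult.assoc)
 also have "... = (v - smat l) * factors v (a # ls)" unfolding linear_commute[of v a l] by (simp only: mult.assoc foldr.simps o_apply)
 finally show ?case .
qed simp

lemma factors_Cons_remove:
 "l \<in> set ls ==> factors v ls = (v - smat l) * factors v (remove1 l ls)"
proof (induction ls)
 case (Cons a ls)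
 show ?case
 proof (cases "a = l")
  case False
  then have "factors v (a # ls) = (v - smat a) * ((v - smat l) * factors v (remove1 l ls))" using Cons by simp
  also have "... = ((v - smat l) * (v - smat a)) * factors v (remove1 l ls)"
   unfolding linear_commute[of v l a] by (simp only: mult.assoc)
  finally show ?thesis using False by (simp add: mult.assoc)
 qed simp
qed simp

lemma annihilating_factors:
 obtains ls where "factors (v :: 'n::finite cmat) ls = 0" "\<forall>l\<in>set ls. eigenvalue v l"
proof -
 obtain p where "p ~= 0" "poly_cmat p v = 0" using annihilating_poly by blast
 then obtain c ls where "c ~= 0" "smat c * factors v ls = 0" using poly_cmat_factors by metis
 then have ex: "factors v ls = 0" by simp
 define n where "n = (LEAST n. \<exists>ls. length ls = n & factors v ls = 0)"
 have "\<exists>ls. length ls = n & factors v ls = 0" unfolding n_def by (rule LeastI) (use ex in blast)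
 then obtain ms where ms: "length ms = n" "factors v ms = 0" by blast
 have "eigenvalue v l" if l: "l \<in> set ms" for l
 proof (rule eigenvalueI)
  have "length (remove1 l ms) < n" using l ms(1) by (metis length_pos_if_in_set length_remove1 diff_less zero_less_one)
  then show "factors v (remove1 l ms) ~= 0" using not_less_Least unfolding n_def by blast
  show "v * factors v (remove1 l ms) = smat l * factors v (remove1 l ms)"
   using factors_Cons_remove[OF l, of v] ms(2) by (simp add: left_diff_distrib)
 qed
 then show ?thesis using ms(2) that by blast
qed

lemma eigenvalue_norm: assumes "eigenvalue v l" shows "cmod l <= norm v"
proof -
 obtain u where u: "u ~= 0" "v * u = smat l * u" using assms unfolding eigenvalue_def by blast
 have "cmod l * norm u = norm (smat l * u)"
 proof (cases "l = 0")
  case False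
  have "norm (smat l * u) <= cmod l * norm u" using norm_mult_ineq[of "smat l" u] by (simp add: norm_smat)
  moreover have "norm u <= norm (smat (1 / l) :: 'a cmat) * norm (smat l * u)"
   using norm_mult_ineq[of "smat (1 / l)" "smat l * u"] False by (simp add: mult.assoc[symmetric] smat_mult[symmetric] smat_simps)
  then have "cmod l * norm u <= norm (smat l * u)" using False by (simp add: norm_smat norm_divide field_simps)
  ultimately show ?thesis by simp
 qed (simp add: smat_simps)
 also have "... <= norm v * norm u" using u(2) norm_mult_ineq[of v u] by simp
 finally show ?thesis using u(1) by simp
qed

lemma exp_poly_linear_ode:
 assumes W: "W \<in> exp_poly \<Lambda>" and G: "!!s. (G has_field_derivative l * G s + W s) (at s)"
 shows "G \<in> exp_poly (insert l \<Lambda>)"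
proof -
 have "(%s. W s * (poly 1 s * exp (- l * s))) \<in> exp_poly ((%\<mu>. \<mu> - l) ` \<Lambda>)" by (rule exp_poly_mult_term[OF W]) auto
 from exp_poly_antideriv[OF this] obtain F where F: "F \<in> exp_poly ((%\<mu>. \<mu> - l) ` \<Lambda>)"
  "!!s. (F has_field_derivative W s * exp (- l * s)) (at s)" by auto
 have "((%s. G s * exp (- l * s) - F s) has_field_derivative 0) (at s)" for s
  by (auto intro!: derivative_eq_intros G F(2) simp: algebra_simps)
 then have "\<exists>c. \<forall>s\<in>UNIV. G s * exp (- l * s) - F s = c"
  by (intro has_field_derivative_zero_constant) auto
 then obtain c where c: "!!s. G s * exp (- l * s) - F s = c" by auto
 have "G s = F s * (poly 1 s * exp (l * s)) + poly [:c:] s * exp (l * s)" for s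
 proof -
  have "G s * exp (- l * s) = F s + c" using c[of s] unfolding diff_eq_eq by (simp only: add.commute)
  then have "G s * (exp (- l * s) * exp (l * s)) = (F s + c) * exp (l * s)" by (simp add: mult.assoc[symmetric])
  then show ?thesis by (simp add: exp_minus algebra_simps)
 qed
 then have "G = (%s. F s * (poly 1 s * exp (l * s)) + poly [:c:] s * exp (l * s))" by blast
 moreover have "(%s. F s * (poly 1 s * exp (l * s))) \<in> exp_poly (insert l \<Lambda>)" by (rule exp_poly_mult_term[OF F(1)]) auto
 moreover have "(%s. poly [:c:] s * exp (l * s)) \<in> exp_poly (insert l \<Lambda>)" by (rule exp_poly_term) simp
 ultimately show ?thesis by (simp only: exp_poly_add)
qed

lemma exp_factors_exp_poly:
 "factors v ls * u = 0 ==> (%s. entry (exp (smat s * v) * u) i j) \<in> exp_poly (set ls)"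
proof (induction ls arbitrary: u)
 case Nil
 then show ?case using exp_poly.zero by (simp del: rep_simps(6))
next
 case (Cons l ls)
 define w where "w = (v - smat l) * u"
 have "factors v ls * w = 0"
  using Cons.prems factors_commute[of v ls l] unfolding w_def by (simp add: mult.assoc[symmetric])
 then have IH: "(%s. entry (exp (smat s * v) * w) i j) \<in> exp_poly (set ls)" by (rule Cons.IH)
 have "entry (exp (smat s * v) * v * u) i j = l * entry (exp (smat s * v) * u) i j + entry (exp (smat s * v) * w) i j" for s
 proof -
  have "exp (smat s * v) * v * u = smat l * (exp (smat s * v) * u) + exp (smat s * v) * w"
   by (simp add: w_def algebra_simps smat_left_commute)
  then show ?thesis by (simp only: rep_simps(3) vector_add_component entry_smat_mult)
 qed
 then have "((%s. entry (exp (smat s * v) * u) i j) has_field_derivative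
   l * entry (exp (smat s * v) * u) i j + entry (exp (smat s * v) * w) i j) (at s)" for s
  using has_field_derivative_exp_entry[of 1 v u i j s] by simp
 then show ?case using exp_poly_linear_ode[OF IH] by simp
qed

lemma exp_entries_exp_poly:
 fixes v :: "'n::finite cmat"
 obtains \<Lambda> where "finite \<Lambda>" "\<forall>l\<in>\<Lambda>. eigenvalue v l" "\<forall>i j. (%s. entry (exp (smat s * v)) i j) \<in> exp_poly \<Lambda>"
proof -
 obtain ls where ls: "factors v ls = 0" "\<forall>l\<in>set ls. eigenvalue v l" using annihilating_factors .
 show ?thesis
 proof (rule that[of "set ls"])
  show "\<forall>i j. (%s. entry (exp (smat s * v)) i j) \<in> exp_poly (set ls)"
   using exp_factors_exp_poly[of v ls 1] ls(1) by (simp del: rep_simps)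
 qed (use ls(2) in auto)
qed

lemma poly_fun_exp_poly:
 assumes "p \<in> poly_fun UNIV"
  and S: "0 \<in> S" "!!\<mu> \<nu>. \<mu> \<in> S ==> \<nu> \<in> S ==> \<mu> + \<nu> \<in> S"
  and M: "!!i j. (%s. M s $ i $ j) \<in> exp_poly S"
 shows "(%s. p (M s)) \<in> exp_poly S"
 using assms(1)
proof (induction rule: poly_fun.induct)
 case (mult p q)
 then show ?case by (intro exp_poly_mult[of _ S _ S] S(2)) auto
qed (auto intro: exp_poly_const S M exp_poly_add)

abbreviation strip :: "real => complex set" where "strip c \<equiv> {\<mu>. \<bar>Im \<mu>\<bar> <= c}"

lemma poly_fun_exp_poly_strip:
 fixes p :: "complex^'n^'n => complex"
 assumes "p \<in> poly_fun UNIV"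
 shows "\<exists>d::nat. \<forall>c\<ge>0. \<forall>M :: complex => complex^'n^'n. (\<forall>i j. (%s. M s $ i $ j) \<in> exp_poly (strip c)) -->
   (%s. p (M s)) \<in> exp_poly (strip (real d * c))"
 using assms
proof (induction rule: poly_fun.induct)
 case (const c)
 show ?case by (intro exI[of _ 0]) (auto intro!: exp_poly_const)
next
 case (entry i j)
 show ?case by (intro exI[of _ 1]) auto
next
 case (add p q)
 then obtain d e where IH: "!!c (M :: complex => complex^'n^'n). c >= 0 ==> (\<forall>i j. (%s. M s $ i $ j) \<in> exp_poly (strip c)) ==>
   (%s. p (M s)) \<in> exp_poly (strip (real d * c)) & (%s. q (M s)) \<in> exp_poly (strip (real e * c))" by blast
 have "strip (real d * c) \<subseteq> strip (real (d + e) * c)" "strip (real e * c) \<subseteq> strip (real (d + e) * c)" if "c >= 0" for c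
  using that by (auto simp: distrib_right intro: order_trans)
 then show ?case using IH by (intro exI[of _ "d + e"] allI impI exp_poly_add) (blast intro: exp_poly_mono)+
next
 case (mult p q)
 then obtain d e where IH: "!!c (M :: complex => complex^'n^'n). c >= 0 ==> (\<forall>i j. (%s. M s $ i $ j) \<in> exp_poly (strip c)) ==>
   (%s. p (M s)) \<in> exp_poly (strip (real d * c)) & (%s. q (M s)) \<in> exp_poly (strip (real e * c))" by blast
 have "\<mu> + \<nu> \<in> strip (real (d + e) * c)" if "\<mu> \<in> strip (real d * c)" "\<nu> \<in> strip (real e * c)" for \<mu> \<nu> c
  using that by (auto simp: distrib_right)
 then show ?case using IH by (intro exI[of _ "d + e"] allI impI exp_poly_mult[of _ "strip (real d * _)" _ "strip (real e * _)"]) blast+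
qed

lemma invertible_exp: "invertible (rep (exp v))"
 using exp_inverse_cmat[of v] unfolding invertible_def
 by (metis rep_simps(2) rep_simps(6))

definition real_spectrum :: "'n::finite cmat => bool" where
 "real_spectrum v \<longleftrightarrow> (\<forall>l. eigenvalue v l --> l \<in> \<real>)"

lemma countable_exp_resonance:
 fixes \<mu> \<nu> :: complex shows "countable {t::real. \<mu> ~= \<nu> & exp (\<mu> * of_real t) = exp (\<nu> * of_real t)}"
proof -
 have "{t::real. \<mu> ~= \<nu> & exp (\<mu> * of_real t) = exp (\<nu> * of_real t)} \<subseteq>
   range (%n::int. Re (of_int (2 * n) * of_real pi * \<i> / (\<mu> - \<nu>)))"
 proof
  fix t :: real assume "t \<in> {t::real. \<mu> ~= \<nu> & exp (\<mu> * of_real t) = exp (\<nu> * of_real t)}"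
  then obtain n :: int where "\<mu> ~= \<nu>" "\<mu> * of_real t = \<nu> * of_real t + of_int (2 * n) * of_real pi * \<i>"
   by (auto simp: exp_eq)
  then have "of_real t = of_int (2 * n) * of_real pi * \<i> / (\<mu> - \<nu>)" by (simp add: field_simps)
  then have "t = Re (of_int (2 * n) * of_real pi * \<i> / (\<mu> - \<nu>))" by (metis Re_complex_of_real)
  then show "t \<in> range (%n::int. Re (of_int (2 * n) * of_real pi * \<i> / (\<mu> - \<nu>)))" by blast
 qed
 then show ?thesis by (rule countable_subset) simp
qed

lemma countable_additive_closure:
 assumes "finite \<Lambda>"
 obtains S :: "complex set" where "countable S" "\<Lambda> \<subseteq> S" "0 \<in> S" "\<forall>\<mu>\<in>S. \<forall>\<nu>\<in>S. \<mu> + \<nu> \<in> S"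
proof
 show "countable (sum_list ` lists \<Lambda>)" using assms by (intro countable_image countable_lists countable_finite)
 show "\<Lambda> \<subseteq> sum_list ` lists \<Lambda>" by (auto intro!: image_eqI[of _ _ "[_]"])
 show "0 \<in> sum_list ` lists \<Lambda>" by (rule image_eqI[of _ _ "[]"]) auto
 have "sum_list xs + sum_list ys \<in> sum_list ` lists \<Lambda>" if "xs \<in> lists \<Lambda>" "ys \<in> lists \<Lambda>" for xs ys
  using that by (intro image_eqI[of _ _ "xs @ ys"]) auto
 then show "\<forall>\<mu>\<in>sum_list ` lists \<Lambda>. \<forall>\<nu>\<in>sum_list ` lists \<Lambda>. \<mu> + \<nu> \<in> sum_list ` lists \<Lambda>" by blast
qed

section \<open>Hilbert's basis theorem\<close>

definition subring_set :: "'r::comm_ring_1 set => bool" where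
 "subring_set A \<longleftrightarrow> 0 \<in> A & 1 \<in> A & (\<forall>a\<in>A. \<forall>b\<in>A. a + b \<in> A & a * b \<in> A) & (\<forall>a\<in>A. - a \<in> A)"

inductive_set ideal_gen :: "'r::comm_ring_1 set => 'r set => 'r set" for A F where
 zero: "0 \<in> ideal_gen A F"
| step: "h \<in> ideal_gen A F ==> a \<in> A ==> f \<in> F ==> h + a * f \<in> ideal_gen A F"

definition noetherian_set :: "'r::comm_ring_1 set => bool" where
 "noetherian_set A \<longleftrightarrow> (\<forall>P\<subseteq>A. \<exists>F\<subseteq>P. finite F & P \<subseteq> ideal_gen A F)"

lemma subring_setD:
 assumes "subring_set A"
 shows "0 \<in> A" "1 \<in> A" "a \<in> A ==> b \<in> A ==> a + b \<in> A" "a \<in> A ==> b \<in> A ==> a * b \<in> A" "a \<in> A ==> - a \<in> A"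
 using assms by (auto simp: subring_set_def)

lemma subring_diff: "subring_set A ==> a \<in> A ==> b \<in> A ==> a - b \<in> A"
 using subring_setD(3,5)[of A] by (metis diff_conv_add_uminus)

lemma subring_sum: "subring_set A ==> (!!i. i \<in> S ==> f i \<in> A) ==> sum f S \<in> A"
 by (induction S rule: infinite_finite_induct) (auto simp: subring_set_def)

lemma ideal_gen_add: "h \<in> ideal_gen A F ==> k \<in> ideal_gen A F ==> h + k \<in> ideal_gen A F"
proof (induction rule: ideal_gen.induct)
 case (step h a f)
 from ideal_gen.step[OF step.IH[OF step.prems] step.hyps(2,3)] show ?case by (simp add: algebra_simps)
qed simp

lemma ideal_gen_mult: assumes "subring_set A" "h \<in> ideal_gen A F" "b \<in> A" shows "b * h \<in> ideal_gen A F"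
 using assms(2)
proof (induction rule: ideal_gen.induct)
 case (step h a f)
 have "b * a \<in> A" using assms(1,3) step.hyps(2) by (simp add: subring_set_def)
 from ideal_gen.step[OF step.IH this step.hyps(3)] show ?case by (simp add: algebra_simps)
qed (simp add: ideal_gen.zero)

lemma ideal_gen_base: assumes "subring_set A" "f \<in> F" shows "f \<in> ideal_gen A F"
 using ideal_gen.step[OF ideal_gen.zero, of 1 A f F] assms by (simp add: subring_set_def)

lemma ideal_gen_diff: "subring_set A ==> h \<in> ideal_gen A F ==> k \<in> ideal_gen A F ==> h - k \<in> ideal_gen A F"
 using ideal_gen_add[of h A F "- 1 * k"] ideal_gen_mult[of A k F "- 1"] by (simp add: subring_set_def)

lemma ideal_gen_sum: "(!!i. i \<in> S ==> f i \<in> ideal_gen A F) ==> sum f S \<in> ideal_gen A F"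
 by (induction S rule: infinite_finite_induct) (auto simp: ideal_gen.zero ideal_gen_add)

lemma ideal_gen_subset: assumes "subring_set A" "F \<subseteq> A" "h \<in> ideal_gen A F" shows "h \<in> A"
 using assms(3) by (induction rule: ideal_gen.induct) (use assms(1,2) in \<open>auto simp: subring_set_def\<close>)

lemma ideal_gen_mono: assumes "F \<subseteq> G" "h \<in> ideal_gen A F" shows "h \<in> ideal_gen A G"
 using assms(2) by (induction rule: ideal_gen.induct) (use assms(1) in \<open>auto intro: ideal_gen.intros\<close>)

lemma ideal_gen_trans:
 assumes A: "subring_set A" and G: "G \<subseteq> ideal_gen A F" and h: "h \<in> ideal_gen A G" shows "h \<in> ideal_gen A F"
 using h
proof (induction rule: ideal_gen.induct)
 case (step h a f)
 have "f \<in> ideal_gen A F" using step.hyps(3) G by (rule subsetD[rotated])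
 from ideal_gen_add[OF step.IH ideal_gen_mult[OF A this step.hyps(2)]] show ?case .
qed (rule ideal_gen.zero)

lemma ideal_gen_finite: "h \<in> ideal_gen A P ==> \<exists>F\<subseteq>P. finite F & h \<in> ideal_gen A F"
proof (induction rule: ideal_gen.induct)
 case (step h a f)
 then obtain F where F: "F \<subseteq> P" "finite F" "h \<in> ideal_gen A F" by (elim exE conjE)
 have "h \<in> ideal_gen A (insert f F)" by (rule ideal_gen_mono[OF _ F(3)]) auto
 from ideal_gen.step[OF this step.hyps(2), of f] show ?case
  using F step.hyps(3) by (intro exI[of _ "insert f F"]) auto
qed (auto intro: ideal_gen.zero)

lemma ideal_gen_finite_set: assumes "finite G" "G \<subseteq> ideal_gen A P" shows "\<exists>F\<subseteq>P. finite F & G \<subseteq> ideal_gen A F"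
 using assms
proof (induction rule: finite_induct)
 case (insert g G)
 then obtain F where F: "F \<subseteq> P" "finite F" "G \<subseteq> ideal_gen A F" by (elim meta_impE exE conjE) auto
 obtain F' where F': "F' \<subseteq> P" "finite F'" "g \<in> ideal_gen A F'" using ideal_gen_finite[of g A P] insert.prems by auto
 have "G \<subseteq> ideal_gen A (F \<union> F')" using F(3) ideal_gen_mono[of F "F \<union> F'" _ A] by auto
 moreover have "g \<in> ideal_gen A (F \<union> F')" by (rule ideal_gen_mono[OF _ F'(3)]) auto
 ultimately show ?case using F F' by (intro exI[of _ "F \<union> F'"]) auto
qed auto

lemma ideal_gen_image_sum:
 assumes A: "subring_set A" and h: "h \<in> ideal_gen A (g ` {..<N::nat})"
 shows "\<exists>c. (\<forall>j. c j \<in> A) & h = (\<Sum>j<N. c j * g j)"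
 using h
proof (induction rule: ideal_gen.induct)
 case zero
 show ?case using A by (intro exI[of _ "%_. 0"]) (auto simp: subring_set_def)
next
 case (step h a f)
 then obtain c where c: "!!j. c j \<in> A" "h = (\<Sum>j<N. c j * g j)" by auto
 obtain k where k: "k < N" "f = g k" using step.hyps(3) by auto
 define c' where "c' j = c j + (if j = k then a else 0)" for j
 have "(\<Sum>j<N. c' j * g j) = (\<Sum>j<N. c j * g j) + (\<Sum>j<N. if j = k then a * g j else 0)"
  unfolding sum.distrib[symmetric] by (rule sum.cong) (auto simp: c'_def algebra_simps)
 then have "h + a * f = (\<Sum>j<N. c' j * g j)" using c(2) k by simp
 moreover have "c' j \<in> A" for j using A c(1) step.hyps(2) by (auto simp: c'_def subring_set_def)
 ultimately show ?case by blast
qed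

definition polys_over :: "'r::comm_ring_1 set => 'r poly set" where "polys_over A = {q. \<forall>i. coeff q i \<in> A}"

definition adjoin :: "'r::comm_ring_1 set => 'r => 'r set" where "adjoin A x = (%q. poly q x) ` polys_over A"

lemma subring_polys_over: assumes A: "subring_set A" shows "subring_set (polys_over A)"
proof -
 have "coeff (p * q) i \<in> A" if "p \<in> polys_over A" "q \<in> polys_over A" for p q i
  unfolding coeff_mult using that A by (intro subring_sum) (auto simp: polys_over_def subring_set_def)
 then show ?thesis using A by (auto simp: subring_set_def polys_over_def coeff_1)
qed

lemma subring_adjoin: assumes A: "subring_set A" shows "subring_set (adjoin A x)"
 using subring_setD[OF subring_polys_over[OF A]] unfolding subring_set_def adjoin_def
 by (force simp flip: poly_add poly_mult poly_minus intro: image_eqI[of _ _ 0] image_eqI[of _ _ 1])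

lemma monom_polys_over: "subring_set A ==> a \<in> A ==> monom a i \<in> polys_over A"
 by (auto simp: polys_over_def subring_set_def)

lemma adjoin_base: "subring_set A ==> a \<in> A ==> a \<in> adjoin A x"
 unfolding adjoin_def by (rule image_eqI[of _ _ "monom a 0"]) (simp_all add: poly_monom monom_polys_over)

lemma adjoin_elem: "subring_set A ==> x \<in> adjoin A x"
 unfolding adjoin_def by (rule image_eqI[of _ _ "monom 1 1"]) (simp_all add: poly_monom monom_polys_over subring_set_def)

lemma leading_term_reduction:
 fixes n :: nat
 assumes A: "subring_set A"
  and deg: "!!j. j < n ==> degree (q j) <= degree p"
  and lead: "lead_coeff p \<in> ideal_gen A ((%j. lead_coeff (q j)) ` {..<n})"
 obtains s where "\<forall>j. s j \<in> polys_over A"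
  "p - (\<Sum>j<n. s j * q j) = 0 \<or> degree (p - (\<Sum>j<n. s j * q j)) < degree p"
proof -
 obtain c where c: "\<forall>j. c j \<in> A" "lead_coeff p = (\<Sum>j<n. c j * lead_coeff (q j))"
  using ideal_gen_image_sum[OF A lead] by blast
 define s where "s j = monom (c j) (degree p - degree (q j))" for j
 have "coeff (s j * q j) (degree p) = c j * lead_coeff (q j)" if "j < n" for j
  using deg[OF that] by (simp add: s_def coeff_monom_mult)
 then have top: "coeff (p - (\<Sum>j<n. s j * q j)) (degree p) = 0" using c(2) by (simp add: coeff_sum)
 have "degree (s j * q j) <= degree p" if "j < n" for j
 proof -
  have "degree (s j * q j) <= degree (s j) + degree (q j)" by (rule degree_mult_le)
  also have "... <= (degree p - degree (q j)) + degree (q j)" by (simp add: s_def degree_monom_le)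
  finally show ?thesis using deg[OF that] by simp
 qed
 then have "degree (p - (\<Sum>j<n. s j * q j)) <= degree p" by (intro degree_diff_le degree_sum_le) auto
 then have "p - (\<Sum>j<n. s j * q j) = 0 \<or> degree (p - (\<Sum>j<n. s j * q j)) < degree p"
  using top by (metis le_neq_implies_less leading_coeff_0_iff)
 then show ?thesis using that[of s] c(1) monom_polys_over[OF A] by (simp add: s_def)
qed

lemma not_finitely_generated:
 assumes B: "subring_set B" and no: "\<not> (\<exists>F\<subseteq>P. finite F & P \<subseteq> ideal_gen B F)"
  and G: "finite G" "G \<subseteq> ideal_gen B P"
 shows "\<exists>h\<in>ideal_gen B P. h \<notin> ideal_gen B G"
proof (rule ccontr)
 assume "\<not> ?thesis"
 then have all: "ideal_gen B P \<subseteq> ideal_gen B G" by blast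
 obtain F where F: "F \<subseteq> P" "finite F" "G \<subseteq> ideal_gen B F" using ideal_gen_finite_set[OF G] by blast
 have "P \<subseteq> ideal_gen B F" using ideal_gen_base[OF B] all ideal_gen_trans[OF B F(3)] by blast
 then show False using no F by blast
qed

definition outside :: "'r::comm_ring_1 set => 'r => 'r set => (nat => 'r poly) => nat => 'r poly => bool" where
 "outside A x P q n r \<longleftrightarrow> r \<in> polys_over A & poly r x \<in> ideal_gen (adjoin A x) P &
   poly r x \<notin> ideal_gen (adjoin A x) ((%j. poly (q j) x) ` {..<n})"

text \<open>In an ideal that is not finitely generated, choose polynomials of minimal degree outside the ideal
 generated by the previous ones; their leading coefficients would generate an ideal of \<open>A\<close> that is not
 finitely generated either.\<close>

lemma minimal_outside_sequence:
 assumes A: "subring_set A" and P: "P \<subseteq> adjoin A x"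
  and no: "\<not> (\<exists>F\<subseteq>P. finite F & P \<subseteq> ideal_gen (adjoin A x) F)"
 obtains q where "\<forall>n. outside A x P q n (q n)" "\<forall>n r. outside A x P q n r --> degree (q n) <= degree r"
proof -
 note B = subring_adjoin[OF A, of x]
 have "\<exists>q. \<forall>n. is_arg_min degree (outside A x P q n) (q n)"
 proof (rule dependent_wellorder_choice)
  fix n :: nat and q assume "!!j. j < n ==> is_arg_min degree (outside A x P q j) (q j)"
  then have "(%j. poly (q j) x) ` {..<n} \<subseteq> ideal_gen (adjoin A x) P" by (auto simp: is_arg_min_def outside_def)
  then obtain h where h: "h \<in> ideal_gen (adjoin A x) P" "h \<notin> ideal_gen (adjoin A x) ((%j. poly (q j) x) ` {..<n})"
   using not_finitely_generated[OF B no] by (metis finite_imageI finite_lessThan)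
  then obtain r where "outside A x P q n r" using ideal_gen_subset[OF B P h(1)] by (auto simp: adjoin_def outside_def)
  then show "\<exists>r. is_arg_min degree (outside A x P q n) r" using ex_has_least_nat[of "outside A x P q n" r degree]
   by (auto simp: is_arg_min_linorder)
 next
  fix q q' :: "nat => 'a poly" and n r assume "!!j. j < n ==> q j = q' j"
  then have "outside A x P q n = outside A x P q' n" by (intro ext) (auto simp: outside_def)
  then show "is_arg_min degree (outside A x P q n) r = is_arg_min degree (outside A x P q' n) r" by simp
 qed
 then show ?thesis using that by (auto simp: is_arg_min_linorder)
qed

lemma outside_diff:
 assumes A: "subring_set A" and q: "\<forall>n. outside A x P q n (q n)" and s: "\<forall>j. s j \<in> polys_over A"
 shows "outside A x P q n (q n - (\<Sum>j<n. s j * q j))"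
proof -
 let ?B = "adjoin A x" and ?q = "(%j. poly (q j) x) ` {..<n}"
 note B = subring_adjoin[OF A, of x]
 have comb: "poly (\<Sum>j<n. s j * q j) x \<in> ideal_gen ?B ?q"
  unfolding poly_sum poly_mult using s
  by (intro ideal_gen_sum ideal_gen_mult[OF B] ideal_gen_base[OF B]) (auto simp: adjoin_def)
 have "(\<Sum>j<n. s j * q j) \<in> polys_over A" using subring_polys_over[OF A] s q
  by (intro subring_sum) (auto simp: outside_def subring_setD)
 then have "q n - (\<Sum>j<n. s j * q j) \<in> polys_over A"
  using q by (intro subring_diff subring_polys_over[OF A]) (auto simp: outside_def)
 moreover have "?q \<subseteq> ideal_gen ?B P" using q by (auto simp: outside_def)
 then have "poly (q n - (\<Sum>j<n. s j * q j)) x \<in> ideal_gen ?B P"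
  using ideal_gen_diff[OF B] ideal_gen_trans[OF B _ comb] q by (simp add: outside_def)
 moreover have "poly (q n - (\<Sum>j<n. s j * q j)) x \<notin> ideal_gen ?B ?q"
  using ideal_gen_add[OF _ comb, of "poly (q n - (\<Sum>j<n. s j * q j)) x"] q by (auto simp: outside_def)
 ultimately show ?thesis by (simp add: outside_def)
qed

lemma noetherian_adjoin:
 assumes A: "subring_set A" and N: "noetherian_set A"
 shows "noetherian_set (adjoin A x)"
 unfolding noetherian_set_def
proof (intro allI impI, rule ccontr)
 fix P assume P: "P \<subseteq> adjoin A x" and no: "\<not> (\<exists>F\<subseteq>P. finite F & P \<subseteq> ideal_gen (adjoin A x) F)"
 obtain q where q: "\<forall>n. outside A x P q n (q n)" "\<forall>n r. outside A x P q n r --> degree (q n) <= degree r"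
  using minimal_outside_sequence[OF A P no] .
 have mono: "degree (q j) <= degree (q n)" if "j <= n" for j n
  using q(1) ideal_gen_mono[OF image_mono, of "{..<j}" "{..<n}"] that
  by (intro q(2)[rule_format]) (auto simp: outside_def)
 let ?a = "%n. lead_coeff (q n)"
 have "range ?a \<subseteq> A" using q(1) by (auto simp: outside_def polys_over_def)
 then obtain F where F: "F \<subseteq> range ?a" "finite F" "range ?a \<subseteq> ideal_gen A F"
  using N[unfolded noetherian_set_def, rule_format, of "range ?a"] by blast
 obtain K where K: "finite K" "F = ?a ` K" using finite_subset_image[OF F(2,1)] by blast
 obtain n where n: "K \<subseteq> {..<n}" using finite_nat_bounded[OF K(1)] by blast
 have "?a n \<in> ideal_gen A (?a ` {..<n})" by (rule ideal_gen_mono[of F]) (use K n F(3) in auto)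
 with mono[of _ n] obtain s where s: "\<forall>j. s j \<in> polys_over A"
  "q n - (\<Sum>j<n. s j * q j) = 0 \<or> degree (q n - (\<Sum>j<n. s j * q j)) < degree (q n)"
  by (elim leading_term_reduction[OF A, rotated]) auto
 have "outside A x P q n (q n - (\<Sum>j<n. s j * q j))" by (rule outside_diff[OF A q(1) s(1)])
 moreover from this have "q n - (\<Sum>j<n. s j * q j) ~= 0" by (auto simp: outside_def ideal_gen.zero)
 ultimately show False using q(2) s(2) by (meson leD)
qed

lemma noetherian_constants: "noetherian_set (range (%c (_::'x). c :: complex))"
 unfolding noetherian_set_def
proof (intro allI impI)
 fix P :: "('x => complex) set" assume P: "P \<subseteq> range (%c _. c)"
 show "\<exists>F\<subseteq>P. finite F & P \<subseteq> ideal_gen (range (%c _. c)) F"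
 proof (cases "P \<subseteq> {0}")
  case True
  then show ?thesis using ideal_gen.zero by (intro exI[of _ "{}"]) auto
 next
  case False
  then obtain f where f: "f \<in> P" "f ~= 0" by auto
  then obtain c where c: "f = (%_. c)" using P by auto
  have c0: "c ~= 0" using f(2) unfolding c by (auto simp: zero_fun_def)
  have "h \<in> ideal_gen (range (%c _. c)) {f}" if h: "h \<in> P" for h
  proof -
   obtain d where d: "h = (%_. d)" using P h by auto
   have "0 + (%_. d / c) * f \<in> ideal_gen (range (%c _. c)) {f}" by (rule ideal_gen.step[OF ideal_gen.zero]) auto
   moreover have "0 + (%_. d / c) * f = h" using c0 by (auto simp: c d fun_eq_iff)
   ultimately show ?thesis by simp
  qed
  then show ?thesis using f(1) by (intro exI[of _ "{f}"]) auto
 qed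
qed

lemma subring_constants: "subring_set (range (%c (_::'x). c :: complex))"
 unfolding subring_set_def by (auto simp: zero_fun_def one_fun_def plus_fun_def times_fun_def fun_Compl_def)

lemma noetherian_poly_fun:
 "\<exists>A. subring_set A & noetherian_set A & poly_fun UNIV \<subseteq> (A :: (complex^'n^'n => complex) set)"
proof -
 let ?e = "%(i, j) (X :: complex^'n^'n). X $ i $ j"
 have "\<exists>A. subring_set A & noetherian_set A & range (%c _. c) \<subseteq> A & ?e ` V \<subseteq> A" if "finite V" for V
  using that
 proof (induction rule: finite_induct)
  case empty
  then show ?case using subring_constants noetherian_constants by (intro exI[of _ "range (%c _. c)"]) auto
 next
  case (insert v V)
  then obtain A where A: "subring_set A" "noetherian_set A" "range (%c _. c) \<subseteq> A" "?e ` V \<subseteq> A" by (elim exE conjE)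
  have "A \<subseteq> adjoin A (?e v)" using adjoin_base[OF A(1)] by blast
  then show ?case
   using A subring_adjoin[OF A(1), of "?e v"] noetherian_adjoin[OF A(1,2), of "?e v"] adjoin_elem[OF A(1), of "?e v"]
   by (intro exI[of _ "adjoin A (?e v)"]) auto
 qed
 from this[of UNIV] obtain A where A: "subring_set A" "noetherian_set A" "range (%c _. c) \<subseteq> A" "range ?e \<subseteq> A" by auto
 have "p \<in> A" if "p \<in> poly_fun UNIV" for p
  using that
 proof (induction rule: poly_fun.induct)
  case (entry i j)
  then show ?case using A(4) by (auto dest!: subsetD[of _ _ "?e (i, j)"])
 next
  case (add p q)
  then have "p + q \<in> A" using A(1) by (simp add: subring_set_def)
  then show ?case by (simp add: plus_fun_def)
 next
  case (mult p q)
  then have "p * q \<in> A" using A(1) by (simp add: subring_set_def)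
  then show ?case by (simp add: times_fun_def)
 qed (use A(3) in auto)
 then show ?thesis using A by blast
qed

lemma zero_locus_finite:
 fixes P :: "(complex^'n^'n => complex) set"
 assumes "P \<subseteq> poly_fun UNIV" shows "\<exists>F\<subseteq>P. finite F & zero_locus F = zero_locus P"
proof -
 obtain A :: "(complex^'n^'n => complex) set" where A: "noetherian_set A" "poly_fun UNIV \<subseteq> A" using noetherian_poly_fun by blast
 have "P \<subseteq> A" using assms A(2) by blast
 from A(1)[unfolded noetherian_set_def, rule_format, OF this]
 obtain F where F: "F \<subseteq> P" "finite F" "P \<subseteq> ideal_gen A F" by (elim exE conjE)
 have "h X = 0" if "h \<in> ideal_gen A F" "\<forall>p\<in>F. p X = 0" for h X
  using that(1) by (induction rule: ideal_gen.induct) (use that(2) in auto)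
 then have "zero_locus F \<subseteq> zero_locus P" using F(3) unfolding zero_locus_def by auto
 moreover have "zero_locus P \<subseteq> zero_locus F" using F(1) unfolding zero_locus_def by auto
 ultimately show ?thesis using F by blast
qed

lemma zariski_descending_chain:
 assumes C: "!!k::nat. closedin zariski (C k)" and d: "!!k. C (Suc k) \<subseteq> C k"
 shows "\<exists>k. C (Suc k) = C k"
proof -
 have dec: "C l \<subseteq> C k" if "k <= l" for k l using that d by (rule lift_Suc_antimono_le[rotated])
 have "\<forall>k. \<exists>P\<subseteq>poly_fun UNIV. C k = zero_locus P" using C by (simp add: closedin_zariski)
 then obtain P where P: "!!k. P k \<subseteq> poly_fun UNIV" "!!k. C k = zero_locus (P k)" by metis
 have "(\<Union>k. P k) \<subseteq> poly_fun UNIV" using P(1) by blast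
 from zero_locus_finite[OF this] obtain F where F: "F \<subseteq> (\<Union>k. P k)" "finite F" "zero_locus F = zero_locus (\<Union>k. P k)" by blast
 have "\<forall>f\<in>F. \<exists>k. f \<in> P k" using F(1) by blast
 then obtain \<kappa> where \<kappa>: "!!f. f \<in> F ==> f \<in> P (\<kappa> f)" by metis
 obtain n where n: "\<kappa> ` F \<subseteq> {..<n}" using finite_nat_bounded[of "\<kappa> ` F"] F(2) by auto
 have "C n \<subseteq> zero_locus F"
 proof
  fix X assume X: "X \<in> C n"
  have "f X = 0" if f: "f \<in> F" for f
  proof -
   have "\<kappa> f <= n" using n f by auto
   then have "X \<in> zero_locus (P (\<kappa> f))" using dec X P(2) by blast
   then show ?thesis using \<kappa>[OF f] by (simp add: zero_locus_def)
  qed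
  moreover have "X \<in> GL_set" using X unfolding P(2) zero_locus_def by simp
  ultimately show "X \<in> zero_locus F" by (simp add: zero_locus_def)
 qed
 also have "zero_locus F \<subseteq> C (Suc n)"
 proof -
  have "zero_locus (\<Union>k. P k) \<subseteq> zero_locus (P (Suc n))" by (auto simp: zero_locus_def)
  then show ?thesis using F(3) P(2)[of "Suc n"] by simp
 qed
 finally show ?thesis using d[of n] by blast
qed

section \<open>A Nullstellensatz over an uncountable field\<close>

abbreviation regular :: "(complex^'n^'n => complex) set" where "regular \<equiv> poly_fun UNIV"

lemma regular_const: "(%_. c) \<in> regular" by (rule poly_fun.const) simp

lemma regular_scale: "p \<in> regular ==> (%X. c * p X) \<in> regular" by (rule poly_fun.mult[OF regular_const])

lemma subring_regular: "subring_set regular"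
 unfolding subring_set_def zero_fun_def one_fun_def plus_fun_def times_fun_def fun_Compl_def
 using regular_scale[of _ "- 1"] by (auto intro: poly_fun.intros)

lemma regular_sum: "(!!i. i \<in> S ==> f i \<in> regular) ==> (%X. \<Sum>i\<in>S. f i X) \<in> regular"
 by (induction S rule: infinite_finite_induct) (auto intro: regular_const poly_fun.add)

lemma regular_prod: "(!!i. i \<in> S ==> f i \<in> regular) ==> (%X. \<Prod>i\<in>S. f i X) \<in> regular"
 by (induction S rule: infinite_finite_induct) (auto intro: regular_const poly_fun.mult)

lemma regular_det: "(det :: complex^'n^'n => complex) \<in> regular"
proof -
 have "(%X :: complex^'n^'n. \<Sum>p\<in>{p. p permutes UNIV}. of_int (sign p) * (\<Prod>i\<in>UNIV. X $ i $ p i)) \<in> regular"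
  by (intro regular_sum regular_scale regular_prod poly_fun.entry)
 then show ?thesis by (simp add: det_def[abs_def])
qed

lemma regular_poly: "x \<in> regular ==> (%X. poly w (x X)) \<in> regular"
 by (induction w) (auto intro: regular_const poly_fun.add poly_fun.mult)

subsection \<open>Countable dimension\<close>

interpretation cfun: vector_space "%(c::complex) (f::'x => complex) X. c * f X"
 by unfold_locales (auto simp: fun_eq_iff algebra_simps)

definition monomial :: "('n \<times> 'n) list => complex^'n^'n => complex" where
 "monomial l X = prod_list (map (%(i, j). X $ i $ j) l)"

lemma cfun_sum: "(\<Sum>i\<in>S. f i) X = (\<Sum>i\<in>S. f i X :: complex)"
 by (induction S rule: infinite_finite_induct) auto

lemma subspace_mult_in_span: "cfun.subspace {q. (%X. m X * q X) \<in> cfun.span B}"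
proof (rule cfun.subspaceI; clarify)
 show "(%X. m X * 0 X) \<in> cfun.span B" using cfun.span_zero[of B] by (simp add: zero_fun_def)
 show "(%X. m X * (p + q) X) \<in> cfun.span B"
  if "(%X. m X * p X) \<in> cfun.span B" "(%X. m X * q X) \<in> cfun.span B" for p q
  using cfun.span_add[OF that] by (simp add: plus_fun_def distrib_left)
 show "(%X. m X * (c * q X)) \<in> cfun.span B" if "(%X. m X * q X) \<in> cfun.span B" for c q
  using cfun.span_scale[OF that, of c] by (simp add: mult.left_commute)
qed

lemma span_monomial_mult:
 assumes "p \<in> cfun.span (range monomial)" "q \<in> cfun.span (range monomial)"
 shows "(%X. p X * q X) \<in> cfun.span (range monomial)"
proof -
 have left: "(%X. monomial k X * q X) \<in> cfun.span (range monomial)" for k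
  using assms(2)
 proof (rule cfun.span_induct)
  show "(%X. monomial k X * q X) \<in> cfun.span (range monomial)" if q: "q \<in> range monomial" for q
  proof -
   obtain l where "q = monomial l" using q by blast
   then have "(%X. monomial k X * q X) = monomial (k @ l)" by (simp add: monomial_def fun_eq_iff)
   then show ?thesis by (simp add: cfun.span_base)
  qed
 qed (rule subspace_mult_in_span)
 show ?thesis
  using assms(1)
 proof (rule cfun.span_induct)
  show "cfun.subspace {p. (%X. p X * q X) \<in> cfun.span (range monomial)}"
   using subspace_mult_in_span[of q] by (simp only: mult.commute)
 qed (use left in blast)
qed

lemma regular_span_monomial:
 fixes p :: "complex^'n^'n => complex"
 shows "p \<in> regular ==> p \<in> cfun.span (range monomial)"
proof (induction rule: poly_fun.induct)
 case (const c)
 have "(%X. c * monomial [] X) \<in> cfun.span (range (monomial :: _ => complex^'n^'n => complex))"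
  by (intro cfun.span_scale cfun.span_base) simp
 moreover have "(%X. c * monomial [] X) = (%X :: complex^'n^'n. c)" by (simp add: monomial_def)
 ultimately show ?case by simp
next
 case (entry i j)
 have "monomial [(i, j)] = (%X. X $ i $ j)" by (simp add: monomial_def fun_eq_iff)
 then show ?case by (metis cfun.span_base rangeI)
next
 case (add p q)
 then show ?case using cfun.span_add[OF add.IH] by (simp add: plus_fun_def)
qed (rule span_monomial_mult)

lemma span_family_dependent:
 assumes "finite T" "finite B" "card B < card T" and p: "!!t. t \<in> T ==> p t \<in> cfun.span B"
 shows "\<exists>\<gamma>. (\<exists>t\<in>T. \<gamma> t ~= 0) & (\<forall>X. (\<Sum>t\<in>T. \<gamma> t * p t X) = 0)"
proof (cases "inj_on p T")
 case True
 have "p ` T \<subseteq> cfun.span B" "card B < card (p ` T)" using p assms(3) by (auto simp: card_image True)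
 then have "cfun.dependent (p ` T)" using cfun.independent_span_bound[OF assms(2), of "p ` T"] by auto
 then obtain u where u: "\<exists>v\<in>p ` T. u v ~= 0" "(\<Sum>v\<in>p ` T. (%X. u v * v X)) = 0"
  using cfun.dependent_finite[of "p ` T"] assms(1) by blast
 have "(\<Sum>t\<in>T. u (p t) * p t X) = 0" for X
  using fun_cong[OF u(2), of X] by (simp add: sum.reindex[OF True] cfun_sum)
 then show ?thesis using u(1) by (intro exI[of _ "%t. u (p t)"]) auto
next
 case False
 then obtain s t where st: "s \<in> T" "t \<in> T" "s ~= t" "p s = p t" by (auto simp: inj_on_def)
 let ?\<gamma> = "%r. if r = s then 1 else if r = t then - 1 else (0::complex)"
 have "(\<Sum>r\<in>T. ?\<gamma> r * p r X) = (\<Sum>r\<in>{s, t}. ?\<gamma> r * p r X)" for X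
  using st assms(1) by (intro sum.mono_neutral_right) auto
 then show ?thesis using st by (intro exI[of _ ?\<gamma>]) auto
qed

lemma lagrange_combination_nonzero:
 fixes e :: "'t => complex"
 assumes "finite T" "inj_on e T" "t0 \<in> T" "\<gamma> t0 ~= 0"
 shows "(\<Sum>t\<in>T. smult (\<gamma> t) (\<Prod>b\<in>T - {t}. [:- e b, 1:])) ~= 0"
proof -
 have "poly (\<Sum>t\<in>T. smult (\<gamma> t) (\<Prod>b\<in>T - {t}. [:- e b, 1:])) (e t0) = (\<Sum>t\<in>T. \<gamma> t * (\<Prod>b\<in>T - {t}. e t0 - e b))"
  by (simp add: poly_sum poly_prod)
 also have "... = \<gamma> t0 * (\<Prod>b\<in>T - {t0}. e t0 - e b) + (\<Sum>t\<in>T - {t0}. \<gamma> t * (\<Prod>b\<in>T - {t}. e t0 - e b))"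
  using assms(1,3) by (rule sum.remove)
 also have "(\<Sum>t\<in>T - {t0}. \<gamma> t * (\<Prod>b\<in>T - {t}. e t0 - e b)) = 0"
  using assms(1,3) by (intro sum.neutral ballI) (auto intro!: prod_zero bexI[of _ t0])
 finally have "poly (\<Sum>t\<in>T. smult (\<gamma> t) (\<Prod>b\<in>T - {t}. [:- e b, 1:])) (e t0) ~= 0"
  using assms by (auto simp: inj_on_def)
 then show ?thesis by auto
qed

subsection \<open>Ideals maximal among those disjoint from a multiplicative set\<close>

definition ideal_in :: "'r::comm_ring_1 set => 'r set => bool" where
 "ideal_in A J \<longleftrightarrow> J \<subseteq> A & 0 \<in> J & (\<forall>p\<in>J. \<forall>q\<in>J. p + q \<in> J) & (\<forall>p\<in>J. \<forall>r\<in>A. r * p \<in> J)"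

lemma ideal_inD:
 assumes "ideal_in A J"
 shows "p \<in> J ==> p \<in> A" "0 \<in> J" "p \<in> J ==> q \<in> J ==> p + q \<in> J" "p \<in> J ==> r \<in> A ==> r * p \<in> J"
 using assms unfolding ideal_in_def by auto

lemma ideal_in_sum: "ideal_in A J ==> (!!i. i \<in> S ==> f i \<in> J) ==> sum f S \<in> J"
 by (induction S rule: infinite_finite_induct) (auto intro: ideal_inD)

locale maximal_disjoint_ideal =
 fixes A S M :: "'r::comm_ring_1 set"
 assumes A: "subring_set A" and S: "S \<subseteq> A" "1 \<in> S" "s \<in> S ==> t \<in> S ==> s * t \<in> S"
  and M: "ideal_in A M" "M \<inter> S = {}"
  and maximal: "ideal_in A M' ==> M \<subseteq> M' ==> M' \<inter> S = {} ==> M' = M"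

lemma maximal_disjoint_ideal_exists:
 assumes "subring_set A" "S \<subseteq> A" "1 \<in> S" "!!s t. s \<in> S ==> t \<in> S ==> s * t \<in> S"
  and J: "ideal_in A J" "J \<inter> S = {}"
 obtains M where "maximal_disjoint_ideal A S M" "J \<subseteq> M"
proof -
 define \<A> where "\<A> = {M. ideal_in A M & J \<subseteq> M & M \<inter> S = {}}"
 have "\<exists>M\<in>\<A>. \<forall>M'\<in>\<A>. M \<subseteq> M' --> M' = M"
 proof (rule subset_Zorn_nonempty)
  show "\<A> ~= {}" using J by (auto simp: \<A>_def)
  fix \<C> assume \<C>: "\<C> ~= {}" "subset.chain \<A> \<C>"
  then have ideal: "ideal_in A M & J \<subseteq> M & M \<inter> S = {}" if "M \<in> \<C>" for M
   using that by (auto simp: subset_chain_def \<A>_def)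
  have sum: "p + q \<in> \<Union>\<C>" if pq: "p \<in> \<Union>\<C>" "q \<in> \<Union>\<C>" for p q
  proof -
   obtain M where "M \<in> \<C>" "p \<in> M" "q \<in> M" using \<C>(2) pq unfolding subset_chain_def by blast
   then show ?thesis using ideal ideal_inD(3) by blast
  qed
  have "ideal_in A (\<Union>\<C>)"
   unfolding ideal_in_def
  proof (intro conjI ballI)
   show "\<Union>\<C> \<subseteq> A" using ideal ideal_inD(1) by blast
   show "0 \<in> \<Union>\<C>" using \<C>(1) ideal ideal_inD(2) by blast
   show "r * p \<in> \<Union>\<C>" if "p \<in> \<Union>\<C>" "r \<in> A" for p r using that ideal ideal_inD(4) by blast
  qed (rule sum)
  then show "\<Union>\<C> \<in> \<A>" using \<C>(1) ideal by (auto simp: \<A>_def)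
 qed
 then obtain M where M: "ideal_in A M" "J \<subseteq> M" "M \<inter> S = {}" and maximal: "\<forall>M'\<in>\<A>. M \<subseteq> M' --> M' = M"
  unfolding \<A>_def by blast
 have "M' = M" if "ideal_in A M'" "M \<subseteq> M'" "M' \<inter> S = {}" for M'
  using bspec[OF maximal, of M'] that M(2) unfolding \<A>_def by auto
 then have "maximal_disjoint_ideal A S M" using assms(1-4) M(1,3) by unfold_locales auto
 then show ?thesis using M(2) by (rule that)
qed

context maximal_disjoint_ideal
begin

lemmas MD = ideal_inD[OF M(1)]

lemma meets_S:
 assumes a: "a \<in> A" "a \<notin> M" obtains s j r where "s \<in> S" "j \<in> M" "r \<in> A" "s = j + r * a"
proof -
 define M' where "M' = {j + r * a | j r. j \<in> M & r \<in> A}"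
 note AD = subring_setD[OF A]
 have "ideal_in A M'"
  unfolding ideal_in_def
 proof (intro conjI ballI)
  show "M' \<subseteq> A" using MD(1) AD a(1) by (auto simp: M'_def)
  show "0 \<in> M'" unfolding M'_def using MD(2) AD(1) by force
  show "p + q \<in> M'" if pq: "p \<in> M'" "q \<in> M'" for p q
  proof -
   obtain j r j' r' where "p = j + r * a" "q = j' + r' * a" "j \<in> M" "j' \<in> M" "r \<in> A" "r' \<in> A"
    using pq by (auto simp: M'_def)
   then show ?thesis unfolding M'_def using MD(3) AD(3)
    by (intro CollectI exI[of _ "j + j'"] exI[of _ "r + r'"]) (auto simp: algebra_simps)
  qed
  show "t * p \<in> M'" if pt: "p \<in> M'" "t \<in> A" for p t
  proof -
   obtain j r where "p = j + r * a" "j \<in> M" "r \<in> A" using pt by (auto simp: M'_def)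
   then show ?thesis unfolding M'_def using MD(4) AD(4) pt(2)
    by (intro CollectI exI[of _ "t * j"] exI[of _ "t * r"]) (auto simp: algebra_simps)
  qed
 qed
 moreover have "M \<subseteq> M'" unfolding M'_def using AD(1) by force
 moreover have "a \<in> M'" unfolding M'_def using MD(2) AD(2) by force
 ultimately have "M' \<inter> S ~= {}" using maximal[of M'] a(2) by blast
 then show ?thesis using that by (auto simp: M'_def)
qed

lemma prime:
 assumes pq: "p \<in> A" "q \<in> A" "p * q \<in> M" shows "p \<in> M \<or> q \<in> M"
proof (rule ccontr)
 assume "\<not> ?thesis"
 then have notin: "p \<notin> M" "q \<notin> M" by auto
 obtain s j r where s: "s \<in> S" "j \<in> M" "r \<in> A" "s = j + r * p" using meets_S[OF pq(1) notin(1)] .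
 obtain s' j' r' where s': "s' \<in> S" "j' \<in> M" "r' \<in> A" "s' = j' + r' * q" using meets_S[OF pq(2) notin(2)] .
 note AD = subring_setD[OF A]
 have "s * j' \<in> M" "(r' * q) * j \<in> M" "(r * r') * (p * q) \<in> M"
  using MD(4) s(2) s'(2) pq S(1) s(1,3) s'(3) AD(4) by auto
 then have "s * j' + ((r' * q) * j + (r * r') * (p * q)) \<in> M" using MD(3) by blast
 moreover have "s * j' + ((r' * q) * j + (r * r') * (p * q)) = s * s'" by (simp add: s(4) s'(4) algebra_simps)
 ultimately show False using M(2) S(3)[OF s(1) s'(1)] by auto
qed

end

text \<open>The residue field of such an ideal of regular functions has countable dimension if \<open>S\<close> is countable,
 hence is \<open>complex\<close>, and the residues of the matrix entries define a point.\<close>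

locale nullstellensatz = maximal_disjoint_ideal "poly_fun UNIV :: (complex^'n^'n => complex) set" S M for S M +
 assumes countable_S: "countable S"
begin

lemma const_notin_M: assumes "c ~= 0" shows "(%_. c) \<notin> M"
proof
 assume "(%_. c) \<in> M"
 from MD(4)[OF this regular_const[of "1 / c"]] have "1 \<in> M" using assms by (simp add: times_fun_def one_fun_def)
 then show False using S(2) M(2) by blast
qed

lemma regular_minus_const: "x \<in> regular ==> x - (%_. a) \<in> regular"
 by (intro subring_diff[OF subring_regular] regular_const)

lemma algebraic_residue:
 assumes x: "x \<in> regular" and "w ~= 0" "(%X. poly w (x X)) \<in> M" shows "\<exists>a. x - (%_. a) \<in> M"
 using assms(2,3)
proof (induction "degree w" arbitrary: w)
 case 0
 then obtain c where "w = [:c:]" by (metis degree_eq_zeroE)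
 then show ?case using 0 const_notin_M[of c] by auto
next
 case (Suc n)
 then have "\<not> constant (poly w)" by (simp add: constant_degree)
 then obtain l where "poly w l = 0" using fundamental_theorem_of_algebra by blast
 then obtain q where q: "w = [:- l, 1:] * q" by (auto simp: poly_eq_0_iff_dvd)
 have q0: "q ~= 0" using Suc.prems q by auto
 have dq: "n = degree q" using Suc.hyps(2) q0 unfolding q by (subst (asm) degree_mult_eq) auto
 have "(x - (%_. l)) * (%X. poly q (x X)) \<in> M" using Suc.prems(2) unfolding q by (simp add: algebra_simps times_fun_def)
 then have "x - (%_. l) \<in> M \<or> (%X. poly q (x X)) \<in> M"
  by (rule prime[OF regular_minus_const[OF x] regular_poly[OF x]])
 then show ?case using Suc.hyps(1)[OF dq q0] by blast
qed

lemma inverse_combination_in_M: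
 assumes x: "x \<in> regular" and T: "finite T" and s: "s \<in> S"
  and eq: "!!c. c \<in> T ==> j c \<in> M & s = j c + q c * (x - (%_. e c))"
  and rel: "!!X. (\<Sum>c\<in>T. \<gamma> c * q c X) = 0"
 shows "(%X. poly (\<Sum>c\<in>T. smult (\<gamma> c) (\<Prod>b\<in>T - {c}. [:- e b, 1:])) (x X)) \<in> M"
proof -
 define L where "L c X = \<gamma> c * (\<Prod>b\<in>T - {c}. x X - e b)" for c X
 let ?w = "\<Sum>c\<in>T. smult (\<gamma> c) (\<Prod>b\<in>T - {c}. [:- e b, 1:])"
 have L: "L c \<in> regular" for c
  unfolding L_def using regular_minus_const[OF x]
  by (intro regular_scale regular_prod) (simp add: fun_diff_def)
 have "s X * poly ?w (x X) = (\<Sum>c\<in>T. L c X * j c X)" for X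
 proof -
  have "s X * poly ?w (x X) = (\<Sum>c\<in>T. L c X * s X)" by (simp add: poly_sum poly_prod L_def sum_distrib_left mult_ac)
  also have "... = (\<Sum>c\<in>T. L c X * j c X + (\<Prod>b\<in>T. x X - e b) * (\<gamma> c * q c X))"
  proof (rule sum.cong[OF refl])
   fix c assume c: "c \<in> T"
   have prod: "(\<Prod>b\<in>T. x X - e b) = (x X - e c) * (\<Prod>b\<in>T - {c}. x X - e b)" using T c by (rule prod.remove)
   have sX: "s X = j c X + q c X * (x X - e c)" using eq[OF c] by simp
   show "L c X * s X = L c X * j c X + (\<Prod>b\<in>T. x X - e b) * (\<gamma> c * q c X)"
    unfolding prod sX L_def by (simp only: ring_distribs mult_ac)
  qed
  also have "... = (\<Sum>c\<in>T. L c X * j c X) + (\<Prod>b\<in>T. x X - e b) * (\<Sum>c\<in>T. \<gamma> c * q c X)"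
   by (simp only: sum.distrib sum_distrib_left)
  finally show ?thesis using rel by simp
 qed
 then have "s * (%X. poly ?w (x X)) = (\<Sum>c\<in>T. L c * j c)" by (simp add: fun_eq_iff cfun_sum)
 moreover have "(\<Sum>c\<in>T. L c * j c) \<in> M" using eq MD(4)[OF _ L] by (intro ideal_in_sum[OF M(1)]) auto
 ultimately have "s * (%X. poly ?w (x X)) \<in> M" by simp
 then show ?thesis using prime[OF _ regular_poly[OF x]] s S(1) M(2) by blast
qed

lemma residue_exists:
 assumes x: "x \<in> regular" shows "\<exists>a. x - (%_. a) \<in> M"
proof (rule ccontr)
 assume no: "\<not> ?thesis"
 have "\<exists>s j q. s \<in> S & j \<in> M & q \<in> regular & s = j + q * (x - (%_. complex_of_real c))" for c
  using meets_S[OF regular_minus_const[OF x]] no by metis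
 then obtain s j q where sjq: "!!c. s c \<in> S" "!!c. j c \<in> M" "!!c. q c \<in> regular"
  "!!c. s c = j c + q c * (x - (%_. complex_of_real c))" by metis
 have "\<exists>B. finite B & B \<subseteq> range monomial & q c \<in> cfun.span B" for c
  using regular_span_monomial[OF sjq(3)[of c]] unfolding cfun.span_explicit by blast
 then obtain B where B: "!!c. finite (B c)" "!!c. B c \<subseteq> range monomial" "!!c. q c \<in> cfun.span (B c)" by metis
 let ?index = "S \<times> {B. finite B & B \<subseteq> range monomial}"
 have countable: "countable ?index" using countable_S by (intro countable_SIGMA countable_Collect_finite_subset) auto
 have "c \<in> (\<Union>i\<in>?index. {c. (s c, B c) = i})" for c
  by (rule UN_I[of "(s c, B c)"]) (use sjq(1) B(1,2) in auto)
 then have cover: "(\<Union>i\<in>?index. {c. (s c, B c) = i}) = UNIV" by blast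
 have "\<not> (\<forall>i\<in>?index. countable {c. (s c, B c) = i})"
 proof
  assume "\<forall>i\<in>?index. countable {c. (s c, B c) = i}"
  then have "countable (\<Union>i\<in>?index. {c. (s c, B c) = i})" by (intro countable_UN[OF countable]) (rule bspec)
  then show False unfolding cover using uncountable_UNIV_real by contradiction
 qed
 then obtain i where "infinite {c. (s c, B c) = i}" using countable_finite by blast
 then obtain s0 B0 where "infinite {c. s c = s0 & B c = B0}" by (cases i) auto
 then obtain T where T: "finite T" "card T = Suc (card B0)" "T \<subseteq> {c. s c = s0 & B c = B0}"
  using infinite_arbitrarily_large by blast
 have "T ~= {}" using T(2) by auto
 then have B0: "finite B0" "s0 \<in> S" using T(3) B(1) sjq(1) by auto
 have "q c \<in> cfun.span B0" if "c \<in> T" for c using B(3)[of c] T(3) that by auto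
 then obtain \<gamma> where \<gamma>: "\<exists>c\<in>T. \<gamma> c ~= 0" "\<forall>X. (\<Sum>c\<in>T. \<gamma> c * q c X) = 0"
  using span_family_dependent[OF T(1) B0(1), of q] T(2) by auto
 let ?w = "\<Sum>c\<in>T. smult (\<gamma> c) (\<Prod>b\<in>T - {c}. [:- complex_of_real b, 1:])"
 have "?w ~= 0" using \<gamma>(1) lagrange_combination_nonzero[OF T(1), of complex_of_real] by (auto simp: inj_on_def)
 moreover have "(%X. poly ?w (x X)) \<in> M"
 proof (rule inverse_combination_in_M[OF x T(1) B0(2)])
  show "j c \<in> M & s0 = j c + q c * (x - (%_. complex_of_real c))" if "c \<in> T" for c
   using sjq(2)[of c] sjq(4)[of c] T(3) that by auto
 qed (use \<gamma>(2) in blast)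
 ultimately show False using algebraic_residue[OF x] no by blast
qed

lemma common_zero: "\<exists>a. (\<forall>p\<in>M. p a = 0) & (\<forall>s\<in>S. s a ~= 0)"
proof -
 have "\<forall>i k. \<exists>c. (%X :: complex^'n^'n. X $ i $ k) - (%_. c) \<in> M" using residue_exists[OF poly_fun.entry] by blast
 then obtain c where c: "!!i k. (%X :: complex^'n^'n. X $ i $ k) - (%_. c i k) \<in> M" by metis
 define a :: "complex^'n^'n" where "a = (\<chi> i k. c i k)"
 have residue: "p - (%_. p a) \<in> M" if "p \<in> regular" for p
  using that
 proof (induction rule: poly_fun.induct)
  case (const c)
  then show ?case using MD(2) by (simp add: zero_fun_def fun_diff_def)
 next
  case (entry i k)
  then show ?case using c[of i k] by (simp add: a_def fun_diff_def)
 next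
  case (add p q)
  from MD(3)[OF add.IH] show ?case by (simp add: fun_diff_def plus_fun_def algebra_simps)
 next
  case (mult p q)
  from MD(3)[OF MD(4)[OF mult.IH(1) mult.hyps(2)] MD(4)[OF mult.IH(2) regular_const[of "p a"]]] show ?case by (simp add: fun_diff_def plus_fun_def times_fun_def algebra_simps)
 qed
 have "p a = 0" if p: "p \<in> M" for p
 proof (rule ccontr)
  assume "p a ~= 0"
  have "(%_. - 1) * (p - (%_. p a)) \<in> M" using MD(4)[OF residue[OF MD(1)[OF p]] regular_const] .
  from MD(3)[OF p this] have "(%_. p a) \<in> M" by (simp add: fun_diff_def plus_fun_def times_fun_def)
  then show False using const_notin_M[OF \<open>p a ~= 0\<close>] by simp
 qed
 moreover have "s a ~= 0" if s: "s \<in> S" for s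
 proof
  assume "s a = 0"
  moreover have "s - (%_. s a) \<in> M" using residue s S(1) by blast
  ultimately have "s \<in> M" by (simp add: fun_diff_def)
  then show False using s M(2) by blast
 qed
 ultimately show ?thesis by blast
qed

end

lemma irreducible_nonzero_prod:
 assumes C: "C \<subseteq> GL_set" "C ~= {}"
  and irr: "!!A B. closedin zariski A ==> closedin zariski B ==> C \<subseteq> A \<union> B ==> C \<subseteq> A \<or> C \<subseteq> B"
  and L: "!!h. h \<in> L ==> h \<in> regular & (\<exists>X\<in>C. h X ~= 0)"
 shows "hs \<in> lists L ==> prod_list hs \<in> regular & (\<exists>X\<in>C. prod_list hs X ~= 0)"
proof (induction hs)
 case Nil
 then show ?case using C(2) regular_const[of 1] by (auto simp: one_fun_def)
next
 case (Cons h hs)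
 have h: "h \<in> regular" "\<exists>X\<in>C. h X ~= 0" using L Cons.prems by auto
 have hs: "prod_list hs \<in> regular" "\<exists>X\<in>C. prod_list hs X ~= 0" using Cons by auto
 have closed: "closedin zariski (zero_locus {h})" "closedin zariski (zero_locus {prod_list hs})"
  using h(1) hs(1) closedin_zariski by blast+
 have "\<exists>X\<in>C. h X * prod_list hs X ~= 0"
 proof (rule ccontr)
  assume "\<not> ?thesis"
  then have "C \<subseteq> zero_locus {h} \<union> zero_locus {prod_list hs}" using C(1) by (auto simp: zero_locus_def)
  from irr[OF closed this] show False using h(2) hs(2) by (auto simp: zero_locus_def)
 qed
 then show ?case using poly_fun.mult[OF h(1) hs(1)] by (auto simp: times_fun_def)
qed

lemma irreducible_countable_cover:
 fixes C :: "(complex^'n^'n) set"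
 assumes C: "closedin zariski C" "C ~= {}"
  and irr: "!!A B. closedin zariski A ==> closedin zariski B ==> C \<subseteq> A \<union> B ==> C \<subseteq> A \<or> C \<subseteq> B"
  and D: "countable \<D>" "!!D. D \<in> \<D> ==> closedin zariski D" "C \<subseteq> \<Union>\<D>"
 shows "\<exists>D\<in>\<D>. C \<subseteq> D"
proof (rule ccontr)
 assume no: "\<not> ?thesis"
 have GL: "C \<subseteq> GL_set" using closedin_subset[OF C(1)] by simp
 obtain P where P: "P \<subseteq> regular" "C = zero_locus P" using C(1) closedin_zariski by blast
 have "\<exists>f\<in>regular. (\<forall>X\<in>D. f X = 0) & (\<exists>X\<in>C. f X ~= 0)" if D_in: "D \<in> \<D>" for D
 proof -
  obtain Q where Q: "Q \<subseteq> regular" "D = zero_locus Q" using D(2)[OF D_in] closedin_zariski by blast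
  obtain X where X: "X \<in> C" "X \<notin> D" using no D_in by blast
  then obtain f where "f \<in> Q" "f X ~= 0" using GL unfolding Q(2) zero_locus_def by blast
  then show ?thesis using Q X(1) by (intro bexI[of _ f]) (auto simp: zero_locus_def)
 qed
 then obtain f where f: "!!D. D \<in> \<D> ==> f D \<in> regular & (\<forall>X\<in>D. f D X = 0) & (\<exists>X\<in>C. f D X ~= 0)" by metis
 define L where "L = insert det (f ` \<D>)"
 have "h \<in> regular & (\<exists>X\<in>C. h X ~= 0)" if "h \<in> L" for h
  using that f regular_det C(2) GL unfolding L_def by (auto simp: invertible_det_nz)
 note prod = irreducible_nonzero_prod[OF GL C(2) irr this]
 let ?S = "prod_list ` lists L" and ?J = "{p \<in> regular. \<forall>X\<in>C. p X = 0}"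
 have J: "ideal_in regular ?J"
  unfolding ideal_in_def using subring_setD[OF subring_regular] by auto
 have S: "?S \<subseteq> regular" "?J \<inter> ?S = {}" using prod by auto
 have S_one: "1 \<in> ?S" by (rule image_eqI[of _ _ "[]"]) auto
 have S_mult: "s * t \<in> ?S" if "s \<in> ?S" "t \<in> ?S" for s t
  using that by (auto simp: image_iff intro!: bexI[of _ "_ @ _"])
 obtain M where max_M: "maximal_disjoint_ideal regular ?S M" "?J \<subseteq> M"
  using maximal_disjoint_ideal_exists[OF subring_regular S(1) S_one S_mult J S(2)] .
 have "countable ?S" unfolding L_def using D(1) by (intro countable_image countable_lists countable_insert)
 then interpret nullstellensatz ?S M using max_M(1) by (simp add: nullstellensatz_def nullstellensatz_axioms_def)
 obtain a where a: "\<forall>p\<in>M. p a = 0" "\<forall>s\<in>?S. s a ~= 0" using common_zero by blast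
 have L: "h a ~= 0" if "h \<in> L" for h using a(2) that by (auto dest!: bspec[of _ _ "[h]"])
 have "a \<in> GL_set" using L[of det] by (auto simp: L_def invertible_det_nz)
 moreover have "p a = 0" if "p \<in> P" for p using a(1) max_M(2) P that by (auto simp: zero_locus_def)
 ultimately have "a \<in> C" unfolding P(2) zero_locus_def by auto
 then obtain D where "D \<in> \<D>" "a \<in> D" using D(3) by blast
 then show False using f[of D] L[of "f D"] by (auto simp: L_def)
qed

section \<open>Zariski closures of semigroups\<close>

lemma regular_left: "p \<in> regular ==> (%X. p ((A :: complex^'n^'n) ** X)) \<in> regular"
proof (induction rule: poly_fun.induct)
 case (entry i j)
 show ?case unfolding matrix_matrix_mult_def by (simp, intro regular_sum regular_scale poly_fun.entry)
qed (auto intro: poly_fun.intros)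

lemma regular_right: "p \<in> regular ==> (%X. p (X ** (A :: complex^'n^'n))) \<in> regular"
proof (induction rule: poly_fun.induct)
 case (entry i j)
 show ?case unfolding matrix_matrix_mult_def by (simp, intro regular_sum poly_fun.mult poly_fun.entry regular_const)
qed (auto intro: poly_fun.intros)

lemma regular_continuous: "p \<in> regular ==> continuous_on UNIV (p :: complex^'n^'n => complex)"
 by (induction rule: poly_fun.induct) (auto intro!: continuous_intros)

lemma closed_left_preimage:
 assumes "closedin zariski C" "invertible A"
 shows "closedin zariski {X \<in> GL_set. A ** X \<in> (C :: (complex^'n^'n) set)}"
proof -
 obtain P where P: "P \<subseteq> regular" "C = zero_locus P" using assms(1) closedin_zariski by blast
 let ?Q = "(%p X. p (A ** X)) ` P"
 have "?Q \<subseteq> regular" using P(1) regular_left by blast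
 moreover have "{X \<in> GL_set. A ** X \<in> C} = zero_locus ?Q"
  unfolding P(2) zero_locus_def using assms(2) by (auto simp: invertible_mult)
 ultimately show ?thesis using closedin_zariski by blast
qed

lemma closed_right_preimage:
 assumes "closedin zariski C" "invertible A"
 shows "closedin zariski {X \<in> GL_set. X ** A \<in> (C :: (complex^'n^'n) set)}"
proof -
 obtain P where P: "P \<subseteq> regular" "C = zero_locus P" using assms(1) closedin_zariski by blast
 let ?Q = "(%p X. p (X ** A)) ` P"
 have "?Q \<subseteq> regular" using P(1) regular_right by blast
 moreover have "{X \<in> GL_set. X ** A \<in> C} = zero_locus ?Q"
  unfolding P(2) zero_locus_def using assms(2) by (auto simp: invertible_mult)
 ultimately show ?thesis using closedin_zariski by blast
qed

lemma matrix_subgroup_inverse: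
 assumes M: "group (matrix_group M)" and N: "subgroup N (matrix_group M)" and X: "X \<in> N"
 shows "\<exists>Y\<in>N. X ** Y = mat 1 & Y ** X = (mat 1 :: complex^'n^'n)"
proof -
 let ?Y = "inv\<^bsub>matrix_group M\<^esub> X"
 have "X \<otimes>\<^bsub>matrix_group M\<^esub> ?Y = \<one>\<^bsub>matrix_group M\<^esub>" "?Y \<otimes>\<^bsub>matrix_group M\<^esub> X = \<one>\<^bsub>matrix_group M\<^esub>"
  using subgroup.mem_carrier[OF N X] by (simp_all add: group.l_inv[OF M] group.r_inv[OF M])
 then show ?thesis using subgroup.m_inv_closed[OF N X] by (auto simp: matrix_group_def)
qed

lemma alg_groupI:
 fixes C :: "(complex^'n^'n) set"
 assumes closed: "closedin zariski C" and one: "mat 1 \<in> C" and mult: "!!X Y. X \<in> C ==> Y \<in> C ==> X ** Y \<in> C"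
  and inverse: "!!X. X \<in> C ==> \<exists>Y\<in>C. X ** Y = mat 1 & Y ** X = mat 1"
 shows "linear_algebraic_group C"
proof -
 have GL: "C \<subseteq> GL_set" using closedin_subset[OF closed] by simp
 have "inv\<^bsub>matrix_group GL_set\<^esub> X \<in> C" if X: "X \<in> C" for X
 proof -
  obtain Y where Y: "Y \<in> C" "X ** Y = mat 1" "Y ** X = mat 1" using inverse[OF X] by blast
  have "inv\<^bsub>matrix_group GL_set\<^esub> X = Y"
   by (rule group.inv_equality[OF group_GL]) (use X Y GL in \<open>auto simp: matrix_group_def\<close>)
  then show ?thesis using Y(1) by simp
 qed
 then have "subgroup C (matrix_group GL_set)"
  by (intro group.subgroupI[OF group_GL]) (use GL one mult in \<open>auto simp: matrix_group_def\<close>)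
 then show ?thesis using closed by (simp add: linear_algebraic_group_def)
qed

lemma alg_groupD:
 fixes C :: "(complex^'n^'n) set"
 assumes C: "linear_algebraic_group C"
 shows "closedin zariski C" "mat 1 \<in> C" "X \<in> C ==> Y \<in> C ==> X ** Y \<in> C"
  "X \<in> C ==> \<exists>Y\<in>C. X ** Y = mat 1 & Y ** X = mat 1" "X \<in> C ==> invertible X"
proof -
 have sub: "subgroup C (matrix_group GL_set)" using C by (simp add: linear_algebraic_group_def)
 show closed: "closedin zariski C" using C by (simp add: linear_algebraic_group_def)
 show "mat 1 \<in> C" using subgroup.one_closed[OF sub] by (simp add: matrix_group_def)
 show "X \<in> C ==> Y \<in> C ==> X ** Y \<in> C" using subgroup.m_closed[OF sub] by (simp add: matrix_group_def)
 show "X \<in> C ==> \<exists>Y\<in>C. X ** Y = mat 1 & Y ** X = mat 1" by (rule matrix_subgroup_inverse[OF group_GL sub])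
 show "X \<in> C ==> invertible X" using closedin_subset[OF closed] by auto
qed

lemma alg_group_inverse:
 assumes C: "linear_algebraic_group C" and X: "X \<in> C" and Y: "X ** Y = mat 1 \<or> Y ** X = mat 1" shows "Y \<in> C"
 using alg_groupD(4)[OF C X] Y by (metis matrix_mul_assoc matrix_mul_lid matrix_mul_rid)

lemma matrix_pow_cancel:
 assumes "Y ** X = mat 1" shows "matrix_pow Y k ** matrix_pow X k = (mat 1 :: complex^'n^'n)"
proof -
 have "Cm Y * Cm X = 1" by (rule cmat_eqI) (simp add: assms)
 then have "Cm Y ^ k * Cm X ^ k = 1"
 proof (induction k)
  case (Suc k)
  have "Cm Y ^ Suc k * Cm X ^ Suc k = Cm Y ^ k * (Cm Y * Cm X) * Cm X ^ k"
   by (simp add: power_Suc2[of "Cm Y"] mult.assoc del: power_Suc) simp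
  then show ?case using Suc by simp
 qed simp
 then have "rep (Cm Y ^ k * Cm X ^ k) = mat 1" by simp
 then show ?thesis by (simp add: rep_power)
qed

lemma zariski_closure_mult:
 assumes S: "S \<subseteq> GL_set" "!!X Y. X \<in> S ==> Y \<in> S ==> X ** Y \<in> (S :: (complex^'n^'n) set)"
  and XY: "X \<in> zariski closure_of S" "Y \<in> zariski closure_of S"
 shows "X ** Y \<in> zariski closure_of S"
proof -
 let ?L = "zariski closure_of S"
 have closed: "closedin zariski ?L" by simp
 have GL: "?L \<subseteq> GL_set" using closedin_subset[OF closed] by simp
 have S_L: "S \<subseteq> ?L" using S(1) by (intro closure_of_subset) simp
 have left: "s ** Z \<in> ?L" if s: "s \<in> S" and Z: "Z \<in> ?L" for s Z
 proof -
  have "closedin zariski {Z \<in> GL_set. s ** Z \<in> ?L}" using S(1) s by (intro closed_left_preimage[OF closed]) auto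
  then have "?L \<subseteq> {Z \<in> GL_set. s ** Z \<in> ?L}" using S S_L s by (intro closure_of_minimal) blast
  then show ?thesis using Z by blast
 qed
 have "closedin zariski {Z \<in> GL_set. Z ** Y \<in> ?L}" using GL XY(2) by (intro closed_right_preimage[OF closed]) auto
 then have "?L \<subseteq> {Z \<in> GL_set. Z ** Y \<in> ?L}" using S(1) left XY(2) by (intro closure_of_minimal) blast
 then show ?thesis using XY(1) by blast
qed

text \<open>The closed sets \<open>X\<^sup>k L\<close> decrease, so they are eventually constant.\<close>

lemma zariski_closed_semigroup_inverse:
 assumes L: "closedin zariski L" "mat 1 \<in> L" "!!X Y. X \<in> L ==> Y \<in> L ==> X ** Y \<in> (L :: (complex^'n^'n) set)"
  and X: "X \<in> L" and Y: "X ** Y = mat 1" "Y ** X = mat 1"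
 shows "Y \<in> L"
proof -
 have pow: "invertible (matrix_pow X k)" "invertible (matrix_pow Y k)" for k
  using matrix_pow_cancel[OF Y(1), of k] matrix_pow_cancel[OF Y(2), of k] by (auto simp: invertible_def)
 define C where "C k = {Z \<in> GL_set. matrix_pow Y k ** Z \<in> L}" for k
 have "closedin zariski (C k)" for k unfolding C_def by (rule closed_left_preimage[OF L(1) pow(2)])
 moreover have "C (Suc k) \<subseteq> C k" for k
 proof
  fix Z assume "Z \<in> C (Suc k)"
  then have Z: "Z \<in> GL_set" "Y ** matrix_pow Y k ** Z \<in> L" by (auto simp: C_def)
  have "matrix_pow Y k ** Z \<in> L" using L(3)[OF X Z(2)] by (simp add: matrix_mul_assoc Y(1))
  then show "Z \<in> C k" using Z(1) by (simp add: C_def)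
 qed
 ultimately obtain k where k: "C (Suc k) = C k" using zariski_descending_chain[of C] by blast
 have "matrix_pow X k \<in> C k" using pow L(2) matrix_pow_cancel[OF Y(2), of k] by (simp add: C_def)
 then have "Y ** matrix_pow Y k ** matrix_pow X k \<in> L" unfolding k[symmetric] by (simp add: C_def)
 then show ?thesis using matrix_pow_cancel[OF Y(2), of k] by (simp add: matrix_mul_assoc[symmetric])
qed

lemma alg_group_closure:
 assumes S: "S \<subseteq> GL_set" "mat 1 \<in> S" "!!X Y. X \<in> S ==> Y \<in> S ==> X ** Y \<in> (S :: (complex^'n^'n) set)"
 shows "linear_algebraic_group (zariski closure_of S)"
proof -
 let ?L = "zariski closure_of S"
 have closed: "closedin zariski ?L" by simp
 note mult = zariski_closure_mult[OF S(1,3)]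
 have one: "mat 1 \<in> ?L" using S(1,2) closure_of_subset[of S zariski] by auto
 have "\<exists>Y\<in>?L. X ** Y = mat 1 & Y ** X = mat 1" if X: "X \<in> ?L" for X
 proof -
  obtain Y where "X ** Y = mat 1" "Y ** X = mat 1"
   using X closedin_subset[OF closed] by (auto simp: invertible_def)
  then show ?thesis using zariski_closed_semigroup_inverse[OF closed one mult X] by blast
 qed
 then show ?thesis using alg_groupI[OF closed one mult] by blast
qed

section \<open>The Lie algebra of an algebraic group\<close>

definition lie :: "(complex^'n^'n) set => 'n cmat set" where
 "lie C = {v. \<forall>s. rep (exp (smat s * v)) \<in> C}"

lemma lie_scale: "v \<in> lie C ==> smat c * v \<in> lie C"
 unfolding lie_def by (simp add: mult.assoc[symmetric] smat_mult[symmetric])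

lemma lie_scaleR: "v \<in> lie C ==> r *\<^sub>R v \<in> lie C"
 using lie_scale[of v C "of_real r"] by (simp add: smat_of_real)

lemma lie_exp: "v \<in> lie C ==> rep (exp v) \<in> C"
proof -
 assume "v \<in> lie C"
 then have "\<forall>s. rep (exp (smat s * v)) \<in> C" by (simp add: lie_def)
 then have "rep (exp (smat 1 * v)) \<in> C" by (rule spec)
 then show ?thesis by (simp add: smat_simps)
qed

lemma zero_locus_limit:
 assumes C: "closedin zariski C" and X: "!!k::nat. X k \<in> C" "X \<longlonglongrightarrow> L" "invertible (L :: complex^'n^'n)"
 shows "L \<in> C"
proof -
 obtain P where P: "P \<subseteq> regular" "C = zero_locus P" using C closedin_zariski by blast
 have "p L = 0" if p: "p \<in> P" for p
 proof -
  have "isCont p L" using regular_continuous[of p] P(1) p by (auto simp: continuous_on_eq_continuous_at)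
  then have "(%k. p (X k)) \<longlonglongrightarrow> p L" using X(2) by (rule isCont_tendsto_compose)
  moreover have "p (X k) = 0" for k using X(1)[of k] p unfolding P(2) zero_locus_def by simp
  ultimately show ?thesis by (simp add: LIMSEQ_const_iff)
 qed
 then show ?thesis using X(3) unfolding P(2) zero_locus_def by simp
qed

lemma power_diff_norm:
 fixes x y :: "'a::real_normed_algebra_1"
 assumes "norm x <= B" "norm y <= B" "1 <= B" shows "norm (x ^ k - y ^ k) <= real k * B ^ k * norm (x - y)"
proof (induction k)
 case (Suc k)
 have "x ^ Suc k - y ^ Suc k = x * (x ^ k - y ^ k) + (x - y) * y ^ k" by (simp add: algebra_simps)
 then have "norm (x ^ Suc k - y ^ Suc k) <= norm x * norm (x ^ k - y ^ k) + norm (x - y) * norm (y ^ k)"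
  by (metis norm_triangle_le add_mono norm_mult_ineq)
 also have "... <= B * (real k * B ^ k * norm (x - y)) + norm (x - y) * B ^ Suc k"
 proof (intro add_mono mult_mono Suc.IH assms mult_left_mono)
  have "norm (y ^ k) <= norm y ^ k" by (rule norm_power_ineq)
  also have "... <= B ^ k" using assms(2) by (intro power_mono) auto
  also have "... <= B ^ Suc k" using assms(3) by (intro power_increasing) auto
  finally show "norm (y ^ k) <= B ^ Suc k" .
 qed (use assms in auto)
 also have "... = real (Suc k) * B ^ Suc k * norm (x - y)" by (simp add: algebra_simps)
 finally show ?case .
qed simp

lemma exp_difference_quotient:
 "(%k. real k *\<^sub>R (exp ((1 / real k) *\<^sub>R a) - 1)) \<longlonglongrightarrow> (a :: 'n::finite cmat)"
proof -
 have "(%k. real k *\<^sub>R (exp ((1 / real k) *\<^sub>R a) - 1) - a) \<longlonglongrightarrow> 0"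
 proof (rule Lim_null_comparison)
  have "\<forall>\<^sub>F k in sequentially. norm a + 1 <= real k" by (rule filterlim_real_sequentially[unfolded filterlim_at_top, rule_format])
  then show "\<forall>\<^sub>F k in sequentially. norm (real k *\<^sub>R (exp ((1 / real k) *\<^sub>R a) - 1) - a) <= (norm a)\<^sup>2 * (1 / real k)"
  proof (rule eventually_mono)
   fix k assume k: "norm a + 1 <= real k"
   then have k0: "real k > 0" using norm_ge_zero[of a] by linarith
   let ?x = "(1 / real k) *\<^sub>R a"
   have "norm ?x <= 1" using k k0 by (simp add: field_simps)
   from norm_exp_remainder[OF this] have "norm (exp ?x - 1 - ?x) <= (norm ?x)\<^sup>2" .
   moreover have "real k *\<^sub>R (exp ?x - 1) - a = real k *\<^sub>R (exp ?x - 1 - ?x)"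
    using k0 by (simp add: scaleR_diff_right)
   ultimately have "norm (real k *\<^sub>R (exp ?x - 1) - a) <= real k * (norm ?x)\<^sup>2" using k0 by simp
   also have "... = (norm a)\<^sup>2 * (1 / real k)" using k0 by (simp add: power2_eq_square field_simps)
   finally show "norm (real k *\<^sub>R (exp ?x - 1) - a) <= (norm a)\<^sup>2 * (1 / real k)" .
  qed
  show "(%k. (norm a)\<^sup>2 * (1 / real k)) \<longlonglongrightarrow> 0"
   using tendsto_mult[OF tendsto_const lim_1_over_n, of "(norm a)\<^sup>2"] by simp
 qed
 then show ?thesis by (simp add: LIM_zero_iff)
qed

lemma scaled_limit_imp_limit:
 fixes x :: "nat => 'a::real_normed_vector"
 assumes "(%k. real k *\<^sub>R (x k - c)) \<longlonglongrightarrow> w" shows "x \<longlonglongrightarrow> c"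
proof -
 have "(%k. (1 / real k) *\<^sub>R (real k *\<^sub>R (x k - c))) \<longlonglongrightarrow> 0 *\<^sub>R w"
  by (intro tendsto_intros assms lim_1_over_n)
 moreover have "\<forall>\<^sub>F k in sequentially. (1 / real k) *\<^sub>R (real k *\<^sub>R (x k - c)) = x k - c"
  using eventually_gt_at_top[of 0] by eventually_elim simp
 ultimately have "(%k. x k - c) \<longlonglongrightarrow> 0" by (simp add: tendsto_cong)
 then show ?thesis by (simp add: LIM_zero_iff)
qed

lemma eventually_norm_le_exp:
 fixes x :: "nat => 'a::real_normed_algebra_1"
 assumes x: "(%k. real k *\<^sub>R (x k - 1)) \<longlonglongrightarrow> w" and c: "norm w < c"
 shows "\<forall>\<^sub>F k in sequentially. norm (x k) <= exp (c / real k)"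
proof -
 have "\<forall>\<^sub>F k in sequentially. norm (real k *\<^sub>R (x k - 1)) < c" using tendsto_norm[OF x] c by (rule order_tendstoD)
 then show ?thesis using eventually_gt_at_top[of 0]
 proof eventually_elim
  case (elim k)
  have "real k * norm (x k - 1) < c" using elim(1) by (simp only: norm_scaleR abs_of_nat)
  then have "norm (x k - 1) <= c / real k" using elim(2) by (simp add: field_simps)
  then have "norm (x k) <= 1 + c / real k" using norm_triangle_ineq[of 1 "x k - 1"] by simp
  also have "... <= exp (c / real k)" by (rule exp_ge_add_one_self)
  finally show ?case .
 qed
qed

lemma power_diff_tendsto_0:
 fixes y z :: "nat => 'a::real_normed_algebra_1"
 assumes y: "(%k. real k *\<^sub>R (y k - 1)) \<longlonglongrightarrow> w" and z: "(%k. real k *\<^sub>R (z k - 1)) \<longlonglongrightarrow> w"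
 shows "(%k. z k ^ k - y k ^ k) \<longlonglongrightarrow> 0"
proof (rule Lim_null_comparison)
 define c where "c = norm w + 1"
 have c: "norm w < c" "0 <= c" by (simp_all add: c_def)
 show "\<forall>\<^sub>F k in sequentially. norm (z k ^ k - y k ^ k) <= exp c * norm (real k *\<^sub>R (z k - 1) - real k *\<^sub>R (y k - 1))"
  using eventually_norm_le_exp[OF z c(1)] eventually_norm_le_exp[OF y c(1)] eventually_gt_at_top[of 0]
 proof eventually_elim
  case (elim k)
  have "1 <= exp (c / real k)" using c(2) by simp
  from power_diff_norm[OF elim(1,2) this, of k]
  have "norm (z k ^ k - y k ^ k) <= real k * exp (c / real k) ^ k * norm (z k - y k)" .
  also have "exp (c / real k) ^ k = exp c" using elim(3) by (simp add: exp_of_nat_mult[symmetric])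
  also have "real k * exp c * norm (z k - y k) = exp c * norm (real k *\<^sub>R (z k - y k))" by simp
  also have "real k *\<^sub>R (z k - y k) = real k *\<^sub>R (z k - 1) - real k *\<^sub>R (y k - 1)" by (simp add: algebra_simps)
  finally show ?case .
 qed
 have "(%k. exp c * norm (real k *\<^sub>R (z k - 1) - real k *\<^sub>R (y k - 1))) \<longlonglongrightarrow> exp c * norm (w - w)"
  by (intro tendsto_intros z y)
 then show "(%k. exp c * norm (real k *\<^sub>R (z k - 1) - real k *\<^sub>R (y k - 1))) \<longlonglongrightarrow> 0" by simp
qed

lemma power_limit_exp:
 assumes z: "(%k. real k *\<^sub>R (z k - 1)) \<longlonglongrightarrow> (w :: 'n::finite cmat)"
 shows "(%k. z k ^ k) \<longlonglongrightarrow> exp w"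
proof -
 define y where "y k = exp ((1 / real k) *\<^sub>R w)" for k :: nat
 have "(%k. z k ^ k - y k ^ k) \<longlonglongrightarrow> 0"
  unfolding y_def by (rule power_diff_tendsto_0[OF exp_difference_quotient z])
 moreover have "\<forall>\<^sub>F k in sequentially. y k ^ k = exp w"
  using eventually_gt_at_top[of 0]
 proof eventually_elim
  case (elim k)
  have "of_nat k * ((1 / real k) *\<^sub>R w) = w" using elim by (simp add: of_nat_smat smat_of_real[of "real k", simplified])
  then show ?case unfolding y_def exp_power by simp
 qed
 then have "(%k. y k ^ k) \<longlonglongrightarrow> exp w" by (rule tendsto_eventually)
 ultimately have "(%k. (z k ^ k - y k ^ k) + y k ^ k) \<longlonglongrightarrow> 0 + exp w" by (rule tendsto_add)
 then show ?thesis by simp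
qed

lemma alg_group_power: "linear_algebraic_group C ==> rep x \<in> C ==> rep (x ^ k) \<in> C"
proof (induction k)
 case (Suc k)
 have "rep x ** rep (x ^ k) \<in> C" by (rule alg_groupD(3)) (use Suc in auto)
 then show ?case by simp
qed (simp add: alg_groupD(2))

lemma lie_of_exp_poly:
 fixes v :: "'n::finite cmat"
 assumes C: "linear_algebraic_group C" "C = zero_locus P" and x: "rep (exp (smat t * v)) \<in> C"
  and P: "!!p. p \<in> P ==> (%s. p (rep (exp (smat s * v)))) \<in> exp_poly S"
  and inj: "inj_on (%\<mu>. exp (\<mu> * t)) S" "t ~= 0"
 shows "v \<in> lie C"
proof -
 have "p (rep (exp (smat s * v))) = 0" if p: "p \<in> P" for p s
 proof (rule exp_poly_zero[where f="%s. p (rep (exp (smat s * v)))" and s=s, OF P[OF p] inj])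
  fix k :: nat
  have "exp (smat (of_nat k * t) * v) = exp (smat t * v) ^ k" by (simp add: exp_power of_nat_smat smat_mult mult.assoc)
  then have "rep (exp (smat (of_nat k * t) * v)) \<in> C" using alg_group_power[OF C(1) x, of k] by simp
  then show "p (rep (exp (smat (of_nat k * t) * v))) = 0" using p unfolding C(2) zero_locus_def by blast
 qed
 then show ?thesis unfolding lie_def C(2) zero_locus_def by (simp add: invertible_exp)
qed

lemma lie_of_additive_exponents:
 fixes v :: "'n::finite cmat"
 assumes C: "linear_algebraic_group C" and x: "rep (exp (smat t * v)) \<in> C"
  and \<Lambda>: "\<forall>i j. (%s. entry (exp (smat s * v)) i j) \<in> exp_poly \<Lambda>" "\<Lambda> \<subseteq> S"
  and S: "0 \<in> S" "!!\<mu> \<nu>. \<mu> \<in> S ==> \<nu> \<in> S ==> \<mu> + \<nu> \<in> S"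
  and inj: "inj_on (%\<mu>. exp (\<mu> * t)) S" "t ~= 0"
 shows "v \<in> lie C"
proof -
 obtain P where P: "P \<subseteq> regular" "C = zero_locus P" using alg_groupD(1)[OF C] closedin_zariski by blast
 show ?thesis
  by (rule lie_of_exp_poly[OF C P(2) x poly_fun_exp_poly[OF subsetD[OF P(1)] S exp_poly_mono[OF \<Lambda>(1)[rule_format] \<Lambda>(2)]] inj])
qed

lemma lie_realI:
 assumes C: "linear_algebraic_group C" and v: "real_spectrum v" and x: "rep (exp v) \<in> C" shows "v \<in> lie C"
proof -
 obtain \<Lambda> where "finite \<Lambda>" and \<Lambda>: "\<forall>l\<in>\<Lambda>. eigenvalue v l" "\<forall>i j. (%s. entry (exp (smat s * v)) i j) \<in> exp_poly \<Lambda>"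
  using exp_entries_exp_poly .
 have sub: "\<Lambda> \<subseteq> \<real>" using \<Lambda>(1) v unfolding real_spectrum_def by blast
 have inj: "inj_on (%\<mu>::complex. exp (\<mu> * 1)) \<real>" by (auto simp: inj_on_def Reals_def exp_of_real)
 show ?thesis
  by (rule lie_of_additive_exponents[OF C _ \<Lambda>(2) sub Reals_0 Reals_add inj]) (use x in \<open>simp_all add: smat_simps\<close>)
qed

lemma lie_generic:
 "\<exists>B :: real set. countable B &
   (\<forall>t C. t \<notin> B --> linear_algebraic_group C --> rep (exp (t *\<^sub>R (v :: 'n::finite cmat))) \<in> C --> v \<in> lie C)"
proof -
 obtain \<Lambda> where \<Lambda>: "finite \<Lambda>" "\<forall>i j. (%s. entry (exp (smat s * v)) i j) \<in> exp_poly \<Lambda>" using exp_entries_exp_poly .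
 obtain S where S: "countable S" "\<Lambda> \<subseteq> S" "0 \<in> S" "\<forall>\<mu>\<in>S. \<forall>\<nu>\<in>S. \<mu> + \<nu> \<in> S"
  using countable_additive_closure[OF \<Lambda>(1)] .
 define B where "B = insert 0 (\<Union>(\<mu>, \<nu>)\<in>S \<times> S. {t::real. \<mu> ~= \<nu> & exp (\<mu> * of_real t) = exp (\<nu> * of_real t)})"
 have "countable B"
  unfolding B_def using S(1) countable_exp_resonance by (intro countable_insert countable_UN) auto
 moreover have "v \<in> lie C"
  if t: "t \<notin> B" and C: "linear_algebraic_group C" and x: "rep (exp (t *\<^sub>R v)) \<in> C" for t C
 proof (rule lie_of_additive_exponents[OF C _ \<Lambda>(2) S(2,3), of "of_real t"])
  show "rep (exp (smat (of_real t) * v)) \<in> C" using x by (simp add: smat_of_real)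
  show "inj_on (%\<mu>. exp (\<mu> * complex_of_real t)) S" using t unfolding B_def inj_on_def by blast
  show "complex_of_real t ~= 0" using t by (auto simp: B_def)
 qed (use S(4) in auto)
 ultimately show ?thesis by (intro exI[of _ B]) simp
qed

lemma lie_add:
 assumes C: "linear_algebraic_group C" and u: "u \<in> lie C" and v: "v \<in> lie C" shows "u + v \<in> lie C"
 unfolding lie_def
proof (intro CollectI allI)
 fix s
 define a b where "a = smat s * u" and "b = smat s * v"
 have ab: "a \<in> lie C" "b \<in> lie C" using u v lie_scale by (auto simp: a_def b_def)
 define z where "z k = exp ((1 / real k) *\<^sub>R a) * exp ((1 / real k) *\<^sub>R b)" for k :: nat
 let ?E = "%k::nat. exp ((1 / real k) *\<^sub>R a)" and ?F = "%k::nat. exp ((1 / real k) *\<^sub>R b)"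
 have "(%k. real k *\<^sub>R (?E k - 1) * ?F k + real k *\<^sub>R (?F k - 1)) \<longlonglongrightarrow> a * 1 + b"
  by (intro tendsto_intros exp_difference_quotient scaled_limit_imp_limit[OF exp_difference_quotient])
 moreover have "real k *\<^sub>R (z k - 1) = real k *\<^sub>R (?E k - 1) * ?F k + real k *\<^sub>R (?F k - 1)" for k
 proof -
  have "z k - 1 = (?E k - 1) * ?F k + (?F k - 1)" by (simp add: z_def left_diff_distrib)
  then show ?thesis by (simp only: scaleR_add_right mult_scaleR_left)
 qed
 ultimately have "(%k. real k *\<^sub>R (z k - 1)) \<longlonglongrightarrow> a + b" by (simp only: mult_1_right)
 from power_limit_exp[OF this] have lim: "(%k. rep (z k ^ k)) \<longlonglongrightarrow> rep (exp (a + b))" by (rule tendsto_rep)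
 have mem: "rep (z k ^ k) \<in> C" for k
 proof (rule alg_group_power[OF C])
  show "rep (z k) \<in> C" unfolding z_def rep_simps by (rule alg_groupD(3)[OF C]) (rule lie_exp[OF lie_scaleR]; rule ab)+
 qed
 have "rep (exp (a + b)) \<in> C" by (rule zero_locus_limit[OF alg_groupD(1)[OF C] mem lim invertible_exp])
 then show "rep (exp (smat s * (u + v))) \<in> C" by (simp add: a_def b_def distrib_left)
qed

lemma exp_conj:
 assumes "y * x = (1 :: 'n::finite cmat)" shows "exp (x * a * y) = x * exp a * y"
proof (cases "x * y = 1")
 case True
 have "(x * a * y) ^ k = x * a ^ k * y" for k
 proof (induction k)
  case (Suc k)
  have "(x * a * y) ^ Suc k = (x * a * y) * (x * a ^ k * y)" using Suc by simp
  also have "... = x * a * (y * x) * (a ^ k * y)" by (simp only: mult.assoc)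
  finally show ?case by (simp add: assms mult.assoc)
 qed (simp add: True)
 moreover have "(%k. x * (a ^ k /\<^sub>R fact k) * y) sums (x * exp a * y)"
  by (intro sums_mult sums_mult2 exp_converges)
 ultimately have "(%k. (x * a * y) ^ k /\<^sub>R fact k) sums (x * exp a * y)" by simp
 then show ?thesis using exp_converges[of "x * a * y"] sums_unique2 by blast
next
 case False
 have "rep y ** rep x = mat 1" using arg_cong[OF assms, of rep] by simp
 then have "rep x ** rep y = mat 1" using matrix_left_right_inverse by blast
 then have "x * y = 1" by (intro cmat_eqI) simp
 then show ?thesis using False by simp
qed

lemma lie_Ad:
 assumes C: "linear_algebraic_group C" and v: "v \<in> lie C" and x: "rep x \<in> C" "y * x = 1" "x * y = 1"
 shows "x * v * y \<in> lie C"
 unfolding lie_def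
proof (intro CollectI allI)
 fix s
 have "smat s * (x * v * y) = x * (smat s * v) * y" by (simp add: mult.assoc smat_left_commute)
 then have "exp (smat s * (x * v * y)) = x * exp (smat s * v) * y" using exp_conj[OF x(2)] by simp
 moreover have "rep y \<in> C" by (rule alg_group_inverse[OF C x(1)]) (use arg_cong[OF x(3), of rep] in simp)
 ultimately show "rep (exp (smat s * (x * v * y))) \<in> C"
  using v x(1) alg_groupD(3)[OF C] by (simp add: lie_def)
qed

lemma lie_subspace: assumes C: "linear_algebraic_group C" shows "subspace (rep ` lie C)"
proof (rule subspaceI)
 have "0 \<in> lie C" using alg_groupD(2)[OF C] by (simp add: lie_def)
 then show "0 \<in> rep ` lie C" by (rule rev_image_eqI) simp
 show "x + y \<in> rep ` lie C" if xy: "x \<in> rep ` lie C" "y \<in> rep ` lie C" for x y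
 proof -
  obtain u v where "u \<in> lie C" "v \<in> lie C" "x = rep u" "y = rep v" using xy by blast
  then show ?thesis using lie_add[OF C] by (intro rev_image_eqI[of "u + v"]) auto
 qed
 show "c *\<^sub>R x \<in> rep ` lie C" if x: "x \<in> rep ` lie C" for c x
 proof -
  obtain u where "u \<in> lie C" "x = rep u" using x by blast
  then show ?thesis using lie_scaleR[of u C c] by (intro rev_image_eqI[of "c *\<^sub>R u"]) auto
 qed
qed

lemma lie_limit:
 assumes C: "linear_algebraic_group C" and v: "!!k::nat. v k \<in> lie C" "v \<longlonglongrightarrow> w" shows "w \<in> lie C"
proof -
 have cl: "closed (rep ` lie C)" by (rule closed_subspace[OF lie_subspace[OF C]])
 have lim: "(%k. rep (v k)) \<longlonglongrightarrow> rep w" by (rule tendsto_rep[OF v(2)])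
 have "rep w \<in> rep ` lie C" by (rule closed_sequentially[OF cl _ lim]) (use v(1) in simp)
 then show ?thesis by (auto simp: rep_inject)
qed

lemma lie_minus: "linear_algebraic_group C ==> u \<in> lie C ==> v \<in> lie C ==> u - v \<in> lie C"
 using lie_add[of C u "(-1) *\<^sub>R v"] lie_scaleR[of v C "-1"] by simp

lemma lie_bracket:
 assumes C: "linear_algebraic_group C" and u: "u \<in> lie C" and v: "v \<in> lie C" shows "u * v - v * u \<in> lie C"
proof (rule lie_limit[OF C])
 let ?E = "%k::nat. exp ((1 / real k) *\<^sub>R u)" and ?F = "%k::nat. exp ((1 / real k) *\<^sub>R (- u))"
 have F: "?F k = exp (- ((1 / real k) *\<^sub>R u))" for k by simp
 show "real k *\<^sub>R (?E k * v * ?F k - v) \<in> lie C" for k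
 proof -
  have "?E k * v * ?F k \<in> lie C"
   unfolding F by (rule lie_Ad[OF C v lie_exp[OF lie_scaleR[OF u]] exp_inverse_cmat(2,1)])
  then show ?thesis by (rule lie_scaleR[OF lie_minus[OF C _ v]])
 qed
 have "(%k. real k *\<^sub>R (?E k - 1) * v * ?F k + v * (real k *\<^sub>R (?F k - 1))) \<longlonglongrightarrow> u * v * 1 + v * (- u)"
  by (intro tendsto_intros exp_difference_quotient scaled_limit_imp_limit[OF exp_difference_quotient])
 moreover have "real k *\<^sub>R (?E k * v * ?F k - v) = real k *\<^sub>R (?E k - 1) * v * ?F k + v * (real k *\<^sub>R (?F k - 1))" for k
 proof -
  have "?E k * v * ?F k - v = (?E k - 1) * v * ?F k + v * (?F k - 1)"
   by (simp only: left_diff_distrib right_diff_distrib mult_1_left mult_1_right) simp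
  then show ?thesis by (simp only: scaleR_add_right mult_scaleR_left mult_scaleR_right)
 qed
 ultimately show "(%k. real k *\<^sub>R (?E k * v * ?F k - v)) \<longlonglongrightarrow> u * v - v * u"
  by (simp only: mult_1_right mult_minus_right add_uminus_conv_diff)
qed

lemma continuous_on_exp_banach: "continuous_on UNIV (exp :: 'a => 'a::{real_normed_algebra_1, banach})"
proof -
 have "continuous_on (ball 0 B) (exp :: 'a => 'a)" for B
 proof -
  have "uniform_limit (ball 0 B) (%n x. \<Sum>k<n. x ^ k /\<^sub>R fact k) (%x :: 'a. \<Sum>k. x ^ k /\<^sub>R fact k) sequentially"
  proof (rule Weierstrass_m_test)
   fix k and x :: "'a" assume "x \<in> ball 0 B"
   then have "norm x <= B" by simp
   then have "norm (x ^ k) <= B ^ k" using norm_power_ineq[of x k] power_mono[of "norm x" B k] by simp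
   then show "norm (x ^ k /\<^sub>R fact k) <= B ^ k /\<^sub>R fact k" by (simp add: mult_left_mono)
  qed (rule summable_exp_generic)
  then have "uniform_limit (ball 0 B) (%n x. \<Sum>k<n. x ^ k /\<^sub>R fact k) (exp :: 'a => 'a) sequentially"
   by (simp add: exp_def)
  then show ?thesis
   by (rule uniform_limit_theorem[rotated]) (auto intro!: always_eventually continuous_intros)
 qed
 then have "continuous (at x) (exp :: 'a => 'a)" for x
  using continuous_on_interior[of "ball 0 (norm x + 1)" exp x] by simp
 then show ?thesis by (simp add: continuous_at_imp_continuous_on)
qed

lemma exp_locally_surjective:
 assumes "0 < \<delta>" "\<delta> <= 1/2" "norm (x - 1) <= \<delta> / 2"
 shows "\<exists>v. norm v <= \<delta> & exp v = (x :: 'n::finite cmat)"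
proof -
 define S where "S = rep ` cball (0 :: 'n cmat) \<delta>"
 have S: "S = {A. norm (Cm A) <= \<delta>}"
  unfolding S_def by (auto intro!: image_eqI[of _ _ "Cm _"])
 have "closed S" unfolding S by (intro closed_Collect_le continuous_intros continuous_on_id)
 moreover have "bounded S"
  unfolding S_def by (rule bounded_linear_image[OF bounded_cball bounded_linear_rep])
 ultimately have cS: "compact S" by (simp add: compact_eq_bounded_closed)
 have cvx: "convex S" unfolding S_def by (rule convex_linear_image[OF bounded_linear.linear[OF bounded_linear_rep] convex_cball])
 have ne: "S ~= {}" using assms(1) by (auto simp: S_def)
 define \<phi> where "\<phi> A = rep (x - 1 - (exp (Cm A) - 1 - Cm A))" for A
 have "continuous_on S \<phi>" unfolding \<phi>_def
  by (intro continuous_intros continuous_on_compose2[OF continuous_on_exp_banach] continuous_on_id) auto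
 moreover have "\<phi> A \<in> S" if "A \<in> S" for A
 proof -
  have n: "norm (Cm A) <= \<delta>" using that by (simp add: S)
  then have "norm (exp (Cm A) - 1 - Cm A) <= (norm (Cm A))\<^sup>2" using assms(2) by (intro norm_exp_remainder) linarith
  also have "... <= \<delta>\<^sup>2" using n by (intro power_mono) auto
  also have "... <= \<delta> / 2" using assms(1,2) by (simp add: power2_eq_square)
  finally have "norm (x - 1 - (exp (Cm A) - 1 - Cm A)) <= \<delta>" using assms(3) norm_triangle_ineq4[of "x - 1" "exp (Cm A) - 1 - Cm A"] by linarith
  then show ?thesis unfolding S \<phi>_def mem_Collect_eq Cm_rep .
 qed
 then have "\<phi> \<in> S \<rightarrow> S" by blast
 ultimately obtain A where A: "A \<in> S" "\<phi> A = A" using brouwer[OF cS cvx ne] by blast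
 have "x - 1 - (exp (Cm A) - 1 - Cm A) = Cm A" using arg_cong[OF A(2), of Cm] unfolding \<phi>_def Cm_rep .
 then have "exp (Cm A) = x" by (simp add: algebra_simps)
 then show ?thesis using A(1) by (intro exI[of _ "Cm A"]) (simp add: S)
qed

lemma inj_on_exp_strip: assumes "c < pi" shows "inj_on exp (strip c)"
proof (rule inj_onI)
 fix \<mu> \<nu> assume \<mu>: "\<mu> \<in> strip c" "\<nu> \<in> strip c" and "exp \<mu> = exp \<nu>"
 then obtain k :: int where k: "\<mu> = \<nu> + of_int (2 * k) * of_real pi * \<i>" by (auto simp: exp_eq)
 then have "Im \<mu> - Im \<nu> = 2 * real_of_int k * pi" by simp
 moreover have "\<bar>Im \<mu> - Im \<nu>\<bar> <= 2 * c" using \<mu> by (simp add: abs_le_iff)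
 ultimately have "pi * \<bar>real_of_int k\<bar> <= c" by (simp add: abs_mult mult_ac)
 then have "pi * \<bar>real_of_int k\<bar> < pi * 1" using assms by linarith
 then have "\<bar>real_of_int k\<bar> < 1" by (simp only: mult_less_cancel_left_pos pi_gt_zero)
 then have "k = 0" by simp
 then show "\<mu> = \<nu>" using k by simp
qed

lemma zariski_closed_exp_poly_strip:
 fixes C :: "(complex^'n^'n) set"
 assumes "closedin zariski C"
 obtains P and N :: nat where "C = zero_locus P" "1 <= N"
  "\<forall>p\<in>P. \<forall>c\<ge>0. \<forall>M. (\<forall>i j. (%s. M s $ i $ j) \<in> exp_poly (strip c)) --> (%s. p (M s)) \<in> exp_poly (strip (real N * c))"
proof -
 obtain P0 where P0: "P0 \<subseteq> regular" "C = zero_locus P0" using assms closedin_zariski by blast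
 obtain P where P: "P \<subseteq> P0" "finite P" "zero_locus P = zero_locus P0" using zero_locus_finite[OF P0(1)] by blast
 have "\<forall>p\<in>P. \<exists>d::nat. \<forall>c\<ge>0. \<forall>M. (\<forall>i j. (%s. M s $ i $ j) \<in> exp_poly (strip c)) -->
   (%s. p (M s)) \<in> exp_poly (strip (real d * c))"
  using P(1) P0(1) poly_fun_exp_poly_strip by blast
 from bchoice[OF this] obtain d :: "_ => nat"
  where d: "\<forall>p\<in>P. \<forall>c\<ge>0. \<forall>M. (\<forall>i j. (%s. M s $ i $ j) \<in> exp_poly (strip c)) -->
   (%s. p (M s)) \<in> exp_poly (strip (real (d p) * c))" ..
 define N where "N = Max (insert 1 (d ` P))"
 have "(%s. p (M s)) \<in> exp_poly (strip (real N * c))"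
  if p: "p \<in> P" and c: "0 <= c" and M: "\<forall>i j. (%s. M s $ i $ j) \<in> exp_poly (strip c)" for p c M
 proof (rule exp_poly_mono)
  show "(%s. p (M s)) \<in> exp_poly (strip (real (d p) * c))" using d p c M by blast
  have "d p <= N" using P(2) p by (simp add: N_def)
  then have "real (d p) * c <= real N * c" using c by (simp add: mult_right_mono)
  then show "strip (real (d p) * c) \<subseteq> strip (real N * c)" by auto
 qed
 moreover have "C = zero_locus P" "1 <= N" using P P0(2) by (simp_all add: N_def)
 ultimately show ?thesis using that by blast
qed

text \<open>The eigenvalues of a small \<open>v\<close> lie in a strip on which \<open>exp\<close> is injective, so a polynomial in the
 entries of \<open>exp (s v)\<close> that vanishes at the integers vanishes identically.\<close>

lemma alg_group_small_lie:
 assumes C: "linear_algebraic_group (C :: (complex^'n^'n) set)"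
 obtains \<delta> :: real where "0 < \<delta>" "\<delta> <= 1/2" "\<forall>v. norm v <= \<delta> --> rep (exp v) \<in> C --> v \<in> lie C"
proof -
 obtain P and N :: nat where P: "C = zero_locus P" "1 <= N" and strip:
  "\<forall>p\<in>P. \<forall>c\<ge>0. \<forall>M. (\<forall>i j. (%s. M s $ i $ j) \<in> exp_poly (strip c)) --> (%s. p (M s)) \<in> exp_poly (strip (real N * c))"
  using zariski_closed_exp_poly_strip[OF alg_groupD(1)[OF C]] .
 define \<delta> where "\<delta> = 1 / (2 * real N)"
 have \<delta>: "0 < \<delta>" "\<delta> <= 1/2" "real N * \<delta> <= 1" using P(2) by (auto simp: \<delta>_def field_simps)
 have "v \<in> lie C" if v: "norm v <= \<delta>" "rep (exp v) \<in> C" for v :: "'n cmat"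
 proof -
  obtain \<Lambda> where "finite \<Lambda>" and \<Lambda>: "\<forall>l\<in>\<Lambda>. eigenvalue v l" "\<forall>i j. (%s. entry (exp (smat s * v)) i j) \<in> exp_poly \<Lambda>"
   using exp_entries_exp_poly .
  have sub: "\<Lambda> \<subseteq> strip \<delta>"
  proof
   fix l assume "l \<in> \<Lambda>"
   then have "cmod l <= norm v" using \<Lambda>(1) eigenvalue_norm by blast
   then show "l \<in> strip \<delta>" using v(1) abs_Im_le_cmod[of l] by simp
  qed
  show ?thesis
  proof (rule lie_of_exp_poly[OF C P(1), where t=1 and S="strip 1"])
   show "inj_on (%\<mu>. exp (\<mu> * 1)) (strip 1)" using inj_on_exp_strip[of 1] pi_gt3 by simp
   fix p assume p: "p \<in> P"
   have "\<forall>i j. (%s. entry (exp (smat s * v)) i j) \<in> exp_poly (strip \<delta>)" using exp_poly_mono[OF _ sub] \<Lambda>(2) by blast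
   then have "(%s. p (rep (exp (smat s * v)))) \<in> exp_poly (strip (real N * \<delta>))" using strip p \<delta>(1) by auto
   then show "(%s. p (rep (exp (smat s * v)))) \<in> exp_poly (strip 1)" by (rule exp_poly_mono) (use \<delta>(3) in auto)
  qed (use v(2) in \<open>simp_all add: smat_simps\<close>)
 qed
 then show ?thesis using \<delta>(1,2) that by blast
qed

lemma alg_group_log:
 assumes C: "linear_algebraic_group C"
 obtains \<epsilon> :: real where "0 < \<epsilon>" "\<forall>x :: 'n::finite cmat. rep x \<in> C --> norm (x - 1) < \<epsilon> --> (\<exists>v\<in>lie C. exp v = x)"
proof -
 obtain \<delta> :: real where \<delta>: "0 < \<delta>" "\<delta> <= 1/2" "\<forall>v :: 'n cmat. norm v <= \<delta> --> rep (exp v) \<in> C --> v \<in> lie C"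
  using alg_group_small_lie[OF C] .
 have "\<exists>v\<in>lie C. exp v = x" if "rep x \<in> C" "norm (x - 1) < \<delta> / 2" for x :: "'n cmat"
  using exp_locally_surjective[OF \<delta>(1,2), of x] \<delta>(3) that by auto
 then show ?thesis using \<delta>(1) that[of "\<delta> / 2"] by auto
qed

lemma zariski_minimal:
 assumes "S ~= {}" "!!C. C \<in> S ==> closedin zariski (C :: (complex^'n^'n) set)"
 shows "\<exists>C\<in>S. \<forall>D\<in>S. D \<subseteq> C --> D = C"
proof (rule ccontr)
 assume "\<not> ?thesis"
 then have "\<forall>C\<in>S. \<exists>D. D \<in> S & D \<subset> C" by blast
 then obtain f where f: "!!C. C \<in> S ==> f C \<in> S & f C \<subset> C" by metis
 obtain C0 where C0: "C0 \<in> S" using assms(1) by blast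
 define C where "C k = (f ^^ k) C0" for k
 have CS: "C k \<in> S" for k by (induction k) (auto simp: C_def C0 f)
 have "C (Suc k) \<subset> C k" for k using f[OF CS[of k]] by (simp add: C_def)
 then show False using zariski_descending_chain[of C] assms(2)[OF CS] by blast
qed

lemma alg_group_cancel:
 assumes C: "linear_algebraic_group C" and X: "X \<in> C" "X ** W \<in> C" shows "W \<in> C"
proof -
 obtain Y where "Y \<in> C" "Y ** X = mat 1" using alg_groupD(4)[OF C X(1)] by blast
 then show ?thesis using alg_groupD(3)[OF C _ X(2)] by (metis matrix_mul_assoc matrix_mul_lid)
qed

lemma countable_closed_cover_finite:
 assumes \<D>: "countable \<D>" "!!D. D \<in> \<D> ==> closedin zariski D" "Z \<subseteq> \<Union>\<D>"
  and C: "closedin zariski C" "C \<subseteq> (Z :: (complex^'n^'n) set)"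
 shows "\<exists>F\<subseteq>\<D>. finite F & C \<subseteq> \<Union>F"
proof (rule ccontr)
 assume no: "\<not> ?thesis"
 define \<B> where "\<B> = {C. closedin zariski C & C \<subseteq> Z & \<not> (\<exists>F\<subseteq>\<D>. finite F & C \<subseteq> \<Union>F)}"
 have "\<B> ~= {}" using no C by (auto simp: \<B>_def)
 from zariski_minimal[OF this] obtain M where "M \<in> \<B>" and minimal: "!!D. D \<in> \<B> ==> D \<subseteq> M ==> D = M"
  by (auto simp: \<B>_def)
 then have M: "closedin zariski M" "M \<subseteq> Z" "\<not> (\<exists>F\<subseteq>\<D>. finite F & M \<subseteq> \<Union>F)" by (auto simp: \<B>_def)
 have "M ~= {}" using M(3) by auto
 have "M \<subseteq> A \<or> M \<subseteq> B" if AB: "closedin zariski A" "closedin zariski B" "M \<subseteq> A \<union> B" for A B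
 proof (rule ccontr)
  assume not_sub: "\<not> ?thesis"
  have finite_cover: "\<exists>F\<subseteq>\<D>. finite F & M \<inter> E \<subseteq> \<Union>F" if E: "closedin zariski E" "\<not> M \<subseteq> E" for E
  proof (rule ccontr)
   assume "\<not> ?thesis"
   moreover have "closedin zariski (M \<inter> E)" using M(1) E(1) by (rule closedin_Int)
   ultimately have "M \<inter> E \<in> \<B>" using M(2) unfolding \<B>_def by blast
   from minimal[OF this] show False using E(2) by blast
  qed
  obtain F G where "F \<subseteq> \<D>" "finite F" "M \<inter> A \<subseteq> \<Union>F" "G \<subseteq> \<D>" "finite G" "M \<inter> B \<subseteq> \<Union>G"
   using finite_cover[OF AB(1)] finite_cover[OF AB(2)] not_sub by blast
  then have "F \<union> G \<subseteq> \<D> & finite (F \<union> G) & M \<subseteq> \<Union>(F \<union> G)" using AB(3) by blast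
  then show False using M(3) by blast
 qed
 then obtain E where "E \<in> \<D>" "M \<subseteq> E"
  using irreducible_countable_cover[OF M(1) \<open>M ~= {}\<close> _ \<D>(1,2)] M(2) \<D>(3) by blast
 then have "{E} \<subseteq> \<D> & finite {E} & M \<subseteq> \<Union>{E}" by simp
 then show False using M(3) by blast
qed

text \<open>The cosets of \<open>L\<close> are open in the Euclidean topology of \<open>Z\<close>, hence countable in number, hence finite
 in number since they are Zariski closed. So \<open>Z - L\<close> is closed, and \<open>L\<close> contains the component of 1.\<close>

locale lie_full_subgroup =
 fixes Z L :: "(complex^'n^'n) set"
 assumes Z: "linear_algebraic_group Z" and L: "linear_algebraic_group L" "L \<subseteq> Z" and lie: "lie Z \<subseteq> lie L"
begin

definition coset :: "complex^'n^'n => (complex^'n^'n) set" where "coset X = {W \<in> GL_set. X ** W \<in> L}"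

lemma coset_subset: "X \<in> Z ==> coset X \<subseteq> Z"
 using alg_group_cancel[OF Z] L(2) by (auto simp: coset_def)

lemma coset_closed: "X \<in> Z ==> closedin zariski (coset X)"
 unfolding coset_def using alg_groupD(1)[OF L(1)] alg_groupD(5)[OF Z] by (rule closed_left_preimage)

lemma coset_open: assumes X: "X \<in> Z" shows "openin (top_of_set Z) (coset X)"
 unfolding openin_contains_ball
proof (intro conjI ballI)
 show "coset X \<subseteq> Z" by (rule coset_subset[OF X])
 obtain \<epsilon> :: real where \<epsilon>: "0 < \<epsilon>" "\<forall>x :: 'n cmat. rep x \<in> Z --> norm (x - 1) < \<epsilon> --> (\<exists>v\<in>lie Z. exp v = x)"
  using alg_group_log[OF Z] .
 have near: "rep x \<in> L" if "rep x \<in> Z" "norm (x - 1) < \<epsilon>" for x :: "'n cmat"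
  using \<epsilon>(2) that lie_exp[of _ L] lie by blast
 fix W assume W: "W \<in> coset X"
 then obtain Y where Y: "Y \<in> Z" "Y ** W = mat 1" "W ** Y = mat 1" using alg_groupD(4)[OF Z] coset_subset[OF X] by blast
 have "continuous_on UNIV (%V. norm (Cm Y * Cm V - 1))" by (intro continuous_intros)
 then have "open {V. norm (Cm Y * Cm V - 1) < \<epsilon>}" by (intro open_Collect_less continuous_intros)
 moreover have "Cm Y * Cm W = 1" by (rule cmat_eqI) (simp add: Y)
 then have "W \<in> {V. norm (Cm Y * Cm V - 1) < \<epsilon>}" using \<epsilon>(1) by simp
 ultimately obtain r where r: "r > 0" "ball W r \<subseteq> {V. norm (Cm Y * Cm V - 1) < \<epsilon>}" using open_contains_ball by blast
 have "V \<in> coset X" if V: "V \<in> ball W r" "V \<in> Z" for V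
 proof -
  have "rep (Cm Y * Cm V) \<in> L" using r(2) V alg_groupD(3)[OF Z Y(1)] by (intro near) auto
  then have "(X ** W) ** (Y ** V) \<in> L" using W alg_groupD(3)[OF L(1)] by (simp add: coset_def)
  moreover have "(X ** W) ** (Y ** V) = X ** ((W ** Y) ** V)" by (simp only: matrix_mul_assoc)
  ultimately show ?thesis using V alg_groupD(5)[OF Z] by (simp add: coset_def Y(3))
 qed
 then show "\<exists>e>0. ball W e \<inter> Z \<subseteq> coset X" using r(1) by blast
qed

lemma finite_coset_cover: obtains F where "finite F" "F \<subseteq> coset ` Z" "Z \<subseteq> \<Union>F"
proof -
 obtain \<D> where \<D>: "\<D> \<subseteq> coset ` Z" "countable \<D>" "\<Union>\<D> = \<Union>(coset ` Z)"
  using Lindelof_openin[of "coset ` Z" Z] coset_open by blast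
 have cover: "Z \<subseteq> \<Union>\<D>"
 proof
  fix X assume X: "X \<in> Z"
  obtain Y where Y: "Y \<in> Z" "Y ** X = mat 1" using alg_groupD(4)[OF Z X] by blast
  then have "X \<in> coset Y" using alg_groupD(2)[OF L(1)] alg_groupD(5)[OF Z X] by (simp add: coset_def)
  then show "X \<in> \<Union>\<D>" using Y(1) \<D>(3) by blast
 qed
 have "closedin zariski D" if "D \<in> \<D>" for D using that \<D>(1) coset_closed by blast
 from countable_closed_cover_finite[OF \<D>(2) this cover alg_groupD(1)[OF Z]]
 show ?thesis using that \<D>(1) by (metis order_refl subset_trans)
qed

lemma coset_subset_L:
 assumes V: "V \<in> coset X" "V \<in> L" shows "coset X \<subseteq> L"
proof -
 obtain V' where "V' \<in> L" "V ** V' = mat 1" using alg_groupD(4)[OF L(1) V(2)] by blast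
 then have "X \<in> L" using alg_groupD(3)[OF L(1), of "X ** V" V'] V(1) by (simp add: coset_def matrix_mul_assoc[symmetric])
 then have "W \<in> L" if "W \<in> coset X" for W using alg_group_cancel[OF L(1), of X W] that by (simp add: coset_def)
 then show ?thesis by blast
qed

lemma complement_closed: "closedin zariski (Z - L)"
proof -
 obtain F where F: "finite F" "F \<subseteq> coset ` Z" "Z \<subseteq> \<Union>F" using finite_coset_cover .
 have "Z - L = \<Union>{E \<in> F. E \<inter> L = {}}"
 proof
  show "Z - L \<subseteq> \<Union>{E \<in> F. E \<inter> L = {}}"
  proof
   fix W assume W: "W \<in> Z - L"
   then obtain E where E: "E \<in> F" "W \<in> E" using F(3) by blast
   then obtain X where "E = coset X" using F(2) by blast
   then have "E \<inter> L = {}" using coset_subset_L[of _ X] W E(2) by blast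
   then show "W \<in> \<Union>{E \<in> F. E \<inter> L = {}}" using E by blast
  qed
 qed (use F(2) coset_subset in blast)
 moreover have "closedin zariski E" if "E \<in> F" for E using that F(2) coset_closed by blast
 then have "closedin zariski (\<Union>{E \<in> F. E \<inter> L = {}})" using F(1) by (intro closedin_Union) auto
 ultimately show ?thesis by simp
qed

end

theorem identity_component_subset:
 assumes "linear_algebraic_group Z" and L: "linear_algebraic_group L" "L \<subseteq> Z" and "lie Z \<subseteq> lie (L :: (complex^'n^'n) set)"
 shows "identity_component Z \<subseteq> L"
proof
 interpret lie_full_subgroup Z L by (rule lie_full_subgroup.intro[OF assms])
 fix Y assume "Y \<in> identity_component Z"
 then obtain T where T: "connectedin (subtopology zariski Z) T" "mat 1 \<in> T" "Y \<in> T"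
  by (auto simp: identity_component_def connected_component_of_def)
 then have T': "connectedin zariski T" "T \<subseteq> Z" by (auto simp: connectedin_subtopology)
 then have "T \<subseteq> L \<union> (Z - L)" "L \<inter> (Z - L) \<inter> T = {}" "L \<inter> T ~= {}" using T alg_groupD(2)[OF L(1)] by blast+
 then have "(Z - L) \<inter> T = {}"
  using T'(1) complement_closed alg_groupD(1)[OF L(1)] unfolding connectedin_closedin by blast
 then show "Y \<in> L" using T(3) T'(2) by blast
qed

section \<open>Representations of sl2\<close>

lemma conj_ode:
 fixes a :: "'n::finite cmat"
 assumes B: "!!t. (B has_vector_derivative B' t) (at t)" and eq: "!!t. a * B t - B t * a = B' t"
 shows "B 1 = exp a * B 0 * exp (- a)"
proof -
 define P Q where "P t = exp (t *\<^sub>R (- a))" and "Q t = exp (t *\<^sub>R a)" for t :: real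
 have "((%t. P t * B t * Q t) has_vector_derivative 0) (at t)" for t
 proof -
  have dP: "(P has_vector_derivative P t * (- a)) (at t)" and dQ: "(Q has_vector_derivative Q t * a) (at t)"
   unfolding P_def Q_def by (rule exp_scaleR_has_vector_derivative_right)+
  have "((%t. P t * B t * Q t) has_vector_derivative (P t * B t) * (Q t * a) + (P t * B' t + P t * (- a) * B t) * Q t) (at t)"
   by (intro has_vector_derivative_mult dP dQ B)
  moreover have "Q t * a = a * Q t" unfolding Q_def by (rule exp_times_scaleR_commute)
  ultimately show ?thesis unfolding eq[symmetric] by (simp add: algebra_simps)
 qed
 then obtain c where c: "!!t. t \<in> UNIV ==> P t * B t * Q t = c"
  using has_vector_derivative_zero_constant[of UNIV "%t. P t * B t * Q t"] by auto
 have "exp (- a) * B 1 * exp a = B 0" using c[of 1] c[of 0] by (simp add: P_def Q_def)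
 then have "exp a * B 0 * exp (- a) = (exp a * exp (- a)) * B 1 * (exp a * exp (- a))" by (simp only: mult.assoc flip: \<open>exp (- a) * B 1 * exp a = B 0\<close>)
 then show ?thesis by (simp add: exp_inverse_cmat)
qed

definition ad :: "'n::finite cmat => 'n cmat => 'n cmat" where "ad a b = a * b - b * a"

lemma ad_simps:
 "ad a (x + y) = ad a x + ad a y" "ad a (x - y) = ad a x - ad a y" "ad a (smat c * x) = smat c * ad a x"
 "ad a (r *\<^sub>R x) = r *\<^sub>R ad a x" "ad a 0 = 0" "ad a (- x) = - ad a x"
 "ad (x + y) a = ad x a + ad y a" "ad (x - y) a = ad x a - ad y a" "ad (smat c * x) a = smat c * ad x a"
 "ad (r *\<^sub>R x) a = r *\<^sub>R ad x a" "ad 0 a = 0" "ad (- x) a = - ad x a"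
 by (auto simp: ad_def algebra_simps smat_left_commute)

lemma ad_self: "ad a a = 0" by (simp add: ad_def)
lemma ad_flip: "ad b a = - ad a b" by (simp add: ad_def)
lemma ad_jacobi: "ad a (ad b x) = ad b (ad a x) + ad (ad a b) x" by (simp add: ad_def algebra_simps)

lemma exp_conj_quadratic:
 assumes "ad a b = c" "ad a c = d" "ad a d = 0"
 shows "exp a * b * exp (- a) = b + c + (1/2) *\<^sub>R (d :: 'n::finite cmat)"
proof -
 define B where "B t = b + t *\<^sub>R c + (t\<^sup>2 / 2) *\<^sub>R d" for t :: real
 have "(B has_vector_derivative (c + t *\<^sub>R d)) (at t)" for t
  unfolding B_def by (auto intro!: derivative_eq_intros)
 moreover have "a * B t - B t * a = c + t *\<^sub>R d" for t
 proof -
  have "a * B t - B t * a = ad a (B t)" by (simp add: ad_def)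
  also have "... = c + t *\<^sub>R d" unfolding B_def ad_simps assms by simp
  finally show ?thesis .
 qed
 ultimately have "B 1 = exp a * B 0 * exp (- a)" by (rule conj_ode)
 then show ?thesis by (simp add: B_def)
qed

lemma exp_commute_cmat:
 assumes "x * a = a * (x :: 'n::finite cmat)" shows "x * exp a = exp a * x"
proof -
 have "exp (- a) * x * exp (- (- a)) = x + 0 + (1/2) *\<^sub>R 0"
  by (rule exp_conj_quadratic) (simp_all add: ad_def assms)
 then have "exp a * (exp (- a) * x * exp a) = exp a * x" by simp
 then have "(exp a * exp (- a)) * (x * exp a) = exp a * x" by (simp only: mult.assoc)
 then show ?thesis by (simp add: exp_inverse_cmat)
qed

lemma exp_conj_jordan:
 assumes v: "ad h v = smat l * v + q" and q: "ad h q = smat l * (q :: 'n::finite cmat)"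
 shows "exp (smat s * h) * v * exp (- (smat s * h)) = smat (exp (s * l)) * (v + smat s * q)"
proof -
 define B where "B t = smat (exp (t *\<^sub>R (s * l))) * (v + t *\<^sub>R (smat s * q))" for t :: real
 define B' where "B' t = smat (exp (t *\<^sub>R (s * l))) * (smat s * q) + smat (exp (t *\<^sub>R (s * l)) * (s * l)) * (v + t *\<^sub>R (smat s * q))" for t :: real
 have "(B has_vector_derivative B' t) (at t)" for t
 proof -
  have "((%t. smat (exp (t *\<^sub>R (s * l))) :: 'n cmat) has_vector_derivative smat (exp (t *\<^sub>R (s * l)) * (s * l))) (at t)"
   by (rule bounded_linear.has_vector_derivative[OF bounded_linear_smat exp_scaleR_has_vector_derivative_right])
  moreover have "((%t. v + t *\<^sub>R (smat s * q)) has_vector_derivative smat s * q) (at t)"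
   by (auto intro!: derivative_eq_intros)
  ultimately show ?thesis unfolding B_def B'_def by (rule has_vector_derivative_mult)
 qed
 moreover have "smat s * h * B t - B t * (smat s * h) = B' t" for t
 proof -
  have "smat s * h * B t - B t * (smat s * h) = ad (smat s * h) (B t)" by (simp add: ad_def)
  also have "... = B' t" unfolding B_def B'_def ad_simps v q
   by (rule cmat_entryI) (simp add: scaleR_conv_of_real[where 'a=complex] algebra_simps del: rep_simps(6))
  finally show ?thesis .
 qed
 ultimately have "B 1 = exp (smat s * h) * B 0 * exp (- (smat s * h))" by (rule conj_ode)
 then show ?thesis by (simp add: B_def smat_simps)
qed

lemma commute_exp_pi_jordan:
 fixes h y q :: "'n::finite cmat"
 assumes y: "ad h y = smat l * y + q" and q: "ad h q = smat l * q" "q = 0 \<or> (\<exists>k::int. l = 2 * of_int k)"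
  and commute: "exp (smat (of_real pi * \<i>) * h) * y = y * exp (smat (of_real pi * \<i>) * h)"
 shows "q = 0" "y = 0 \<or> (\<exists>n::int. l = 2 * of_int n)"
proof -
 let ?s = "of_real pi * \<i>"
 have "exp (smat ?s * h) * y * exp (- (smat ?s * h)) = y" unfolding commute by (simp add: mult.assoc exp_inverse_cmat)
 then have fixed: "smat (exp (?s * l)) * (y + smat ?s * q) = y" using exp_conj_jordan[OF y q(1), of ?s] by simp
 show q0: "q = 0"
 proof (rule ccontr)
  assume "q ~= 0"
  then obtain k :: int where "l = 2 * of_int k" using q(2) by blast
  then have "exp (?s * l) = 1" by (auto simp: exp_eq_1 algebra_simps)
  then have "smat ?s * q = 0" using fixed by (simp add: smat_simps del: smat_mult_eq_0_iff)
  then show False using \<open>q ~= 0\<close> by simp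
 qed
 have "smat (exp (?s * l) - 1) * y = 0" using fixed q0 by (simp add: smat_simps left_diff_distrib del: smat_mult_eq_0_iff)
 then have "y = 0 \<or> exp (?s * l) = 1" by auto
 moreover have "\<exists>n::int. l = 2 * of_int n" if exp1: "exp (?s * l) = 1"
 proof -
  obtain n :: int where "Re (?s * l) = 0" "Im (?s * l) = of_int (2 * n) * pi" using exp1 by (auto simp: exp_eq_1)
  then have "l = 2 * of_int n" by (simp add: complex_eq_iff)
  then show ?thesis ..
 qed
 ultimately show "y = 0 \<or> (\<exists>n::int. l = 2 * of_int n)" by blast
qed

definition weight_space :: "'n::finite cmat => 'n cmat set => real => 'n cmat set" where
 "weight_space h V r = {v \<in> V. ad h v = r *\<^sub>R v}"

locale sl2_triple =
 fixes e f h :: "'n::finite cmat"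
 assumes he: "ad h e = 2 *\<^sub>R e" and hf: "ad h f = (-2) *\<^sub>R f" and ef: "ad e f = h"
begin

lemma swap: "sl2_triple f e (- h)"
proof
 show "ad (- h) f = 2 *\<^sub>R f" "ad (- h) e = (-2) *\<^sub>R e" "ad f e = - h"
  by (simp_all add: ad_simps he hf ad_flip[of f e] ef)
qed

text \<open>A Cayley transform.\<close>

lemma conj_ih:
 obtains x x' where "x * x' = 1" "x' * x = 1" "x * (smat \<i> * h) * x' = e - f"
  "\<forall>z. z * e = e * z --> z * f = f * z --> z * x = x * z"
proof -
 let ?i = "smat \<i> :: 'n cmat"
 define a b where "a = ?i * e" and "b = smat (\<i> / 2) * f"
 have brfh: "ad f h = 2 *\<^sub>R f" using hf ad_flip[of f h] by simp
 have breh: "ad e h = (-2) *\<^sub>R e" using he ad_flip[of e h] by simp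
 have conj_b: "exp b * (?i * h) * exp (- b) = ?i * h + (- f) + (1/2) *\<^sub>R 0"
 proof (rule exp_conj_quadratic)
  show "ad b (?i * h) = - f" unfolding b_def ad_simps brfh
   by (rule cmat_entryI) (simp add: scaleR_conv_of_real[where 'a=complex] del: rep_simps(6))
 qed (simp_all add: b_def ad_simps ad_self)
 have conj_a: "exp a * (?i * h - f) * exp (- a) = (?i * h - f) + (2 *\<^sub>R e - ?i * h) + (1/2) *\<^sub>R ((-2) *\<^sub>R e)"
 proof (rule exp_conj_quadratic)
  show "ad a (?i * h - f) = 2 *\<^sub>R e - ?i * h" unfolding a_def ad_simps breh ef
   by (rule cmat_entryI) (simp add: scaleR_conv_of_real[where 'a=complex] algebra_simps del: rep_simps(6))
  show "ad a (2 *\<^sub>R e - ?i * h) = (-2) *\<^sub>R e" unfolding a_def ad_simps breh ad_self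
   by (rule cmat_entryI) (simp add: scaleR_conv_of_real[where 'a=complex] algebra_simps del: rep_simps(6))
 qed (simp_all add: a_def ad_simps ad_self)
 have sum: "(?i * h - f) + (2 *\<^sub>R e - ?i * h) + (1/2) *\<^sub>R ((-2) *\<^sub>R e) = e - f"
  by (rule cmat_entryI) (simp add: scaleR_conv_of_real[where 'a=complex] del: rep_simps(6))
 have assoc: "(p * q) * (q' * p') = p * (q * q') * p'" for p q q' p' :: "'n cmat" by (simp only: mult.assoc)
 show ?thesis
 proof (rule that[of "exp a * exp b" "exp (- b) * exp (- a)"])
  show "(exp a * exp b) * (exp (- b) * exp (- a)) = 1" "(exp (- b) * exp (- a)) * (exp a * exp b) = 1"
   unfolding assoc by (simp_all add: exp_inverse_cmat)
  have "(exp a * exp b) * (?i * h) * (exp (- b) * exp (- a)) = exp a * (exp b * (?i * h) * exp (- b)) * exp (- a)"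
   by (simp only: mult.assoc)
  also have "... = e - f" unfolding conj_b using conj_a sum by simp
  finally show "(exp a * exp b) * (?i * h) * (exp (- b) * exp (- a)) = e - f" .
  have "z * (exp a * exp b) = (exp a * exp b) * z" if z: "z * e = e * z" "z * f = f * z" for z
  proof -
   have "z * exp a = exp a * z" unfolding a_def using z(1) by (intro exp_commute_cmat) (simp only: smat_left_commute mult.assoc)
   moreover have "z * exp b = exp b * z" unfolding b_def using z(2) by (intro exp_commute_cmat) (simp only: smat_left_commute mult.assoc)
   ultimately show ?thesis by (metis mult.assoc)
  qed
  then show "\<forall>z. z * e = e * z --> z * f = f * z --> z * (exp a * exp b) = (exp a * exp b) * z" by blast
 qed
qed

lemma fe: "ad f (ad e v) = ad e (ad f v) - ad h v"
 using ad_jacobi[of f e v] by (simp add: ad_flip[of f e] ef ad_simps)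

end

locale sl2_rep = sl2_triple +
 fixes V :: "'n::finite cmat set"
 assumes V_0: "0 \<in> V" and V_add: "v \<in> V ==> w \<in> V ==> v + w \<in> V" and V_scale: "v \<in> V ==> smat c * v \<in> V"
  and V_e: "v \<in> V ==> ad e v \<in> V" and V_f: "v \<in> V ==> ad f v \<in> V"
begin

lemma V_scaleR: "v \<in> V ==> r *\<^sub>R v \<in> V" using V_scale[of v "of_real r"] by (simp add: smat_of_real)
lemma V_diff: "v \<in> V ==> w \<in> V ==> v - w \<in> V" using V_add[of v "(-1) *\<^sub>R w"] V_scaleR[of w "-1"] by simp
lemma V_h: "v \<in> V ==> ad h v \<in> V"
 using fe[of v] V_diff[OF V_e[OF V_f[of v]] V_f[OF V_e[of v]]] by simp

lemma swap_rep: "sl2_rep f e (- h) V"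
 using swap by (auto simp: sl2_rep_def sl2_rep_axioms_def V_0 V_add V_scale V_e V_f)

lemma weight_space_e: "v \<in> weight_space h V r ==> ad e v \<in> weight_space h V (r + 2)"
 using ad_jacobi[of h e v] by (auto simp: weight_space_def V_e he ad_simps scaleR_add_left)
lemma weight_space_f: "v \<in> weight_space h V r ==> ad f v \<in> weight_space h V (r - 2)"
 using ad_jacobi[of h f v] by (auto simp: weight_space_def V_f hf ad_simps scaleR_diff_left)

lemma weight_space_bound: assumes "v \<in> weight_space h V r" "v ~= 0" shows "\<bar>r\<bar> <= 2 * norm h"
proof -
 have "\<bar>r\<bar> * norm v = norm (h * v - v * h)" using assms(1) by (simp add: weight_space_def ad_def)
 also have "... <= norm (h * v) + norm (v * h)" by (rule norm_triangle_ineq4)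
 also have "... <= norm h * norm v + norm v * norm h" by (intro add_mono norm_mult_ineq)
 finally have "\<bar>r\<bar> * norm v <= (2 * norm h) * norm v" by simp
 then show ?thesis using assms(2) by (simp only: mult_le_cancel_right) auto
qed

lemma ef_injective:
 assumes v: "v \<in> weight_space h V r" and r: "r > 0" and ef_v: "ad e (ad f v) = 0" shows "v = 0"
proof (rule ccontr)
 assume nz: "v ~= 0"
 define x where "x k = (ad e ^^ k) v" for k
 have x_Suc: "x (Suc k) = ad e (x k)" for k by (simp add: x_def)
 have x_weight_space: "x k \<in> weight_space h V (r + 2 * real k)" for k
 proof (induction k)
  case (Suc k)
  from weight_space_e[OF Suc] show ?case by (simp add: x_Suc algebra_simps)
 qed (simp add: x_def v)
 have h_x: "ad h (x k) = (r + 2 * real k) *\<^sub>R x k" for k using x_weight_space[of k] by (simp add: weight_space_def)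
 have f_x: "\<exists>c<0. ad f (x (Suc k)) = c *\<^sub>R x k" for k
 proof (induction k)
  case 0
  have "ad f (x (Suc 0)) = (- r) *\<^sub>R x 0" unfolding x_Suc fe using h_x[of 0] by (simp add: x_def ef_v)
  then show ?case using r by (intro exI[of _ "- r"]) simp
 next
  case (Suc k)
  then obtain c where c: "c < 0" "ad f (x (Suc k)) = c *\<^sub>R x k" by blast
  have "ad f (x (Suc (Suc k))) = ad e (ad f (x (Suc k))) - ad h (x (Suc k))" unfolding x_Suc[of "Suc k"] by (rule fe)
  also have "... = (c - (r + 2 * real (Suc k))) *\<^sub>R x (Suc k)"
   unfolding c(2) h_x ad_simps x_Suc[of k, symmetric] by (simp only: scaleR_diff_left)
  finally show ?case using c(1) r by (intro exI[of _ "c - (r + 2 * real (Suc k))"]) auto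
 qed
 have x_nonzero: "x k ~= 0" for k
 proof (induction k)
  case (Suc k)
  obtain c where "c < 0" "ad f (x (Suc k)) = c *\<^sub>R x k" using f_x by blast
  then show ?case using Suc by (auto simp: ad_simps)
 qed (simp add: x_def nz)
 obtain k :: nat where "real k > norm h" using reals_Archimedean2 by blast
 moreover have "\<bar>r + 2 * real k\<bar> <= 2 * norm h" by (rule weight_space_bound[OF x_weight_space x_nonzero])
 ultimately show False using r by linarith
qed

lemma weight_space_subspace: "subspace (rep ` weight_space h V r)"
proof (rule subspaceI)
 show "0 \<in> rep ` weight_space h V r" by (rule image_eqI[of _ _ 0]) (auto simp: weight_space_def V_0 ad_simps)
 show "x + y \<in> rep ` weight_space h V r" if xy: "x \<in> rep ` weight_space h V r" "y \<in> rep ` weight_space h V r" for x y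
 proof -
  obtain u v where "u \<in> weight_space h V r" "v \<in> weight_space h V r" "x = rep u" "y = rep v" using xy by blast
  then show ?thesis by (intro image_eqI[of _ _ "u + v"]) (auto simp: weight_space_def V_add ad_simps scaleR_add_right)
 qed
 show "c *\<^sub>R x \<in> rep ` weight_space h V r" if x: "x \<in> rep ` weight_space h V r" for c x
 proof -
  obtain u where "u \<in> weight_space h V r" "x = rep u" using x by blast
  then show ?thesis by (intro image_eqI[of _ _ "c *\<^sub>R u"]) (auto simp: weight_space_def V_scaleR ad_simps)
 qed
qed

lemma ef_surjective:
 assumes v: "v \<in> weight_space h V r" and r: "r > 0" shows "\<exists>u\<in>weight_space h V r. ad e (ad f u) = v"
proof -
 let ?T = "rep ` weight_space h V r" and ?g = "%A. rep (ad e (ad f (Cm A)))"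
 have Cm_lin: "Cm (A + B) = Cm A + Cm B" "Cm (c *\<^sub>R A) = c *\<^sub>R Cm A" for A B :: "complex^'n^'n" and c
  by (rule cmat_eqI; simp)+
 have lin: "linear ?g" by (rule linearI) (simp_all add: Cm_lin ad_simps)
 have ef_weight_space: "ad e (ad f u) \<in> weight_space h V r" if "u \<in> weight_space h V r" for u using weight_space_e[OF weight_space_f[OF that]] by simp
 have sub: "?g ` ?T \<subseteq> ?T" using ef_weight_space by auto
 have "A = 0" if A: "A \<in> ?T" "?g A = 0" for A
 proof -
  obtain u where u: "u \<in> weight_space h V r" "A = rep u" using A(1) by blast
  have "ad e (ad f u) = 0" by (rule cmat_eqI) (use A(2) u(2) in simp)
  then have "u = 0" by (rule ef_injective[OF u(1) r])
  then show ?thesis by (simp add: u(2))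
 qed
 then have "inj_on ?g ?T" using linear_inj_on_iff_eq_0[OF lin weight_space_subspace] by blast
 then have "inj_on ?g (span ?T)" using span_eq_iff weight_space_subspace by metis
 then have "dim (?g ` ?T) = dim ?T" by (rule dim_image_eq[OF lin])
 then have "?g ` ?T = ?T" using subspace_dim_equal[OF linear_subspace_image[OF lin weight_space_subspace] weight_space_subspace sub] by simp
 then have "rep v \<in> ?g ` ?T" using v by blast
 then obtain u where "u \<in> weight_space h V r" "rep v = rep (ad e (ad f u))" by auto
 then show ?thesis by (metis cmat_eqI)
qed

lemma generated_positive:
 assumes W0: "weight_space h V 0 \<subseteq> W" and We: "!!v. v \<in> W ==> ad e v \<in> W" shows "weight_space h V (2 * real m) \<subseteq> W"
proof (induction m)
 case (Suc m)
 show ?case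
 proof
  fix v assume "v \<in> weight_space h V (2 * real (Suc m))"
  then obtain u where u: "u \<in> weight_space h V (2 * real (Suc m))" "ad e (ad f u) = v" using ef_surjective[of v "2 * real (Suc m)"] by auto
  have "ad f u \<in> weight_space h V (2 * real m)" using weight_space_f[OF u(1)] by (simp add: algebra_simps)
  then show "v \<in> W" using We Suc u(2) by blast
 qed
qed (use W0 in simp)

lemma generated_kernel:
 assumes We: "!!v. v \<in> V ==> ad e v = 0 ==> v \<in> W" and Wf: "!!v. v \<in> W ==> ad f v \<in> W"
  and Wa: "!!v w. v \<in> W ==> w \<in> W ==> v + w \<in> W"
 shows "weight_space h V 0 \<subseteq> W"
proof -
 obtain N :: nat where N: "real N > norm h" using reals_Archimedean2 by blast
 have W0: "0 \<in> W" by (rule We[OF V_0]) (simp add: ad_simps)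
 have "weight_space h V (2 * real (N - k)) \<subseteq> W" for k
 proof (induction k)
  case 0
  show ?case
  proof
   fix v assume v: "v \<in> weight_space h V (2 * real (N - 0))"
   have "v = 0" using weight_space_bound[OF v] N by fastforce
   then show "v \<in> W" using W0 by simp
  qed
 next
  case (Suc k)
  show ?case
  proof (cases "k < N")
   case True
   define m where "m = N - Suc k"
   have m: "2 * real (N - k) = 2 * real m + 2" "N - Suc k = m" using True by (auto simp: m_def of_nat_diff)
   show ?thesis unfolding m
   proof
    fix v assume v: "v \<in> weight_space h V (2 * real m)"
    obtain u where u: "u \<in> weight_space h V (2 * real m + 2)" "ad e (ad f u) = ad e v" using ef_surjective[OF weight_space_e[OF v]] by auto
    have "ad f u \<in> W" using Wf Suc u(1) unfolding m(1) by blast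
    moreover have "v - ad f u \<in> W"
     by (rule We) (use u v in \<open>auto simp: weight_space_def V_diff V_f ad_simps\<close>)
    ultimately have "ad f u + (v - ad f u) \<in> W" by (rule Wa)
    then show "v \<in> W" by simp
   qed
  qed (use Suc in simp)
 qed
 from this[of N] show ?thesis by simp
qed

end

inductive_set ad_primary :: "'n::finite cmat => 'n cmat set" for h where
 zero: "0 \<in> ad_primary h"
| step: "ad h x - smat l * x \<in> ad_primary h ==> x \<in> ad_primary h"

lemma ad_primary_ad: "x \<in> ad_primary h ==> ad h x - smat m * x \<in> ad_primary h"
proof (induction rule: ad_primary.induct)
 case zero then show ?case by (simp add: ad_simps ad_primary.zero)
next
 case (step x l)
 have "ad h (ad h x - smat m * x) - smat l * (ad h x - smat m * x) = ad h (ad h x - smat l * x) - smat m * (ad h x - smat l * x)"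
  unfolding ad_simps by (rule cmat_entryI) (simp add: scaleR_conv_of_real[where 'a=complex] algebra_simps del: rep_simps(6))
 from ad_primary.step[of h "ad h x - smat m * x" l, unfolded this, OF step.IH] show ?case .
qed

lemma ad_primary_add: "x \<in> ad_primary h ==> y \<in> ad_primary h ==> x + y \<in> ad_primary h"
proof (induction arbitrary: y rule: ad_primary.induct)
 case (step x l)
 have "ad h (x + y) - smat l * (x + y) = (ad h x - smat l * x) + (ad h y - smat l * y)" by (simp add: ad_simps algebra_simps)
 from ad_primary.step[of h "x + y" l, unfolded this, OF step.IH[OF ad_primary_ad[OF step.prems]]] show ?case .
qed simp

lemma ad_primary_scale: "x \<in> ad_primary h ==> smat c * x \<in> ad_primary h"
proof (induction rule: ad_primary.induct)
 case (step x l)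
 have "ad h (smat c * x) - smat l * (smat c * x) = smat c * (ad h x - smat l * x)"
  unfolding ad_simps by (rule cmat_entryI) (simp add: scaleR_conv_of_real[where 'a=complex] algebra_simps del: rep_simps(6))
 from ad_primary.step[of h "smat c * x" l, unfolded this, OF step.IH] show ?case .
qed (simp add: ad_primary.zero)

lemma ad_primary_factors: "factors h ls * x = 0 ==> x * factors h rs = 0 ==> x \<in> ad_primary h"
proof (induction "length ls + length rs" arbitrary: ls rs x)
 case 0 then show ?case by (simp add: ad_primary.zero)
next
 case (Suc N)
 show ?case
 proof (cases "ls = [] \<or> rs = []")
  case True then show ?thesis using Suc.prems by (auto simp: ad_primary.zero)
 next
  case False
  then obtain a ls' b rs' where l: "ls = a # ls'" "rs = b # rs'" by (meson neq_Nil_conv)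
  have "(h - smat a) * x \<in> ad_primary h"
  proof (rule Suc.hyps(1))
   show "N = length ls' + length rs" using Suc.hyps(2) l by simp
   have "factors h ls' * ((h - smat a) * x) = factors h ls * x" unfolding mult.assoc[symmetric] factors_commute by (simp add: l)
   then show "factors h ls' * ((h - smat a) * x) = 0" using Suc.prems by simp
   show "(h - smat a) * x * factors h rs = 0" using Suc.prems by (simp only: mult.assoc) simp
  qed
  moreover have "x * (h - smat b) \<in> ad_primary h"
  proof (rule Suc.hyps(1))
   show "N = length ls + length rs'" using Suc.hyps(2) l by simp
   show "factors h ls * (x * (h - smat b)) = 0" using Suc.prems by (simp only: mult.assoc[symmetric]) simp
   show "x * (h - smat b) * factors h rs' = 0" using Suc.prems l by (simp add: mult.assoc)
  qed
  ultimately have "(h - smat a) * x + smat (-1) * (x * (h - smat b)) \<in> ad_primary h" by (intro ad_primary_add ad_primary_scale)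
  moreover have "(h - smat a) * x + smat (-1) * (x * (h - smat b)) = ad h x - smat (a - b) * x"
   by (simp add: ad_def smat_simps algebra_simps smat_central)
  ultimately have "ad h x - smat (a - b) * x \<in> ad_primary h" by simp
  then show ?thesis by (rule ad_primary.step)
 qed
qed

lemma ad_primary_UNIV: "x \<in> ad_primary h"
proof -
 obtain ls where "factors h ls = 0" using annihilating_factors .
 then show ?thesis using ad_primary_factors[of h ls x ls] by simp
qed

inductive_set weight_sum :: "'n::finite cmat => 'n cmat set => 'n cmat set" for h V where
 zero: "0 \<in> weight_sum h V"
| add: "x \<in> weight_sum h V ==> v \<in> weight_space h V (2 * of_int k) ==> x + v \<in> weight_sum h V"

context sl2_rep begin

lemma weight_sum_V: "x \<in> weight_sum h V ==> x \<in> V"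
 by (induction rule: weight_sum.induct) (auto simp: V_0 V_add weight_space_def)

lemma weight_space_scale: "v \<in> weight_space h V r ==> smat c * v \<in> weight_space h V r"
 by (auto simp: weight_space_def V_scale ad_simps)

lemma weight_sum_split:
 "w \<in> weight_sum h V ==> \<exists>p\<in>weight_sum h V. \<exists>q. q \<in> V & ad h q = smat l * q & (q = 0 \<or> (\<exists>k::int. l = 2 * of_int k)) & w = ad h p - smat l * p + q"
proof (induction rule: weight_sum.induct)
 case zero
 show ?case by (intro bexI[of _ 0] exI[of _ 0]) (auto simp: V_0 ad_simps weight_sum.zero)
next
 case (add x v k)
 from add.IH obtain p q where pq: "p \<in> weight_sum h V" "q \<in> V" "ad h q = smat l * q" "q = 0 \<or> (\<exists>k::int. l = 2 * of_int k)"
  "x = ad h p - smat l * p + q" by blast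
 have hv: "ad h v = smat (2 * of_int k) * v" "v \<in> V"
  using add.hyps(2) smat_of_real[of "2 * of_int k" v] by (auto simp: weight_space_def)
 show ?case
 proof (cases "l = 2 * of_int k")
  case True
  show ?thesis
   by (intro bexI[OF _ pq(1)] exI[of _ "q + v"] conjI) (use pq hv True in \<open>simp_all add: V_add ad_simps distrib_left\<close>)
 next
  case False
  define c where "c = 1 / (2 * of_int k - l)"
  have c: "c * (2 * of_int k) - l * c = 1" using False by (simp add: c_def divide_simps)
  have "smat c * (smat (2 * of_int k) * v) - smat l * (smat c * v) = smat (c * (2 * of_int k) - l * c) * v"
   by (simp only: smat_simps smat_mult left_diff_distrib mult.assoc)
  then have "ad h (smat c * v) - smat l * (smat c * v) = v" unfolding ad_simps hv c by (simp add: smat_simps)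
  then have "x + v = ad h (p + smat c * v) - smat l * (p + smat c * v) + q" unfolding pq(5) by (simp add: ad_simps algebra_simps)
  moreover have "p + smat c * v \<in> weight_sum h V" by (rule weight_sum.add[OF pq(1) weight_space_scale[OF add.hyps(2)]])
  ultimately show ?thesis using pq(2-4) by blast
 qed
qed

lemma weight_decomposition:
 assumes S: "!!v. v \<in> V ==> exp (smat (of_real pi * \<i>) * h) * v = v * exp (smat (of_real pi * \<i>) * h)"
 shows "V \<subseteq> weight_sum h V"
proof
 fix x assume "x \<in> V"
 have "x \<in> ad_primary h" by (rule ad_primary_UNIV)
 then show "x \<in> weight_sum h V" using \<open>x \<in> V\<close>
 proof (induction rule: ad_primary.induct)
  case zero show ?case by (rule weight_sum.zero)
 next
  case (step x l)
  have "ad h x - smat l * x \<in> weight_sum h V" using step.IH step.prems by (simp add: V_diff V_h V_scale)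
  from weight_sum_split[OF this, of l] obtain p q where pq: "p \<in> weight_sum h V" "q \<in> V" "ad h q = smat l * q" "q = 0 \<or> (\<exists>k::int. l = 2 * of_int k)"
   "ad h x - smat l * x = ad h p - smat l * p + q" by blast
  define y where "y = x - p"
  have yV: "y \<in> V" using step.prems weight_sum_V[OF pq(1)] by (simp add: y_def V_diff)
  have y: "ad h y = smat l * y + q" using pq(5) by (simp add: y_def ad_simps algebra_simps)
  note jordan = commute_exp_pi_jordan[OF y pq(3,4) S[OF yV]]
  have "p + y \<in> weight_sum h V"
  proof (cases "y = 0")
   case False
   then obtain n :: int where "l = of_real (2 * of_int n)" using jordan(2) by auto
   then have "ad h y = (2 * of_int n) *\<^sub>R y" using y jordan(1) smat_of_real[of "2 * of_int n" y] by simp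
   then show ?thesis by (intro weight_sum.add[OF pq(1)]) (auto simp: weight_space_def yV)
  qed (simp add: pq(1))
  then show ?case by (simp add: y_def)
 qed
qed

theorem generated_by_centralizer:
 assumes S: "!!v. v \<in> V ==> exp (smat (of_real pi * \<i>) * h) * v = v * exp (smat (of_real pi * \<i>) * h)"
  and We: "!!v. v \<in> W ==> ad e v \<in> W" and Wf: "!!v. v \<in> W ==> ad f v \<in> W"
  and Wa: "!!v w. v \<in> W ==> w \<in> W ==> v + w \<in> W"
  and c: "(\<forall>v\<in>V. ad h v = 0 --> v \<in> W) \<or> (\<forall>v\<in>V. ad e v = 0 --> v \<in> W)"
 shows "V \<subseteq> W"
proof -
 have W0: "weight_space h V 0 \<subseteq> W"
  using c generated_kernel[OF _ Wf Wa] by (auto simp: weight_space_def)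
 interpret r: sl2_rep f e "- h" V by (rule swap_rep)
 have "weight_space (- h) V 0 \<subseteq> W" using W0 by (auto simp: weight_space_def ad_simps)
 note neg = r.generated_positive[OF this Wf]
 have "weight_space h V (2 * of_int k) \<subseteq> W" for k :: int
 proof (cases "k >= 0")
  case True then show ?thesis using generated_positive[OF W0 We, of "nat k"] by simp
 next
  case False
  have "weight_space h V (2 * of_int k) \<subseteq> weight_space (- h) V (2 * real (nat (- k)))"
   using False by (auto simp: weight_space_def ad_simps)
  then show ?thesis using neg[of "nat (- k)"] by blast
 qed
 then have "weight_sum h V \<subseteq> W"
 proof (intro subsetI)
  fix x assume a: "!!k. weight_space h V (2 * of_int k) \<subseteq> W" and "x \<in> weight_sum h V"
  from this(2) show "x \<in> W"
  proof (induction rule: weight_sum.induct)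
   case zero
   have "0 \<in> weight_space h V 0" by (simp add: weight_space_def V_0 ad_simps)
   then show ?case using W0 by blast
  next
   case (add x v k) then show ?case using a Wa by blast
  qed
 qed
 then show ?thesis using weight_decomposition[OF S] by blast
qed
end

definition mcnj :: "'n::finite cmat => 'n cmat" where "mcnj A = Cm (\<chi> i j. cnj (entry A i j))"

lemma entry_mcnj [simp]: "entry (mcnj A) i j = cnj (entry A i j)" by (simp add: mcnj_def)

lemma mcnj_simps: "mcnj (A + B) = mcnj A + mcnj B" "mcnj (r *\<^sub>R A) = r *\<^sub>R mcnj A" "mcnj (smat c * A) = smat (cnj c) * mcnj A" "mcnj 1 = 1"
 "mcnj (mcnj A) = A" "mcnj (A * B) = mcnj A * mcnj B" "mcnj (A - B) = mcnj A - mcnj B" "mcnj (- A) = - mcnj A"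
proof -
 show "mcnj (A + B) = mcnj A + mcnj B" "mcnj (r *\<^sub>R A) = r *\<^sub>R mcnj A" "mcnj (smat c * A) = smat (cnj c) * mcnj A"
  "mcnj (mcnj A) = A" "mcnj (A - B) = mcnj A - mcnj B" "mcnj (- A) = - mcnj A"
  by (rule cmat_entryI; simp del: rep_simps(6))+
 show "mcnj 1 = 1" by (rule cmat_entryI) (simp add: mat_def)
 show "mcnj (A * B) = mcnj A * mcnj B" by (rule cmat_entryI) (simp add: matrix_matrix_mult_def)
qed

lemma mcnj_real_iff: "mcnj A = A \<longleftrightarrow> (\<forall>i j. entry A i j \<in> \<real>)"
proof
 assume "mcnj A = A"
 then have "cnj (entry A i j) = entry A i j" for i j by (metis entry_mcnj)
 then show "\<forall>i j. entry A i j \<in> \<real>" by (simp add: Reals_cnj_iff)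
qed (auto intro!: cmat_entryI simp: Reals_cnj_iff)

lemma bounded_linear_mcnj: "bounded_linear (mcnj :: 'n::finite cmat => 'n cmat)"
proof -
 have "linear (%A :: complex^'n^'n. \<chi> i j. cnj (A $ i $ j))" by (rule linearI) (simp_all add: vec_eq_iff)
 then have "bounded_linear (%A :: complex^'n^'n. \<chi> i j. cnj (A $ i $ j))" by (simp add: linear_conv_bounded_linear)
 from bounded_linear_compose[OF bounded_linear_Cm bounded_linear_compose[OF this bounded_linear_rep]]
 show ?thesis by (simp add: mcnj_def[abs_def])
qed

lemma mcnj_power: "mcnj (A ^ k) = mcnj A ^ k" by (induction k) (auto simp: mcnj_simps)

lemma mcnj_exp: "exp (mcnj A) = mcnj (exp A)"
proof -
 have "(%k. mcnj (A ^ k /\<^sub>R fact k)) sums mcnj (exp A)" by (rule bounded_linear.sums[OF bounded_linear_mcnj exp_converges])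
 then have "(%k. mcnj A ^ k /\<^sub>R fact k) sums mcnj (exp A)" by (simp add: mcnj_simps mcnj_power)
 then show ?thesis using exp_converges sums_unique2 by blast
qed

lemma eigenvalue_conj:
 assumes l: "eigenvalue (x * v * y) l" and xy: "y * x = 1" "x * y = 1" shows "eigenvalue v l"
proof -
 obtain u where u: "u ~= 0" "x * v * y * u = smat l * u" using l unfolding eigenvalue_def by blast
 have "y * (x * v * y * u) = (y * x) * v * (y * u)" by (simp only: mult.assoc)
 then have "v * (y * u) = smat l * (y * u)" using u(2) xy(1) by (simp add: smat_left_commute)
 moreover have "y * u ~= 0"
 proof
  assume "y * u = 0"
  then have "(x * y) * u = 0" by (simp add: mult.assoc)
  then show False using u(1) xy(2) by simp
 qed
 ultimately show ?thesis by (rule eigenvalueI)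
qed

lemma eigenvalue_scaleR: assumes "eigenvalue v l" shows "eigenvalue (c *\<^sub>R v) (of_real c * l)"
proof -
 obtain u where u: "u ~= 0" "v * u = smat l * u" using assms unfolding eigenvalue_def by blast
 have "c *\<^sub>R v * u = smat (of_real c) * (v * u)" by (simp add: smat_of_real)
 also have "... = smat (of_real c * l) * u" unfolding u(2) by (simp only: smat_mult mult.assoc)
 finally show ?thesis using u(1) by (rule eigenvalueI)
qed

lemma real_spectrum_conj: "real_spectrum v ==> y * x = 1 ==> x * y = 1 ==> real_spectrum (x * v * y)"
 using eigenvalue_conj unfolding real_spectrum_def by blast

lemma real_spectrum_scaleR: assumes v: "real_spectrum v" and c: "c ~= 0" shows "real_spectrum (c *\<^sub>R v)"
 unfolding real_spectrum_def
proof (intro allI impI)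
 fix l assume "eigenvalue (c *\<^sub>R v) l"
 from eigenvalue_scaleR[OF this, of "1 / c"] have "eigenvalue v (of_real (1 / c) * l)" using c by simp
 then have "of_real (1 / c) * l \<in> \<real>" using v unfolding real_spectrum_def by blast
 from Reals_mult[OF Reals_of_real this, of c] show "l \<in> \<real>" using c by simp
qed

lemma exp_kernel: assumes "a * u = (0 :: 'n::finite cmat)" shows "exp a * u = u"
proof -
 have "((%t. exp (t *\<^sub>R a) * u) has_vector_derivative 0) (at t)" for t
 proof -
  have "((%t. exp (t *\<^sub>R a) * u) has_vector_derivative exp (t *\<^sub>R a) * a * u) (at t)"
   by (rule has_vector_derivative_mult_left[OF exp_scaleR_has_vector_derivative_right])
  then show ?thesis by (simp add: mult.assoc assms)
 qed
 then obtain c where c: "!!t. t \<in> UNIV ==> exp (t *\<^sub>R a) * u = c"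
  using has_vector_derivative_zero_constant[of UNIV "%t. exp (t *\<^sub>R a) * u"] by auto
 show ?thesis using c[of 0] c[of 1] by simp
qed

lemma exp_eigen: assumes "v * u = smat l * u" shows "exp (smat s * v) * u = smat (exp (s * l)) * u"
proof -
 have "smat s * v = smat (s * l) + smat s * (v - smat l)" by (simp add: smat_mult right_diff_distrib)
 then have "exp (smat s * v) * u = smat (exp (s * l)) * (exp (smat s * (v - smat l)) * u)"
  by (simp only: exp_add_smat mult.assoc)
 moreover have "smat s * (v - smat l) * u = 0" by (simp add: mult.assoc left_diff_distrib assms)
 ultimately show ?thesis by (simp add: exp_kernel)
qed

lemma ad_derivative:
 assumes "!!t. exp (t *\<^sub>R a) * b * exp (- (t *\<^sub>R a)) = B t" "(B has_vector_derivative w) (at 0)"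
 shows "ad a b = (w :: 'n::finite cmat)"
proof -
 have P: "((%t. exp (t *\<^sub>R a)) has_vector_derivative exp (0 *\<^sub>R a) * a) (at 0)"
  and N: "((%t. exp (t *\<^sub>R (- a))) has_vector_derivative exp (0 *\<^sub>R (- a)) * (- a)) (at 0)"
  by (rule exp_scaleR_has_vector_derivative_right)+
 have "((%t. (exp (t *\<^sub>R a) * b) * exp (t *\<^sub>R (- a))) has_vector_derivative
   (exp (0 *\<^sub>R a) * b) * (exp (0 *\<^sub>R (- a)) * (- a)) + (exp (0 *\<^sub>R a) * a * b) * exp (0 *\<^sub>R (- a))) (at 0)"
  by (intro has_vector_derivative_mult N has_vector_derivative_mult_left[OF P])
 then have "(B has_vector_derivative ad a b) (at 0)" by (simp add: ad_def assms(1)[abs_def])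
 then show ?thesis using assms(2) by (rule vector_derivative_unique_at)
qed

lemma one_parameter_exp:
 fixes \<phi> :: "real => 'n::finite cmat"
 assumes add: "!!s t. \<phi> (s + t) = \<phi> s * \<phi> t" and one: "\<phi> 0 = 1" and der: "(\<phi> has_vector_derivative w) (at 0)"
 shows "\<phi> t = exp (t *\<^sub>R w)"
proof -
 define \<psi> where "\<psi> t = \<phi> t * exp (t *\<^sub>R (- w))" for t
 have d\<phi>: "(\<phi> has_vector_derivative \<phi> t * w) (at t)" for t
 proof -
  have "((%s. \<phi> t * \<phi> s) has_vector_derivative \<phi> t * w) (at 0)"
   by (rule has_vector_derivative_mult_right[OF der])
  then have "((%s. \<phi> (t + s)) has_vector_derivative \<phi> t * w) (at (t - t))" by (simp add: add)
  moreover have "((%s. s - t) has_vector_derivative 1) (at t)" by (auto intro!: derivative_eq_intros)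
  ultimately have "((%s. \<phi> (t + s)) \<circ> (%s. s - t) has_vector_derivative 1 *\<^sub>R (\<phi> t * w)) (at t)"
   by (intro vector_diff_chain_at)
  then show ?thesis by (simp add: o_def)
 qed
 have "(\<psi> has_vector_derivative 0) (at t)" for t
 proof -
  have "(\<psi> has_vector_derivative \<phi> t * (exp (t *\<^sub>R (- w)) * (- w)) + \<phi> t * w * exp (t *\<^sub>R (- w))) (at t)"
   unfolding \<psi>_def by (intro has_vector_derivative_mult d\<phi> exp_scaleR_has_vector_derivative_right)
  moreover have "exp (t *\<^sub>R (- w)) * (- w) = (- w) * exp (t *\<^sub>R (- w))" by (rule exp_times_scaleR_commute)
  ultimately show ?thesis by (simp only:) (simp add: mult.assoc)
 qed
 then obtain c where c: "!!t. t \<in> UNIV ==> \<psi> t = c"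
  using has_vector_derivative_zero_constant[of UNIV \<psi>] by auto
 have "\<phi> t * exp (- (t *\<^sub>R w)) = 1" using c[of t] c[of 0] by (simp add: \<psi>_def one)
 then have "\<phi> t * (exp (- (t *\<^sub>R w)) * exp (t *\<^sub>R w)) = exp (t *\<^sub>R w)" by (simp add: mult.assoc[symmetric])
 then show ?thesis by (simp add: exp_inverse_cmat)
qed

lemma Cm_simps: "Cm (A ** B) = Cm A * Cm B" "Cm (mat 1) = 1" "Cm (A + B) = Cm A + Cm B" "Cm (r *\<^sub>R A) = r *\<^sub>R Cm A"
 by (rule cmat_eqI; simp)+

locale sl2_hom =
 fixes \<rho> :: "real^2^2 => complex^'n^'n"
 assumes mul: "k \<in> SL2R ==> l \<in> SL2R ==> \<rho> (k ** l) = \<rho> k ** \<rho> l"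
  and inv: "k \<in> SL2R ==> invertible (\<rho> k)"
  and smooth: "smooth_map_on SL2R \<rho>"
  and real: "k \<in> SL2R ==> \<rho> k $ i $ j \<in> \<real>"
begin

definition R :: "real^2^2 => 'n cmat" where "R k = Cm (\<rho> k)"

lemma rep_R [simp]: "rep (R k) = \<rho> k" by (simp add: R_def)

lemma R_mult: "k \<in> SL2R ==> l \<in> SL2R ==> R (k ** l) = R k * R l"
 by (simp add: R_def mul Cm_simps)

lemma R_one: "R (mat 1) = 1"
proof -
 obtain Y where Y: "Y ** \<rho> (mat 1) = mat 1" using inv[OF SL2R_one] by (auto simp: invertible_def)
 have "\<rho> (mat 1) = (Y ** \<rho> (mat 1)) ** \<rho> (mat 1)" by (simp add: Y)
 also have "... = Y ** \<rho> (mat 1 ** mat 1)" unfolding mul[OF SL2R_one SL2R_one] by (simp add: matrix_mul_assoc)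
 finally show ?thesis by (simp add: Y R_def Cm_simps)
qed

lemma R_adj2: "k \<in> SL2R ==> R k * R (adj2 k) = 1" "k \<in> SL2R ==> R (adj2 k) * R k = 1"
 using R_mult[of k "adj2 k"] R_mult[of "adj2 k" k] by (simp_all add: adj2_SL2R R_one)

lemma mcnj_R: "k \<in> SL2R ==> mcnj (R k) = R k" using real by (simp add: mcnj_real_iff)

lemma differential_exists:
 "\<exists>D. linear D & (\<forall>c X. (\<forall>t. c t \<in> SL2R) --> c 0 = mat 1 --> (c has_vector_derivative X) (at 0) -->
   ((%t::real. R (c t)) has_vector_derivative D X) (at 0))"
proof -
 obtain U F where U: "open U" "mat 1 \<in> U" "\<forall>k. Ck_on k U F" "\<forall>y\<in>U \<inter> SL2R. F y = \<rho> y"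
  using smooth SL2R_one unfolding smooth_map_on_def by blast
 have "Ck_on (Suc 0) U F" using U(3) by blast
 then have "F differentiable at (mat 1)" using U(2) by simp
 then obtain D where D: "(F has_derivative D) (at (mat 1))" by (auto simp: differentiable_def)
 have linD: "linear D" using D by (rule has_derivative_linear)
 have "linear (%X. Cm (D X))" by (rule linearI) (simp_all add: linear_add[OF linD] linear_scale[OF linD] Cm_simps)
 moreover have "((%t. R (c t)) has_vector_derivative Cm (D X)) (at 0)"
  if c: "\<forall>t. c t \<in> SL2R" "c 0 = mat 1" "(c has_vector_derivative X) (at 0)" for c :: "real => real^2^2" and X
 proof -
  have "(c has_derivative (%t. t *\<^sub>R X)) (at 0)" using c(3) by (simp add: has_vector_derivative_def)
  moreover have "(F has_derivative D) (at (c 0))" using D c(2) by simp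
  ultimately have "(F \<circ> c has_derivative D \<circ> (%t. t *\<^sub>R X)) (at 0)" by (rule diff_chain_at)
  then have Fc: "((%t. F (c t)) has_vector_derivative D X) (at 0)"
   by (simp add: has_vector_derivative_def o_def linear_scale[OF linD])
  have "isCont c 0" using c(3) has_vector_derivative_continuous by blast
  then have "\<forall>\<^sub>F t in nhds 0. c t \<in> U"
   unfolding isCont_def tendsto_at_iff_tendsto_nhds by (rule topological_tendstoD) (use U(1,2) c(2) in simp_all)
  then have "\<forall>\<^sub>F t in nhds 0. F (c t) = \<rho> (c t)" by eventually_elim (use U(4) c(1) in auto)
  then obtain S where S: "open S" "0 \<in> S" "!!t. t \<in> S ==> F (c t) = \<rho> (c t)" unfolding eventually_nhds by blast
  have "((%t. \<rho> (c t)) has_vector_derivative D X) (at 0)"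
   by (rule has_vector_derivative_transform_within_open[OF Fc S])
  from bounded_linear.has_vector_derivative[OF bounded_linear_Cm this] show ?thesis by (simp add: R_def)
 qed
 ultimately show ?thesis by blast
qed

definition d :: "real^2^2 => 'n cmat" where
 "d = (SOME D. linear D & (\<forall>c X. (\<forall>t. c t \<in> SL2R) --> c 0 = mat 1 --> (c has_vector_derivative X) (at 0) -->
   ((%t::real. R (c t)) has_vector_derivative D X) (at 0)))"

lemma d_linear: "linear d" unfolding d_def using someI_ex[OF differential_exists] by (rule conjunct1)

lemma d_curve:
 assumes "!!t. c t \<in> SL2R" "c 0 = mat 1" "(c has_vector_derivative X) (at 0)"
 shows "((%t::real. R (c t)) has_vector_derivative d X) (at 0)"
 using someI_ex[OF differential_exists, folded d_def, THEN conjunct2, rule_format, OF assms] .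

abbreviation "Ad k v \<equiv> R k * v * R (adj2 k)"

abbreviation "e \<equiv> d (sl 0 1 0)"
abbreviation "f \<equiv> d (sl 0 0 1)"
abbreviation "h \<equiv> d (sl 1 0 0)"

lemma d_sl: "d (sl p q r) = p *\<^sub>R h + q *\<^sub>R e + r *\<^sub>R f"
proof -
 have "sl p q r = p *\<^sub>R sl 1 0 0 + q *\<^sub>R sl 0 1 0 + r *\<^sub>R sl 0 0 1" by (simp add: mat2_simps)
 then show ?thesis by (simp only: linear_add[OF d_linear] linear_scale[OF d_linear])
qed

lemma R_one_param: assumes "one_param c X" shows "R (c t) = exp (t *\<^sub>R d X)"
proof (rule one_parameter_exp[where \<phi>="%t. R (c t)"])
 show "R (c (s + t)) = R (c s) * R (c t)" for s t using assms R_mult by (simp add: one_param_def)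
 show "R (c 0) = 1" using assms R_one by (simp add: one_param_def)
 show "((%t. R (c t)) has_vector_derivative d X) (at 0)" using assms by (intro d_curve) (auto simp: one_param_def)
qed

lemmas R_upper = R_one_param[OF one_param_upper] and R_lower = R_one_param[OF one_param_lower]
 and R_diag = R_one_param[OF one_param_diag] and R_rot = R_one_param[OF one_param_rot]

lemma mcnj_d: assumes "one_param c X" shows "mcnj (d X) = d X"
proof -
 have deriv: "((%t. R (c t)) has_vector_derivative d X) (at 0)" using assms by (intro d_curve) (auto simp: one_param_def)
 have "((%t. mcnj (R (c t))) has_vector_derivative mcnj (d X)) (at 0)"
  by (rule bounded_linear.has_vector_derivative[OF bounded_linear_mcnj deriv])
 moreover have "mcnj (R (c t)) = R (c t)" for t using assms by (simp add: one_param_def mcnj_R)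
 ultimately show ?thesis using deriv vector_derivative_unique_at by fastforce
qed

lemma mcnj_efh: "mcnj e = e" "mcnj f = f" "mcnj h = h" by (rule mcnj_d one_param_upper one_param_lower one_param_diag)+

lemma d_conj_one_param:
 assumes c: "one_param c X" and k: "k \<in> SL2R" shows "d (k ** X ** adj2 k) = R k * d X * R (adj2 k)"
proof -
 have cs: "!!t. c t \<in> SL2R" "c 0 = mat 1" "(c has_vector_derivative X) (at 0)" using c by (auto simp: one_param_def)
 have "linear (%Y. k ** Y ** adj2 k)" by (rule linear_sandwich2)
 then have "bounded_linear (%Y. k ** Y ** adj2 k)" by (simp add: linear_conv_bounded_linear)
 from bounded_linear.has_vector_derivative[OF this cs(3)]
 have "((%t. k ** c t ** adj2 k) has_vector_derivative k ** X ** adj2 k) (at 0)" .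
 then have "((%t. R (k ** c t ** adj2 k)) has_vector_derivative d (k ** X ** adj2 k)) (at 0)"
  by (intro d_curve) (simp_all add: SL2R_mult k cs adj2_SL2R)
 moreover have "R (k ** c t ** adj2 k) = Ad k (R (c t))" for t
  by (simp add: R_mult SL2R_mult k cs adj2_SL2R)
 ultimately have deriv: "((%t. Ad k (R (c t))) has_vector_derivative d (k ** X ** adj2 k)) (at 0)" by simp
 have "((%t. Ad k (R (c t))) has_vector_derivative R k * d X * R (adj2 k)) (at 0)"
  by (rule has_vector_derivative_mult_left[OF has_vector_derivative_mult_right[OF d_curve[OF cs]]])
 then show ?thesis using deriv vector_derivative_unique_at by blast
qed

lemmas d_conj_E = d_conj_one_param[OF one_param_upper] and d_conj_F = d_conj_one_param[OF one_param_lower] and d_conj_H = d_conj_one_param[OF one_param_diag]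

lemma d_conj: assumes k: "k \<in> SL2R" shows "d (k ** sl p q r ** adj2 k) = Ad k (d (sl p q r))"
proof -
 have "sl p q r = p *\<^sub>R sl 1 0 0 + q *\<^sub>R sl 0 1 0 + r *\<^sub>R sl 0 0 1" by (simp add: mat2_simps)
 then have "k ** sl p q r ** adj2 k = p *\<^sub>R (k ** sl 1 0 0 ** adj2 k) + q *\<^sub>R (k ** sl 0 1 0 ** adj2 k) + r *\<^sub>R (k ** sl 0 0 1 ** adj2 k)"
  by (simp only: linear_add[OF linear_sandwich2] linear_scale[OF linear_sandwich2])
 then show ?thesis unfolding d_sl[of p q r]
  by (simp only: linear_add[OF d_linear] linear_scale[OF d_linear] d_conj_E[OF k] d_conj_F[OF k] d_conj_H[OF k]) (simp add: algebra_simps)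
qed

lemma triple: "sl2_triple e f h"
proof
 have eh: "ad e h = (-2) *\<^sub>R e"
 proof (rule ad_derivative)
  have A: "R (upper t) * h * R (adj2 (upper t)) = h - (2 * t) *\<^sub>R e" for t
   using d_conj[of "upper t" 1 0 0] d_sl[of 1 "- (2 * t)" 0] by (simp add: mat2_simps)
  show "exp (t *\<^sub>R e) * h * exp (- (t *\<^sub>R e)) = h - (2 * t) *\<^sub>R e" for t
   using A[of t] R_upper[of t] R_upper[of "- t"] by simp
  show "((%t. h - (2 * t) *\<^sub>R e) has_vector_derivative (-2) *\<^sub>R e) (at 0)" by (auto intro!: derivative_eq_intros)
 qed
 show "ad h e = 2 *\<^sub>R e" unfolding ad_flip[of h e] eh by simp
 have fh: "ad f h = 2 *\<^sub>R f"
 proof (rule ad_derivative)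
  have A: "R (lower t) * h * R (adj2 (lower t)) = h + (2 * t) *\<^sub>R f" for t
   using d_conj[of "lower t" 1 0 0] d_sl[of 1 0 "2 * t"] by (simp add: mat2_simps)
  show "exp (t *\<^sub>R f) * h * exp (- (t *\<^sub>R f)) = h + (2 * t) *\<^sub>R f" for t
   using A[of t] R_lower[of t] R_lower[of "- t"] by simp
  show "((%t. h + (2 * t) *\<^sub>R f) has_vector_derivative 2 *\<^sub>R f) (at 0)" by (auto intro!: derivative_eq_intros)
 qed
 show "ad h f = (-2) *\<^sub>R f" unfolding ad_flip[of h f] fh by simp
 show "ad e f = h"
 proof (rule ad_derivative)
  have A: "R (upper t) * f * R (adj2 (upper t)) = t *\<^sub>R h - (t * t) *\<^sub>R e + f" for t
   using d_conj[of "upper t" 0 0 1] d_sl[of t "- (t * t)" 1] by (simp add: mat2_simps)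
  show "exp (t *\<^sub>R e) * f * exp (- (t *\<^sub>R e)) = t *\<^sub>R h - (t * t) *\<^sub>R e + f" for t
   using A[of t] R_upper[of t] R_upper[of "- t"] by simp
  show "((%t. t *\<^sub>R h - (t * t) *\<^sub>R e + f) has_vector_derivative h) (at 0)" by (auto intro!: derivative_eq_intros)
 qed
qed

sublocale sl2_triple e f h by (rule triple)

abbreviation "minus1 \<equiv> mat2 (- 1) 0 0 (- 1)"

lemma R_minus1: "R minus1 * R minus1 = 1" using R_mult[of minus1 minus1] R_one by (simp add: mat2_simps mat2_one)

lemma R_minus1_commute: "k \<in> SL2R ==> R minus1 * R k = R k * R minus1"
proof -
 assume k: "k \<in> SL2R"
 obtain a b c d where "k = mat2 a b c d" by (rule mat2_cases)
 then have "minus1 ** k = k ** minus1" by (simp add: mat2_simps)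
 then show ?thesis using R_mult[of minus1 k] R_mult[of k minus1] k by simp
qed

lemma R_minus1_d: "R minus1 * d (sl p q r) = d (sl p q r) * R minus1"
proof -
 have "R minus1 * d (sl p q r) * R minus1 = d (sl p q r)" using d_conj[of minus1 p q r] by (simp add: mat2_simps)
 then have "R minus1 * d (sl p q r) * (R minus1 * R minus1) = d (sl p q r) * R minus1" by (simp add: mult.assoc[symmetric])
 then show ?thesis by (simp add: R_minus1)
qed

lemma exp_pi_h: "exp (smat (of_real pi * \<i>) * h) = R minus1"
proof -
 define a where "a = smat (of_real pi * \<i>) * h"
 obtain x x' where x: "x * x' = 1" "x' * x = 1" "x * (smat \<i> * h) * x' = e - f"
  "\<forall>z. z * e = e * z --> z * f = f * z --> z * x = x * z" using conj_ih .
 have "a = pi *\<^sub>R (smat \<i> * h)" unfolding a_def smat_mult mult.assoc by (rule smat_of_real)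
 then have "x * a * x' = pi *\<^sub>R d (sl 0 1 (- 1))" using x(3) d_sl[of 0 1 "- 1"] by simp
 then have "exp (x * a * x') = R (rot pi)" by (simp only: R_rot)
 then have "x * exp a * x' = R minus1" using exp_conj[OF x(2), of a] by simp
 then have "(x' * x) * exp a * (x' * x) = x' * R minus1 * x" by (metis mult.assoc)
 also have "... = (x' * x) * R minus1" using x(4) R_minus1_d[of 0 1 0] R_minus1_d[of 0 0 1] by (simp add: mult.assoc)
 finally show ?thesis by (simp add: x(2) a_def)
qed

lemma lie_differential_A0: "lie_differential \<rho> A0 = rep h"
proof -
 have "((%t. R (diag t)) has_vector_derivative h) (at 0)"
  using one_param_diag by (intro d_curve) (auto simp: one_param_def)
 from bounded_linear.has_vector_derivative[OF bounded_linear_rep this]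
 have "((%t. \<rho> (diag t)) has_vector_derivative rep h) (at 0)" by simp
 then show ?thesis unfolding lie_differential_def matrix_exp_A0 by (rule vector_derivative_at)
qed

lemma sigma_eq: "sigma \<rho> = \<rho> minus1"
proof -
 have "Cm (\<chi> i j. of_real pi * \<i> * rep h $ i $ j) = smat (of_real pi * \<i>) * h"
  by (rule cmat_entryI) (simp only: entry_smat_mult, simp)
 then show ?thesis unfolding sigma_def lie_differential_A0 matrix_exp_eq by (simp add: exp_pi_h)
qed

lemma real_spectrum_h: "real_spectrum h"
 unfolding real_spectrum_def
proof (intro allI impI)
 fix l assume "eigenvalue h l"
 then obtain u where u: "u ~= 0" "h * u = smat l * u" unfolding eigenvalue_def by blast
 let ?s = "of_real pi * \<i>"
 have minus1_u: "R minus1 * u = smat (exp (?s * l)) * u" using exp_eigen[OF u(2), of ?s] by (simp add: exp_pi_h)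
 have "u = R minus1 * (R minus1 * u)" by (simp add: mult.assoc[symmetric] R_minus1)
 also have "... = R minus1 * (smat (exp (?s * l)) * u)" by (simp only: minus1_u)
 also have "... = smat (exp (?s * l)) * (R minus1 * u)" by (rule smat_left_commute)
 also have "... = smat (exp (?s * l) * exp (?s * l)) * u" unfolding minus1_u by (simp only: smat_mult mult.assoc)
 finally have "smat (exp (?s * l) * exp (?s * l) - 1) * u = 0"
  by (simp add: smat_simps left_diff_distrib del: smat_mult_eq_0_iff)
 then have "exp (?s * l + ?s * l) = 1" using u(1) unfolding exp_add by simp
 then have "Re (?s * l + ?s * l) = 0" by (simp only: exp_eq_1)
 then show "l \<in> \<real>" by (simp add: complex_is_Real_iff)
qed

lemma eigenvalue_e_scaled: assumes "eigenvalue e l" shows "eigenvalue e (of_real (exp (- (2 * t))) * l)"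
proof -
 have k: "diag t \<in> SL2R" by (simp add: exp_minus)
 have "Ad (diag t) e = (exp (2 * t)) *\<^sub>R e"
  using d_conj[OF k, of 0 1 0] d_sl[of 0 "exp (2 * t)" 0] by (simp add: mat2_simps exp_minus exp_add[symmetric])
 moreover have "R (adj2 (diag t)) * (Ad (diag t) e) * R (diag t)
   = (R (adj2 (diag t)) * R (diag t)) * e * (R (adj2 (diag t)) * R (diag t))" by (simp only: mult.assoc)
 ultimately have "R (adj2 (diag t)) * (exp (2 * t) *\<^sub>R e) * R (diag t) = e" using R_adj2[OF k] by simp
 then have "eigenvalue (exp (2 * t) *\<^sub>R e) l" using eigenvalue_conj R_adj2[OF k] assms by metis
 from eigenvalue_scaleR[OF this, of "exp (- (2 * t))"] show ?thesis by (simp add: exp_minus)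
qed

lemma real_spectrum_e: "real_spectrum e"
 unfolding real_spectrum_def
proof (intro allI impI)
 fix l assume l: "eigenvalue e l"
 have bound: "exp (- (2 * t)) * cmod l <= norm e" for t :: real
  using eigenvalue_norm[OF eigenvalue_e_scaled[OF l, of t]] by (simp add: norm_mult)
 have "l = 0"
 proof (rule ccontr)
  assume "l ~= 0"
  then have pos: "cmod l > 0" by simp
  define M where "M = (norm e + 1) / cmod l"
  have M: "M > 0" using pos by (simp add: M_def add_nonneg_pos)
  have "exp (- (2 * (- ln M / 2))) * cmod l = norm e + 1" using M pos by (simp add: M_def)
  then show False using bound[of "- ln M / 2"] by linarith
 qed
 then show "l \<in> \<real>" by simp
qed

end

section \<open>Identity components and commutants\<close>

lemma zariski_left_continuous:
 assumes "invertible (A :: complex^'n^'n)" shows "continuous_map zariski zariski (%X. A ** X)"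
 unfolding continuous_map_closedin
proof (intro conjI allI impI)
 show "(%X. A ** X) \<in> topspace zariski \<rightarrow> topspace zariski" using assms by (auto intro: invertible_mult)
 fix C assume "closedin zariski (C :: (complex^'n^'n) set)"
 from closed_left_preimage[OF this assms] show "closedin zariski {x \<in> topspace zariski. A ** x \<in> C}" by simp
qed

lemma identity_component_iff:
 "Y \<in> identity_component Z \<longleftrightarrow> (\<exists>T. connectedin zariski T & T \<subseteq> Z & mat 1 \<in> T & Y \<in> T)"
 unfolding identity_component_def by (auto simp: connected_component_of_def connectedin_subtopology)

lemma identity_component_subset_self: "identity_component Z \<subseteq> Z"
 unfolding identity_component_iff[abs_def] by (auto simp: identity_component_iff)

lemma identity_component_mult:
 assumes Z: "linear_algebraic_group Z" and X: "X \<in> identity_component Z" and Y: "Y \<in> identity_component Z"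
 shows "X ** Y \<in> identity_component (Z :: (complex^'n^'n) set)"
proof -
 obtain S T where S: "connectedin zariski S" "S \<subseteq> Z" "mat 1 \<in> S" "X \<in> S" and T: "connectedin zariski T" "T \<subseteq> Z" "mat 1 \<in> T" "Y \<in> T"
  using X Y unfolding identity_component_iff by blast
 have XZ: "X \<in> Z" using S by blast
 let ?T = "(%A. X ** A) ` T"
 have conn: "connectedin zariski ?T"
  by (rule connectedin_continuous_map_image[OF zariski_left_continuous[OF alg_groupD(5)[OF Z XZ]] T(1)])
 have "X \<in> ?T" using T(3) by (intro image_eqI[of _ _ "mat 1"]) auto
 then have "connectedin zariski (S \<union> ?T)" using S(4) by (intro connectedin_Un S(1) conn) blast
 moreover have "?T \<subseteq> Z" using T(2) alg_groupD(3)[OF Z XZ] by blast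
 moreover have "X ** Y \<in> ?T" using T(4) by blast
 ultimately show ?thesis unfolding identity_component_iff using S(2,3) by (intro exI[of _ "S \<union> ?T"]) blast
qed

lemma identity_component_inverse:
 assumes Z: "linear_algebraic_group Z" and X: "X \<in> identity_component Z" and Y: "Y ** X = mat 1"
 shows "Y \<in> identity_component (Z :: (complex^'n^'n) set)"
proof -
 obtain S where S: "connectedin zariski S" "S \<subseteq> Z" "mat 1 \<in> S" "X \<in> S" using X unfolding identity_component_iff by blast
 have YZ: "Y \<in> Z" using alg_group_inverse[OF Z _ disjI2[OF Y]] S by blast
 let ?T = "(%A. Y ** A) ` S"
 have conn: "connectedin zariski ?T"
  by (rule connectedin_continuous_map_image[OF zariski_left_continuous[OF alg_groupD(5)[OF Z YZ]] S(1)])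
 have "mat 1 \<in> ?T" by (rule image_eqI[where x = X]) (simp_all add: Y S)
 moreover have "Y \<in> ?T" using S(3) by (intro image_eqI[of _ _ "mat 1"]) auto
 moreover have "?T \<subseteq> Z" using S(2) alg_groupD(3)[OF Z YZ] by blast
 ultimately show ?thesis unfolding identity_component_iff using conn by (intro exI[of _ ?T]) blast
qed

lemma identity_component_closed:
 assumes Z: "linear_algebraic_group Z" shows "closedin zariski (identity_component (Z :: (complex^'n^'n) set))"
proof -
 have "closedin (subtopology zariski Z) (identity_component Z)"
  unfolding identity_component_def by (rule closedin_connected_component_of)
 then show ?thesis using closedin_trans_full alg_groupD(1)[OF Z] by blast
qed

lemma continuous_map_zariski:
 fixes \<gamma> :: "'a::topological_space => complex^'n^'n"
 assumes cont: "continuous_on UNIV \<gamma>" and inv: "!!s. invertible (\<gamma> s)"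
 shows "continuous_map euclidean zariski \<gamma>"
 unfolding continuous_map_closedin
proof (intro conjI allI impI)
 show "\<gamma> \<in> topspace euclidean \<rightarrow> topspace zariski" using inv by simp
 fix C assume "closedin zariski (C :: (complex^'n^'n) set)"
 then obtain P where P: "P \<subseteq> regular" "C = zero_locus P" using closedin_zariski by blast
 have "closed {s. p (\<gamma> s) = 0}" if "p \<in> P" for p
 proof -
  have "continuous_on UNIV (%s. p (\<gamma> s))"
   by (rule continuous_on_compose2[OF regular_continuous cont]) (use that P(1) in auto)
  then show ?thesis by (intro closed_Collect_eq continuous_intros)
 qed
 then have "closed (\<Inter>p\<in>P. {s. p (\<gamma> s) = 0})" by blast
 moreover have "{s \<in> topspace euclidean. \<gamma> s \<in> C} = (\<Inter>p\<in>P. {s. p (\<gamma> s) = 0})"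
  unfolding P(2) zero_locus_def using inv by auto
 ultimately show "closedin euclidean {s \<in> topspace euclidean. \<gamma> s \<in> C}" by simp
qed

lemma identity_component_exp:
 assumes v: "v \<in> lie Z" shows "rep (exp (smat s * v)) \<in> identity_component (Z :: (complex^'n^'n) set)"
proof -
 let ?\<gamma> = "%s. rep (exp (smat s * v))"
 have "continuous_on UNIV ?\<gamma>"
  by (intro continuous_intros continuous_on_compose2[OF continuous_on_exp_banach]) auto
 then have "continuous_map euclidean zariski ?\<gamma>" by (rule continuous_map_zariski[OF _ invertible_exp])
 then have "connectedin zariski (range ?\<gamma>)"
  by (rule connectedin_continuous_map_image) (simp add: connectedin_iff_connected connected_UNIV)
 moreover have "range ?\<gamma> \<subseteq> Z" using v by (auto simp: lie_def)
 moreover have "mat 1 \<in> range ?\<gamma>" by (rule image_eqI[of _ _ 0]) (auto simp: smat_simps)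
 ultimately show ?thesis unfolding identity_component_iff by blast
qed

lemma poly_fun_real_cnj:
 "p \<in> poly_fun \<real> ==> p (rep (mcnj (Cm X))) = cnj (p (X :: complex^'n^'n))"
 by (induction rule: poly_fun.induct) (auto simp: Reals_cnj_iff)

lemma closedin_commutant: "closedin zariski {X \<in> GL_set. A ** X = X ** (A :: complex^'n^'n)}"
proof -
 let ?p = "%(i, j) X. (A ** X) $ i $ j + (-1) * (X ** A) $ i $ j"
 have entry: "(%X. X $ i $ j) \<in> regular" for i j :: 'n by (rule poly_fun.entry)
 have "?p (i, j) \<in> regular" for i j
  using poly_fun.add[OF regular_left[OF entry] regular_scale[OF regular_right[OF entry], of "- 1"]] by simp
 then have "range ?p \<subseteq> regular" by auto
 moreover have "{X \<in> GL_set. A ** X = X ** A} = zero_locus (range ?p)" by (auto simp: zero_locus_def vec_eq_iff)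
 ultimately show ?thesis unfolding closedin_zariski by blast
qed

lemma alg_group_commutant:
 assumes GG: "linear_algebraic_group GG"
 shows "linear_algebraic_group {X \<in> GG. A ** X = X ** (A :: complex^'n^'n)}" (is "linear_algebraic_group ?Z")
proof (rule alg_groupI)
 note GD = alg_groupD[OF GG]
 have "?Z = GG \<inter> {X \<in> GL_set. A ** X = X ** A}" using GD(5) by blast
 then show "closedin zariski ?Z" using closedin_Int[OF GD(1) closedin_commutant] by simp
 show "mat 1 \<in> ?Z" using GD(2) by simp
 show "X ** Y \<in> ?Z" if XY: "X \<in> ?Z" "Y \<in> ?Z" for X Y
 proof -
  have "A ** (X ** Y) = (X ** A) ** Y" using XY by (simp add: matrix_mul_assoc)
  also have "... = (X ** Y) ** A" using XY by (simp add: matrix_mul_assoc[symmetric])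
  finally show ?thesis using XY GD(3) by simp
 qed
 show "\<exists>Y\<in>?Z. X ** Y = mat 1 & Y ** X = mat 1" if X: "X \<in> ?Z" for X
 proof -
  obtain Y where Y: "Y \<in> GG" "X ** Y = mat 1" "Y ** X = mat 1" using X GD(4) by blast
  have "A ** Y = (Y ** X) ** A ** Y" by (simp add: Y)
  also have "... = Y ** (X ** A) ** Y" by (simp add: matrix_mul_assoc)
  also have "... = Y ** (A ** X) ** Y" using X by simp
  also have "... = Y ** A ** (X ** Y)" by (simp add: matrix_mul_assoc)
  finally show ?thesis using Y by auto
 qed
qed

lemma commute_derivative:
 assumes "!!t::real. S * exp (t *\<^sub>R v) = exp (t *\<^sub>R v) * (S :: 'n::finite cmat)" shows "S * v = v * S"
proof -
 have exp_v: "((%t. exp (t *\<^sub>R v)) has_vector_derivative exp (0 *\<^sub>R v) * v) (at 0)" by (rule exp_scaleR_has_vector_derivative_right)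
 have left: "((%t. S * exp (t *\<^sub>R v)) has_vector_derivative S * (exp (0 *\<^sub>R v) * v)) (at 0)"
  by (rule has_vector_derivative_mult_right[OF exp_v])
 have right: "((%t. exp (t *\<^sub>R v) * S) has_vector_derivative (exp (0 *\<^sub>R v) * v) * S) (at 0)"
  by (rule has_vector_derivative_mult_left[OF exp_v])
 have "S * (exp (0 *\<^sub>R v) * v) = (exp (0 *\<^sub>R v) * v) * S" by (rule vector_derivative_unique_at[OF left[unfolded assms] right])
 then show ?thesis by simp
qed

lemma lie_ad: "linear_algebraic_group C ==> u \<in> lie C ==> v \<in> lie C ==> ad u v \<in> lie C"
 unfolding ad_def by (rule lie_bracket)

lemma lie_scaleR_cancel: "c *\<^sub>R v \<in> lie C ==> c ~= 0 ==> v \<in> lie C"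
 using lie_scaleR[of "c *\<^sub>R v" C "1 / c"] by simp

context sl2_triple
begin

lemma ad_h_combination:
 "2 *\<^sub>R ad h (p *\<^sub>R h + q *\<^sub>R e + r *\<^sub>R f) + ad h (ad h (p *\<^sub>R h + q *\<^sub>R e + r *\<^sub>R f)) = (8 * q) *\<^sub>R e"
proof -
 have first: "ad h (p *\<^sub>R h + q *\<^sub>R e + r *\<^sub>R f) = (2 * q) *\<^sub>R e - (2 * r) *\<^sub>R f"
  unfolding ad_simps he hf ad_self by (simp add: mult.commute)
 have "ad h ((2 * q) *\<^sub>R e - (2 * r) *\<^sub>R f) = (4 * q) *\<^sub>R e + (4 * r) *\<^sub>R f"
  unfolding ad_simps he hf by (simp add: mult.commute)
 then have "2 *\<^sub>R ad h (p *\<^sub>R h + q *\<^sub>R e + r *\<^sub>R f) + ad h (ad h (p *\<^sub>R h + q *\<^sub>R e + r *\<^sub>R f))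
   = (4 * q) *\<^sub>R e + (4 * q) *\<^sub>R e" unfolding first by (simp add: scaleR_diff_right)
 also have "... = (8 * q) *\<^sub>R e" by (simp flip: scaleR_add_left)
 finally show ?thesis .
qed

lemma lie_contains_triple:
 assumes C: "linear_algebraic_group C" and x: "p *\<^sub>R h + q *\<^sub>R e + r *\<^sub>R f \<in> lie C" "r ~= 0" and e: "e \<in> lie C"
 shows "f \<in> lie C" "h \<in> lie C"
proof -
 let ?x = "p *\<^sub>R h + q *\<^sub>R e + r *\<^sub>R f"
 have eh: "ad e h = (-2) *\<^sub>R e" using he ad_flip[of e h] by simp
 have "ad e ?x \<in> lie C" by (rule lie_ad[OF C e x(1)])
 then have "(p *\<^sub>R (-2) *\<^sub>R e + r *\<^sub>R h) - (- 2 * p) *\<^sub>R e \<in> lie C"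
  unfolding ad_simps eh ad_self ef by (intro lie_minus[OF C] lie_scaleR e) simp
 then have "r *\<^sub>R h \<in> lie C" by (simp add: mult.commute)
 then show h: "h \<in> lie C" using x(2) by (rule lie_scaleR_cancel)
 have "?x - (p *\<^sub>R h + q *\<^sub>R e) \<in> lie C" by (intro lie_minus[OF C] lie_add[OF C] lie_scaleR x e h)
 then have "r *\<^sub>R f \<in> lie C" by simp
 then show "f \<in> lie C" using x(2) by (rule lie_scaleR_cancel)
qed

lemma lie_contains_e:
 assumes C: "linear_algebraic_group C" and x: "p *\<^sub>R h + q *\<^sub>R e + r *\<^sub>R f \<in> lie C" "q ~= 0" and h: "h \<in> lie C"
 shows "e \<in> lie C"
proof -
 note hx = lie_ad[OF C h x(1)]
 have "(8 * q) *\<^sub>R e \<in> lie C"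
  using lie_add[OF C lie_scaleR[OF hx, of 2] lie_ad[OF C h hx]] unfolding ad_h_combination .
 then show ?thesis by (rule lie_scaleR_cancel) (use x(2) in simp)
qed

end

lemma sl2_triple_conj:
 assumes t: "sl2_triple e f h" and xy: "y * x = 1"
 shows "sl2_triple (x * e * y) (x * f * y) (x * h * y)"
proof -
 interpret sl2_triple e f h by (rule t)
 have conj: "ad (x * a * y) (x * b * y) = x * ad a b * y" for a b
 proof -
  have "(x * a * y) * (x * b * y) = x * a * (y * x) * b * y" for a b by (simp only: mult.assoc)
  then show ?thesis unfolding ad_def xy by (simp add: algebra_simps)
 qed
 show ?thesis by unfold_locales (simp_all add: conj he hf ef)
qed

section \<open>Zariski dense deformations\<close>

lemma spread_spanning_family:
 fixes V :: "bool => 'a::euclidean_space set"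
 assumes g: "2 * DIM('a) <= g" and V0: "!!\<theta>. 0 \<in> V \<theta>"
 obtains \<theta> w where "\<forall>i. w i \<in> V (T i)" "V \<theta> \<subseteq> span (w ` {..<g::nat})"
proof -
 let ?I = "%\<theta>. {i \<in> {..<g}. T i = \<theta>}"
 have "{..<g} = ?I True \<union> ?I False" by auto
 then have "g <= card (?I True) + card (?I False)" by (metis card_Un_le card_lessThan)
 then have "DIM('a) <= card (?I True) \<or> DIM('a) <= card (?I False)" using g by linarith
 then obtain \<theta> where \<theta>: "DIM('a) <= card (?I \<theta>)" by blast
 obtain B where B: "B \<subseteq> V \<theta>" "independent B" "V \<theta> \<subseteq> span B" "card B = dim (V \<theta>)"
  using basis_exists[of "V \<theta>"] by blast
 have "card B <= card (?I \<theta>)" using B(4) dim_subset_UNIV[of "V \<theta>"] \<theta> by linarith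
 then obtain j where j: "j ` B \<subseteq> ?I \<theta>" "inj_on j B"
  using card_le_inj[of B "?I \<theta>"] independent_bound[OF B(2)] by auto
 define w where "w i = (if i \<in> j ` B then inv_into B j i else 0)" for i
 have "w i \<in> V (T i)" for i
 proof (cases "i \<in> j ` B")
  case True
  then have "inv_into B j i \<in> V \<theta>" "T i = \<theta>" using B(1) j(1) inv_into_into[of i j B] by auto
  then show ?thesis using True by (simp add: w_def)
 qed (simp add: w_def V0)
 moreover have "B \<subseteq> w ` {..<g}"
 proof
  fix b assume "b \<in> B"
  then have "b = w (j b)" "j b \<in> {..<g}" using j by (auto simp: w_def)
  then show "b \<in> w ` {..<g}" by (rule image_eqI)
 qed
 then have "V \<theta> \<subseteq> span (w ` {..<g})" using B(3) span_mono by blast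
 ultimately show ?thesis using that by blast
qed

locale real_sl2 = sl2_hom \<rho> for \<rho> :: "real^2^2 => complex^'n^'n" +
 fixes GG G :: "(complex^'n^'n) set"
 assumes GG: "linear_algebraic_group GG" and GGR: "defined_over_R GG"
  and G_GG: "G \<subseteq> real_points GG" and G_mult: "X \<in> G ==> Y \<in> G ==> X ** Y \<in> G" and G_one: "mat 1 \<in> G"
  and G_inv: "X \<in> G ==> \<exists>Y\<in>G. X ** Y = mat 1 & Y ** X = mat 1"
  and G_open: "openin (top_of_set (real_points GG)) G"
  and \<rho>G: "k \<in> SL2R ==> \<rho> k \<in> G"
begin

abbreviation "Z \<equiv> {X \<in> GG. \<rho> minus1 ** X = X ** \<rho> minus1}"
abbreviation "Z0 \<equiv> identity_component Z"
abbreviation "H \<equiv> G \<inter> Z0"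

lemma G_even_eq: "G_even GG G \<rho> = H"
 using G_GG identity_component_subset_self[of Z] by (auto simp: G_even_def GG_even_def sigma_eq real_points_def)

lemma Z: "linear_algebraic_group Z" by (rule alg_group_commutant[OF GG])

lemma \<rho>Z: "k \<in> SL2R ==> \<rho> k \<in> Z"
proof -
 assume k: "k \<in> SL2R"
 have "rep (R minus1 * R k) = rep (R k * R minus1)" using R_minus1_commute[OF k] by simp
 then show ?thesis using \<rho>G[OF k] G_GG by (auto simp: real_points_def)
qed

lemma lie_efh: assumes C: "linear_algebraic_group C" and k: "!!k. k \<in> SL2R ==> \<rho> k \<in> C" shows "e \<in> lie C" "f \<in> lie C" "h \<in> lie C"
proof -
 have "rep (exp (1 *\<^sub>R e)) = \<rho> (upper 1)" unfolding R_upper[symmetric] by simp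
 moreover have "\<rho> (upper 1) \<in> C" by (rule k) simp
 ultimately have "rep (exp e) \<in> C" by simp
 then show el: "e \<in> lie C" by (rule lie_realI[OF C real_spectrum_e])
 let ?J = "mat2 0 1 (- 1) 0"
 have J: "?J \<in> SL2R" by simp
 have "rep (R ?J) \<in> C" using k[OF J] by simp
 from lie_Ad[OF C el this R_adj2(2)[OF J] R_adj2(1)[OF J]] have "R ?J * e * R (adj2 ?J) \<in> lie C" .
 moreover have "R ?J * e * R (adj2 ?J) = (- 1) *\<^sub>R f"
  using d_conj[OF J, of 0 1 0] d_sl[of 0 0 "- 1"] by (simp add: mat2_simps)
 ultimately have "(- 1) *\<^sub>R f \<in> lie C" by (simp only:)
 then show fl: "f \<in> lie C" by (rule lie_scaleR_cancel) simp
 show "h \<in> lie C" using lie_ad[OF C el fl] unfolding ef .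
qed

lemma rho_mem: assumes C: "mat 1 \<in> C" "!!X Y. X \<in> C ==> Y \<in> C ==> X ** Y \<in> C"
  and ef': "!!s. rep (exp (smat s * e)) \<in> C" "!!s. rep (exp (smat s * f)) \<in> C" and k: "k \<in> SL2R"
 shows "\<rho> k \<in> C"
proof -
 obtain x y z w where k_eq: "k = upper x ** lower y ** upper z ** lower w" using SL2R_generated[OF k] by blast
 have E: "\<rho> (upper t) \<in> C" for t
 proof -
  have "rep (exp (smat (of_real t) * e)) = \<rho> (upper t)" unfolding smat_of_real R_upper[symmetric] by simp
  then show ?thesis using ef'(1)[of "of_real t"] by (simp only:)
 qed
 have F: "\<rho> (lower t) \<in> C" for t
 proof -
  have "rep (exp (smat (of_real t) * f)) = \<rho> (lower t)" unfolding smat_of_real R_lower[symmetric] by simp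
  then show ?thesis using ef'(2)[of "of_real t"] by (simp only:)
 qed
 have S: "upper t \<in> SL2R" "lower t \<in> SL2R" for t by simp_all
 have "\<rho> k = \<rho> (upper x) ** \<rho> (lower y) ** \<rho> (upper z) ** \<rho> (lower w)"
  unfolding k_eq using S by (simp only: mul SL2R_mult)
 then show ?thesis using C(2) E F by (simp only:)
qed

lemmas Z0_Z = identity_component_subset_self[of Z]

lemma Z0_one: "mat 1 \<in> Z0"
 using identity_component_exp[of 0 Z 0] alg_groupD(2)[OF Z] by (simp add: lie_def)

lemma \<rho>Z0: "k \<in> SL2R ==> \<rho> k \<in> Z0"
 by (rule rho_mem[OF Z0_one identity_component_mult[OF Z]
  identity_component_exp[OF lie_efh(1)[OF Z \<rho>Z]] identity_component_exp[OF lie_efh(2)[OF Z \<rho>Z]]])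

lemma H_mult: "X \<in> H ==> Y \<in> H ==> X ** Y \<in> H" using G_mult identity_component_mult[OF Z] by blast
lemma H_one: "mat 1 \<in> H" using G_one Z0_one by blast
lemma H_inv: "X \<in> H ==> \<exists>Y\<in>H. X ** Y = mat 1 & Y ** X = mat 1"
 using G_inv identity_component_inverse[OF Z] by blast
lemma \<rho>H: "k \<in> SL2R ==> \<rho> k \<in> H" using \<rho>G \<rho>Z0 by blast

lemma group_H: "group (matrix_group H)"
proof (rule groupI)
 show "\<exists>Y\<in>carrier (matrix_group H). Y \<otimes>\<^bsub>matrix_group H\<^esub> X = \<one>\<^bsub>matrix_group H\<^esub>"
  if "X \<in> carrier (matrix_group H)" for X
  using H_inv[of X] that by (simp add: matrix_group_def) blast
qed (use H_mult H_one in \<open>auto simp: matrix_group_def matrix_mul_assoc\<close>)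

lemma lie_Z_commute: assumes v: "v \<in> lie Z" shows "R minus1 * v = v * R minus1"
proof (rule commute_derivative)
 fix t :: real
 have "rep (exp (smat (of_real t) * v)) \<in> Z" using v unfolding lie_def by blast
 then have "\<rho> minus1 ** rep (exp (t *\<^sub>R v)) = rep (exp (t *\<^sub>R v)) ** \<rho> minus1" by (simp add: smat_of_real)
 then have "rep (R minus1 * exp (t *\<^sub>R v)) = rep (exp (t *\<^sub>R v) * R minus1)" by simp
 then show "R minus1 * exp (t *\<^sub>R v) = exp (t *\<^sub>R v) * R minus1" by (rule cmat_eqI)
qed

lemma minus1_SL: "minus1 \<in> SL2R" by simp

lemma mcnj_Z: assumes X: "X \<in> Z" shows "rep (mcnj (Cm X)) \<in> Z"
proof -
 obtain P where P: "P \<subseteq> poly_fun \<real>" "GG = zero_locus P" using GGR unfolding defined_over_R_def by blast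
 obtain Y where Y: "X ** Y = mat 1" "Y ** X = mat 1" using X alg_groupD(4)[OF GG] by blast
 have "mcnj (Cm X) * mcnj (Cm Y) = 1" "mcnj (Cm Y) * mcnj (Cm X) = 1"
  unfolding mcnj_simps(6)[symmetric] Cm_simps(1)[symmetric] Y Cm_simps(2) mcnj_simps(4) by simp_all
 from arg_cong[OF this(1), of rep] arg_cong[OF this(2), of rep]
 have "invertible (rep (mcnj (Cm X)))" unfolding invertible_def by auto
 moreover have "p (rep (mcnj (Cm X))) = 0" if "p \<in> P" for p
  using poly_fun_real_cnj[of p X] that P X unfolding zero_locus_def by auto
 ultimately have mem: "rep (mcnj (Cm X)) \<in> GG" unfolding P(2) zero_locus_def by simp
 have "R minus1 * Cm X = Cm X * R minus1" by (rule cmat_eqI) (use X in simp)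
 from arg_cong[OF this, of mcnj] have "R minus1 * mcnj (Cm X) = mcnj (Cm X) * R minus1" unfolding mcnj_simps mcnj_R[OF minus1_SL] .
 from arg_cong[OF this, of rep] show ?thesis using mem by simp
qed

lemma mcnj_lie: assumes v: "v \<in> lie Z" shows "mcnj v \<in> lie Z"
 unfolding lie_def
proof (rule CollectI, rule allI)
 fix s
 have "smat s * mcnj v = mcnj (smat (cnj s) * v)" by (simp only: mcnj_simps(3) complex_cnj_cnj)
 then have "rep (exp (smat s * mcnj v)) = rep (mcnj (Cm (rep (exp (smat (cnj s) * v)))))" by (simp add: mcnj_exp)
 moreover have "rep (exp (smat (cnj s) * v)) \<in> Z" using v unfolding lie_def by blast
 ultimately show "rep (exp (smat s * mcnj v)) \<in> Z" using mcnj_Z by (simp only:)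
qed

lemma exp_real_H: assumes v: "v \<in> lie Z" "mcnj v = v" shows "rep (exp (t *\<^sub>R v)) \<in> H"
proof -
 let ?\<gamma> = "%t. rep (exp (t *\<^sub>R v))"
 have Zt: "?\<gamma> t \<in> Z" "?\<gamma> t \<in> Z0" for t
  using v(1) identity_component_exp[OF v(1), of "of_real t"] unfolding lie_def by (auto simp: smat_of_real[symmetric])
 have "mcnj (exp (t *\<^sub>R v)) = exp (t *\<^sub>R v)" for t unfolding mcnj_exp[symmetric] mcnj_simps v(2) ..
 then have real: "?\<gamma> t \<in> real_points GG" for t using Zt(1) unfolding real_points_def mcnj_real_iff by blast
 obtain W where W: "open W" "G = real_points GG \<inter> W" using G_open unfolding openin_open by blast
 have cont: "continuous_on UNIV ?\<gamma>"
  by (intro continuous_intros continuous_on_compose2[OF continuous_on_exp_banach]) auto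
 have "open (?\<gamma> -` W)" by (rule open_vimage[OF W(1) cont])
 moreover have "0 \<in> ?\<gamma> -` W" using G_one W(2) by simp
 ultimately obtain \<delta> where d: "\<delta> > 0" "ball 0 \<delta> \<subseteq> ?\<gamma> -` W" using open_contains_ball by blast
 obtain m :: nat where m: "real m > \<bar>t\<bar> / \<delta>" using reals_Archimedean2 by blast
 have m0: "real m > 0" using m divide_nonneg_pos[OF abs_ge_zero[of t] d(1)] by linarith
 have "\<bar>t / real m\<bar> < \<delta>" using m m0 d(1) by (simp add: field_simps)
 then have "t / real m \<in> ball 0 \<delta>" by simp
 then have G1: "?\<gamma> (t / real m) \<in> G" using d(2) W(2) real by blast
 have "?\<gamma> (real j * (t / real m)) \<in> G" for j
 proof (induction j)
  case (Suc j)
  have "exp ((real (Suc j) * (t / real m)) *\<^sub>R v) = exp ((t / real m) *\<^sub>R v) * exp ((real j * (t / real m)) *\<^sub>R v)"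
  proof -
   have split: "real (Suc j) * x = x + real j * x" for x by (simp add: distrib_right)
   show ?thesis unfolding split scaleR_add_left by (rule exp_add_commuting) simp
  qed
  then show ?case using G_mult[OF G1 Suc] by simp
 qed (use G_one in simp)
 from this[of m] m0 have "?\<gamma> t \<in> G" by simp
 then show ?thesis using Zt(2) by blast
qed

lemma rep_lie_Z: "sl2_rep e f h (lie Z)"
proof (rule sl2_rep.intro[OF triple], rule sl2_rep_axioms.intro)
 show "0 \<in> lie Z" using alg_groupD(2)[OF Z] by (simp add: lie_def)
 show "v + w \<in> lie Z" if "v \<in> lie Z" "w \<in> lie Z" for v w by (rule lie_add[OF Z that])
 show "smat c * v \<in> lie Z" if "v \<in> lie Z" for v c by (rule lie_scale[OF that])
 show "ad e v \<in> lie Z" if "v \<in> lie Z" for v by (rule lie_ad[OF Z lie_efh(1)[OF Z \<rho>Z] that])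
 show "ad f v \<in> lie Z" if "v \<in> lie Z" for v by (rule lie_ad[OF Z lie_efh(2)[OF Z \<rho>Z] that])
qed

abbreviation "y T \<equiv> d (std_gen T)"

lemma d_conj_std_gen: assumes k: "k \<in> SL2R" shows "d (k ** std_gen T ** adj2 k) = Ad k (y T)"
 unfolding std_gen_def by (cases T) (simp_all only: if_True if_False d_conj[OF k])

lemma mcnj_y: "mcnj (y T) = y T" unfolding std_gen_def by (cases T) (simp_all only: if_True if_False mcnj_efh)

lemma R_normal_form:
 assumes "normal_form T k a"
 obtains S c where "c ~= 0" "S = 1 \<or> S = R minus1" "R a = S * exp (c *\<^sub>R (Ad k (y T)))"
proof -
 obtain s c where k: "k \<in> SL2R" and s: "s = 1 \<or> s = - 1" and c: "c ~= 0" and a: "a = s *\<^sub>R (k ** std_curve T c ** adj2 k)"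
  using assms unfolding normal_form_def by blast
 have RcY: "R (std_curve T c) = exp (c *\<^sub>R y T)" unfolding std_curve_def std_gen_def by (cases T) (simp_all only: if_True if_False R_diag R_upper)
 have S: "k ** std_curve T c ** adj2 k \<in> SL2R" by (intro SL2R_mult adj2_SL2R k std_curve_SL2R)
 have "R (k ** std_curve T c ** adj2 k) = Ad k (exp (c *\<^sub>R y T))"
  by (simp add: R_mult SL2R_mult adj2_SL2R k std_curve_SL2R RcY)
 also have "... = exp (c *\<^sub>R (Ad k (y T)))" using exp_conj[OF R_adj2(2)[OF k], of "c *\<^sub>R y T"] by simp
 finally have E: "R (k ** std_curve T c ** adj2 k) = exp (c *\<^sub>R (Ad k (y T)))" .
 have "(- 1) *\<^sub>R X = minus1 ** X" for X :: "real^2^2" by (cases X rule: mat2_cases) (simp add: mat2_simps)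
 then have "R ((- 1) *\<^sub>R (k ** std_curve T c ** adj2 k)) = R minus1 * R (k ** std_curve T c ** adj2 k)" using R_mult[OF minus1_SL S] by simp
 then have "R a = 1 * exp (c *\<^sub>R (Ad k (y T))) \<or> R a = R minus1 * exp (c *\<^sub>R (Ad k (y T)))"
  using s E unfolding a by auto
 then show ?thesis using that[OF c] by blast
qed

lemma lie_normal_form:
 assumes L: "linear_algebraic_group L" and a: "normal_form T k a" and aL: "\<rho> a \<in> L"
 shows "Ad k (y T) \<in> lie L"
proof -
 let ?X = "Ad k (y T)"
 obtain S c where c: "c ~= 0" and S: "S = 1 \<or> S = R minus1" "R a = S * exp (c *\<^sub>R ?X)" using R_normal_form[OF a] .
 note SL = normal_form_SL2R[OF a]
 have SS: "S * S = 1" "S * R a = R a * S" using S(1) R_minus1 R_minus1_commute[OF SL(2)] by auto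
 have "exp (c *\<^sub>R ?X) = S * R a" unfolding S(2) mult.assoc[symmetric] SS by simp
 then have "exp (c *\<^sub>R ?X) * exp (c *\<^sub>R ?X) = S * (R a * S) * R a" by (simp add: mult.assoc)
 also have "... = (S * S) * R a * R a" unfolding SS(2)[symmetric] by (simp add: mult.assoc)
 finally have "exp ((c + c) *\<^sub>R ?X) = R a * R a" unfolding SS scaleR_add_left by (subst exp_add_commuting) auto
 then have "rep (exp ((c + c) *\<^sub>R ?X)) \<in> L" using alg_groupD(3)[OF L aL aL] by simp
 moreover have "real_spectrum (y T)" using real_spectrum_h real_spectrum_e unfolding std_gen_def by (cases T) (simp_all only: if_True if_False)
 then have "real_spectrum ((c + c) *\<^sub>R ?X)" by (intro real_spectrum_scaleR real_spectrum_conj) (use c R_adj2[OF SL(1)] in auto)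
 ultimately have "(c + c) *\<^sub>R ?X \<in> lie L" by (intro lie_realI[OF L])
 then show ?thesis by (rule lie_scaleR_cancel) (use c in simp)
qed

lemma rho_mem_conj:
 assumes L: "linear_algebraic_group L" and k0: "k0 \<in> SL2R"
  and ef_L: "Ad k0 e \<in> lie L" "Ad k0 f \<in> lie L" and k: "k \<in> SL2R"
 shows "\<rho> k \<in> L"
proof -
 let ?C = "{Y. \<rho> k0 ** Y ** \<rho> (adj2 k0) \<in> L}"
 have inv: "\<rho> k0 ** \<rho> (adj2 k0) = mat 1" "\<rho> (adj2 k0) ** \<rho> k0 = mat 1"
  using arg_cong[OF R_adj2(1)[OF k0], of rep] arg_cong[OF R_adj2(2)[OF k0], of rep] by simp_all
 have "exp (smat s * (Ad k0 v)) = Ad k0 (exp (smat s * v))" for s v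
  using exp_conj[OF R_adj2(2)[OF k0], of "smat s * v"] by (simp add: mult.assoc smat_left_commute)
 then have exp_C: "rep (exp (smat s * v)) \<in> ?C" if "Ad k0 v \<in> lie L" for s v using that by (simp add: lie_def)
 have "\<rho> (adj2 k0 ** k ** k0) \<in> ?C"
 proof (rule rho_mem[OF _ _ exp_C[OF ef_L(1)] exp_C[OF ef_L(2)]])
  show "mat 1 \<in> ?C" using inv alg_groupD(2)[OF L] by simp
  fix X Y assume "X \<in> ?C" "Y \<in> ?C"
  then have "(\<rho> k0 ** X ** \<rho> (adj2 k0)) ** (\<rho> k0 ** Y ** \<rho> (adj2 k0)) \<in> L" using alg_groupD(3)[OF L] by blast
  moreover have "(\<rho> k0 ** X ** \<rho> (adj2 k0)) ** (\<rho> k0 ** Y ** \<rho> (adj2 k0)) = \<rho> k0 ** X ** (\<rho> (adj2 k0) ** \<rho> k0) ** Y ** \<rho> (adj2 k0)"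
   by (simp only: matrix_mul_assoc)
  ultimately show "X ** Y \<in> ?C" by (simp add: inv matrix_mul_assoc)
 qed (intro SL2R_mult adj2_SL2R k0 k)
 then have "\<rho> (k0 ** (adj2 k0 ** k ** k0) ** adj2 k0) \<in> L" by (simp add: mul SL2R_mult adj2_SL2R k0 k)
 moreover have "k0 ** (adj2 k0 ** k ** k0) ** adj2 k0 = (k0 ** adj2 k0) ** k ** (k0 ** adj2 k0)" by (simp only: matrix_mul_assoc)
 ultimately show ?thesis by (simp add: adj2_SL2R[OF k0])
qed

lemma rho_mem_closure:
 assumes L: "linear_algebraic_group L"
  and a0: "normal_form T0 k0 a0" "\<rho> a0 \<in> L" and a1: "normal_form T1 k1 a1" "\<rho> a1 \<in> L"
  and noncomm: "\<not> words_commute a0 a1" and k: "k \<in> SL2R"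
 shows "\<rho> k \<in> L"
proof -
 obtain p q r where pqr: "(adj2 k0 ** k1) ** std_gen T1 ** adj2 (adj2 k0 ** k1) = sl p q r" "r ~= 0" "T0 --> q ~= 0"
  using generation_criterion[OF a0(1) a1(1) noncomm] by blast
 note k0 = normal_form_SL2R(1)[OF a0(1)] and k1 = normal_form_SL2R(1)[OF a1(1)]
 have "k0 ** sl p q r ** adj2 k0 = (k0 ** adj2 k0) ** k1 ** std_gen T1 ** adj2 k1 ** (k0 ** adj2 k0)"
  unfolding pqr(1)[symmetric] by (simp add: adj2_mult adj2_adj2 matrix_mul_assoc)
 then have "k0 ** sl p q r ** adj2 k0 = k1 ** std_gen T1 ** adj2 k1" by (simp add: adj2_SL2R[OF k0])
 then have "Ad k0 (d (sl p q r)) = Ad k1 (y T1)" using d_conj[OF k0, of p q r] d_conj_std_gen[OF k1] by simp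
 then have x: "p *\<^sub>R Ad k0 h + q *\<^sub>R Ad k0 e + r *\<^sub>R Ad k0 f \<in> lie L"
  using lie_normal_form[OF L a1] unfolding d_sl[of p q r] by (simp only: distrib_left distrib_right mult_scaleR_left mult_scaleR_right)
 interpret conj: sl2_triple "Ad k0 e" "Ad k0 f" "Ad k0 h" by (rule sl2_triple_conj[OF triple R_adj2(2)[OF k0]])
 have y: "Ad k0 (y T0) \<in> lie L" by (rule lie_normal_form[OF L a0])
 have "Ad k0 e \<in> lie L"
 proof (cases T0)
  case True
  then have "q ~= 0" "Ad k0 h \<in> lie L" using pqr(3) y by (simp_all add: std_gen_def)
  then show ?thesis by (rule conj.lie_contains_e[OF L x])
 next
  case False
  then show ?thesis using y by (simp add: std_gen_def)
 qed
 then show ?thesis using conj.lie_contains_triple(1)[OF L x pqr(2)] by (intro rho_mem_conj[OF L k0 _ _ k])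
qed

definition real_centralizer :: "bool => 'n cmat set" where
 "real_centralizer T = {v \<in> lie Z. mcnj v = v & ad (y T) v = 0}"

lemma zero_real_centralizer: "0 \<in> real_centralizer T"
 using alg_groupD(2)[OF Z] mcnj_simps(7)[of 0 0] by (simp add: real_centralizer_def lie_def ad_simps)

lemma conj_real_centralizer:
 assumes a: "normal_form T k a" and w: "w \<in> real_centralizer T" and v: "v = Ad k w"
 shows "v \<in> lie Z" "mcnj v = v" "R a * v = v * R a"
proof -
 note k = normal_form_SL2R(1)[OF a]
 show vZ: "v \<in> lie Z" unfolding v
  by (rule lie_Ad[OF Z _ _ R_adj2(2,1)[OF k]]) (use w \<rho>Z[OF k] in \<open>simp_all add: real_centralizer_def\<close>)
 show "mcnj v = v" unfolding v mcnj_simps using w k by (simp add: mcnj_R adj2_SL2R real_centralizer_def)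
 let ?Y = "Ad k (y T)"
 obtain P c where P: "P = 1 \<or> P = R minus1" "R a = P * exp (c *\<^sub>R ?Y)" using R_normal_form[OF a] .
 have Pv: "P * v = v * P" using P(1) lie_Z_commute[OF vZ] by auto
 have conj_mult: "(Ad k p) * (Ad k q) = Ad k (p * q)" for p q
 proof -
  have "(Ad k p) * (Ad k q) = R k * p * (R (adj2 k) * R k) * q * R (adj2 k)"
   by (simp only: mult.assoc)
  then show ?thesis unfolding R_adj2(2)[OF k] by (simp add: mult.assoc)
 qed
 have "y T * w = w * y T" using w by (simp add: real_centralizer_def ad_def)
 then have "v * (c *\<^sub>R ?Y) = (c *\<^sub>R ?Y) * v" using conj_mult unfolding v by simp
 from exp_commute_cmat[OF this] show "R a * v = v * R a" unfolding P(2) by (metis Pv mult.assoc)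
qed

lemma lie_conj_cancel:
 assumes L: "linear_algebraic_group L" and k: "k \<in> SL2R" "\<rho> (adj2 k) \<in> L" and v: "Ad k w \<in> lie L"
 shows "w \<in> lie L"
proof -
 have "R (adj2 k) * (Ad k w) * R k \<in> lie L" using R_adj2[OF k(1)] k(2) by (intro lie_Ad[OF L v]) simp_all
 moreover have "R (adj2 k) * (Ad k w) * R k = (R (adj2 k) * R k) * w * (R (adj2 k) * R k)"
  by (simp only: mult.assoc)
 ultimately show ?thesis unfolding R_adj2(2)[OF k(1)] by simp
qed

lemma identity_component_dense:
 assumes L: "linear_algebraic_group L" "L \<subseteq> Z" and k: "!!k. k \<in> SL2R ==> \<rho> k \<in> L"
  and centralizer: "real_centralizer T \<subseteq> lie L"
 shows "Z0 \<subseteq> L"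
proof (rule identity_component_subset[OF Z L])
 have complex: "v \<in> lie L" if v: "v \<in> lie Z" "ad (y T) v = 0" for v
 proof -
  note real_imag = lie_add[OF Z v(1) mcnj_lie[OF v(1)]] lie_scale[OF lie_minus[OF Z v(1) mcnj_lie[OF v(1)]], of "- \<i>"]
  have "ad (y T) (mcnj v) = mcnj (ad (y T) v)" by (simp add: ad_def mcnj_simps mcnj_y)
  also have "... = 0" unfolding v(2) using mcnj_simps(7)[of 0 0] by simp
  finally have "ad (y T) (v + mcnj v) = 0" "ad (y T) (smat (- \<i>) * (v - mcnj v)) = 0" using v(2) by (simp_all add: ad_simps)
  moreover have "mcnj (v + mcnj v) = v + mcnj v" by (simp add: mcnj_simps)
  moreover have "mcnj (smat (- \<i>) * (v - mcnj v)) = smat (- \<i>) * (v - mcnj v)"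
   unfolding mcnj_simps(3) mcnj_simps(5,7) by (simp add: smat_simps algebra_simps)
  ultimately have "v + mcnj v \<in> lie L" "smat (- \<i>) * (v - mcnj v) \<in> lie L" using real_imag centralizer by (auto simp: real_centralizer_def)
  from lie_add[OF L(1) this(1) lie_scale[OF this(2), of \<i>]]
  have "v + mcnj v + smat \<i> * (smat (- \<i>) * (v - mcnj v)) \<in> lie L" .
  moreover have "smat \<i> * (smat (- \<i>) * (v - mcnj v)) = v - mcnj v"
   by (simp add: mult.assoc[symmetric] smat_mult[symmetric] smat_simps)
  ultimately have "2 *\<^sub>R v \<in> lie L" by (simp add: scaleR_2)
  then show ?thesis by (rule lie_scaleR_cancel) simp
 qed
 note efh = lie_efh[OF L(1) k]
 show "lie Z \<subseteq> lie L"
 proof (rule sl2_rep.generated_by_centralizer[OF rep_lie_Z])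
  show "exp (smat (of_real pi * \<i>) * h) * v = v * exp (smat (of_real pi * \<i>) * h)" if "v \<in> lie Z" for v
   unfolding exp_pi_h by (rule lie_Z_commute[OF that])
  show "(\<forall>v\<in>lie Z. ad h v = 0 --> v \<in> lie L) \<or> (\<forall>v\<in>lie Z. ad e v = 0 --> v \<in> lie L)"
   using complex unfolding std_gen_def by (cases T) (simp_all only: if_True if_False, blast+)
 qed (use L(1) efh lie_ad lie_add in blast)+
qed

definition path_inv :: "(real => 'n cmat) => (real => 'n cmat) => bool" where
 "path_inv F F' \<longleftrightarrow> continuous_on UNIV F & continuous_on UNIV F' &
   (\<forall>t. rep (F t) \<in> H & rep (F' t) \<in> H & F t * F' t = 1 & F' t * F t = 1)"

definition path_group :: "(real => 'n cmat) monoid" where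
 "path_group = \<lparr>carrier = {F. \<exists>F'. path_inv F F'}, mult = (%E F t. E t * F t), one = (%_. 1)\<rparr>"

lemma group_path_group: "group path_group"
proof (rule groupI)
 fix E F assume "E \<in> carrier path_group" "F \<in> carrier path_group"
 then obtain E' F' where c: "path_inv E E'" "path_inv F F'" by (auto simp: path_group_def)
 have "path_inv (%t. E t * F t) (%t. F' t * E' t)"
  unfolding path_inv_def
 proof (intro conjI allI)
  fix t
  show "rep (E t * F t) \<in> H" "rep (F' t * E' t) \<in> H" using H_mult c by (simp_all add: path_inv_def)
  have "E t * F t * (F' t * E' t) = E t * (F t * F' t) * E' t" "F' t * E' t * (E t * F t) = F' t * (E' t * E t) * F t"
   by (simp_all only: mult.assoc)
  then show "E t * F t * (F' t * E' t) = 1" "F' t * E' t * (E t * F t) = 1" using c by (simp_all add: path_inv_def)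
 qed (use c in \<open>auto simp: path_inv_def intro: continuous_on_mult\<close>)
 then show "E \<otimes>\<^bsub>path_group\<^esub> F \<in> carrier path_group" by (auto simp: path_group_def)
next
 have "path_inv (%_. 1) (%_. 1)" using H_one by (simp add: path_inv_def)
 then show "\<one>\<^bsub>path_group\<^esub> \<in> carrier path_group" by (auto simp: path_group_def)
next
 fix F assume "F \<in> carrier path_group"
 then obtain F' where "path_inv F F'" by (auto simp: path_group_def)
 then have "path_inv F' F" "F' \<otimes>\<^bsub>path_group\<^esub> F = \<one>\<^bsub>path_group\<^esub>" by (auto simp: path_inv_def path_group_def)
 then show "\<exists>E\<in>carrier path_group. E \<otimes>\<^bsub>path_group\<^esub> F = \<one>\<^bsub>path_group\<^esub>" by (auto simp: path_group_def)
qed (simp_all add: path_group_def mult.assoc)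

lemma exp_path_group:
 assumes v: "v \<in> lie Z" "mcnj v = v" shows "(%t. exp (t *\<^sub>R v)) \<in> carrier path_group"
proof -
 have H: "rep (exp (t *\<^sub>R v)) \<in> H" for t by (rule exp_real_H[OF v])
 have inverse: "exp (t *\<^sub>R v) * exp ((- t) *\<^sub>R v) = 1" "exp ((- t) *\<^sub>R v) * exp (t *\<^sub>R v) = 1" for t
  by (simp_all add: exp_inverse_cmat)
 have "path_inv (%t. exp (t *\<^sub>R v)) (%t. exp ((- t) *\<^sub>R v))" unfolding path_inv_def
  by (intro conjI allI continuous_intros continuous_on_compose2[OF continuous_on_exp_banach] subset_UNIV H inverse)
 then show ?thesis by (auto simp: path_group_def)
qed

lemma eval_0_hom: "(%F _. F 0) \<in> hom path_group path_group"
proof (rule homI)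
 fix F assume "F \<in> carrier path_group"
 then obtain F' where "path_inv F F'" by (auto simp: path_group_def)
 then have "path_inv (%_. F 0) (%_. F' 0)" by (auto simp: path_inv_def)
 then show "(%_. F 0) \<in> carrier path_group" by (auto simp: path_group_def)
qed (simp add: path_group_def)

end

locale real_sl2_surface = real_sl2 \<rho> GG G + surface_group \<Gamma> g x \<phi>
 for \<rho> :: "real^2^2 => complex^'n^'n" and GG G \<Gamma> g x \<phi>
begin

lemma const_path_hom: "(%\<gamma> _. R \<gamma>) \<in> hom (matrix_group \<Gamma>) path_group"
proof (rule homI)
 fix a assume "a \<in> carrier (matrix_group \<Gamma>)"
 then have a: "a \<in> SL2R" using \<Gamma>_SL by (auto simp: matrix_group_def)
 have "path_inv (%_. R a) (%_. R (adj2 a))" using a R_adj2 adj2_SL2R(1) \<rho>H by (simp add: path_inv_def)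
 then show "(%_. R a) \<in> carrier path_group" by (auto simp: path_group_def)
 fix b assume "b \<in> carrier (matrix_group \<Gamma>)"
 then have "b \<in> SL2R" using \<Gamma>_SL by (auto simp: matrix_group_def)
 then show "(%_. R (a \<otimes>\<^bsub>matrix_group \<Gamma>\<^esub> b)) = (%_. R a) \<otimes>\<^bsub>path_group\<^esub> (%_. R b)"
  using a by (simp add: matrix_group_def path_group_def R_mult)
qed

definition twist_family :: "(nat => 'n cmat) => (real => real^2^2 => complex^'n^'n) => bool" where
 "twist_family v r \<longleftrightarrow> (\<forall>t. r t \<in> hom (matrix_group \<Gamma>) (matrix_group H)) &
   (\<forall>\<gamma>\<in>\<Gamma>. continuous_on UNIV (%t. r t \<gamma>) & r 0 \<gamma> = \<rho> \<gamma>) &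
   (\<forall>t. \<forall>i<g. r t (gen_a i) = \<rho> (gen_a i) & r t (gen_b i) = rep (exp (t *\<^sub>R v i)) ** \<rho> (gen_b i))"

lemma twist_family_exists:
 assumes v: "!!i. i < g ==> v i \<in> lie Z" "!!i. i < g ==> mcnj (v i) = v i"
  and commute: "!!i. i < g ==> R (gen_a i) * v i = v i * R (gen_a i)"
 shows "\<exists>r. twist_family v r"
proof -
 let ?z = "%i t. exp (t *\<^sub>R v i)"
 have z: "?z i \<in> carrier path_group" if "i < g" for i using that by (intro exp_path_group v)
 have zr: "?z i \<otimes>\<^bsub>path_group\<^esub> (%_. R (gen_a i)) = (%_. R (gen_a i)) \<otimes>\<^bsub>path_group\<^esub> ?z i" if "i < g" for i
  using exp_commute_cmat[of "R (gen_a i)" "_ *\<^sub>R v i"] commute[OF that] by (auto simp: path_group_def)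
 have z0: "(%_. ?z i 0) = \<one>\<^bsub>path_group\<^esub>" if "i < g" for i by (simp add: path_group_def)
 obtain r where r: "r \<in> hom (matrix_group \<Gamma>) path_group"
   "\<forall>i<g. r (gen_a i) = (%_. R (gen_a i)) & r (gen_b i) = ?z i \<otimes>\<^bsub>path_group\<^esub> (%_. R (gen_b i))"
   "\<forall>\<gamma>\<in>\<Gamma>. (%_::real. r \<gamma> 0) = (%_. R \<gamma>)"
  using surface_hom_twist[OF group_path_group const_path_hom, of ?z path_group "%F _. F 0", OF z zr group_path_group eval_0_hom z0] by blast
 have path: "\<exists>F'. path_inv (r \<gamma>) F'" if "\<gamma> \<in> \<Gamma>" for \<gamma>
  using hom_in_carrier[OF r(1)] that by (simp add: matrix_group_def path_group_def)
 have "twist_family v (%t \<gamma>. rep (r \<gamma> t))"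
  unfolding twist_family_def
 proof (intro conjI allI ballI)
  fix t
  show "(%\<gamma>. rep (r \<gamma> t)) \<in> hom (matrix_group \<Gamma>) (matrix_group H)"
   using path hom_mult[OF r(1)] by (fastforce simp: hom_def matrix_group_def path_group_def path_inv_def)
 next
  fix \<gamma> assume \<gamma>: "\<gamma> \<in> \<Gamma>"
  show "continuous_on UNIV (%t. rep (r \<gamma> t))" using path[OF \<gamma>] by (auto simp: path_inv_def intro: continuous_on_rep)
  show "rep (r \<gamma> 0) = \<rho> \<gamma>" using r(3) \<gamma> by (metis rep_R)
 qed (use r(2) in \<open>simp_all add: path_group_def\<close>)
 then show ?thesis by blast
qed

context
 fixes v r assumes family: "twist_family v r"
begin

lemma twist_family_simps:
 "\<gamma> \<in> \<Gamma> ==> r t \<gamma> \<in> H" "a \<in> \<Gamma> ==> b \<in> \<Gamma> ==> r t (a ** b) = r t a ** r t b"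
 "\<gamma> \<in> \<Gamma> ==> continuous_on UNIV (%t. r t \<gamma>)" "\<gamma> \<in> \<Gamma> ==> r 0 \<gamma> = \<rho> \<gamma>"
 "i < g ==> r t (gen_a i) = \<rho> (gen_a i)" "i < g ==> r t (gen_b i) = rep (exp (t *\<^sub>R v i)) ** \<rho> (gen_b i)"
 using family unfolding twist_family_def by (auto simp: hom_def matrix_group_def)

lemma twist_family_continuous: "continuous_map euclideanreal (Hom_topology \<Gamma> G) (%t. restrict (r t) \<Gamma>)"
 unfolding Hom_topology_def continuous_map_in_subtopology continuous_map_componentwise
proof (intro conjI ballI)
 show "(%t. restrict (r t) \<Gamma>) \<in> topspace euclideanreal \<rightarrow> hom (matrix_group \<Gamma>) (matrix_group G)"
  using twist_family_simps(1,2) \<Gamma>_mult by (auto simp: hom_def matrix_group_def)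
 show "continuous_map euclideanreal euclidean (%t. restrict (r t) \<Gamma> \<gamma>)"
  "(%t. restrict (r t) \<Gamma> \<gamma>) \<in> topspace euclideanreal \<rightarrow> G" if "\<gamma> \<in> \<Gamma>" for \<gamma>
  using twist_family_simps(1,3)[OF that] that by auto
qed auto

lemma generic_twist:
 assumes U: "openin (Hom_topology \<Gamma> G) U" "restrict \<rho> \<Gamma> \<in> U"
 obtains t where "restrict (r t) \<Gamma> \<in> U"
  "\<forall>i C. linear_algebraic_group C --> rep (exp (t *\<^sub>R v i)) \<in> C --> v i \<in> lie C"
proof -
 have "open {t. restrict (r t) \<Gamma> \<in> U}" using openin_continuous_map_preimage[OF twist_family_continuous U(1)] by simp
 moreover have "restrict (r 0) \<Gamma> = restrict \<rho> \<Gamma>" using twist_family_simps(4) by (auto simp: restrict_def)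
 then have "{t. restrict (r t) \<Gamma> \<in> U} ~= {}" using U(2) by (metis (mono_tags) empty_iff mem_Collect_eq)
 moreover obtain B :: "nat => real set" where B: "!!i. countable (B i)"
  "!!i t C. t \<notin> B i ==> linear_algebraic_group C ==> rep (exp (t *\<^sub>R v i)) \<in> C ==> v i \<in> lie C"
  using lie_generic[of "v _"] by metis
 have "countable (\<Union>i. B i)" using B(1) by blast
 ultimately obtain t where "t \<in> {t. restrict (r t) \<Gamma> \<in> U}" "t \<notin> (\<Union>i. B i)" using open_minus_countable by metis
 then have t: "restrict (r t) \<Gamma> \<in> U" "!!i. t \<notin> B i" by blast+
 show ?thesis by (rule that[OF t(1)]) (intro allI impI, rule B(2)[OF t(2)])
qed

lemma twist_closure_group: "linear_algebraic_group (zariski closure_of (r t ` \<Gamma>))"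
 and twist_closure_subset: "zariski closure_of (r t ` \<Gamma>) \<subseteq> Z0"
 and twist_mem_closure: "\<gamma> \<in> \<Gamma> ==> r t \<gamma> \<in> zariski closure_of (r t ` \<Gamma>)"
proof -
 have sub: "r t ` \<Gamma> \<subseteq> Z0" "r t ` \<Gamma> \<subseteq> GL_set"
  using twist_family_simps(1) Z0_Z alg_groupD(5)[OF Z] by blast+
 have "r t (mat 1) = mat 1"
  using hom_one[of "r t" "matrix_group \<Gamma>" "matrix_group H", OF _ group_\<Gamma> group_H] family
  by (simp add: twist_family_def matrix_group_def)
 then have "mat 1 \<in> r t ` \<Gamma>" using \<Gamma>_one by (metis image_eqI)
 then show "linear_algebraic_group (zariski closure_of (r t ` \<Gamma>))"
  by (rule alg_group_closure[OF sub(2)]) (use \<Gamma>_mult in \<open>auto simp flip: twist_family_simps(2)\<close>)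
 show "zariski closure_of (r t ` \<Gamma>) \<subseteq> Z0" by (rule closure_of_minimal[OF sub(1) identity_component_closed[OF Z]])
 show "\<gamma> \<in> \<Gamma> ==> r t \<gamma> \<in> zariski closure_of (r t ` \<Gamma>)" using closure_of_subset[of "r t ` \<Gamma>" zariski] sub(2) by auto
qed

lemma rho_mem_twist_closure:
 assumes disc: "discrete \<Gamma>" and g: "2 <= g" and k: "k \<in> SL2R"
 shows "\<rho> k \<in> zariski closure_of (r t ` \<Gamma>)"
proof -
 have i: "0 < g" "1 < g" using g by auto
 have gen_a_L: "\<rho> (gen_a i) \<in> zariski closure_of (r t ` \<Gamma>)" if "i < g" for i
  using twist_mem_closure[OF gen_a(1)[OF that]] twist_family_simps(5)[OF that] by metis
 obtain T0 k0 T1 k1 where "normal_form T0 k0 (gen_a 0)" "normal_form T1 k1 (gen_a 1)"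
  using gen_a_normal_form[OF disc] i by blast
 from rho_mem_closure[OF twist_closure_group this(1) gen_a_L[OF i(1)] this(2) gen_a_L[OF i(2)] not_words_commute[OF g] k]
 show ?thesis .
qed

lemma exp_mem_twist_closure:
 assumes disc: "discrete \<Gamma>" and g: "2 <= g" and i: "i < g"
 shows "rep (exp (t *\<^sub>R v i)) \<in> zariski closure_of (r t ` \<Gamma>)" (is "_ \<in> ?L")
proof -
 note LD = alg_groupD[OF twist_closure_group]
 have "gen_b i \<in> SL2R" using gen_b(1)[OF i] \<Gamma>_SL by blast
 then have "\<rho> (gen_b i) \<in> ?L" by (rule rho_mem_twist_closure[OF disc g])
 then obtain Y where Y: "Y \<in> ?L" "\<rho> (gen_b i) ** Y = mat 1" using LD(4) by blast
 have "rep (exp (t *\<^sub>R v i)) ** \<rho> (gen_b i) ** Y \<in> ?L"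
  using LD(3)[OF twist_mem_closure[OF gen_b(1)[OF i]] Y(1)] twist_family_simps(6)[OF i] by simp
 then show ?thesis using Y(2) by (simp add: matrix_mul_assoc[symmetric])
qed

end

theorem dense_deformation:
 assumes disc: "discrete \<Gamma>" and g: "2 * DIM(complex^'n^'n) <= g"
  and U: "openin (Hom_topology \<Gamma> G) U" "restrict \<rho> \<Gamma> \<in> U"
 shows "\<exists>\<rho>'\<in>U. subtopology zariski G closure_of (\<rho>' ` \<Gamma>) = H"
proof -
 have g2: "2 <= g" using g DIM_positive[where 'a="complex^'n^'n"] by linarith
 obtain k T where normal: "!!i. i < g ==> normal_form (T i) (k i) (gen_a i)" using gen_a_normal_form[OF disc] by metis
 have zero: "0 \<in> rep ` real_centralizer \<theta>" for \<theta> using zero_real_centralizer by (intro image_eqI[of _ _ 0]) simp_all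
 obtain \<theta> w where w: "\<forall>i. w i \<in> rep ` real_centralizer (T i)" "rep ` real_centralizer \<theta> \<subseteq> span (w ` {..<g})"
  using spread_spanning_family[where V="%\<theta>. rep ` real_centralizer \<theta>" and T=T, OF g zero] .
 define v where "v i = Ad (k i) (Cm (w i))" for i
 have centralizes: "Cm (w i) \<in> real_centralizer (T i)" for i using w(1) by (metis Cm_rep imageE)
 have v: "v i \<in> lie Z" "mcnj (v i) = v i" "R (gen_a i) * v i = v i * R (gen_a i)" if "i < g" for i
  using conj_real_centralizer[OF normal[OF that] centralizes v_def] by blast+
 obtain r where r: "twist_family v r" using twist_family_exists[OF v] by blast
 obtain t where t: "restrict (r t) \<Gamma> \<in> U"
  "\<forall>i C. linear_algebraic_group C --> rep (exp (t *\<^sub>R v i)) \<in> C --> v i \<in> lie C" using generic_twist[OF r U] .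
 let ?L = "zariski closure_of (r t ` \<Gamma>)"
 note L = twist_closure_group[OF r, of t] and \<rho>L = rho_mem_twist_closure[OF r disc g2, of _ t]
 have "w i \<in> rep ` lie ?L" if i: "i < g" for i
 proof (rule image_eqI)
  have k: "k i \<in> SL2R" by (rule normal_form_SL2R(1)[OF normal[OF i]])
  have "v i \<in> lie ?L" using t(2) L exp_mem_twist_closure[OF r disc g2 i] by blast
  then show "Cm (w i) \<in> lie ?L" unfolding v_def by (rule lie_conj_cancel[OF L k \<rho>L[OF adj2_SL2R(1)[OF k]]])
 qed simp
 then have "span (w ` {..<g}) \<subseteq> rep ` lie ?L" by (intro span_minimal lie_subspace[OF L]) blast
 then have "real_centralizer \<theta> \<subseteq> lie ?L" using w(2) by (auto simp: rep_inject dest!: subsetD)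
 then have "Z0 \<subseteq> ?L" using twist_closure_subset[OF r, of t] Z0_Z \<rho>L by (intro identity_component_dense[OF L]) blast+
 then have "?L = Z0" using twist_closure_subset[OF r, of t] by blast
 moreover have "G \<inter> restrict (r t) \<Gamma> ` \<Gamma> = r t ` \<Gamma>" using twist_family_simps(1)[OF r] by (auto simp: image_iff)
 ultimately show ?thesis using t(1) unfolding closure_of_subtopology by (intro bexI[of _ "restrict (r t) \<Gamma>"]) simp_all
qed

end

lemma group_real_points:
 assumes GG: "linear_algebraic_group (GG :: (complex^'n^'n) set)" shows "group (matrix_group (real_points GG))"
proof (rule groupI)
 have real_points_iff: "X \<in> real_points GG \<longleftrightarrow> X \<in> GG & mcnj (Cm X) = Cm X" for X by (auto simp: real_points_def mcnj_real_iff)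
 show "\<one>\<^bsub>matrix_group (real_points GG)\<^esub> \<in> carrier (matrix_group (real_points GG))"
  using alg_groupD(2)[OF GG] by (simp add: matrix_group_def real_points_iff Cm_simps mcnj_simps)
 fix X assume "X \<in> carrier (matrix_group (real_points GG))"
 then have X: "X \<in> GG" "mcnj (Cm X) = Cm X" by (simp_all add: matrix_group_def real_points_iff)
 show "X \<otimes>\<^bsub>matrix_group (real_points GG)\<^esub> Y \<in> carrier (matrix_group (real_points GG))"
  if "Y \<in> carrier (matrix_group (real_points GG))" for Y
  using that X alg_groupD(3)[OF GG] by (simp add: matrix_group_def real_points_iff Cm_simps mcnj_simps)
 obtain Y where Y: "Y \<in> GG" "X ** Y = mat 1" "Y ** X = mat 1" using alg_groupD(4)[OF GG X(1)] by blast
 have YX: "Cm Y * Cm X = 1" "Cm X * Cm Y = 1" using Y by (simp_all add: Cm_simps(1)[symmetric] Cm_simps(2))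
 have "mcnj (Cm Y) * Cm X = 1" using arg_cong[OF YX(1), of mcnj] by (simp add: mcnj_simps X(2))
 then have "mcnj (Cm Y) = Cm Y" by (metis YX(2) mult.assoc mult.left_neutral mult.right_neutral)
 then show "\<exists>Y\<in>carrier (matrix_group (real_points GG)). Y \<otimes>\<^bsub>matrix_group (real_points GG)\<^esub> X = \<one>\<^bsub>matrix_group (real_points GG)\<^esub>"
  using Y by (auto simp: matrix_group_def real_points_iff)
qed (simp_all add: matrix_group_def matrix_mul_assoc)

lemma real_sl2_of_real_reductive:
 assumes G: "real_reductive_group GG G" and \<rho>: "lie_group_hom SL2R G \<rho>"
 shows "real_sl2 \<rho> GG (G :: (complex^'n^'n) set)"
proof -
 have GG: "linear_algebraic_group GG" "defined_over_R GG" and G_sub: "subgroup G (matrix_group (real_points GG))"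
  and G_open: "openin (top_of_set (real_points GG)) G"
  using G by (auto simp: real_reductive_group_def reductive_def)
 have sub: "G \<subseteq> real_points GG" "mat 1 \<in> G" "!!X Y. X \<in> G ==> Y \<in> G ==> X ** Y \<in> G"
  using subgroup.subset[OF G_sub] subgroup.one_closed[OF G_sub] subgroup.m_closed[OF G_sub] by (simp_all add: matrix_group_def)
 have hom: "\<rho> k \<in> G" "l \<in> SL2R ==> \<rho> (k ** l) = \<rho> k ** \<rho> l" if "k \<in> SL2R" for k l
  using \<rho> that by (auto simp: lie_group_hom_def hom_def matrix_group_def)
 have G_GG: "X \<in> GG" "X $ i $ j \<in> \<real>" if "X \<in> G" for X i j using that sub(1) by (auto simp: real_points_def)
 show ?thesis
 proof
  show "smooth_map_on SL2R \<rho>" using \<rho> by (simp add: lie_group_hom_def)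
  show "invertible (\<rho> k)" if "k \<in> SL2R" for k using hom(1)[OF that] G_GG(1) alg_groupD(5)[OF GG(1)] by blast
  show "\<exists>Y\<in>G. X ** Y = mat 1 & Y ** X = mat 1" if "X \<in> G" for X
   using that by (rule matrix_subgroup_inverse[OF group_real_points[OF GG(1)] G_sub])
 qed (use hom sub G_GG GG G_open in auto)
qed

theorem theorem1p6:
  fixes GG G :: "(complex^'n^'n) set"
    and \<rho> :: "real^2^2 \<Rightarrow> complex^'n^'n"
  assumes "real_reductive_group GG G"
    and "lie_group_hom SL2R G \<rho>"
  shows "\<exists>g\<^sub>0\<ge>2. \<forall>g\<ge>g\<^sub>0. \<forall>\<Gamma> :: (real^2^2) set. \<forall>x \<in> topspace (genus_surface g).
           subgroup \<Gamma> (matrix_group SL2R) \<and> discrete \<Gamma> \<and>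
           matrix_group \<Gamma> \<cong> fundamental_group (genus_surface g) x \<longrightarrow>
           (\<forall>U. openin (Hom_topology \<Gamma> G) U \<and> restrict \<rho> \<Gamma> \<in> U \<longrightarrow>
              (\<exists>\<rho>'\<in>U. subtopology zariski G closure_of (\<rho>' ` \<Gamma>) = G_even GG G \<rho>))"
proof (intro exI[of _ "2 * DIM(complex^'n^'n)"] conjI allI ballI impI; (elim conjE)?)
 show "2 <= 2 * DIM(complex^'n^'n)" using DIM_positive[where 'a="complex^'n^'n"] by linarith
 interpret real_sl2 \<rho> GG G by (rule real_sl2_of_real_reductive[OF assms])
 fix g \<Gamma> x U
 assume g: "2 * DIM(complex^'n^'n) <= g" and x: "x \<in> topspace (genus_surface g)"
  and \<Gamma>: "subgroup \<Gamma> (matrix_group SL2R)" "discrete \<Gamma>" "matrix_group \<Gamma> \<cong> fundamental_group (genus_surface g) x"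
  and U: "openin (Hom_topology \<Gamma> G) U" "restrict \<rho> \<Gamma> \<in> U"
 obtain \<phi> where \<phi>: "\<phi> \<in> iso (matrix_group \<Gamma>) (fundamental_group (genus_surface g) x)" using \<Gamma>(3) by (auto simp: is_iso_def)
 have "1 <= g" using g DIM_positive[where 'a="complex^'n^'n"] by linarith
 then interpret real_sl2_surface \<rho> GG G \<Gamma> g x \<phi>
  by (intro real_sl2_surface.intro real_sl2_axioms surface_group.intro SL2R_subgroup.intro surface_group_axioms.intro \<Gamma>(1) x \<phi>)
 show "\<exists>\<rho>'\<in>U. subtopology zariski G closure_of (\<rho>' ` \<Gamma>) = G_even GG G \<rho>"
  unfolding G_even_eq by (rule dense_deformation[OF \<Gamma>(2) g U])
qed

end
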